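(* Let $(M,\nabla)$ be a connected smooth $n$-dimensional manifold ($n\ge2$) with a symmetric linear connection $\nabla$ and a globally defined nowhere zero vector field $\xi$ with $\nabla\xi=0$. Let $f$ be a smooth function on $M$ and $t\in\mathbb R$ with $f(x)\ne t$ for all $x\in M$. Let $a>0$, $b>0$ be constants, let $T^*M$ carry the proper natural Riemann extension $\overline g$ with constants $a,b$ and the almost para-complex structure $P$ given by $PX^C=X^C+2C(\nabla X)-\frac ba X^VW$, $P\alpha^V=-\alpha^V$. Let $$\widetilde H_t=\{(x,\omega)\in T^*M:\ \omega(\xi_x)+f(x)=t\}$$ with the induced metric $g=\overline g|_{\widetilde H_t}$ and the time-like unit normal vector field $$N=\frac{1}{\sqrt b\,\xi^V}\Big\{\xi^C-\frac ba\,\xi^VW+(df)^V\Big\},$$ and let $(\varphi,\overline\xi,\eta,g)$ be the almost paracontact metric structure on $\widetilde H_t$ given by $$\overline\xi=PN,\qquad \eta(X)=\overline g(X,PN),\qquad \varphi X=PX-\eta(X)N$$ for $X$ tangent to $\widetilde H_t$. Then for the $(2n-1)$-dimensional almost paracontact metric manifold $(\widetilde H_t,\varphi,\overline\xi,\eta,g)$: (i) If $M$ is flat or $\dim M=2$, then $\widetilde H_t\in\mathbb G_5\oplus\mathbb G_{10}$. (ii) If $M$ is not flat and $\dim M>2$, then $\widetilde H_t\in\mathbb G_4\oplus\mathbb G_5\oplus\mathbb G_{10}$. In both cases (i) and (ii), $\widetilde H_t$ is paracontact metric if and only if $b=4a^2$.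
   Context: **Cotangent bundle and lifts.** Points of $T^*M$ are pairs $(x,\omega)$, $x\in M$, $\omega\in T^*_xM$. A chart $(x^i)$ of $M$ induces coordinates $(x^i,\omega_i)$ on $T^*M$ with $\omega=\omega_i\,dx^i$; put $\partial_i=\partial/\partial x^i$, $\partial_{i*}=\partial/\partial\omega_i$. $W=\sum_i\omega_i\partial_{i*}$ is the Liouville type vector field. For a vector field $X=X^i\partial_i$ on $M$: $X^V$ is the function $X^V(x,\omega)=\omega(X_x)$ on $T^*M$; $X^C$ (complete lift) is the vector field on $T^*M$ with $X^C(Z^V)=[X,Z]^V$ for all vector fields $Z$ on $M$, locally $X^C=\sum_iX^i\partial_i-\sum_{h,i}\omega_h(\partial_iX^h)\partial_{i*}$. For a 1-form $\alpha=\sum_i\alpha_idx^i$ on $M$, $\alpha^V=\sum_i\alpha_i\partial_{i*}$, a vector field on $T^*M$. For a $(1,1)$ tensor field $T$ on $M$, $C(T)$ is the vector field on $T^*M$ with $C(T)(Z^V)_{(x,\omega)}=\omega((TZ)_x)$ for all $Z$; here $\nabla X$ is the $(1,1)$ tensor field $Z\mapsto\nabla_ZX$. **Proper natural Riemann extension** with constants $a>0$, $b\neq0$: the metric $\overline g$ on $T^*M$ (signature $(n,n)$) with $$\overline g_{(x,\omega)}(X^C,Y^C)=-a\,\omega(\nabla_{X_x}Y+\nabla_{Y_x}X)+b\,\omega(X_x)\omega(Y_x),$$ $\overline g_{(x,\omega)}(X^C,\alpha^V)=a\,\alpha_x(X_x)$, $\overline g_{(x,\omega)}(\alpha^V,\beta^V)=0$.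 $M$ is flat if the curvature tensor of $\nabla$ vanishes. A unit normal is time-like if $\overline g(N,N)=-1$. **Almost paracontact metric manifolds.** $(\widetilde M^{2m+1},\varphi,\overline\xi,\eta,g)$ with $\varphi$ a $(1,1)$ tensor field, $\overline\xi$ a vector field, $\eta$ a 1-form, $g$ a pseudo-Riemannian metric, such that $\varphi^2=\mathrm{Id}-\eta\otimes\overline\xi$, $\eta(\overline\xi)=1$, $\varphi\overline\xi=0$, $g(\varphi X,\varphi Y)=-g(X,Y)+\eta(X)\eta(Y)$. Put $\phi(X,Y)=g(X,\varphi Y)$ and $\widetilde F(X,Y,Z)=g((\widetilde\nabla_X\varphi)Y,Z)$, where $\widetilde\nabla$ is the Levi-Civita connection of $g$. The manifold is paracontact metric if $\phi=d\eta$, with the convention $d\eta(X,Y)=\frac12\big(X\eta(Y)-Y\eta(X)-\eta([X,Y])\big)$. **Classes.** Consider $(0,3)$ tensor fields $F$ with $F(X,Y,Z)=-F(X,Z,Y)$ and $F(X,\varphi Y,\varphi Z)=F(X,Y,Z)+\eta(Y)F(X,Z,\overline\xi)-\eta(Z)F(X,Y,\overline\xi)$ (these hold for $\widetilde F$). Put $\theta_F(\overline\xi)=\sum_{i,j=1}^{2m}g^{ij}F(e_i,e_j,\overline\xi)$, where $(e_i)$ is a basis of $\ker\eta$ and $(g^{ij})$ is the inverse of $(g(e_i,e_j))$. The conditions defining the classes are: - $\mathbb G_4$: $F(\overline\xi,Y,Z)=F(X,\overline\xi,Z)=0$ and the cyclic sum of $F(X,Y,Z)$ over $X,Y,Z$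 is $0$; - $\mathbb G_5$: $F(X,Y,Z)=\frac{\theta_F(\overline\xi)}{2m}\{\eta(Y)g(\varphi X,\varphi Z)-\eta(Z)g(\varphi X,\varphi Y)\}$; - $\mathbb G_{10}$: $F(X,Y,Z)=-\eta(Y)F(X,Z,\overline\xi)+\eta(Z)F(X,Y,\overline\xi)$ and $F(X,Y,\overline\xi)=F(Y,X,\overline\xi)=F(\varphi X,\varphi Y,\overline\xi)$. $\widetilde M\in\mathbb G_i$ means that $\widetilde F$ satisfies the condition of $\mathbb G_i$; $\widetilde M\in\mathbb G_i\oplus\mathbb G_j\oplus\cdots$ means that $\widetilde F$ is a sum of tensor fields satisfying the conditions of $\mathbb G_i$, $\mathbb G_j$, ... respectively. For $\widetilde H_t$, $m=n-1$.
   Formalization: That N is a time-like unit normal is taken as a hypothesis; since g̅(N,N) = −1 + 2a ξ(f)/(b(ξ^V)²), it amounts to ξ(f) = 0, without which N is not unit and the almost paracontact structure does not exist. *)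

theory Defs
  imports "HOL-Analysis.Analysis" "HOL-Library.Function_Algebras"
begin

text \<open>Real-valued operators on functions (tangent vectors, covectors) form a real vector space
  pointwise; the additive structure comes from \<^theory>\<open>HOL-Library.Function_Algebras\<close>.\<close>

instantiation "fun" :: (type, real_vector) real_vector
begin

definition scaleR_fun :: "real \<Rightarrow> ('a \<Rightarrow> 'b) \<Rightarrow> 'a \<Rightarrow> 'b"
  where "scaleR_fun r f = (\<lambda>x. r *\<^sub>R f x)"

instance
  by standard (simp_all add: scaleR_fun_def plus_fun_def fun_eq_iff scaleR_add_left scaleR_add_right)

end

section \<open>Smooth manifolds\<close>

text \<open>Only used for open \<open>S\<close>.\<close>

primrec C_k :: "nat \<Rightarrow> 'a set \<Rightarrow> ('a::real_normed_vector \<Rightarrow> 'b::real_normed_vector) \<Rightarrow> bool" where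
  "C_k 0 S f \<longleftrightarrow> continuous_on S f"
| "C_k (Suc k) S f \<longleftrightarrow>
     f differentiable_on S \<and> (\<forall>v. C_k k S (\<lambda>x. frechet_derivative f (at x) v))"

definition C_infinity :: "'a set \<Rightarrow> ('a::real_normed_vector \<Rightarrow> 'b::real_normed_vector) \<Rightarrow> bool"
  where "C_infinity S f \<longleftrightarrow> (\<forall>k. C_k k S f)"

text \<open>A chart is its domain together with the coordinate map. An atlas determines the set of
  points of the manifold and its topology, so it serves as the manifold itself.\<close>

type_synonym ('p, 'e) chart = "'p set \<times> ('p \<Rightarrow> 'e)"
type_synonym ('p, 'e) atlas = "('p, 'e) chart set"

definition points :: "('p, 'e) atlas \<Rightarrow> 'p set"
  where "points A = (\<Union>C\<in>A. fst C)"

definition chart_inv :: "('p, 'e) chart \<Rightarrow> 'e \<Rightarrow> 'p"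
  where "chart_inv C = inv_into (fst C) (snd C)"

definition smooth_atlas :: "('p, 'e::euclidean_space) atlas \<Rightarrow> bool"
  where "smooth_atlas A \<longleftrightarrow>
    (\<forall>C\<in>A. inj_on (snd C) (fst C) \<and> open (snd C ` fst C)) \<and>
    (\<forall>C\<in>A. \<forall>D\<in>A. open (snd C ` (fst C \<inter> fst D)) \<and>
       C_infinity (snd C ` (fst C \<inter> fst D)) (snd D \<circ> chart_inv C))"

definition manifold_topology :: "('p, 'e::euclidean_space) atlas \<Rightarrow> 'p topology"
  where "manifold_topology A =
    topology (\<lambda>S. S \<subseteq> points A \<and> (\<forall>C\<in>A. open (snd C ` (S \<inter> fst C))))"

lemma openin_manifold_topology:
  assumes "smooth_atlas A"
  shows "openin (manifold_topology A) S \<longleftrightarrow>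
    S \<subseteq> points A \<and> (\<forall>C\<in>A. open (snd C ` (S \<inter> fst C)))"
proof -
  have "istopology (\<lambda>S. S \<subseteq> points A \<and> (\<forall>C\<in>A. open (snd C ` (S \<inter> fst C))))"
    unfolding istopology_def
  proof (intro conjI allI impI ballI)
    fix S T C
    assume S: "S \<subseteq> points A \<and> (\<forall>C\<in>A. open (snd C ` (S \<inter> fst C)))"
      and T: "T \<subseteq> points A \<and> (\<forall>C\<in>A. open (snd C ` (T \<inter> fst C)))"
    show "S \<inter> T \<subseteq> points A" using S by blast
    assume "C \<in> A"
    then have "inj_on (snd C) (fst C)" using assms by (auto simp: smooth_atlas_def)
    then have "snd C ` (S \<inter> T \<inter> fst C) = snd C ` (S \<inter> fst C) \<inter> snd C ` (T \<inter> fst C)"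
      by (subst inj_on_image_Int[symmetric, of _ "fst C"]) (auto intro!: arg_cong[where f = "image _"])
    then show "open (snd C ` (S \<inter> T \<inter> fst C))" using S T \<open>C \<in> A\<close> by auto
  next
    fix \<K> C
    assume K: "\<forall>K\<in>\<K>. K \<subseteq> points A \<and> (\<forall>C\<in>A. open (snd C ` (K \<inter> fst C)))"
    show "\<Union>\<K> \<subseteq> points A" using K by blast
    assume "C \<in> A"
    have "snd C ` (\<Union>\<K> \<inter> fst C) = (\<Union>K\<in>\<K>. snd C ` (K \<inter> fst C))" by blast
    then show "open (snd C ` (\<Union>\<K> \<inter> fst C))" using K \<open>C \<in> A\<close> by auto
  qed
  then show ?thesis by (simp add: manifold_topology_def topology_inverse')
qed

definition smooth_manifold :: "('p, 'e::euclidean_space) atlas \<Rightarrow> bool"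
  where "smooth_manifold A \<longleftrightarrow> smooth_atlas A \<and> Hausdorff_space (manifold_topology A) \<and>
    second_countable (manifold_topology A)"

definition smooth_funs :: "('p, 'e::euclidean_space) atlas \<Rightarrow> 'p set \<Rightarrow> ('p \<Rightarrow> real) set"
  where "smooth_funs A U =
    {f. openin (manifold_topology A) U \<and>
        (\<forall>C\<in>A. C_infinity (snd C ` (U \<inter> fst C)) (f \<circ> chart_inv C))}"

definition smooth_near :: "('p, 'e::euclidean_space) atlas \<Rightarrow> 'p \<Rightarrow> ('p \<Rightarrow> real) \<Rightarrow> bool"
  where "smooth_near A p f \<longleftrightarrow> (\<exists>U. p \<in> U \<and> f \<in> smooth_funs A U)"

section \<open>Tangent vectors and tensor fields\<close>

text \<open>Tangent vectors at \<open>p\<close> are the operators \<open>f \<mapsto> \<Sum>\<^sub>i v\<^sup>i \<partial>\<^sub>i f (p)\<close> on functions that are smooth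
  near \<open>p\<close>. They vanish on all other functions, so that equal tangent vectors are equal as
  operators.\<close>

type_synonym 'p tvec = "('p \<Rightarrow> real) \<Rightarrow> real"
type_synonym 'p covec = "'p tvec \<Rightarrow> real"
type_synonym 'p vfield = "'p \<Rightarrow> 'p tvec"

definition coord_vec :: "('p, 'e::euclidean_space) atlas \<Rightarrow> ('p, 'e) chart \<Rightarrow> 'p \<Rightarrow> 'e \<Rightarrow> 'p tvec"
  where "coord_vec A C p v =
    (\<lambda>f. if smooth_near A p f then frechet_derivative (f \<circ> chart_inv C) (at (snd C p)) v else 0)"

definition tangent_space :: "('p, 'e::euclidean_space) atlas \<Rightarrow> 'p \<Rightarrow> 'p tvec set"
  where "tangent_space A p = {coord_vec A C p v |C v. C \<in> A \<and> p \<in> fst C}"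

definition lin_on :: "'v::real_vector set \<Rightarrow> ('v \<Rightarrow> 'w::real_vector) \<Rightarrow> bool"
  where "lin_on T L \<longleftrightarrow>
    (\<forall>u\<in>T. \<forall>v\<in>T. \<forall>r s. L (r *\<^sub>R u + s *\<^sub>R v) = r *\<^sub>R L u + s *\<^sub>R L v)"

text \<open>Covectors vanish outside the tangent space for the same reason.\<close>

definition cotangent_space :: "('p, 'e::euclidean_space) atlas \<Rightarrow> 'p \<Rightarrow> 'p covec set"
  where "cotangent_space A p =
    {w. lin_on (tangent_space A p) w \<and> (\<forall>v. v \<notin> tangent_space A p \<longrightarrow> w v = 0)}"

text \<open>Vector fields on an open subset \<open>U\<close>; values outside \<open>U\<close> are arbitrary.\<close>

definition vfields :: "('p, 'e::euclidean_space) atlas \<Rightarrow> 'p set \<Rightarrow> 'p vfield set"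
  where "vfields A U =
    {X. openin (manifold_topology A) U \<and> (\<forall>p\<in>U. X p \<in> tangent_space A p) \<and>
        (\<forall>V f. V \<subseteq> U \<longrightarrow> f \<in> smooth_funs A V \<longrightarrow> (\<lambda>p. X p f) \<in> smooth_funs A V)}"

definition bracket :: "('p, 'e::euclidean_space) atlas \<Rightarrow> 'p vfield \<Rightarrow> 'p vfield \<Rightarrow> 'p vfield"
  where "bracket A X Y p =
    (\<lambda>f. if smooth_near A p f then X p (\<lambda>q. Y q f) - Y p (\<lambda>q. X q f) else 0)"

definition one_forms :: "('p, 'e::euclidean_space) atlas \<Rightarrow> 'p set \<Rightarrow> ('p \<Rightarrow> 'p covec) set"
  where "one_forms A U =
    {\<alpha>. openin (manifold_topology A) U \<and> (\<forall>p\<in>U. \<alpha> p \<in> cotangent_space A p) \<and>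
        (\<forall>V X. V \<subseteq> U \<longrightarrow> X \<in> vfields A V \<longrightarrow> (\<lambda>p. \<alpha> p (X p)) \<in> smooth_funs A V)}"

definition differential :: "('p, 'e::euclidean_space) atlas \<Rightarrow> ('p \<Rightarrow> real) \<Rightarrow> 'p \<Rightarrow> 'p covec"
  where "differential A f p = (\<lambda>v. if v \<in> tangent_space A p then v f else 0)"

definition tensor11 :: "('p, 'e::euclidean_space) atlas \<Rightarrow> ('p \<Rightarrow> 'p tvec \<Rightarrow> 'p tvec) \<Rightarrow> bool"
  where "tensor11 A T \<longleftrightarrow>
    (\<forall>p\<in>points A. T p ` tangent_space A p \<subseteq> tangent_space A p \<and> lin_on (tangent_space A p) (T p)) \<and>
    (\<forall>U. \<forall>X\<in>vfields A U. (\<lambda>p. T p (X p)) \<in> vfields A U)"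

definition tensor02 :: "('p, 'e::euclidean_space) atlas \<Rightarrow> ('p \<Rightarrow> 'p tvec \<Rightarrow> 'p tvec \<Rightarrow> real) \<Rightarrow> bool"
  where "tensor02 A g \<longleftrightarrow>
    (\<forall>p\<in>points A. \<forall>u\<in>tangent_space A p.
       lin_on (tangent_space A p) (\<lambda>v. g p v u) \<and> lin_on (tangent_space A p) (\<lambda>v. g p u v)) \<and>
    (\<forall>U. \<forall>X\<in>vfields A U. \<forall>Y\<in>vfields A U. (\<lambda>p. g p (X p) (Y p)) \<in> smooth_funs A U)"

definition tensor03 ::
    "('p, 'e::euclidean_space) atlas \<Rightarrow> ('p \<Rightarrow> 'p tvec \<Rightarrow> 'p tvec \<Rightarrow> 'p tvec \<Rightarrow> real) \<Rightarrow> bool"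
  where "tensor03 A F \<longleftrightarrow>
    (\<forall>p\<in>points A. \<forall>u\<in>tangent_space A p. \<forall>v\<in>tangent_space A p.
       lin_on (tangent_space A p) (\<lambda>x. F p x u v) \<and>
       lin_on (tangent_space A p) (\<lambda>x. F p u x v) \<and>
       lin_on (tangent_space A p) (\<lambda>x. F p u v x)) \<and>
    (\<forall>U. \<forall>X\<in>vfields A U. \<forall>Y\<in>vfields A U. \<forall>Z\<in>vfields A U.
       (\<lambda>p. F p (X p) (Y p) (Z p)) \<in> smooth_funs A U)"

definition pseudo_riemannian_metric ::
    "('p, 'e::euclidean_space) atlas \<Rightarrow> ('p \<Rightarrow> 'p tvec \<Rightarrow> 'p tvec \<Rightarrow> real) \<Rightarrow> bool"
  where "pseudo_riemannian_metric A g \<longleftrightarrow> tensor02 A g \<and>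
    (\<forall>p\<in>points A. \<forall>u\<in>tangent_space A p.
       (\<forall>v\<in>tangent_space A p. g p u v = g p v u) \<and>
       ((\<forall>v\<in>tangent_space A p. g p u v = 0) \<longrightarrow> u = 0))"

section \<open>Linear connections\<close>

text \<open>A linear connection acts on the vector fields on \<open>U\<close>, for every open subset \<open>U\<close>, compatibly
  with restriction to smaller open subsets.\<close>

type_synonym 'p connection = "'p vfield \<Rightarrow> 'p vfield \<Rightarrow> 'p vfield"

definition linear_connection :: "('p, 'e::euclidean_space) atlas \<Rightarrow> 'p connection \<Rightarrow> bool"
  where "linear_connection A D \<longleftrightarrow>
    (\<forall>U. \<forall>X\<in>vfields A U. \<forall>Y\<in>vfields A U. D X Y \<in> vfields A U \<and>
      (\<forall>X'\<in>vfields A U. \<forall>Y'\<in>vfields A U. \<forall>f\<in>smooth_funs A U. \<forall>p\<in>U.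
         D (\<lambda>q. X q + X' q) Y p = D X Y p + D X' Y p \<and>
         D (\<lambda>q. f q *\<^sub>R X q) Y p = f p *\<^sub>R D X Y p \<and>
         D X (\<lambda>q. Y q + Y' q) p = D X Y p + D X Y' p \<and>
         D X (\<lambda>q. f q *\<^sub>R Y q) p = X p f *\<^sub>R Y p + f p *\<^sub>R D X Y p \<and>
         ((\<forall>q\<in>U. X q = X' q \<and> Y q = Y' q) \<longrightarrow> D X Y p = D X' Y' p)))"

definition symmetric_connection :: "('p, 'e::euclidean_space) atlas \<Rightarrow> 'p connection \<Rightarrow> bool"
  where "symmetric_connection A D \<longleftrightarrow> linear_connection A D \<and>
    (\<forall>U. \<forall>X\<in>vfields A U. \<forall>Y\<in>vfields A U. \<forall>p\<in>U. D X Y p - D Y X p = bracket A X Y p)"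

definition parallel_field :: "('p, 'e::euclidean_space) atlas \<Rightarrow> 'p connection \<Rightarrow> 'p vfield \<Rightarrow> bool"
  where "parallel_field A D \<xi> \<longleftrightarrow> (\<forall>U. \<forall>X\<in>vfields A U. \<forall>p\<in>U. D X \<xi> p = 0)"

definition flat :: "('p, 'e::euclidean_space) atlas \<Rightarrow> 'p connection \<Rightarrow> bool"
  where "flat A D \<longleftrightarrow>
    (\<forall>U. \<forall>X\<in>vfields A U. \<forall>Y\<in>vfields A U. \<forall>Z\<in>vfields A U. \<forall>p\<in>U.
       D X (D Y Z) p - D Y (D X Z) p - D (bracket A X Y) Z p = 0)"

definition levi_civita ::
    "('p, 'e::euclidean_space) atlas \<Rightarrow> ('p \<Rightarrow> 'p tvec \<Rightarrow> 'p tvec \<Rightarrow> real) \<Rightarrow> 'p connection \<Rightarrow> bool"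
  where "levi_civita A g D \<longleftrightarrow> symmetric_connection A D \<and>
    (\<forall>U. \<forall>X\<in>vfields A U. \<forall>Y\<in>vfields A U. \<forall>Z\<in>vfields A U. \<forall>p\<in>U.
       X p (\<lambda>q. g q (Y q) (Z q)) = g p (D X Y p) (Z p) + g p (Y p) (D X Z p))"

section \<open>The cotangent bundle and lifts\<close>

type_synonym 'p cot = "'p \<times> 'p covec"

definition cotangent_over :: "('p, 'e::euclidean_space) atlas \<Rightarrow> 'p set \<Rightarrow> 'p cot set"
  where "cotangent_over A U = {(x, w). x \<in> U \<and> w \<in> cotangent_space A x}"

text \<open>Induced coordinates \<open>(x\<^sup>i, \<omega>\<^sub>i)\<close> with \<open>\<omega>\<^sub>i = \<omega>(\<partial>\<^sub>i)\<close>.\<close>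

definition cotangent_chart ::
    "('p, 'e::euclidean_space) atlas \<Rightarrow> ('p, 'e) chart \<Rightarrow> ('p cot, 'e \<times> 'e) chart"
  where "cotangent_chart A C =
    (cotangent_over A (fst C), \<lambda>(x, w). (snd C x, \<Sum>b\<in>Basis. w (coord_vec A C x b) *\<^sub>R b))"

definition cotangent_atlas :: "('p, 'e::euclidean_space) atlas \<Rightarrow> ('p cot, 'e \<times> 'e) atlas"
  where "cotangent_atlas A = cotangent_chart A ` A"

text \<open>The function \<open>X\<^sup>V\<close>.\<close>

definition vlift :: "'p vfield \<Rightarrow> 'p cot \<Rightarrow> real"
  where "vlift X = (\<lambda>(x, w). w (X x))"

text \<open>\<open>\<Sum>\<^sub>i \<beta>\<^sub>i \<partial>\<^sub>i\<^sub>*\<close> at \<open>(x, \<omega>)\<close>: differentiation along the line \<open>s \<mapsto> (x, \<omega> + s \<beta>)\<close>, which has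
  coordinates \<open>(x\<^sup>i, \<omega>\<^sub>i + s \<beta>\<^sub>i)\<close> in every induced chart.\<close>

definition vertical_vec :: "('p, 'e::euclidean_space) atlas \<Rightarrow> 'p cot \<Rightarrow> 'p covec \<Rightarrow> 'p cot tvec"
  where "vertical_vec A q \<beta> =
    (\<lambda>F. if smooth_near (cotangent_atlas A) q F
         then deriv (\<lambda>s. F (fst q, snd q + s *\<^sub>R \<beta>)) 0 else 0)"

definition form_vlift :: "('p, 'e::euclidean_space) atlas \<Rightarrow> ('p \<Rightarrow> 'p covec) \<Rightarrow> 'p cot vfield"
  where "form_vlift A \<alpha> q = vertical_vec A q (\<alpha> (fst q))"

definition liouville :: "('p, 'e::euclidean_space) atlas \<Rightarrow> 'p cot vfield"
  where "liouville A q = vertical_vec A q (snd q)"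

text \<open>\<open>XC\<close> is the complete lift \<open>X\<^sup>C\<close> of the vector field \<open>X\<close> on the open set \<open>U\<close>.\<close>

definition complete_lift ::
    "('p, 'e::euclidean_space) atlas \<Rightarrow> 'p set \<Rightarrow> 'p vfield \<Rightarrow> 'p cot vfield \<Rightarrow> bool"
  where "complete_lift A U X XC \<longleftrightarrow> XC \<in> vfields (cotangent_atlas A) (cotangent_over A U) \<and>
    (\<forall>V Z. V \<subseteq> U \<longrightarrow> Z \<in> vfields A V \<longrightarrow>
       (\<forall>q\<in>cotangent_over A V. XC q (vlift Z) = vlift (bracket A X Z) q))"

text \<open>\<open>CT\<close> is \<open>C(T)\<close> over \<open>U\<close>; the (1,1) tensor field \<open>T\<close> is given as an operator on vector fields.\<close>

definition C_lift ::
    "('p, 'e::euclidean_space) atlas \<Rightarrow> 'p set \<Rightarrow> ('p vfield \<Rightarrow> 'p vfield) \<Rightarrow> 'p cot vfield \<Rightarrow> bool"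
  where "C_lift A U T CT \<longleftrightarrow> CT \<in> vfields (cotangent_atlas A) (cotangent_over A U) \<and>
    (\<forall>V Z. V \<subseteq> U \<longrightarrow> Z \<in> vfields A V \<longrightarrow>
       (\<forall>q\<in>cotangent_over A V. CT q (vlift Z) = vlift (T Z) q))"

definition natural_riemann_extension ::
    "('p, 'e::euclidean_space) atlas \<Rightarrow> 'p connection \<Rightarrow> real \<Rightarrow> real \<Rightarrow>
     ('p cot \<Rightarrow> 'p cot tvec \<Rightarrow> 'p cot tvec \<Rightarrow> real) \<Rightarrow> bool"
  where "natural_riemann_extension A D a b G \<longleftrightarrow>
    pseudo_riemannian_metric (cotangent_atlas A) G \<and>
    (\<forall>U X Y XC YC. X \<in> vfields A U \<longrightarrow> Y \<in> vfields A U \<longrightarrow>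
       complete_lift A U X XC \<longrightarrow> complete_lift A U Y YC \<longrightarrow>
       (\<forall>q\<in>cotangent_over A U. G q (XC q) (YC q) =
          - a * snd q (D X Y (fst q) + D Y X (fst q)) + b * vlift X q * vlift Y q)) \<and>
    (\<forall>U X XC \<alpha>. X \<in> vfields A U \<longrightarrow> complete_lift A U X XC \<longrightarrow> \<alpha> \<in> one_forms A U \<longrightarrow>
       (\<forall>q\<in>cotangent_over A U. G q (XC q) (form_vlift A \<alpha> q) = a * \<alpha> (fst q) (X (fst q)))) \<and>
    (\<forall>U \<alpha> \<beta>. \<alpha> \<in> one_forms A U \<longrightarrow> \<beta> \<in> one_forms A U \<longrightarrow>
       (\<forall>q\<in>cotangent_over A U. G q (form_vlift A \<alpha> q) (form_vlift A \<beta> q) = 0))"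

definition natural_paracomplex ::
    "('p, 'e::euclidean_space) atlas \<Rightarrow> 'p connection \<Rightarrow> real \<Rightarrow> real \<Rightarrow>
     ('p cot \<Rightarrow> 'p cot tvec \<Rightarrow> 'p cot tvec) \<Rightarrow> bool"
  where "natural_paracomplex A D a b P \<longleftrightarrow> tensor11 (cotangent_atlas A) P \<and>
    (\<forall>U X XC CT. X \<in> vfields A U \<longrightarrow> complete_lift A U X XC \<longrightarrow>
       C_lift A U (\<lambda>Z. D Z X) CT \<longrightarrow>
       (\<forall>q\<in>cotangent_over A U. P q (XC q) =
          XC q + 2 *\<^sub>R CT q - (b / a * vlift X q) *\<^sub>R liouville A q)) \<and>
    (\<forall>U \<alpha>. \<alpha> \<in> one_forms A U \<longrightarrow>
       (\<forall>q\<in>cotangent_over A U. P q (form_vlift A \<alpha> q) = - form_vlift A \<alpha> q))"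

section \<open>Embedded submanifolds\<close>

text \<open>Differential at \<open>p\<close> of the inclusion into the manifold \<open>A\<close> of a submanifold through \<open>p\<close>.\<close>

definition incl :: "('p, 'e::euclidean_space) atlas \<Rightarrow> 'p \<Rightarrow> 'p tvec \<Rightarrow> 'p tvec"
  where "incl A p v = (\<lambda>f. if smooth_near A p f then v f else 0)"

definition embedded_submanifold ::
    "('p, 'e::euclidean_space) atlas \<Rightarrow> ('p, 'h::euclidean_space) atlas \<Rightarrow> bool"
  where "embedded_submanifold A B \<longleftrightarrow> smooth_manifold B \<and> points B \<subseteq> points A \<and>
    manifold_topology B = subtopology (manifold_topology A) (points B) \<and>
    (\<forall>C\<in>B. \<forall>D\<in>A. C_infinity (snd C ` (fst C \<inter> fst D)) (snd D \<circ> chart_inv C)) \<and>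
    (\<forall>p\<in>points B. inj_on (incl A p) (tangent_space B p))"

text \<open>The vector tangent to the submanifold \<open>B\<close> with image \<open>u\<close> under the differential of the
  inclusion. Meaningful only if \<open>u\<close> is tangent to \<open>B\<close>.\<close>

definition tangent_part ::
    "('p, 'e::euclidean_space) atlas \<Rightarrow> ('p, 'h::euclidean_space) atlas \<Rightarrow> 'p \<Rightarrow> 'p tvec \<Rightarrow> 'p tvec"
  where "tangent_part A B p u = inv_into (tangent_space B p) (incl A p) u"

definition induced_metric ::
    "('p, 'e::euclidean_space) atlas \<Rightarrow> ('p \<Rightarrow> 'p tvec \<Rightarrow> 'p tvec \<Rightarrow> real) \<Rightarrow>
     'p \<Rightarrow> 'p tvec \<Rightarrow> 'p tvec \<Rightarrow> real"
  where "induced_metric A G p u v = G p (incl A p u) (incl A p v)"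

definition timelike_unit_normal ::
    "('p, 'e::euclidean_space) atlas \<Rightarrow> ('p, 'h::euclidean_space) atlas \<Rightarrow>
     ('p \<Rightarrow> 'p tvec \<Rightarrow> 'p tvec \<Rightarrow> real) \<Rightarrow> 'p vfield \<Rightarrow> bool"
  where "timelike_unit_normal A B G N \<longleftrightarrow>
    (\<forall>p\<in>points B. N p \<in> tangent_space A p \<and>
       (\<forall>v\<in>tangent_space B p. G p (incl A p v) (N p) = 0) \<and> G p (N p) (N p) = - 1)"

section \<open>Almost paracontact metric manifolds\<close>

definition almost_paracontact_metric ::
    "('p, 'e::euclidean_space) atlas \<Rightarrow> ('p \<Rightarrow> 'p tvec \<Rightarrow> 'p tvec) \<Rightarrow> 'p vfield \<Rightarrow>
     ('p \<Rightarrow> 'p covec) \<Rightarrow> ('p \<Rightarrow> 'p tvec \<Rightarrow> 'p tvec \<Rightarrow> real) \<Rightarrow> bool"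
  where "almost_paracontact_metric A \<phi> \<xi> \<eta> g \<longleftrightarrow>
    smooth_manifold A \<and> odd DIM('e) \<and> tensor11 A \<phi> \<and> \<xi> \<in> vfields A (points A) \<and>
    \<eta> \<in> one_forms A (points A) \<and> pseudo_riemannian_metric A g \<and>
    (\<forall>p\<in>points A. \<eta> p (\<xi> p) = 1 \<and> \<phi> p (\<xi> p) = 0 \<and>
       (\<forall>u\<in>tangent_space A p. \<phi> p (\<phi> p u) = u - \<eta> p u *\<^sub>R \<xi> p \<and>
          (\<forall>v\<in>tangent_space A p. g p (\<phi> p u) (\<phi> p v) = - g p u v + \<eta> p u * \<eta> p v)))"

definition paracontact_metric ::
    "('p, 'e::euclidean_space) atlas \<Rightarrow> ('p \<Rightarrow> 'p tvec \<Rightarrow> 'p tvec) \<Rightarrow> 'p vfield \<Rightarrow>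
     ('p \<Rightarrow> 'p covec) \<Rightarrow> ('p \<Rightarrow> 'p tvec \<Rightarrow> 'p tvec \<Rightarrow> real) \<Rightarrow> bool"
  where "paracontact_metric A \<phi> \<xi> \<eta> g \<longleftrightarrow> almost_paracontact_metric A \<phi> \<xi> \<eta> g \<and>
    (\<forall>U. \<forall>X\<in>vfields A U. \<forall>Y\<in>vfields A U. \<forall>p\<in>U.
       g p (X p) (\<phi> p (Y p)) =
         1 / 2 * (X p (\<lambda>q. \<eta> q (Y q)) - Y p (\<lambda>q. \<eta> q (X q)) - \<eta> p (bracket A X Y p)))"

text \<open>The ambient space of (0,3) tensor fields that the classes divide up.\<close>

definition F_space ::
    "('p, 'e::euclidean_space) atlas \<Rightarrow> ('p \<Rightarrow> 'p tvec \<Rightarrow> 'p tvec) \<Rightarrow> 'p vfield \<Rightarrow>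
     ('p \<Rightarrow> 'p covec) \<Rightarrow> ('p \<Rightarrow> 'p tvec \<Rightarrow> 'p tvec \<Rightarrow> 'p tvec \<Rightarrow> real) \<Rightarrow> bool"
  where "F_space A \<phi> \<xi> \<eta> F \<longleftrightarrow> tensor03 A F \<and>
    (\<forall>p\<in>points A. \<forall>x\<in>tangent_space A p. \<forall>y\<in>tangent_space A p. \<forall>z\<in>tangent_space A p.
       F p x y z = - F p x z y \<and>
       F p x (\<phi> p y) (\<phi> p z) = F p x y z + \<eta> p y * F p x z (\<xi> p) - \<eta> p z * F p x y (\<xi> p))"

text \<open>\<open>\<theta>\<^sub>F(\<xi>)\<close>, where \<open>2m = DIM('e) - 1\<close>, \<open>e\<close> enumerates a basis of \<open>ker \<eta>\<close> and \<open>h\<close> is the inverse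
  of the matrix \<open>g(e\<^sub>i, e\<^sub>j)\<close>. The value does not depend on the basis.\<close>

definition theta ::
    "('p, 'e::euclidean_space) atlas \<Rightarrow> 'p vfield \<Rightarrow> ('p \<Rightarrow> 'p covec) \<Rightarrow>
     ('p \<Rightarrow> 'p tvec \<Rightarrow> 'p tvec \<Rightarrow> real) \<Rightarrow> ('p \<Rightarrow> 'p tvec \<Rightarrow> 'p tvec \<Rightarrow> 'p tvec \<Rightarrow> real) \<Rightarrow>
     'p \<Rightarrow> real"
  where "theta (A :: ('p, 'e) atlas) \<xi> \<eta> g F p =
    (THE s. \<exists>(e :: nat \<Rightarrow> 'p tvec) (h :: nat \<Rightarrow> nat \<Rightarrow> real). let I = {..<DIM('e) - 1} in
       inj_on e I \<and> independent (e ` I) \<and> span (e ` I) = {v \<in> tangent_space A p. \<eta> p v = 0} \<and>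
       (\<forall>i\<in>I. \<forall>j\<in>I. (\<Sum>k\<in>I. h i k * g p (e k) (e j)) = (if i = j then 1 else 0)) \<and>
       s = (\<Sum>i\<in>I. \<Sum>j\<in>I. h i j * F p (e i) (e j) (\<xi> p)))"

definition class_G4 ::
    "('p, 'e::euclidean_space) atlas \<Rightarrow> ('p \<Rightarrow> 'p tvec \<Rightarrow> 'p tvec) \<Rightarrow> 'p vfield \<Rightarrow>
     ('p \<Rightarrow> 'p covec) \<Rightarrow> ('p \<Rightarrow> 'p tvec \<Rightarrow> 'p tvec \<Rightarrow> real) \<Rightarrow>
     ('p \<Rightarrow> 'p tvec \<Rightarrow> 'p tvec \<Rightarrow> 'p tvec \<Rightarrow> real) \<Rightarrow> bool"
  where "class_G4 A \<phi> \<xi> \<eta> g F \<longleftrightarrow> F_space A \<phi> \<xi> \<eta> F \<and>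
    (\<forall>p\<in>points A. \<forall>x\<in>tangent_space A p. \<forall>y\<in>tangent_space A p. \<forall>z\<in>tangent_space A p.
       F p (\<xi> p) y z = 0 \<and> F p x (\<xi> p) z = 0 \<and> F p x y z + F p y z x + F p z x y = 0)"

definition class_G5 ::
    "('p, 'e::euclidean_space) atlas \<Rightarrow> ('p \<Rightarrow> 'p tvec \<Rightarrow> 'p tvec) \<Rightarrow> 'p vfield \<Rightarrow>
     ('p \<Rightarrow> 'p covec) \<Rightarrow> ('p \<Rightarrow> 'p tvec \<Rightarrow> 'p tvec \<Rightarrow> real) \<Rightarrow>
     ('p \<Rightarrow> 'p tvec \<Rightarrow> 'p tvec \<Rightarrow> 'p tvec \<Rightarrow> real) \<Rightarrow> bool"
  where "class_G5 A \<phi> \<xi> \<eta> g F \<longleftrightarrow> F_space A \<phi> \<xi> \<eta> F \<and>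
    (\<forall>p\<in>points A. \<forall>x\<in>tangent_space A p. \<forall>y\<in>tangent_space A p. \<forall>z\<in>tangent_space A p.
       F p x y z = theta A \<xi> \<eta> g F p / real (DIM('e) - 1) *
         (\<eta> p y * g p (\<phi> p x) (\<phi> p z) - \<eta> p z * g p (\<phi> p x) (\<phi> p y)))"

definition class_G10 ::
    "('p, 'e::euclidean_space) atlas \<Rightarrow> ('p \<Rightarrow> 'p tvec \<Rightarrow> 'p tvec) \<Rightarrow> 'p vfield \<Rightarrow>
     ('p \<Rightarrow> 'p covec) \<Rightarrow> ('p \<Rightarrow> 'p tvec \<Rightarrow> 'p tvec \<Rightarrow> real) \<Rightarrow>
     ('p \<Rightarrow> 'p tvec \<Rightarrow> 'p tvec \<Rightarrow> 'p tvec \<Rightarrow> real) \<Rightarrow> bool"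
  where "class_G10 A \<phi> \<xi> \<eta> g F \<longleftrightarrow> F_space A \<phi> \<xi> \<eta> F \<and>
    (\<forall>p\<in>points A. \<forall>x\<in>tangent_space A p. \<forall>y\<in>tangent_space A p. \<forall>z\<in>tangent_space A p.
       F p x y z = - \<eta> p y * F p x z (\<xi> p) + \<eta> p z * F p x y (\<xi> p) \<and>
       F p x y (\<xi> p) = F p y x (\<xi> p) \<and> F p y x (\<xi> p) = F p (\<phi> p x) (\<phi> p y) (\<xi> p))"

text \<open>Membership in the direct sum of the listed classes: \<open>g((\<nabla>\<^sub>X \<phi>)Y, Z)\<close>, with \<open>\<nabla> = D\<close> the
  Levi-Civita connection of \<open>g\<close>, is a sum of tensor fields from the respective classes.\<close>

definition in_class_sum ::
    "('p, 'e::euclidean_space) atlas \<Rightarrow> 'p connection \<Rightarrow> ('p \<Rightarrow> 'p tvec \<Rightarrow> 'p tvec) \<Rightarrow> 'p vfield \<Rightarrow>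
     ('p \<Rightarrow> 'p covec) \<Rightarrow> ('p \<Rightarrow> 'p tvec \<Rightarrow> 'p tvec \<Rightarrow> real) \<Rightarrow>
     (('p, 'e) atlas \<Rightarrow> ('p \<Rightarrow> 'p tvec \<Rightarrow> 'p tvec) \<Rightarrow> 'p vfield \<Rightarrow> ('p \<Rightarrow> 'p covec) \<Rightarrow>
      ('p \<Rightarrow> 'p tvec \<Rightarrow> 'p tvec \<Rightarrow> real) \<Rightarrow>
      ('p \<Rightarrow> 'p tvec \<Rightarrow> 'p tvec \<Rightarrow> 'p tvec \<Rightarrow> real) \<Rightarrow> bool) list \<Rightarrow> bool"
  where "in_class_sum A D \<phi> \<xi> \<eta> g Gs \<longleftrightarrow> almost_paracontact_metric A \<phi> \<xi> \<eta> g \<and>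
    (\<exists>Fs. list_all2 (\<lambda>G F. G A \<phi> \<xi> \<eta> g F) Gs Fs \<and>
       (\<forall>U. \<forall>X\<in>vfields A U. \<forall>Y\<in>vfields A U. \<forall>Z\<in>vfields A U. \<forall>p\<in>U.
          g p (D X (\<lambda>q. \<phi> q (Y q)) p - \<phi> p (D X Y p)) (Z p) =
          (\<Sum>F\<leftarrow>Fs. F p (X p) (Y p) (Z p))))"

section \<open>The hypersurface\<close>

definition hypersurface ::
    "('p, 'e::euclidean_space) atlas \<Rightarrow> 'p vfield \<Rightarrow> ('p \<Rightarrow> real) \<Rightarrow> real \<Rightarrow> 'p cot set"
  where "hypersurface A \<xi> f t = {q \<in> points (cotangent_atlas A). snd q (\<xi> (fst q)) + f (fst q) = t}"

text \<open>\<open>\<xi>C\<close> stands for the complete lift of \<open>\<xi>\<close>.\<close>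

definition hypersurface_normal ::
    "('p, 'e::euclidean_space) atlas \<Rightarrow> real \<Rightarrow> real \<Rightarrow> 'p vfield \<Rightarrow> 'p cot vfield \<Rightarrow> ('p \<Rightarrow> real) \<Rightarrow>
     'p cot vfield"
  where "hypersurface_normal A a b \<xi> \<xi>C f q = (1 / (sqrt b * vlift \<xi> q)) *\<^sub>R
    (\<xi>C q - (b / a * vlift \<xi> q) *\<^sub>R liouville A q + form_vlift A (differential A f) q)"

end

theory Submission
  imports Defs
begin

text \<open>
  The geometry becomes transparent in a frame adapted to \<open>P\<close>. In induced coordinates \<open>(x, \<omega>)\<close> put
  \<open>\<kappa> = b / (2 a)\<close>. The eigenbundle of \<open>P\<close> for \<open>-1\<close> is the vertical bundle, the one for \<open>1\<close> is
  spanned by the fields \<open>D\<^sub>i = \<partial>\<^sub>i + (\<omega>\<^sub>h \<Gamma>\<^sup>h\<^sub>i\<^sub>j - \<kappa> \<omega>\<^sub>i \<omega>\<^sub>j) \<partial>\<^sub>j\<^sub>*\<close>, and both are null. A tangent vector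
  becomes a pair \<open>(h, v)\<close> of a horizontal vector and a vertical covector, with \<open>P(h, v) = (h, - v)\<close> and
  metric \<open>a (v(k) + l(h))\<close> between \<open>(h, v)\<close> and \<open>(k, l)\<close> (lemmas \<open>P_adapted\<close>, \<open>G_adapted\<close>). With
  \<open>s = \<omega>(\<xi>)\<close> the normal is \<open>N = (\<xi>, df - \<kappa> s \<omega>) / (\<surd>b s)\<close>; its square is \<open>- 1\<close> exactly where
  \<open>\<xi> f = 0\<close>, so \<open>f\<close> is a first integral of \<open>\<xi>\<close> (\<open>dF_xi\<close>).

  The Levi-Civita connection of the ambient metric has a short expression in this frame
  (\<open>cderiv\<close>). It is verified to be metric and torsion free along a parametrisation of the
  hypersurface, and these two properties characterise \<open>g(\<nabla>\<^sub>X Y, Z)\<close> (\<open>cderiv_unique\<close>). The outcome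
  (\<open>cderiv_phi\<close>) is, with horizontal parts denoted by a prime,
  \<open>F(X, Y, Z) = - 2 a \<omega>(R(Y', Z') X') + \<eta>(Y) H(X, Z) - \<eta>(Z) H(X, Y)\<close>,
  where the second fundamental form is
  \<open>H(X, Z) = \<surd>b / (2 a) (g + \<eta> \<otimes> \<eta>)(X, Z) - a / (\<surd>b s) (Hess f + (2 / s) df \<otimes> df)(X', Z')
  - a / (\<surd>b s) \<omega>(R(Z', \<xi>) X')\<close>.

  The three classes can be read off (\<open>F_tensor_split\<close>). Restricted to \<open>ker \<eta>\<close> only the curvature term
  survives; composed with the projection to \<open>ker \<eta>\<close> it is the part in \<open>\<bbbG>\<^sub>4\<close>, by the first Bianchi
  identity. The term with \<open>g\<close> is the part in \<open>\<bbbG>\<^sub>5\<close>, and \<open>\<eta> \<otimes> \<eta>\<close> cancels. What is left has the form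
  \<open>\<eta>(Y) k(X, Z) - \<eta>(Z) k(X, Y)\<close>, where \<open>k\<close> is symmetric, depends on horizontal parts only, and is
  annihilated by the structure vector field because \<open>\<xi> f = 0\<close>, \<open>\<nabla>\<xi> = 0\<close> and \<open>R(\<cdot>, \<cdot>)\<xi> = 0\<close>; this is
  the part in \<open>\<bbbG>\<^sub>1\<^sub>0\<close>. The part in \<open>\<bbbG>\<^sub>4\<close> vanishes if \<open>R = 0\<close>, and also if \<open>M\<close> is a surface, since
  \<open>ker \<eta>\<close> then projects to a line.

  On the hypersurface \<open>\<eta>\<close> is \<open>\<surd>b\<close> times the canonical 1-form plus an exact form, so \<open>d\<eta>\<close> is a multiple
  of the canonical symplectic form, and so is \<open>g(X, \<phi> Y)\<close>. The factor between them is \<open>\<surd>b / (2 a)\<close>,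
  which is \<open>1\<close> precisely for \<open>b = 4 a\<^sup>2\<close> (\<open>deta\<close>, \<open>paracontact_iff\<close>).

  All computations take place in charts. Smoothness of tangent fields of the hypersurface is obtained
  from their ambient components by solving an injective linear system with smooth coefficients
  (\<open>C_infinity_solve_injective\<close>).\<close>

section \<open>Smooth maps between Euclidean spaces\<close>

abbreviation fd :: "('a::real_normed_vector \<Rightarrow> 'b::real_normed_vector) \<Rightarrow> 'a \<Rightarrow> 'a \<Rightarrow> 'b"
  where "fd f x \<equiv> frechet_derivative f (at x)"

lemma fd_eq: "(f has_derivative f') (at x) \<Longrightarrow> fd f x = f'"
  by (simp add: frechet_derivative_at[symmetric])

lemma fd_cong:
  assumes "open S" "x \<in> S" "\<And>y. y \<in> S \<Longrightarrow> f y = g y"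
  shows "fd f x = fd g x"
proof -
  have "(f has_derivative h) (at x) = (g has_derivative h) (at x)" for h
    using assms has_derivative_transform_within_open[of f h x UNIV S g]
      has_derivative_transform_within_open[of g h x UNIV S f] by auto
  then show ?thesis unfolding frechet_derivative_def by simp
qed

lemma C_k_SucD:
  assumes "open S" "C_k (Suc k) S f"
  shows "x \<in> S \<Longrightarrow> (f has_derivative fd f x) (at x)" "C_k k S (\<lambda>x. fd f x v)"
  using assms by (auto simp: differentiable_on_def at_within_open[OF _ \<open>open S\<close>] frechet_derivative_works)

lemma C_k_cong_imp:
  assumes "open S" "\<And>x. x \<in> S \<Longrightarrow> f x = g x" "C_k k S f"
  shows "C_k k S g"
  using assms(2,3)
proof (induction k arbitrary: f g)
  case 0
  then show ?case by (simp cong: continuous_on_cong)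
next
  case (Suc k)
  have "g differentiable_on S"
    unfolding differentiable_on_def
  proof
    fix x assume x: "x \<in> S"
    have "(g has_derivative fd f x) (at x within S)"
      by (rule has_derivative_transform[OF x _ has_derivative_at_withinI[OF C_k_SucD(1)[OF assms(1) Suc.prems(2) x]]])
         (simp add: Suc.prems(1))
    then show "g differentiable at x within S" by (rule differentiableI)
  qed
  moreover have "C_k k S (\<lambda>x. fd g x v)" for v
    by (rule Suc.IH[OF _ C_k_SucD(2)[OF assms(1) Suc.prems(2)]])
       (simp add: fd_cong[OF assms(1) _ Suc.prems(1)])
  ultimately show ?case by simp
qed

text \<open>Allows a derivative in any convenient form, which keeps \<open>frechet_derivative\<close> out of the
  inductions on \<open>k\<close>.\<close>

lemma C_k_SucI:
  assumes "open S" "\<And>x. x \<in> S \<Longrightarrow> (f has_derivative f' x) (at x)" "\<And>v. C_k k S (\<lambda>x. f' x v)"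
  shows "C_k (Suc k) S f"
proof -
  have "f differentiable_on S"
    using assms(2) by (auto simp: differentiable_on_def intro: differentiableI has_derivative_at_withinI)
  moreover have "C_k k S (\<lambda>x. fd f x v)" for v
    by (rule C_k_cong_imp[OF assms(1) _ assms(3)[of v]]) (simp add: fd_eq[OF assms(2)])
  ultimately show ?thesis by simp
qed

lemma C_k_subset: "C_k k S f \<Longrightarrow> T \<subseteq> S \<Longrightarrow> C_k k T f"
  by (induction k arbitrary: f) (auto intro: continuous_on_subset differentiable_on_subset)

lemma C_k_pred: "open S \<Longrightarrow> C_k (Suc k) S f \<Longrightarrow> C_k k S f"
  by (induction k arbitrary: f) (auto simp: differentiable_imp_continuous_on)

lemma C_k_local:
  assumes "\<And>x. x \<in> S \<Longrightarrow> \<exists>T. open T \<and> x \<in> T \<and> C_k k T f"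
  shows "C_k k S f"
  using assms
proof (induction k arbitrary: f)
  case 0
  show ?case unfolding C_k.simps continuous_on_eq_continuous_within
  proof
    fix x assume "x \<in> S"
    then obtain T where "open T" "x \<in> T" "continuous_on T f" using 0 by auto
    then have "continuous (at x) f" by (simp add: continuous_on_eq_continuous_at)
    then show "continuous (at x within S) f" by (rule continuous_at_imp_continuous_at_within)
  qed
next
  case (Suc k)
  have "f differentiable_on S" unfolding differentiable_on_def
  proof
    fix x assume "x \<in> S"
    then obtain T where "open T" "x \<in> T" "C_k (Suc k) T f" using Suc by metis
    then show "f differentiable at x within S"
      using C_k_SucD(1)[of T k f x] by (auto intro: differentiableI has_derivative_at_withinI)
  qed
  moreover have "C_k k S (\<lambda>x. fd f x v)" for v
    by (rule Suc.IH) (metis Suc.prems C_k.simps(2))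
  ultimately show ?case by simp
qed

lemma C_k_const: "open S \<Longrightarrow> C_k k S (\<lambda>x. c)"
  by (induction k arbitrary: c) (auto intro!: continuous_on_const)

lemma C_k_linear: "bounded_linear L \<Longrightarrow> open S \<Longrightarrow> C_k k S L"
  by (cases k) (auto intro!: C_k_SucI C_k_const bounded_linear_imp_has_derivative
      linear_continuous_on simp del: C_k.simps(2))

lemma C_k_add: "open S \<Longrightarrow> C_k k S f \<Longrightarrow> C_k k S g \<Longrightarrow> C_k k S (\<lambda>x. f x + g x)"
proof (induction k arbitrary: f g)
  case (Suc k)
  note C_k.simps(2)[simp del]
  show ?case
    by (rule C_k_SucI[OF \<open>open S\<close> has_derivative_add])
       (use Suc in \<open>auto intro: C_k_SucD\<close>)
qed (auto intro: continuous_on_add)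

lemma C_k_bilinear:
  assumes "bounded_bilinear B" "open S" 
  shows "C_k k S f \<Longrightarrow> C_k k S g \<Longrightarrow> C_k k S (\<lambda>x. B (f x) (g x))"
proof (induction k arbitrary: f g)
  case 0
  then show ?case using bounded_bilinear.continuous_on[OF assms(1)] by auto
next
  case (Suc k)
  note C_k.simps(2)[simp del]
  show ?case
    by (rule C_k_SucI[OF assms(2) bounded_bilinear.FDERIV[OF assms(1)]])
       (use Suc assms in \<open>auto intro!: C_k_add intro: C_k_SucD C_k_pred\<close>)
qed

lemma C_k_sum: "open S \<Longrightarrow> (\<And>i. i \<in> I \<Longrightarrow> C_k k S (f i)) \<Longrightarrow> C_k k S (\<lambda>x. \<Sum>i\<in>I. f i x)"
  by (induction I rule: infinite_finite_induct) (auto intro: C_k_const C_k_add)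

text \<open>The chain rule is expanded over a basis, so that the induction hypothesis is applied to the
  derivatives of \<open>g\<close> in fixed directions.\<close>

lemma C_k_compose:
  fixes f :: "'a::real_normed_vector \<Rightarrow> 'b::euclidean_space" and g :: "'b \<Rightarrow> 'c::real_normed_vector"
  assumes "open S" "open T" "f ` S \<subseteq> T"
  shows "C_k k S f \<Longrightarrow> C_k k T g \<Longrightarrow> C_k k S (\<lambda>x. g (f x))"
proof (induction k arbitrary: g)
  case 0
  then show ?case using assms continuous_on_compose2[of T g S f] by auto
next
  case (Suc k)
  note C_k.simps(2)[simp del]
  note df = C_k_SucD[OF assms(1) Suc.prems(1)] and dg = C_k_SucD[OF assms(2) Suc.prems(2)]
  have eq: "fd g y v = (\<Sum>b\<in>Basis. (v \<bullet> b) *\<^sub>R fd g y b)" if "y \<in> T" for y v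
  proof -
    interpret bounded_linear "fd g y" using dg(1)[OF that] by (rule has_derivative_bounded_linear)
    show ?thesis by (metis (no_types, lifting) euclidean_representation scale sum sum.cong)
  qed
  show ?case
  proof (rule C_k_SucI[OF assms(1)])
    fix x assume x: "x \<in> S"
    then have d: "((\<lambda>x. g (f x)) has_derivative (\<lambda>v. fd g (f x) (fd f x v))) (at x)"
      using has_derivative_compose[OF df(1)[OF x] dg(1)] assms(3) by auto
    have "(\<lambda>v. fd g (f x) (fd f x v)) = (\<lambda>v. \<Sum>b\<in>Basis. (fd f x v \<bullet> b) *\<^sub>R fd g (f x) b)"
      by (rule ext, rule eq) (use x assms(3) in blast)
    with d show "((\<lambda>x. g (f x)) has_derivative
        (\<lambda>v. \<Sum>b\<in>Basis. (fd f x v \<bullet> b) *\<^sub>R fd g (f x) b)) (at x)"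
      by simp
  next
    fix v
    have "C_k k S (\<lambda>x. fd f x v \<bullet> b)" for b
      by (rule C_k_bilinear[OF bounded_bilinear_inner assms(1) df(2) C_k_const[OF assms(1)]])
    then show "C_k k S (\<lambda>x. \<Sum>b\<in>Basis. (fd f x v \<bullet> b) *\<^sub>R fd g (f x) b)"
      using Suc.IH[OF C_k_pred[OF assms(1) Suc.prems(1)] dg(2)]
      by (intro C_k_sum assms C_k_bilinear[OF bounded_bilinear_scaleR assms(1)]) auto
  qed
qed

lemma C_k_inverse: "C_k k (- {0}) (inverse :: real \<Rightarrow> real)"
proof (induction k)
  case 0
  show ?case unfolding C_k.simps by (intro continuous_on_inverse continuous_on_id) auto
next
  case (Suc k)
  have o: "open (- {0::real})" by auto
  have "C_k k (- {0}) (\<lambda>x::real. (- v) * (inverse x * inverse x))" for v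
    by (intro C_k_bilinear[OF bounded_bilinear_mult o] Suc C_k_const[OF o])
  then show ?case
    by (intro C_k_SucI[OF o, where f' = "\<lambda>x v. (- v) * (inverse x * inverse x)"])
       (auto intro!: derivative_eq_intros simp del: C_k.simps)
qed

text \<open>The derivatives of a solution \<open>u\<close> of \<open>M(x) u(x) = z(x)\<close> solve systems with the same
  matrix \<open>M(x)\<close>, which is why the regularity of \<open>u\<close> follows by induction; the lower bound on
  \<open>M(x)\<close> starts it.\<close>

lemma C_k_linear_system:
  fixes M :: "'a::real_normed_vector \<Rightarrow> 'b::euclidean_space \<Rightarrow> 'b"
  assumes S: "open S" and lin: "\<And>x. x \<in> S \<Longrightarrow> linear (M x)"
    and low: "\<And>x v. x \<in> S \<Longrightarrow> norm v \<le> 2 * norm (M x v)"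
    and M: "\<And>k v. C_k k S (\<lambda>x. M x v)"
  shows "C_k k S z \<Longrightarrow> (\<And>x. x \<in> S \<Longrightarrow> M x (u x) = z x) \<Longrightarrow> C_k k S u"
proof (induction k arbitrary: z u)
  case 0
  show ?case unfolding C_k.simps continuous_on_eq_continuous_at[OF S]
  proof
    fix x assume x: "x \<in> S"
    have "((\<lambda>y. z y - M y (u x)) \<longlongrightarrow> z x - M x (u x)) (at x)"
      using 0(1) M[of 0 "u x"] x S
      by (intro tendsto_diff) (auto simp: continuous_on_eq_continuous_at isCont_def)
    then have "((\<lambda>y. 2 * norm (z y - M y (u x))) \<longlongrightarrow> 0) (at x)"
      using 0(2)[OF x] tendsto_mult_right_zero tendsto_norm_zero by fastforce
    moreover have "eventually (\<lambda>y. norm (u y - u x) \<le> 2 * norm (z y - M y (u x))) (at x)"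
      using eventually_at_topological S x low 0(2) linear_diff[OF lin]
      by (metis (no_types, lifting))
    ultimately have "((\<lambda>y. u y - u x) \<longlongrightarrow> 0) (at x)" by (rule Lim_null_comparison[rotated])
    then show "isCont u x" by (simp add: isCont_def LIM_zero_iff)
  qed
next
  case (Suc k)
  note C_k.simps(2)[simp del]
  note dz = C_k_SucD[OF S Suc.prems(1)] and dM = C_k_SucD[OF S M]
  have uk: "C_k k S u" by (rule Suc.IH[OF C_k_pred[OF S Suc.prems(1)] Suc.prems(2)])
  have inj: "inj (M x)" if "x \<in> S" for x
    unfolding linear_injective_0[OF lin[OF that]]
    using low[OF that] by (metis mult_zero_right norm_le_zero_iff norm_zero)
  define dM' where "dM' x h v = (\<Sum>b\<in>Basis. (v \<bullet> b) *\<^sub>R fd (\<lambda>x. M x b) x h)" for x h v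
  have Mrep: "M x v = (\<Sum>b\<in>Basis. (v \<bullet> b) *\<^sub>R M x b)" if "x \<in> S" for x v
  proof -
    have "M x v = M x (\<Sum>b\<in>Basis. (v \<bullet> b) *\<^sub>R b)" by (simp add: euclidean_representation)
    also have "\<dots> = (\<Sum>b\<in>Basis. (v \<bullet> b) *\<^sub>R M x b)"
      by (simp add: linear_sum[OF lin[OF that]] linear_scale[OF lin[OF that]])
    finally show ?thesis .
  qed
  have dMd: "((\<lambda>x. M x v) has_derivative (\<lambda>h. dM' x h v)) (at x)" if x: "x \<in> S" for x v
  proof -
    have "((\<lambda>x. \<Sum>b\<in>Basis. (v \<bullet> b) *\<^sub>R M x b) has_derivative (\<lambda>h. dM' x h v)) (at x)"
      unfolding dM'_def
      by (intro has_derivative_sum has_derivative_scaleR_right dM(1)) (rule x)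
    then show ?thesis
      by (rule has_derivative_transform_within_open[OF _ S x]) (simp add: Mrep)
  qed
  \<comment> \<open>The candidate for the derivative, from differentiating \<open>M(x) u(x) = z(x)\<close> formally.\<close>
  define du where "du x h = inv (M x) (fd z x h - dM' x h (u x))" for x h
  have Mdu: "M x (du x h) = fd z x h - dM' x h (u x)" if "x \<in> S" for x h
    unfolding du_def using linear_injective_imp_surjective[OF lin[OF that] inj[OF that]]
    by (simp add: surj_f_inv_f)
  show ?case
  proof (rule C_k_SucI[OF S, where f' = du])
    fix x assume x: "x \<in> S"
    define r where "r h = fd z x h - dM' x h (u x)" for h
    have blr: "bounded_linear r" unfolding r_def
      by (intro bounded_linear_sub has_derivative_bounded_linear[OF dz(1)[OF x]]
          has_derivative_bounded_linear[OF dMd[OF x]])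
    have "linear (inv (M x))"
      using inj_linear_imp_inv_linear[OF lin[OF x] inj[OF x]] .
    then have lindu: "linear (du x)"
      unfolding du_def using linear_compose[OF bounded_linear.linear[OF blr], of "inv (M x)"]
      by (simp add: o_def r_def)
    obtain K where K: "\<And>h. norm (r h) \<le> norm h * K" "K > 0"
      using bounded_linear.pos_bounded[OF blr] by blast
    have bdu: "norm (du x h) \<le> norm h * (2 * K)" for h
      using low[OF x, of "du x h"] Mdu[OF x, of h] K(1)[of h] by (simp add: r_def)
    have bldu: "bounded_linear (du x)"
      using lindu bdu by (auto simp: bounded_linear_def bounded_linear_axioms_def)
    define q where "q y = z y - M y (u x)" for y
    have qd: "(q has_derivative r) (at x)"
      unfolding q_def r_def by (intro has_derivative_diff dz(1) dMd x)
    have divi: "E \<le> 2 * (A + d * G) \<Longrightarrow> d > 0 \<Longrightarrow> E / d \<le> 2 * (A / d + G)" for E A d G :: real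
      by (simp add: field_simps)
    have Mt: "((\<lambda>y. norm (M y b - M x b)) \<longlongrightarrow> 0) (at x)" for b
      using M[of 0 b] x S
      by (intro tendsto_norm_zero) (auto simp: continuous_on_eq_continuous_at isCont_def LIM_zero_iff)
    have St: "((\<lambda>y. \<Sum>b\<in>Basis. (2 * K) * norm (M y b - M x b)) \<longlongrightarrow> 0) (at x)"
      using tendsto_sum[of Basis "\<lambda>b y. (2 * K) * norm (M y b - M x b)" "\<lambda>_. 0" "at x"]
        tendsto_mult_right_zero[OF Mt] by simp
    have qt: "((\<lambda>y. norm (q y - q x - r (y - x)) / norm (y - x)) \<longlongrightarrow> 0) (at x)"
      using qd unfolding has_derivative_iff_norm by simp
    have "((\<lambda>y. 2 * (norm (q y - q x - r (y - x)) / norm (y - x)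
        + (\<Sum>b\<in>Basis. (2 * K) * norm (M y b - M x b)))) \<longlongrightarrow> 0) (at x)"
      using tendsto_mult_right_zero[OF tendsto_add_zero[OF qt St], of 2] .
    moreover have "eventually (\<lambda>y. norm (norm (u y - u x - du x (y - x)) / norm (y - x))
        \<le> 2 * (norm (q y - q x - r (y - x)) / norm (y - x)
          + (\<Sum>b\<in>Basis. (2 * K) * norm (M y b - M x b)))) (at x)"
      unfolding eventually_at_topological
    proof (intro exI[of _ S] conjI S x ballI impI)
      fix y assume y: "y \<in> S" "y \<noteq> x"
      define d where "d = du x (y - x)"
      have M1: "M y (u y - u x - d) = (q y - q x - r (y - x)) - (M y d - M x d)"
        unfolding d_def Mdu[OF x] q_def r_def
        using Suc.prems(2)[OF x] Suc.prems(2)[OF y(1)]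
        by (simp add: linear_diff[OF lin[OF y(1)]])
      have "M y d - M x d = (\<Sum>b\<in>Basis. (d \<bullet> b) *\<^sub>R (M y b - M x b))"
        by (simp add: Mrep[OF y(1), of d] Mrep[OF x, of d] sum_subtractf scaleR_diff_right)
      then have "norm (M y d - M x d) \<le> (\<Sum>b\<in>Basis. \<bar>d \<bullet> b\<bar> * norm (M y b - M x b))"
        by (simp add: sum_norm_le)
      also have "\<dots> \<le> (\<Sum>b\<in>Basis. (norm (y - x) * (2 * K)) * norm (M y b - M x b))"
        by (intro sum_mono mult_right_mono) (auto intro: order.trans[OF Basis_le_norm] simp: d_def bdu)
      finally have M2: "norm (M y d - M x d) \<le> norm (y - x) * (\<Sum>b\<in>Basis. (2 * K) * norm (M y b - M x b))"
        by (simp add: sum_distrib_left mult.assoc)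
      have "norm (u y - u x - d) \<le> 2 * norm ((q y - q x - r (y - x)) - (M y d - M x d))"
        using low[OF y(1), of "u y - u x - d"] by (simp only: M1)
      also have "\<dots> \<le> 2 * (norm (q y - q x - r (y - x)) + norm (M y d - M x d))"
        by (intro mult_left_mono norm_triangle_ineq4) simp
      also have "\<dots> \<le> 2 * (norm (q y - q x - r (y - x))
          + norm (y - x) * (\<Sum>b\<in>Basis. (2 * K) * norm (M y b - M x b)))"
        by (intro mult_left_mono add_left_mono M2) simp
      finally have e: "norm (u y - u x - d) \<le> 2 * (norm (q y - q x - r (y - x))
          + norm (y - x) * (\<Sum>b\<in>Basis. (2 * K) * norm (M y b - M x b)))" .
      have nn: "norm (norm (u y - u x - du x (y - x)) / norm (y - x)) = norm (u y - u x - d) / norm (y - x)"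
        by (simp add: d_def)
      show "norm (norm (u y - u x - du x (y - x)) / norm (y - x))
        \<le> 2 * (norm (q y - q x - r (y - x)) / norm (y - x)
          + (\<Sum>b\<in>Basis. (2 * K) * norm (M y b - M x b)))"
        unfolding nn by (rule divi[OF e]) (use y(2) in simp)
    qed
    ultimately have "((\<lambda>y. norm (u y - u x - du x (y - x)) / norm (y - x)) \<longlongrightarrow> 0) (at x)"
      by (rule Lim_null_comparison[rotated])
    then show "(u has_derivative du x) (at x)"
      unfolding has_derivative_iff_norm using bldu by simp
  next
    fix v
    have "C_k k S (\<lambda>x. u x \<bullet> b)" for b
      by (rule C_k_bilinear[OF bounded_bilinear_inner S uk C_k_const[OF S]])
    then have "C_k k S (\<lambda>x. dM' x v (u x))" unfolding dM'_def
      by (intro C_k_sum S C_k_bilinear[OF bounded_bilinear_scaleR S] dM(2)) 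
    then have "C_k k S (\<lambda>x. fd z x v + (- 1) *\<^sub>R dM' x v (u x))"
      by (intro C_k_add S dz(2) C_k_bilinear[OF bounded_bilinear_scaleR S] C_k_const)
    then show "C_k k S (\<lambda>x. du x v)"
      by (rule Suc.IH) (simp add: Mdu)
  qed
qed


named_theorems smooth_intros

lemma C_infinity_cong:
  "open S \<Longrightarrow> C_infinity S f \<Longrightarrow> (\<And>x. x \<in> S \<Longrightarrow> g x = f x) \<Longrightarrow> C_infinity S g"
  unfolding C_infinity_def by (metis C_k_cong_imp)

lemma C_infinity_subset: "C_infinity S f \<Longrightarrow> T \<subseteq> S \<Longrightarrow> C_infinity T f"
  unfolding C_infinity_def by (metis C_k_subset)

lemma C_infinity_local:
  "(\<And>x. x \<in> S \<Longrightarrow> \<exists>T. open T \<and> x \<in> T \<and> C_infinity T f) \<Longrightarrow> C_infinity S f"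
  unfolding C_infinity_def by (metis C_k_local)

lemma C_infinity_continuous: "C_infinity S f \<Longrightarrow> continuous_on S f"
  unfolding C_infinity_def by (metis C_k.simps(1))

lemma C_infinity_has_derivative:
  "C_infinity S f \<Longrightarrow> open S \<Longrightarrow> x \<in> S \<Longrightarrow> (f has_derivative fd f x) (at x)"
  unfolding C_infinity_def by (metis C_k_SucD(1))

lemma C_infinity_fd [smooth_intros]:
  "open S \<Longrightarrow> C_infinity S f \<Longrightarrow> C_infinity S (\<lambda>x. fd f x v)"
  unfolding C_infinity_def by (metis C_k_SucD(2))

lemma C_infinity_const [smooth_intros]: "open S \<Longrightarrow> C_infinity S (\<lambda>x. c)"
  by (simp add: C_infinity_def C_k_const)

lemma C_infinity_linear: "bounded_linear L \<Longrightarrow> open S \<Longrightarrow> C_infinity S L"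
  by (simp add: C_infinity_def C_k_linear)

lemma C_infinity_ident [smooth_intros]: "open S \<Longrightarrow> C_infinity S (\<lambda>x. x)"
  by (rule C_infinity_linear[OF bounded_linear_ident])

lemma C_infinity_add [smooth_intros]:
  "open S \<Longrightarrow> C_infinity S f \<Longrightarrow> C_infinity S g \<Longrightarrow> C_infinity S (\<lambda>x. f x + g x)"
  by (simp add: C_infinity_def C_k_add)

lemma C_infinity_sum [smooth_intros]:
  "open S \<Longrightarrow> (\<And>i. i \<in> I \<Longrightarrow> C_infinity S (f i)) \<Longrightarrow> C_infinity S (\<lambda>x. \<Sum>i\<in>I. f i x)"
  by (simp add: C_infinity_def C_k_sum)

lemma C_infinity_bilinear:
  "bounded_bilinear B \<Longrightarrow> open S \<Longrightarrow> C_infinity S f \<Longrightarrow> C_infinity S g \<Longrightarrow> C_infinity S (\<lambda>x. B (f x) (g x))"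
  by (simp add: C_infinity_def C_k_bilinear)

lemmas C_infinity_scaleR [smooth_intros] = C_infinity_bilinear[OF bounded_bilinear_scaleR]
lemmas C_infinity_inner [smooth_intros] = C_infinity_bilinear[OF bounded_bilinear_inner]
lemmas C_infinity_mult [smooth_intros] = C_infinity_bilinear[OF bounded_bilinear_mult]

lemma C_infinity_minus [smooth_intros]:
  "open S \<Longrightarrow> C_infinity S f \<Longrightarrow> C_infinity S (\<lambda>x. - f x)"
  using C_infinity_scaleR[OF _ C_infinity_const, of S f "- 1"] by simp

lemma C_infinity_diff [smooth_intros]:
  "open S \<Longrightarrow> C_infinity S f \<Longrightarrow> C_infinity S g \<Longrightarrow> C_infinity S (\<lambda>x. f x - g x)"
  using C_infinity_add[OF _ _ C_infinity_minus, of S f g] by simp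

lemma C_infinity_compose:
  fixes f :: "'a::real_normed_vector \<Rightarrow> 'b::euclidean_space" and g :: "'b \<Rightarrow> 'c::real_normed_vector"
  shows "open S \<Longrightarrow> open T \<Longrightarrow> f ` S \<subseteq> T \<Longrightarrow> C_infinity S f \<Longrightarrow> C_infinity T g \<Longrightarrow>
    C_infinity S (\<lambda>x. g (f x))"
  by (simp add: C_infinity_def C_k_compose)

lemma C_infinity_linear_compose:
  fixes f :: "'a::real_normed_vector \<Rightarrow> 'b::euclidean_space"
  shows "bounded_linear L \<Longrightarrow> open S \<Longrightarrow> C_infinity S f \<Longrightarrow> C_infinity S (\<lambda>x. L (f x))"
  by (rule C_infinity_compose[of S UNIV f L]) (auto intro: C_infinity_linear)

lemmas C_infinity_fst [smooth_intros] = C_infinity_linear_compose[OF bounded_linear_fst]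
lemmas C_infinity_snd [smooth_intros] = C_infinity_linear_compose[OF bounded_linear_snd]

lemma C_infinity_Pair [smooth_intros]:
  fixes f :: "'a::real_normed_vector \<Rightarrow> 'b::euclidean_space" and g :: "'a \<Rightarrow> 'c::euclidean_space"
  assumes S: "open S" and f: "C_infinity S f" and g: "C_infinity S g"
  shows "C_infinity S (\<lambda>x. (f x, g x))"
proof -
  have 1: "bounded_linear (\<lambda>x::'b. (x, 0::'c))" and 2: "bounded_linear (\<lambda>x::'c. (0::'b, x))"
    by (auto intro: bounded_linear_Pair bounded_linear_ident bounded_linear_zero)
  show ?thesis
    using C_infinity_add[OF S C_infinity_linear_compose[OF 1 S f] C_infinity_linear_compose[OF 2 S g]]
    by simp
qed

lemma C_infinity_divide [smooth_intros]:
  fixes f g :: "'a::real_normed_vector \<Rightarrow> real"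
  assumes "open S" "C_infinity S f" "C_infinity S g" "\<And>x. x \<in> S \<Longrightarrow> g x \<noteq> 0"
  shows "C_infinity S (\<lambda>x. f x / g x)"
proof -
  have "C_infinity S (\<lambda>x. inverse (g x))"
    by (rule C_infinity_compose[OF assms(1) _ _ assms(3), of "- {0}"])
       (use assms(4) in \<open>auto simp: C_infinity_def C_k_inverse\<close>)
  then show ?thesis using C_infinity_mult[OF assms(1,2)] by (simp add: divide_inverse)
qed

lemma linear_euclidean_sum:
  fixes v :: "'a::euclidean_space"
  assumes "linear L"
  shows "L v = (\<Sum>b\<in>Basis. (v \<bullet> b) *\<^sub>R L b)"
proof -
  have "L v = L (\<Sum>b\<in>Basis. (v \<bullet> b) *\<^sub>R b)" by (simp add: euclidean_representation)
  also have "\<dots> = (\<Sum>b\<in>Basis. (v \<bullet> b) *\<^sub>R L b)"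
    by (simp add: linear_sum[OF assms] linear_scale[OF assms])
  finally show ?thesis .
qed

lemma C_infinity_linear_family:
  fixes v :: "'a::real_normed_vector \<Rightarrow> 'b::euclidean_space"
  assumes "open S" "C_infinity S v" "\<And>u. C_infinity S (\<lambda>x. L x u)" "\<And>x. x \<in> S \<Longrightarrow> linear (L x)"
  shows "C_infinity S (\<lambda>x. L x (v x))"
proof (rule C_infinity_cong[OF assms(1)])
  show "C_infinity S (\<lambda>x. \<Sum>b\<in>Basis. (v x \<bullet> b) *\<^sub>R L x b)"
    by (intro C_infinity_sum C_infinity_scaleR C_infinity_inner C_infinity_const assms)
qed (rule linear_euclidean_sum[OF assms(4)])

lemma linear_fd: "C_infinity S f \<Longrightarrow> open S \<Longrightarrow> x \<in> S \<Longrightarrow> linear (fd f x)"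
  by (rule has_derivative_linear[OF C_infinity_has_derivative])

lemma C_infinity_fd_along [smooth_intros]:
  fixes f :: "'a::euclidean_space \<Rightarrow> 'b::real_normed_vector"
  assumes "open S" "C_infinity S f" "C_infinity S v"
  shows "C_infinity S (\<lambda>x. fd f x (v x))"
  by (rule C_infinity_linear_family) (auto intro: assms smooth_intros linear_fd)

text \<open>Leibniz rule for \<open>L(y) v(y)\<close>: in the first summand only the operator is differentiated.\<close>

lemma fd_linear_family:
  fixes v :: "'a::real_normed_vector \<Rightarrow> 'b::euclidean_space"
  assumes S: "open S" and v: "C_infinity S v" and L: "\<And>u. C_infinity S (\<lambda>x. L x u)"
    and lin: "\<And>x. x \<in> S \<Longrightarrow> linear (L x)" and x: "x \<in> S"
  shows "fd (\<lambda>y. L y (v y)) x h = fd (\<lambda>y. L y (v x)) x h + L x (fd v x h)"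
proof -
  note dL = C_infinity_has_derivative[OF L S x] and dv = C_infinity_has_derivative[OF v S x]
  have "((\<lambda>y. \<Sum>b\<in>Basis. (v y \<bullet> b) *\<^sub>R L y b) has_derivative
      (\<lambda>h. \<Sum>b\<in>Basis. (v x \<bullet> b) *\<^sub>R fd (\<lambda>y. L y b) x h + (fd v x h \<bullet> b) *\<^sub>R L x b)) (at x)"
    by (intro has_derivative_sum has_derivative_scaleR has_derivative_inner_left dL dv)
  then have "((\<lambda>y. L y (v y)) has_derivative
      (\<lambda>h. \<Sum>b\<in>Basis. (v x \<bullet> b) *\<^sub>R fd (\<lambda>y. L y b) x h + (fd v x h \<bullet> b) *\<^sub>R L x b)) (at x)"
    by (rule has_derivative_transform_within_open[OF _ S x])
       (rule linear_euclidean_sum[OF lin, symmetric])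
  moreover have "((\<lambda>y. \<Sum>b\<in>Basis. (v x \<bullet> b) *\<^sub>R L y b) has_derivative
      (\<lambda>h. \<Sum>b\<in>Basis. (v x \<bullet> b) *\<^sub>R fd (\<lambda>y. L y b) x h)) (at x)"
    by (intro has_derivative_sum has_derivative_scaleR_right dL)
  then have "((\<lambda>y. L y (v x)) has_derivative
      (\<lambda>h. \<Sum>b\<in>Basis. (v x \<bullet> b) *\<^sub>R fd (\<lambda>y. L y b) x h)) (at x)"
    by (rule has_derivative_transform_within_open[OF _ S x])
       (rule linear_euclidean_sum[OF lin, symmetric])
  ultimately show ?thesis
    by (simp only: fd_eq sum.distrib linear_euclidean_sum[OF lin[OF x], of "fd v x h", symmetric])
qed

text \<open>Applied to a parametrisation \<open>\<iota>\<close> of a submanifold: a tangent field is smooth as soon as its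
  ambient components are. A left inverse of the derivative at one point turns the equation into a square
  system, which stays well conditioned near that point.\<close>

lemma C_infinity_solve_injective:
  fixes \<iota> :: "'a::euclidean_space \<Rightarrow> 'b::euclidean_space"
  assumes S: "open S" and \<iota>: "C_infinity S \<iota>" and inj: "\<And>x. x \<in> S \<Longrightarrow> inj (fd \<iota> x)"
    and w: "C_infinity S w" and v: "\<And>x. x \<in> S \<Longrightarrow> fd \<iota> x (v x) = w x"
  shows "C_infinity S v"
proof (rule C_infinity_local)
  fix x0 assume x0: "x0 \<in> S"
  obtain L where L: "linear L" "L \<circ> fd \<iota> x0 = id"
    using linear_injective_left_inverse[OF linear_fd[OF \<iota> S x0] inj[OF x0]] by blast
  have bl: "bounded_linear L" using L(1) by (simp add: linear_conv_bounded_linear)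
  define M where "M x u = L (fd \<iota> x u)" for x u
  have linM: "linear (M x)" if "x \<in> S" for x
    unfolding M_def using linear_compose[OF linear_fd[OF \<iota> S that] L(1)] by (simp add: o_def)
  have smM: "C_infinity S (\<lambda>x. M x u)" for u
    unfolding M_def by (intro C_infinity_linear_compose[OF bl] smooth_intros S \<iota>)
  define e where "e x = (\<Sum>b\<in>Basis. norm (M x b - b))" for x
  have "continuous_on S e" unfolding e_def
    by (intro continuous_intros C_infinity_continuous smM)
  moreover have "e x0 = 0" using L(2) by (simp add: e_def M_def fun_eq_iff)
  \<comment> \<open>A Neumann series bound: deviation below \<open>1/2\<close> from the identity gives \<open>low\<close> below.\<close>
  ultimately obtain T where T: "open T" "x0 \<in> T" "T \<subseteq> S" "\<And>x. x \<in> T \<Longrightarrow> e x < 1/2"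
    using continuous_on_open_vimage[OF S, of e] x0
    by (auto elim!: allE[of _ "{..<1/2}"] intro!: that[of "e -` {..<1/2} \<inter> S"])
  have low: "norm u \<le> 2 * norm (M x u)" if x: "x \<in> T" for x u
  proof -
    have "u - M x u = (\<Sum>b\<in>Basis. (u \<bullet> b) *\<^sub>R (b - M x b))"
      using linear_euclidean_sum[OF linM, of x u] x T(3)
      by (auto simp: scaleR_diff_right sum_subtractf euclidean_representation)
    then have "norm (u - M x u) \<le> (\<Sum>b\<in>Basis. \<bar>u \<bullet> b\<bar> * norm (M x b - b))"
      by (simp add: sum_norm_le norm_minus_commute)
    also have "\<dots> \<le> (\<Sum>b\<in>Basis. norm u * norm (M x b - b))"
      by (intro sum_mono mult_right_mono) (auto simp: Basis_le_norm)
    also have "\<dots> = norm u * e x" by (simp add: e_def sum_distrib_left)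
    also have "\<dots> \<le> norm u * (1/2)" using T(4)[OF x] by (intro mult_left_mono) auto
    finally show ?thesis using norm_triangle_ineq2[of u "M x u"] by linarith
  qed
  have "C_k k T v" for k
  proof (rule C_k_linear_system[OF T(1)])
    show "C_k k T (\<lambda>x. L (w x))"
      using C_infinity_subset[OF C_infinity_linear_compose[OF bl S w] T(3)] by (simp add: C_infinity_def)
    show "C_k k T (\<lambda>x. M x u)" for k u
      using C_infinity_subset[OF smM T(3)] by (simp add: C_infinity_def)
    show "linear (M x)" if "x \<in> T" for x using linM T(3) that by auto
    show "norm u \<le> 2 * norm (M x u)" if "x \<in> T" for x u by (rule low[OF that])
    show "M x (v x) = L (w x)" if "x \<in> T" for x using v T(3) that by (auto simp: M_def)
  qed
  then show "\<exists>T. open T \<and> x0 \<in> T \<and> C_infinity T v" using T by (auto simp: C_infinity_def)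
qed

text \<open>Both mixed derivatives are limits of the second difference quotient of \<open>f\<close> over small
  parallelograms, by the mean value theorem used once in each direction.\<close>

lemma second_difference_mean_value:
  fixes f :: "'a::real_normed_vector \<Rightarrow> real"
  assumes S: "open S" and f: "C_infinity S f" and h: "h > 0"
    and sub: "\<And>s t. 0 \<le> s \<Longrightarrow> s \<le> h \<Longrightarrow> 0 \<le> t \<Longrightarrow> t \<le> h \<Longrightarrow> x + s *\<^sub>R u + t *\<^sub>R v \<in> S"
  obtains s t where "0 < s" "s < h" "0 < t" "t < h"
    "f (x + h *\<^sub>R u + h *\<^sub>R v) - f (x + h *\<^sub>R u) - f (x + h *\<^sub>R v) + f x =
      h * h * fd (\<lambda>y. fd f y u) (x + s *\<^sub>R u + t *\<^sub>R v) v"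
proof -
  have line: "((\<lambda>s. g (p + s *\<^sub>R d)) has_real_derivative fd g (p + s *\<^sub>R d) d) (at s)"
    if "C_infinity S g" "p + s *\<^sub>R d \<in> S" for g :: "'a \<Rightarrow> real" and p d s
    unfolding has_field_derivative_def
  proof (rule has_derivative_eq_rhs)
    show "((\<lambda>s. g (p + s *\<^sub>R d)) has_derivative (\<lambda>r. fd g (p + s *\<^sub>R d) (r *\<^sub>R d))) (at s)"
      by (rule has_derivative_compose[of "\<lambda>s. p + s *\<^sub>R d" "\<lambda>r. r *\<^sub>R d" s UNIV g "fd g (p + s *\<^sub>R d)"])
         (auto intro!: derivative_eq_intros C_infinity_has_derivative[OF that(1) S that(2)])
    show "(\<lambda>r. fd g (p + s *\<^sub>R d) (r *\<^sub>R d)) = (*) (fd g (p + s *\<^sub>R d) d)"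
      using linear_fd[OF that(1) S that(2)] by (auto simp: linear_scale fun_eq_iff)
  qed
  have sub': "x + h *\<^sub>R v + s *\<^sub>R u \<in> S" "x + s *\<^sub>R u \<in> S" if "0 \<le> s" "s \<le> h" for s
    using sub[OF that, of h] sub[OF that, of 0] h by (simp_all add: ac_simps)
  have "\<exists>s>0. s < h \<and> (f (x + h *\<^sub>R v + h *\<^sub>R u) - f (x + h *\<^sub>R u)) - (f (x + h *\<^sub>R v + 0 *\<^sub>R u) - f (x + 0 *\<^sub>R u))
     = (h - 0) * (fd f (x + h *\<^sub>R v + s *\<^sub>R u) u - fd f (x + s *\<^sub>R u) u)"
    by (rule MVT2[OF h]) (auto intro!: DERIV_diff line f sub')
  then obtain s where s: "0 < s" "s < h" and 1: "(f (x + h *\<^sub>R v + h *\<^sub>R u) - f (x + h *\<^sub>R u)) - (f (x + h *\<^sub>R v) - f x)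
     = h * (fd f (x + h *\<^sub>R v + s *\<^sub>R u) u - fd f (x + s *\<^sub>R u) u)" by auto
  have "\<exists>t>0. t < h \<and> fd f (x + s *\<^sub>R u + h *\<^sub>R v) u - fd f (x + s *\<^sub>R u + 0 *\<^sub>R v) u
     = (h - 0) * (fd (\<lambda>y. fd f y u) (x + s *\<^sub>R u + t *\<^sub>R v) v)"
    by (rule MVT2[OF h]) (use sub[of s] s in \<open>auto intro!: line[of "\<lambda>y. fd f y u"] f smooth_intros S\<close>)
  then obtain t where t: "0 < t" "t < h" and 2: "fd f (x + s *\<^sub>R u + h *\<^sub>R v) u - fd f (x + s *\<^sub>R u) u
     = h * (fd (\<lambda>y. fd f y u) (x + s *\<^sub>R u + t *\<^sub>R v) v)" by auto
  show ?thesis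
    by (rule that[OF s t]) (use 1 2 in \<open>simp add: algebra_simps\<close>)
qed

lemma mixed_derivatives_commute_real:
  fixes f :: "'a::real_normed_vector \<Rightarrow> real"
  assumes S: "open S" and f: "C_infinity S f" and x: "x \<in> S"
  shows "fd (\<lambda>y. fd f y u) x v = fd (\<lambda>y. fd f y v) x u"
proof (rule ccontr)
  let ?A = "\<lambda>y. fd (\<lambda>y. fd f y u) y v" and ?B = "\<lambda>y. fd (\<lambda>y. fd f y v) y u"
  assume "?A x \<noteq> ?B x"
  define e where "e = \<bar>?A x - ?B x\<bar> / 2"
  have e: "e > 0" using \<open>?A x \<noteq> ?B x\<close> by (simp add: e_def)
  have "isCont ?A x" "isCont ?B x"
    using C_infinity_continuous[of S ?A] C_infinity_continuous[of S ?B] S x f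
    by (auto simp: continuous_on_eq_continuous_at intro!: smooth_intros)
  then have "eventually (\<lambda>y. \<bar>?A y - ?A x\<bar> < e) (nhds x)" "eventually (\<lambda>y. \<bar>?B y - ?B x\<bar> < e) (nhds x)"
    using e by (auto simp: isCont_def tendsto_iff dist_real_def eventually_nhds_conv_at)
  moreover have "eventually (\<lambda>y. y \<in> S) (nhds x)" using S x by (auto simp: eventually_nhds)
  ultimately have "eventually (\<lambda>y. \<bar>?A y - ?A x\<bar> < e \<and> \<bar>?B y - ?B x\<bar> < e \<and> y \<in> S) (nhds x)"
    by eventually_elim auto
  then obtain d where d: "d > 0" and
    near: "\<And>y. dist y x < d \<Longrightarrow> \<bar>?A y - ?A x\<bar> < e \<and> \<bar>?B y - ?B x\<bar> < e \<and> y \<in> S"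
    unfolding eventually_nhds_metric by blast
  \<comment> \<open>Parallelograms with this scaling factor stay inside the ball of radius \<open>d\<close>.\<close>
  define h where "h = d / (norm u + norm v + 1)"
  have h: "h > 0" using d by (simp add: h_def add_nonneg_pos)
  have hd: "h * (norm u + norm v) < d"
  proof -
    have "h * (norm u + norm v) < h * (norm u + norm v + 1)" using h by simp
    also have "\<dots> = d" by (simp add: h_def add_nonneg_eq_0_iff)
    finally show ?thesis .
  qed
  have box: "dist (x + s *\<^sub>R u + t *\<^sub>R v) x < d" if "0 \<le> s" "s \<le> h" "0 \<le> t" "t \<le> h" for s t
  proof -
    have "dist (x + s *\<^sub>R u + t *\<^sub>R v) x \<le> s * norm u + t * norm v"
      using norm_triangle_ineq[of "s *\<^sub>R u" "t *\<^sub>R v"] that by (simp add: dist_norm add.assoc)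
    also have "\<dots> \<le> h * norm u + h * norm v" using that by (intro add_mono mult_right_mono) auto
    also have "\<dots> < d" using hd by (simp add: algebra_simps)
    finally show ?thesis .
  qed
  have box': "dist (x + s *\<^sub>R v + t *\<^sub>R u) x < d" if "0 \<le> s" "s \<le> h" "0 \<le> t" "t \<le> h" for s t
    using box[OF that(3,4,1,2)] by (simp add: algebra_simps)
  obtain s t where st: "0 < s" "s < h" "0 < t" "t < h"
    "f (x + h *\<^sub>R u + h *\<^sub>R v) - f (x + h *\<^sub>R u) - f (x + h *\<^sub>R v) + f x = h * h * ?A (x + s *\<^sub>R u + t *\<^sub>R v)"
    using second_difference_mean_value[OF S f h, of x u v] near box by (smt (verit))
  obtain s' t' where st': "0 < s'" "s' < h" "0 < t'" "t' < h"
    "f (x + h *\<^sub>R v + h *\<^sub>R u) - f (x + h *\<^sub>R v) - f (x + h *\<^sub>R u) + f x = h * h * ?B (x + s' *\<^sub>R v + t' *\<^sub>R u)"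
    using second_difference_mean_value[OF S f h, of x v u] near box' by (smt (verit))
  have "h * h * ?A (x + s *\<^sub>R u + t *\<^sub>R v) = h * h * ?B (x + s' *\<^sub>R v + t' *\<^sub>R u)"
    using st(5) st'(5) by (simp add: algebra_simps)
  then have "?A (x + s *\<^sub>R u + t *\<^sub>R v) = ?B (x + s' *\<^sub>R v + t' *\<^sub>R u)" using h by simp
  moreover have "\<bar>?A (x + s *\<^sub>R u + t *\<^sub>R v) - ?A x\<bar> < e" using near[OF box] st by auto
  moreover have "\<bar>?B (x + s' *\<^sub>R v + t' *\<^sub>R u) - ?B x\<bar> < e" using near[OF box'] st' by auto
  moreover have "p = q \<Longrightarrow> \<bar>p - c\<bar> < \<bar>c - d\<bar> / 2 \<Longrightarrow> \<bar>q - d\<bar> < \<bar>c - d\<bar> / 2 \<Longrightarrow> False" for p q c d :: real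
    by (auto simp: abs_if split: if_splits)
  ultimately show False unfolding e_def by blast
qed

lemma fd_inner_left:
  assumes "C_infinity S f" "open S" "x \<in> S"
  shows "fd (\<lambda>y. f y \<bullet> b) x v = fd f x v \<bullet> b"
  using fd_eq[OF has_derivative_inner_left[OF C_infinity_has_derivative[OF assms], of b]] by simp

lemma mixed_derivatives_commute:
  fixes f :: "'a::real_normed_vector \<Rightarrow> 'b::euclidean_space"
  assumes S: "open S" and f: "C_infinity S f" and x: "x \<in> S"
  shows "fd (\<lambda>y. fd f y u) x v = fd (\<lambda>y. fd f y v) x u"
proof (rule euclidean_eqI)
  fix b :: 'b
  have "fd (\<lambda>y. fd f y u) x v \<bullet> b = fd (\<lambda>y. fd (\<lambda>y. f y \<bullet> b) y u) x v" for u v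
    by (simp add: fd_inner_left[OF C_infinity_fd[OF S f] S x, symmetric] fd_inner_left[OF f S]
        cong: fd_cong[OF S x])
  then show "fd (\<lambda>y. fd f y u) x v \<bullet> b = fd (\<lambda>y. fd f y v) x u \<bullet> b"
    by (simp only: mixed_derivatives_commute_real[OF S C_infinity_inner[OF S f C_infinity_const[OF S]] x, of _ u v])
qed

section \<open>Charts, smooth functions and vector fields\<close>

text \<open>The components of a tangent vector are its values on the coordinate functions, so they are
  recovered by a formula that does not mention the base point.\<close>

definition vcomp :: "('p, 'e::euclidean_space) chart \<Rightarrow> 'p tvec \<Rightarrow> 'e"
  where "vcomp C v = (\<Sum>b\<in>Basis. v (\<lambda>q. snd C q \<bullet> b) *\<^sub>R b)"

definition rep :: "('p, 'e::euclidean_space) chart \<Rightarrow> 'p vfield \<Rightarrow> 'e \<Rightarrow> 'e"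
  where "rep C X y = vcomp C (X (chart_inv C y))"

lemma vcomp_add: "vcomp C (u + v) = vcomp C u + vcomp C v"
  and vcomp_scaleR: "vcomp C (r *\<^sub>R u) = r *\<^sub>R vcomp C u"
  by (simp_all add: vcomp_def scaleR_fun_def scaleR_left_distrib sum.distrib scaleR_sum_right)

lemma vcomp_diff: "vcomp C (u - v) = vcomp C u - vcomp C v"
  and vcomp_zero: "vcomp C 0 = 0"
  by (simp_all add: vcomp_def scaleR_fun_def scaleR_left_diff_distrib sum_subtractf sum_negf)

locale smooth_space =
  fixes M :: "('p, 'e::euclidean_space) atlas"
  assumes atlas: "smooth_atlas M"
begin

abbreviation "opn \<equiv> openin (manifold_topology M)"

lemmas opn_iff = openin_manifold_topology[OF atlas]

lemma chart_inv_left: "C \<in> M \<Longrightarrow> p \<in> fst C \<Longrightarrow> chart_inv C (snd C p) = p"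
  using atlas by (simp add: smooth_atlas_def chart_inv_def)

lemma chart_inv_right:
  "C \<in> M \<Longrightarrow> y \<in> snd C ` W \<Longrightarrow> W \<subseteq> fst C \<Longrightarrow> chart_inv C y \<in> W \<and> snd C (chart_inv C y) = y"
  using chart_inv_left by fastforce

lemma open_img: "C \<in> M \<Longrightarrow> opn W \<Longrightarrow> W \<subseteq> fst C \<Longrightarrow> open (snd C ` W)"
  by (metis inf.absorb1 opn_iff)

lemma open_img_fst: "C \<in> M \<Longrightarrow> open (snd C ` fst C)"
  using atlas by (simp add: smooth_atlas_def)

lemma fst_opn: "C \<in> M \<Longrightarrow> opn (fst C)"
  unfolding opn_iff points_def using atlas by (auto simp: smooth_atlas_def Int_commute)

lemma opn_points: "opn (points M)"
proof -
  have "opn (\<Union>(fst ` M))" by (rule openin_Union) (use fst_opn in blast)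
  then show ?thesis by (simp add: points_def)
qed

lemma opn_sub: "opn U \<Longrightarrow> U \<subseteq> points M"
  by (simp add: opn_iff)

lemma point_chart: "p \<in> points M \<Longrightarrow> \<exists>C\<in>M. p \<in> fst C"
  by (auto simp: points_def)

lemma transition:
  assumes "C \<in> M" "D \<in> M"
  shows "open (snd C ` (fst C \<inter> fst D))"
    "C_infinity (snd C ` (fst C \<inter> fst D)) (\<lambda>y. snd D (chart_inv C y))"
  using assms atlas by (auto simp: smooth_atlas_def o_def)

lemma sf_opn: "f \<in> smooth_funs M U \<Longrightarrow> opn U"
  by (simp add: smooth_funs_def)

lemma sf_img:
  "f \<in> smooth_funs M U \<Longrightarrow> C \<in> M \<Longrightarrow> W \<subseteq> U \<inter> fst C \<Longrightarrow> C_infinity (snd C ` W) (\<lambda>y. f (chart_inv C y))"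
  unfolding smooth_funs_def o_def by (blast intro: C_infinity_subset[OF _ image_mono])

text \<open>One chart suffices because changes of charts are smooth.\<close>

lemma sf_chart:
  assumes C: "C \<in> M" and W: "opn W" "W \<subseteq> fst C" and f: "C_infinity (snd C ` W) (\<lambda>y. f (chart_inv C y))"
  shows "f \<in> smooth_funs M W"
  unfolding smooth_funs_def o_def
proof (intro CollectI conjI W ballI)
  fix D assume D: "D \<in> M"
  let ?S = "snd D ` (W \<inter> fst D)"
  have S: "open ?S" using open_img[OF D, of "W \<inter> fst D"] W(1) fst_opn[OF D] by auto
  have in_W: "chart_inv D y \<in> W" if "y \<in> ?S" for y
    using chart_inv_right[OF D that] by auto
  have t: "C_infinity ?S (\<lambda>y. snd C (chart_inv D y))"
    by (rule C_infinity_subset[OF transition(2)[OF D C]]) (use W(2) in blast)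
  have "C_infinity ?S (\<lambda>y. f (chart_inv C (snd C (chart_inv D y))))"
    by (rule C_infinity_compose[OF S open_img[OF C W] _ t f]) (use in_W in auto)
  then show "C_infinity ?S (\<lambda>y. f (chart_inv D y))"
    by (rule C_infinity_cong[OF S]) (auto simp: chart_inv_left[OF C] chart_inv_left[OF D] subsetD[OF W(2)])
qed

lemma sf_local:
  assumes "opn U" "\<And>p. p \<in> U \<Longrightarrow> \<exists>W. p \<in> W \<and> f \<in> smooth_funs M W"
  shows "f \<in> smooth_funs M U"
  unfolding smooth_funs_def o_def
proof (intro CollectI conjI assms(1) ballI C_infinity_local)
  fix C y assume C: "C \<in> M" and y: "y \<in> snd C ` (U \<inter> fst C)"
  then obtain p where p: "p \<in> U" "p \<in> fst C" "y = snd C p" by blast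
  obtain W where W: "p \<in> W" "f \<in> smooth_funs M W" using assms(2)[OF p(1)] by blast
  have "opn (W \<inter> fst C)" using sf_opn[OF W(2)] fst_opn[OF C] by auto
  then show "\<exists>T. open T \<and> y \<in> T \<and> C_infinity T (\<lambda>y. f (chart_inv C y))"
    using open_img[OF C, of "W \<inter> fst C"] sf_img[OF W(2) C, of "W \<inter> fst C"] p W(1)
    by (intro exI[of _ "snd C ` (W \<inter> fst C)"]) auto
qed

lemma sf_restrict: "f \<in> smooth_funs M U \<Longrightarrow> opn W \<Longrightarrow> W \<subseteq> U \<Longrightarrow> f \<in> smooth_funs M W"
  unfolding smooth_funs_def mem_Collect_eq
  by (metis C_infinity_subset Int_mono image_mono order_refl)

lemma sf_cong: "f \<in> smooth_funs M U \<Longrightarrow> (\<And>p. p \<in> U \<Longrightarrow> g p = f p) \<Longrightarrow> g \<in> smooth_funs M U"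
proof (rule sf_local)
  assume f: "f \<in> smooth_funs M U" and eq: "\<And>p. p \<in> U \<Longrightarrow> g p = f p"
  show U: "opn U" by (rule sf_opn[OF f])
  fix p assume "p \<in> U"
  then obtain C where C: "C \<in> M" "p \<in> fst C" using point_chart opn_sub[OF U] by blast
  let ?W = "U \<inter> fst C"
  have W: "opn ?W" using U fst_opn[OF C(1)] by auto
  have "g \<in> smooth_funs M ?W"
    using chart_inv_right[OF C(1), of _ ?W]
    by (intro sf_chart[OF C(1) W] C_infinity_cong[OF open_img[OF C(1) W] sf_img[OF f C(1)]])
       (auto simp: eq)
  with \<open>p \<in> U\<close> C show "\<exists>W. p \<in> W \<and> g \<in> smooth_funs M W" by blast
qed

lemma near_chart:
  assumes "smooth_near M p f" "C \<in> M" "p \<in> fst C"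
  obtains W where "opn W" "p \<in> W" "W \<subseteq> fst C" "f \<in> smooth_funs M W"
    "open (snd C ` W)" "C_infinity (snd C ` W) (\<lambda>y. f (chart_inv C y))"
proof -
  obtain U where U: "p \<in> U" "f \<in> smooth_funs M U" using assms(1) by (auto simp: smooth_near_def)
  have W: "opn (U \<inter> fst C)" using sf_opn[OF U(2)] fst_opn[OF assms(2)] by auto
  show ?thesis
    by (rule that[OF W _ _ sf_restrict[OF U(2) W] open_img[OF assms(2) W] sf_img[OF U(2) assms(2)]])
       (use U assms in auto)
qed

lemma smooth_nearI: "f \<in> smooth_funs M U \<Longrightarrow> p \<in> U \<Longrightarrow> smooth_near M p f"
  by (auto simp: smooth_near_def)

lemma near_has_derivative:
  assumes "smooth_near M p f" "C \<in> M" "p \<in> fst C"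
  shows "((\<lambda>y. f (chart_inv C y)) has_derivative fd (\<lambda>y. f (chart_inv C y)) (snd C p)) (at (snd C p))"
proof -
  obtain W where W: "opn W" "p \<in> W" "W \<subseteq> fst C" "f \<in> smooth_funs M W"
    "open (snd C ` W)" "C_infinity (snd C ` W) (\<lambda>y. f (chart_inv C y))" by (rule near_chart[OF assms])
  show ?thesis by (rule C_infinity_has_derivative[OF W(6,5)]) (use W in blast)
qed

lemma sf_of_chart:
  assumes "C \<in> M" "opn W" "W \<subseteq> fst C" "C_infinity (snd C ` W) L"
  shows "(\<lambda>q. L (snd C q)) \<in> smooth_funs M W"
  by (rule sf_chart[OF assms(1-3)], rule C_infinity_cong[OF open_img[OF assms(1-3)] assms(4)])
     (use chart_inv_right[OF assms(1) _ assms(3)] in auto)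

lemma coord_vec_apply:
  "smooth_near M p f \<Longrightarrow> coord_vec M C p v f = fd (\<lambda>y. f (chart_inv C y)) (snd C p) v"
  by (simp add: coord_vec_def o_def)

lemma coord_vec_chart_fun:
  assumes "C \<in> M" "opn W" "W \<subseteq> fst C" "C_infinity (snd C ` W) L" "p \<in> W"
  shows "coord_vec M C p v (\<lambda>q. L (snd C q)) = fd L (snd C p) v"
proof -
  have "fd (\<lambda>y. L (snd C (chart_inv C y))) (snd C p) = fd L (snd C p)"
    by (rule fd_cong[OF open_img[OF assms(1-3)]])
       (use chart_inv_right[OF assms(1) _ assms(3)] assms(5) in auto)
  then show ?thesis
    by (simp add: coord_vec_apply[OF smooth_nearI[OF sf_of_chart[OF assms(1-4)] assms(5)]])
qed

text \<open>The coordinate functions are smooth near \<open>p\<close>, so they separate tangent vectors.\<close>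

lemma vcomp_coord_vec:
  assumes C: "C \<in> M" and p: "p \<in> fst C"
  shows "vcomp C (coord_vec M C p v) = v"
proof -
  note o = open_img_fst[OF C]
  have "coord_vec M C p v (\<lambda>q. snd C q \<bullet> b) = v \<bullet> b" for b
  proof -
    have "((\<lambda>y. y \<bullet> b) has_derivative (\<lambda>y. y \<bullet> b)) (at (snd C p))"
      by (auto intro!: derivative_eq_intros)
    then show ?thesis
      using coord_vec_chart_fun[OF C fst_opn[OF C] order_refl _ p, of "\<lambda>y. y \<bullet> b" v] o
      by (simp add: fd_eq C_infinity_inner C_infinity_ident C_infinity_const)
  qed
  then show ?thesis by (simp add: vcomp_def euclidean_representation)
qed

lemma coord_vec_lin:
  assumes "C \<in> M" "p \<in> fst C"
  shows "coord_vec M C p (r *\<^sub>R u + s *\<^sub>R v) = r *\<^sub>R coord_vec M C p u + s *\<^sub>R coord_vec M C p v"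
proof
  fix f
  show "coord_vec M C p (r *\<^sub>R u + s *\<^sub>R v) f = (r *\<^sub>R coord_vec M C p u + s *\<^sub>R coord_vec M C p v) f"
  proof (cases "smooth_near M p f")
    case True
    interpret linear "fd (\<lambda>y. f (chart_inv C y)) (snd C p)"
      by (rule has_derivative_linear[OF near_has_derivative[OF True assms]])
    show ?thesis using True by (simp add: coord_vec_apply scaleR_fun_def add scaleR)
  qed (simp add: coord_vec_def scaleR_fun_def)
qed

lemma linear_coord_vec: "C \<in> M \<Longrightarrow> p \<in> fst C \<Longrightarrow> linear (coord_vec M C p)"
  using coord_vec_lin[of C p 1 _ 1] coord_vec_lin[of C p _ _ 0 0] by (intro linearI) simp_all

lemma coord_vec_change:
  assumes C: "C \<in> M" "p \<in> fst C" and D: "D \<in> M" "p \<in> fst D"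
  shows "coord_vec M D p v = coord_vec M C p (fd (\<lambda>y. snd C (chart_inv D y)) (snd D p) v)"
proof
  fix f
  let ?\<tau> = "\<lambda>y. snd C (chart_inv D y)"
  show "coord_vec M D p v f = coord_vec M C p (fd ?\<tau> (snd D p) v) f"
  proof (cases "smooth_near M p f")
    case True
    let ?S = "snd D ` (fst D \<inter> fst C)"
    have y: "snd D p \<in> ?S" using C D by auto
    note S = transition(1)[OF D(1) C(1)]
    have \<tau>: "(?\<tau> has_derivative fd ?\<tau> (snd D p)) (at (snd D p))"
      by (rule C_infinity_has_derivative[OF transition(2)[OF D(1) C(1)] S y])
    have F: "((\<lambda>y. f (chart_inv C y)) has_derivative fd (\<lambda>y. f (chart_inv C y)) (snd C p)) (at (?\<tau> (snd D p)))"
      using near_has_derivative[OF True C] by (simp add: chart_inv_left[OF D])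
    have "((\<lambda>y. f (chart_inv D y)) has_derivative
        (\<lambda>v. fd (\<lambda>y. f (chart_inv C y)) (snd C p) (fd ?\<tau> (snd D p) v))) (at (snd D p))"
      by (rule has_derivative_transform_within_open[OF has_derivative_compose[OF \<tau> F] S y])
         (use chart_inv_right[OF D(1)] in \<open>auto simp: chart_inv_left[OF C(1)] chart_inv_left[OF D(1)]\<close>)
    then show ?thesis by (simp add: coord_vec_apply[OF True] fd_eq)
  qed (simp add: coord_vec_def)
qed

lemma tangent_space_chart:
  "C \<in> M \<Longrightarrow> p \<in> fst C \<Longrightarrow> tangent_space M p = range (coord_vec M C p)"
  unfolding tangent_space_def
  by (intro subset_antisym subsetI; (elim CollectE rangeE exE conjE)?) (metis coord_vec_change rangeI, blast)

lemma coord_vec_tangent [intro]: "C \<in> M \<Longrightarrow> p \<in> fst C \<Longrightarrow> coord_vec M C p v \<in> tangent_space M p"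
  unfolding tangent_space_def by blast

lemma coord_vec_vcomp:
  "C \<in> M \<Longrightarrow> p \<in> fst C \<Longrightarrow> v \<in> tangent_space M p \<Longrightarrow> coord_vec M C p (vcomp C v) = v"
  by (auto simp: tangent_space_chart vcomp_coord_vec)

lemma tangent_apply:
  "C \<in> M \<Longrightarrow> p \<in> fst C \<Longrightarrow> v \<in> tangent_space M p \<Longrightarrow> smooth_near M p f \<Longrightarrow>
    v f = fd (\<lambda>y. f (chart_inv C y)) (snd C p) (vcomp C v)"
  by (metis coord_vec_apply coord_vec_vcomp)

lemma subspace_tangent_space: "p \<in> points M \<Longrightarrow> subspace (tangent_space M p)"
  using point_chart[of p] linear_coord_vec
  by (auto simp: tangent_space_chart intro!: linear_subspace_image)

lemma vf_opn: "X \<in> vfields M U \<Longrightarrow> opn U" by (simp add: vfields_def)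

lemma vf_tangent: "X \<in> vfields M U \<Longrightarrow> p \<in> U \<Longrightarrow> X p \<in> tangent_space M p"
  by (simp add: vfields_def)

lemma vf_apply: "X \<in> vfields M U \<Longrightarrow> V \<subseteq> U \<Longrightarrow> f \<in> smooth_funs M V \<Longrightarrow> (\<lambda>p. X p f) \<in> smooth_funs M V"
  by (simp add: vfields_def)

lemma vf_restrict: "X \<in> vfields M U \<Longrightarrow> opn W \<Longrightarrow> W \<subseteq> U \<Longrightarrow> X \<in> vfields M W"
  by (auto simp: vfields_def)

lemma vf_rep:
  assumes X: "X \<in> vfields M U" and C: "C \<in> M" and W: "opn W" "W \<subseteq> U \<inter> fst C"
  shows "C_infinity (snd C ` W) (rep C X)"
  unfolding rep_def vcomp_def
proof (intro C_infinity_sum C_infinity_scaleR C_infinity_const)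
  show o: "open (snd C ` W)" "open (snd C ` W)" "open (snd C ` W)"
    using open_img[OF C W(1)] W(2) by auto
  fix b
  have "(\<lambda>q. snd C q \<bullet> b) \<in> smooth_funs M W"
    using W by (intro sf_of_chart[OF C] C_infinity_inner C_infinity_ident C_infinity_const o) auto
  then have "(\<lambda>p. X p (\<lambda>q. snd C q \<bullet> b)) \<in> smooth_funs M W"
    using vf_apply[OF X] W(2) by auto
  then show "C_infinity (snd C ` W) (\<lambda>y. X (chart_inv C y) (\<lambda>q. snd C q \<bullet> b))"
    by (rule sf_img[OF _ C]) (use W in auto)
qed

text \<open>The field differentiates functions along its component function, which preserves smoothness.\<close>

lemma vf_chart:
  assumes C: "C \<in> M" and W: "opn W" "W \<subseteq> fst C" and t: "\<And>p. p \<in> W \<Longrightarrow> X p \<in> tangent_space M p"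
    and X: "C_infinity (snd C ` W) (rep C X)"
  shows "X \<in> vfields M W"
  unfolding vfields_def
proof (intro CollectI conjI W ballI t allI impI)
  fix V f assume V: "V \<subseteq> W" and f: "f \<in> smooth_funs M V"
  have V': "opn V" "V \<subseteq> fst C" using sf_opn[OF f] V W by auto
  note o = open_img[OF C V']
  show "(\<lambda>p. X p f) \<in> smooth_funs M V"
  proof (rule sf_chart[OF C V'], rule C_infinity_cong[OF o])
    show "C_infinity (snd C ` V) (\<lambda>y. fd (\<lambda>y. f (chart_inv C y)) y (rep C X y))"
      by (intro C_infinity_fd_along o sf_img[OF f C] C_infinity_subset[OF X]) (use V V' in auto)
    fix y assume "y \<in> snd C ` V"
    then obtain p where p: "p \<in> V" "y = snd C p" by blast
    then have "p \<in> fst C" "p \<in> W" using V V' by auto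
    then show "X (chart_inv C y) f = fd (\<lambda>y. f (chart_inv C y)) y (rep C X y)"
      using tangent_apply[OF C _ t smooth_nearI[OF f p(1)]]
      by (simp add: p chart_inv_left[OF C] rep_def)
  qed
qed

lemma vf_local:
  assumes "opn U" "\<And>p. p \<in> U \<Longrightarrow> \<exists>W. p \<in> W \<and> X \<in> vfields M W"
  shows "X \<in> vfields M U"
  unfolding vfields_def
proof (intro CollectI conjI assms(1) ballI allI impI)
  fix p assume "p \<in> U"
  then show "X p \<in> tangent_space M p" using assms(2) vf_tangent by blast
next
  fix V f assume V: "V \<subseteq> U" and f: "f \<in> smooth_funs M V"
  show "(\<lambda>p. X p f) \<in> smooth_funs M V"
  proof (rule sf_local[OF sf_opn[OF f]])
    fix p assume p: "p \<in> V"
    then obtain W where W: "p \<in> W" "X \<in> vfields M W" using assms(2) V by blast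
    have "opn (V \<inter> W)" using sf_opn[OF f] vf_opn[OF W(2)] by auto
    then have "(\<lambda>p. X p f) \<in> smooth_funs M (V \<inter> W)"
      using vf_apply[OF W(2)] sf_restrict[OF f] by auto
    then show "\<exists>W. p \<in> W \<and> (\<lambda>p. X p f) \<in> smooth_funs M W" using p W by blast
  qed
qed

lemma vf_cong:
  assumes X: "X \<in> vfields M U" and eq: "\<And>p. p \<in> U \<Longrightarrow> Y p = X p"
  shows "Y \<in> vfields M U"
  unfolding vfields_def
proof (intro CollectI conjI ballI allI impI vf_opn[OF X])
  show "Y p \<in> tangent_space M p" if "p \<in> U" for p using vf_tangent[OF X that] eq[OF that] by simp
  show "(\<lambda>p. Y p f) \<in> smooth_funs M V" if V: "V \<subseteq> U" and f: "f \<in> smooth_funs M V" for V f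
    by (rule sf_cong[OF vf_apply[OF X V f]]) (use eq V in auto)
qed

definition chart_field :: "('p, 'e) chart \<Rightarrow> ('e \<Rightarrow> 'e) \<Rightarrow> 'p vfield"
  where "chart_field C V p = coord_vec M C p (V (snd C p))"

lemma rep_chart_field: "C \<in> M \<Longrightarrow> y \<in> snd C ` fst C \<Longrightarrow> rep C (chart_field C V) y = V y"
  using chart_inv_right[of C y "fst C"] by (simp add: rep_def chart_field_def vcomp_coord_vec)

lemma chart_field_vf:
  assumes "C \<in> M" "opn W" "W \<subseteq> fst C" "C_infinity (snd C ` W) V"
  shows "chart_field C V \<in> vfields M W"
proof (rule vf_chart[OF assms(1-3)])
  show "C_infinity (snd C ` W) (rep C (chart_field C V))"
    by (rule C_infinity_cong[OF open_img[OF assms(1-3)] assms(4)])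
       (use rep_chart_field[OF assms(1)] assms(3) in blast)
qed (use assms(1,3) in \<open>auto simp: chart_field_def\<close>)

lemma chart_field_const_vf: "C \<in> M \<Longrightarrow> opn W \<Longrightarrow> W \<subseteq> fst C \<Longrightarrow> chart_field C (\<lambda>_. v) \<in> vfields M W"
  by (rule chart_field_vf) (auto intro: C_infinity_const open_img)

lemma chart_field_rep: "C \<in> M \<Longrightarrow> p \<in> fst C \<Longrightarrow> X p \<in> tangent_space M p \<Longrightarrow> chart_field C (rep C X) p = X p"
  by (simp add: chart_field_def rep_def chart_inv_left coord_vec_vcomp)

lemma vf_apply_rep:
  assumes "X \<in> vfields M U" "p \<in> U" "C \<in> M" "p \<in> fst C" "smooth_near M p f"
  shows "X p f = fd (\<lambda>y. f (chart_inv C y)) (snd C p) (rep C X (snd C p))"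
  using tangent_apply[OF assms(3,4) vf_tangent[OF assms(1,2)] assms(5)]
  by (simp add: rep_def chart_inv_left assms)

text \<open>The second derivatives of the test function cancel, as mixed derivatives commute.\<close>

lemma bracket_chart:
  assumes C: "C \<in> M" and W: "W \<subseteq> fst C" and X: "X \<in> vfields M W" and Y: "Y \<in> vfields M W" and p: "p \<in> W"
  shows "bracket M X Y p = coord_vec M C p
    (fd (rep C Y) (snd C p) (rep C X (snd C p)) - fd (rep C X) (snd C p) (rep C Y (snd C p)))"
proof
  fix f
  show "bracket M X Y p f = coord_vec M C p
    (fd (rep C Y) (snd C p) (rep C X (snd C p)) - fd (rep C X) (snd C p) (rep C Y (snd C p))) f"
  proof (cases "smooth_near M p f")
    case near: True
    have pC: "p \<in> fst C" using W p by blast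
    obtain W1 where W1: "opn W1" "p \<in> W1" "f \<in> smooth_funs M W1" using near_chart[OF near C pC] by metis
    define V where "V = W1 \<inter> W"
    have V: "opn V" "p \<in> V" "V \<subseteq> W" "V \<subseteq> fst C" and fV: "f \<in> smooth_funs M V"
      using W1 vf_opn[OF X] p W sf_restrict[OF W1(3)] by (auto simp: V_def)
    define F where "F = (\<lambda>y. f (chart_inv C y))"
    note o = open_img[OF C V(1,4)]
    have F: "C_infinity (snd C ` V) F" unfolding F_def using sf_img[OF fV C] V by auto
    have y: "snd C p \<in> snd C ` V" using V by auto
    have act: "fd (\<lambda>y. Z (chart_inv C y) f) (snd C p) h =
        fd (\<lambda>y. fd F y (rep C Z (snd C p))) (snd C p) h + fd F (snd C p) (fd (rep C Z) (snd C p) h)"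
      if Z: "Z \<in> vfields M W" for Z h
    proof -
      have "fd (\<lambda>y. Z (chart_inv C y) f) (snd C p) = fd (\<lambda>y. fd F y (rep C Z y)) (snd C p)"
      proof (rule fd_cong[OF o y])
        fix z assume "z \<in> snd C ` V"
        then obtain q where q: "q \<in> V" "z = snd C q" by blast
        then show "Z (chart_inv C z) f = fd F z (rep C Z z)"
          using vf_apply_rep[OF Z _ C _ smooth_nearI[OF fV q(1)]] V(3,4)
          by (auto simp: F_def chart_inv_left[OF C] subset_iff)
      qed
      then show ?thesis
        using fd_linear_family[OF o vf_rep[OF Z C V(1)] C_infinity_fd[OF o F] linear_fd[OF F o] y] V(3,4) by simp
    qed
    have XY: "X p (\<lambda>q. Z q f) = fd (\<lambda>y. Z (chart_inv C y) f) (snd C p) (rep C X (snd C p))"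
      "Y p (\<lambda>q. Z q f) = fd (\<lambda>y. Z (chart_inv C y) f) (snd C p) (rep C Y (snd C p))"
      if "Z \<in> vfields M W" for Z
      using vf_apply_rep[OF X p C pC] vf_apply_rep[OF Y p C pC]
        smooth_nearI[OF vf_apply[OF that V(3) fV] V(2)] by auto
    show ?thesis
      using near linear_diff[OF linear_fd[OF F o y]]
        mixed_derivatives_commute[OF o F y, of "rep C Y (snd C p)" "rep C X (snd C p)"]
      by (simp add: bracket_def XY[OF X] XY[OF Y] act[OF X] act[OF Y] coord_vec_apply[OF near] F_def[symmetric])
  qed (simp add: bracket_def coord_vec_def)
qed

lemma bracket_vf:
  assumes X: "X \<in> vfields M U" and Y: "Y \<in> vfields M U"
  shows "bracket M X Y \<in> vfields M U"
proof (rule vf_local[OF vf_opn[OF X]])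
  fix p assume p: "p \<in> U"
  then obtain C where C: "C \<in> M" "p \<in> fst C" using point_chart opn_sub[OF vf_opn[OF X]] by blast
  define W where "W = U \<inter> fst C"
  have W: "opn W" "W \<subseteq> fst C" "W \<subseteq> U" "p \<in> W"
    using vf_opn[OF X] fst_opn[OF C(1)] p C by (auto simp: W_def)
  note XW = vf_restrict[OF X W(1,3)] and YW = vf_restrict[OF Y W(1,3)]
  note o = open_img[OF C(1) W(1,2)]
  have "chart_field C (\<lambda>y. fd (rep C Y) y (rep C X y) - fd (rep C X) y (rep C Y y)) \<in> vfields M W"
    by (intro chart_field_vf C(1) W C_infinity_diff C_infinity_fd_along o vf_rep[OF XW] vf_rep[OF YW]) (use W in auto)
  then have "bracket M X Y \<in> vfields M W"
    by (rule vf_cong) (simp add: bracket_chart[OF C(1) W(2) XW YW] chart_field_def)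
  then show "\<exists>W. p \<in> W \<and> bracket M X Y \<in> vfields M W" using W by blast
qed

lemma covector_lin: "w \<in> cotangent_space M p \<Longrightarrow> lin_on (tangent_space M p) w"
  by (simp add: cotangent_space_def)

end

lemma linear_vcomp: "linear (vcomp C)"
  by (rule linearI) (simp_all only: vcomp_add vcomp_scaleR)

context smooth_space
begin

lemma open_img_Int: "opn U \<Longrightarrow> C \<in> M \<Longrightarrow> open (snd C ` (U \<inter> fst C))"
  by (simp add: opn_iff)

lemma sf_const: "opn U \<Longrightarrow> (\<lambda>_. c) \<in> smooth_funs M U"
  unfolding smooth_funs_def o_def by (blast intro: C_infinity_const open_img_Int)

lemma sf_add: "f \<in> smooth_funs M U \<Longrightarrow> g \<in> smooth_funs M U \<Longrightarrow> (\<lambda>p. f p + g p) \<in> smooth_funs M U"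
  unfolding smooth_funs_def o_def mem_Collect_eq
  by (intro conjI ballI C_infinity_add open_img_Int) auto

lemma sf_mult: "f \<in> smooth_funs M U \<Longrightarrow> g \<in> smooth_funs M U \<Longrightarrow> (\<lambda>p. f p * g p) \<in> smooth_funs M U"
  unfolding smooth_funs_def o_def mem_Collect_eq
  by (intro conjI ballI C_infinity_mult open_img_Int) auto

lemma tangent_lin:
  "p \<in> points M \<Longrightarrow> u \<in> tangent_space M p \<Longrightarrow> v \<in> tangent_space M p \<Longrightarrow>
    r *\<^sub>R u + s *\<^sub>R v \<in> tangent_space M p"
  by (simp add: subspace_add subspace_scale subspace_tangent_space)

lemma vf_points: "X \<in> vfields M U \<Longrightarrow> p \<in> U \<Longrightarrow> p \<in> points M"
  using opn_sub[OF vf_opn] by blast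

lemma vf_add:
  assumes X: "X \<in> vfields M U" and Y: "Y \<in> vfields M U"
  shows "(\<lambda>q. X q + Y q) \<in> vfields M U"
  unfolding vfields_def
proof (intro CollectI conjI ballI allI impI vf_opn[OF X])
  show "(\<lambda>p. (X p + Y p) f) \<in> smooth_funs M V" if "V \<subseteq> U" "f \<in> smooth_funs M V" for V f
    using sf_add[OF vf_apply[OF X that] vf_apply[OF Y that]] by simp
  fix p assume p: "p \<in> U"
  show "X p + Y p \<in> tangent_space M p"
    using subspace_add[OF subspace_tangent_space[OF vf_points[OF X p]] vf_tangent[OF X p] vf_tangent[OF Y p]] .
qed

lemma vf_scale:
  assumes X: "X \<in> vfields M U" and g: "g \<in> smooth_funs M U"
  shows "(\<lambda>q. g q *\<^sub>R X q) \<in> vfields M U"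
  unfolding vfields_def
proof (intro CollectI conjI ballI allI impI vf_opn[OF X])
  show "(\<lambda>p. (g p *\<^sub>R X p) f) \<in> smooth_funs M V" if V: "V \<subseteq> U" "f \<in> smooth_funs M V" for V f
    using sf_mult[OF sf_restrict[OF g sf_opn[OF V(2)] V(1)] vf_apply[OF X V]] by (simp add: scaleR_fun_def)
  fix p assume p: "p \<in> U"
  show "g p *\<^sub>R X p \<in> tangent_space M p"
    using subspace_scale[OF subspace_tangent_space[OF vf_points[OF X p]] vf_tangent[OF X p]] .
qed

lemma vf_diff:
  assumes X: "X \<in> vfields M U" and Y: "Y \<in> vfields M U"
  shows "(\<lambda>q. X q - Y q) \<in> vfields M U"
  using vf_add[OF X vf_scale[OF Y sf_const[OF vf_opn[OF X], of "- 1"]]] by simp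

lemma vf_zero: "opn U \<Longrightarrow> (\<lambda>q. 0) \<in> vfields M U"
  unfolding vfields_def
  by (intro CollectI conjI ballI allI impI)
     (use opn_sub[of U] in \<open>auto simp: zero_fun_def intro: sf_const[OF sf_opn]
       subspace_0[OF subspace_tangent_space, unfolded zero_fun_def]\<close>)

lemma vf_sum:
  assumes "opn U" "\<And>b. b \<in> S \<Longrightarrow> X b \<in> vfields M U"
  shows "(\<lambda>q. \<Sum>b\<in>S. X b q) \<in> vfields M U"
  using assms(2) by (induction S rule: infinite_finite_induct) (auto intro: vf_zero[OF assms(1)] vf_add)

end

section \<open>Christoffel symbols\<close>

locale connection_space = smooth_space M for M :: "('p, 'e::euclidean_space) atlas" +
  fixes nabla :: "'p connection"
  assumes conn: "linear_connection M nabla"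
begin

lemma nabla_vf: "X \<in> vfields M U \<Longrightarrow> Y \<in> vfields M U \<Longrightarrow> nabla X Y \<in> vfields M U"
  using conn by (auto simp: linear_connection_def)

lemma nabla_rules:
  assumes "X \<in> vfields M U" "Y \<in> vfields M U" "X' \<in> vfields M U" "Y' \<in> vfields M U"
    "f \<in> smooth_funs M U" "p \<in> U"
  shows "nabla (\<lambda>q. X q + X' q) Y p = nabla X Y p + nabla X' Y p"
    "nabla (\<lambda>q. f q *\<^sub>R X q) Y p = f p *\<^sub>R nabla X Y p"
    "nabla X (\<lambda>q. Y q + Y' q) p = nabla X Y p + nabla X Y' p"
    "nabla X (\<lambda>q. f q *\<^sub>R Y q) p = X p f *\<^sub>R Y p + f p *\<^sub>R nabla X Y p"
    "(\<And>q. q \<in> U \<Longrightarrow> X q = X' q) \<Longrightarrow> (\<And>q. q \<in> U \<Longrightarrow> Y q = Y' q) \<Longrightarrow> nabla X Y p = nabla X' Y' p"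
proof -
  have "\<forall>X'\<in>vfields M U. \<forall>Y'\<in>vfields M U. \<forall>f\<in>smooth_funs M U. \<forall>p\<in>U.
         nabla (\<lambda>q. X q + X' q) Y p = nabla X Y p + nabla X' Y p \<and>
         nabla (\<lambda>q. f q *\<^sub>R X q) Y p = f p *\<^sub>R nabla X Y p \<and>
         nabla X (\<lambda>q. Y q + Y' q) p = nabla X Y p + nabla X Y' p \<and>
         nabla X (\<lambda>q. f q *\<^sub>R Y q) p = X p f *\<^sub>R Y p + f p *\<^sub>R nabla X Y p \<and>
         ((\<forall>q\<in>U. X q = X' q \<and> Y q = Y' q) \<longrightarrow> nabla X Y p = nabla X' Y' p)"
    using conn assms(1,2) unfolding linear_connection_def by blast
  note * = this[rule_format, OF assms(3-6)]
  show "nabla (\<lambda>q. X q + X' q) Y p = nabla X Y p + nabla X' Y p"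
    "nabla (\<lambda>q. f q *\<^sub>R X q) Y p = f p *\<^sub>R nabla X Y p"
    "nabla X (\<lambda>q. Y q + Y' q) p = nabla X Y p + nabla X Y' p"
    "nabla X (\<lambda>q. f q *\<^sub>R Y q) p = X p f *\<^sub>R Y p + f p *\<^sub>R nabla X Y p"
    using * by blast+
  show "nabla X Y p = nabla X' Y' p" if "\<And>q. q \<in> U \<Longrightarrow> X q = X' q" "\<And>q. q \<in> U \<Longrightarrow> Y q = Y' q"
    using * that by blast
qed

lemma nabla_cong:
  assumes "X \<in> vfields M U" "Y \<in> vfields M U" "X' \<in> vfields M U" "Y' \<in> vfields M U" "p \<in> U"
    "\<And>q. q \<in> U \<Longrightarrow> X q = X' q" "\<And>q. q \<in> U \<Longrightarrow> Y q = Y' q"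
  shows "nabla X Y p = nabla X' Y' p"
  using nabla_rules(5)[OF assms(1-4) sf_const[OF vf_opn[OF assms(1)]] assms(5)] assms(6,7) by blast

lemma nabla_sum1:
  assumes U: "opn U" and X: "\<And>b. b \<in> S \<Longrightarrow> X b \<in> vfields M U" and c: "\<And>b. b \<in> S \<Longrightarrow> c b \<in> smooth_funs M U"
    and Y: "Y \<in> vfields M U" and p: "p \<in> U" and S: "finite S"
  shows "nabla (\<lambda>q. \<Sum>b\<in>S. c b q *\<^sub>R X b q) Y p = (\<Sum>b\<in>S. c b p *\<^sub>R nabla (X b) Y p)"
  using S X c
proof (induction S rule: finite_induct)
  case empty
  have "nabla (\<lambda>q. 0 *\<^sub>R Y q) Y p = 0 *\<^sub>R nabla Y Y p"
    by (rule nabla_rules(2)[OF Y Y Y Y sf_const[OF U] p])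
  then show ?case by (simp add: zero_fun_def)
next
  case (insert b S)
  have "nabla (\<lambda>q. c b q *\<^sub>R X b q + (\<Sum>b\<in>S. c b q *\<^sub>R X b q)) Y p =
      nabla (\<lambda>q. c b q *\<^sub>R X b q) Y p + nabla (\<lambda>q. \<Sum>b\<in>S. c b q *\<^sub>R X b q) Y p"
    by (rule nabla_rules(1)[OF _ Y _ Y sf_const[OF U] p])
       (use insert.prems in \<open>auto intro!: vf_sum[OF U] vf_scale\<close>)
  also have "nabla (\<lambda>q. c b q *\<^sub>R X b q) Y p = c b p *\<^sub>R nabla (X b) Y p"
    by (rule nabla_rules(2)[OF _ Y Y Y _ p]) (use insert.prems in auto)
  finally show ?case using insert by simp
qed

lemma nabla_sum2:
  assumes U: "opn U" and Y: "\<And>b. b \<in> S \<Longrightarrow> Y b \<in> vfields M U" and c: "\<And>b. b \<in> S \<Longrightarrow> c b \<in> smooth_funs M U"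
    and X: "X \<in> vfields M U" and p: "p \<in> U" and S: "finite S"
  shows "nabla X (\<lambda>q. \<Sum>b\<in>S. c b q *\<^sub>R Y b q) p = (\<Sum>b\<in>S. X p (c b) *\<^sub>R Y b p + c b p *\<^sub>R nabla X (Y b) p)"
  using S Y c
proof (induction S rule: finite_induct)
  case empty
  have "nabla X (\<lambda>q. 0 + 0) p = nabla X (\<lambda>q. 0) p + nabla X (\<lambda>q. 0) p"
    by (rule nabla_rules(3)[OF X vf_zero[OF U] X vf_zero[OF U] sf_const[OF U] p])
  then have "nabla X (\<lambda>q. 0) p = 0" unfolding add_0_left by (rule add_cancel_right_right[THEN iffD1])
  then show ?case by (simp add: zero_fun_def)
next
  case (insert b S)
  have "nabla X (\<lambda>q. c b q *\<^sub>R Y b q + (\<Sum>b\<in>S. c b q *\<^sub>R Y b q)) p =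
      nabla X (\<lambda>q. c b q *\<^sub>R Y b q) p + nabla X (\<lambda>q. \<Sum>b\<in>S. c b q *\<^sub>R Y b q) p"
    by (rule nabla_rules(3)[OF X _ X _ sf_const[OF U] p])
       (use insert.prems in \<open>auto intro!: vf_sum[OF U] vf_scale\<close>)
  also have "nabla X (\<lambda>q. c b q *\<^sub>R Y b q) p = X p (c b) *\<^sub>R Y b p + c b p *\<^sub>R nabla X (Y b) p"
    by (rule nabla_rules(4)[OF X _ X X _ p]) (use insert.prems in auto)
  finally show ?case using insert by simp
qed

definition \<Gamma> :: "('p, 'e) chart \<Rightarrow> 'e \<Rightarrow> 'e \<Rightarrow> 'e \<Rightarrow> 'e"
  where "\<Gamma> K y u v = rep K (nabla (chart_field K (\<lambda>_. u)) (chart_field K (\<lambda>_. v))) y"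

lemma smooth_\<Gamma>: "K \<in> M \<Longrightarrow> C_infinity (snd K ` fst K) (\<lambda>y. \<Gamma> K y u v)"
  unfolding \<Gamma>_def
  by (rule vf_rep[OF nabla_vf]) (auto intro: chart_field_const_vf fst_opn)

lemma linear_\<Gamma>:
  assumes K: "K \<in> M" and y: "y \<in> snd K ` fst K"
  shows "linear (\<lambda>u. \<Gamma> K y u v)" "linear (\<lambda>v. \<Gamma> K y u v)"
proof -
  let ?E = "\<lambda>u. chart_field K (\<lambda>_. u)"
  note U = fst_opn[OF K]
  note E = chart_field_const_vf[OF K U order_refl]
  obtain p where p: "p \<in> fst K" "y = snd K p" using y by blast
  have [simp]: "chart_inv K y = p" using chart_inv_left[OF K p(1)] p(2) by simp
  have Eadd: "?E (u + v) q = ?E u q + ?E v q" and Esc: "?E (r *\<^sub>R u) q = r *\<^sub>R ?E u q" if "q \<in> fst K" for u v q r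
    using linear_coord_vec[OF K that] by (simp_all add: chart_field_def linear_add linear_scale)
  have 1: "nabla (?E (u + u')) (?E v) p = nabla (?E u) (?E v) p + nabla (?E u') (?E v) p" for u u' v
    by (rule trans[OF nabla_cong[OF E E vf_add[OF E E] E p(1) Eadd] nabla_rules(1)[OF E E E E sf_const[OF U] p(1)]]) auto
  have 2: "nabla (?E (r *\<^sub>R u)) (?E v) p = r *\<^sub>R nabla (?E u) (?E v) p" for r u v
    by (rule trans[OF nabla_cong[OF E E vf_scale[OF E sf_const[OF U]] E p(1) Esc] nabla_rules(2)[OF E E E E sf_const[OF U] p(1)]]) auto
  have 3: "nabla (?E u) (?E (v + v')) p = nabla (?E u) (?E v) p + nabla (?E u) (?E v') p" for u v v'
    by (rule trans[OF nabla_cong[OF E E E vf_add[OF E E] p(1) _ Eadd] nabla_rules(3)[OF E E E E sf_const[OF U] p(1)]]) auto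
  have zero: "?E u p (\<lambda>q. r) = 0" for u r
    using coord_vec_chart_fun[OF K U order_refl C_infinity_const[OF open_img_fst[OF K], of r] p(1), where v = u] by (simp add: chart_field_def)
  have 4: "nabla (?E u) (?E (r *\<^sub>R v)) p = r *\<^sub>R nabla (?E u) (?E v) p" for r u v
  proof -
    have "nabla (?E u) (?E (r *\<^sub>R v)) p = nabla (?E u) (\<lambda>q. r *\<^sub>R ?E v q) p"
      by (rule nabla_cong[OF E E E vf_scale[OF E sf_const[OF U]] p(1) _ Esc]) auto
    also have "\<dots> = ?E u p (\<lambda>q. r) *\<^sub>R ?E v p + r *\<^sub>R nabla (?E u) (?E v) p"
      by (rule nabla_rules(4)[OF E E E E sf_const[OF U] p(1)])
    finally show ?thesis by (simp add: zero)
  qed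
  show "linear (\<lambda>u. \<Gamma> K y u v)" "linear (\<lambda>v. \<Gamma> K y u v)"
    by (auto intro!: linearI simp: \<Gamma>_def rep_def 1 2 3 4 vcomp_add vcomp_scaleR)
qed

text \<open>Both fields are expanded in the coordinate frame of the part of \<open>U\<close> that lies in the chart; by
  locality this does not change \<open>nabla X Y\<close>.\<close>

lemma nabla_rep:
  assumes X: "X \<in> vfields M U" and Y: "Y \<in> vfields M U" and p: "p \<in> U" and K: "K \<in> M" "p \<in> fst K"
  shows "rep K (nabla X Y) (snd K p) =
    fd (rep K Y) (snd K p) (rep K X (snd K p)) + \<Gamma> K (snd K p) (rep K X (snd K p)) (rep K Y (snd K p))"
proof -
  define W where "W = U \<inter> fst K"
  have W: "opn W" "W \<subseteq> fst K" "W \<subseteq> U" "p \<in> W"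
    using vf_opn[OF X] fst_opn[OF K(1)] p K by (auto simp: W_def)
  note XW = vf_restrict[OF X W(1,3)] and YW = vf_restrict[OF Y W(1,3)]
  let ?E = "\<lambda>u. chart_field K (\<lambda>_. u)" and ?y = "snd K p"
  note E = chart_field_const_vf[OF K(1) W(1,2)]
  have [simp]: "chart_inv K ?y = p" by (rule chart_inv_left[OF K])
  note o = open_img[OF K(1) W(1,2)]
  let ?c = "\<lambda>Z b q. rep K Z (snd K q) \<bullet> b"
  have sm: "C_infinity (snd K ` W) (rep K Z)" if "Z \<in> vfields M W" for Z
    by (rule vf_rep[OF that K(1) W(1)]) (use W in auto)
  have c: "?c Z b \<in> smooth_funs M W" if "Z \<in> vfields M W" for Z b
    by (rule sf_of_chart[OF K(1) W(1,2)]) (intro C_infinity_inner C_infinity_const o sm that)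
  have ex: "Z q = (\<Sum>b\<in>Basis. ?c Z b q *\<^sub>R ?E b q)" if "Z \<in> vfields M W" "q \<in> W" for Z q
  proof -
    have "q \<in> fst K" using that W by auto
    then show ?thesis
      using chart_field_rep[OF K(1), of q Z, symmetric] vf_tangent[OF that]
        linear_euclidean_sum[OF linear_coord_vec[OF K(1), of q], of "rep K Z (snd K q)"]
      by (simp add: chart_field_def)
  qed
  have ex_vf: "(\<lambda>q. \<Sum>b\<in>Basis. ?c Z b q *\<^sub>R ?E b q) \<in> vfields M W" if "Z \<in> vfields M W" for Z
    by (rule vf_cong[OF that]) (simp add: ex[OF that])
  have XE: "nabla X (?E b) p = (\<Sum>d\<in>Basis. ?c X d p *\<^sub>R nabla (?E d) (?E b) p)" for b
    by (rule trans[OF nabla_cong[OF XW E ex_vf[OF XW] E W(4) ex[OF XW]] nabla_sum1[OF W(1) E c[OF XW] E W(4)]]) auto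
  have act: "X p (?c Y b) = fd (rep K Y) ?y (rep K X ?y) \<bullet> b" for b
  proof -
    have "X p (?c Y b) = coord_vec M K p (rep K X ?y) (?c Y b)"
      using chart_field_rep[OF K, of X] vf_tangent[OF X p] by (simp add: chart_field_def)
    also have "\<dots> = fd (\<lambda>y. rep K Y y \<bullet> b) ?y (rep K X ?y)"
      by (rule coord_vec_chart_fun[OF K(1) W(1,2) _ W(4)]) (intro C_infinity_inner C_infinity_const o sm YW)
    also have "\<dots> = fd (rep K Y) ?y (rep K X ?y) \<bullet> b"
      by (rule fd_inner_left[OF sm[OF YW] o]) (use W in auto)
    finally show ?thesis .
  qed
  have y: "?y \<in> snd K ` fst K" using K by auto
  have l1: "(\<Sum>d\<in>Basis. (v \<bullet> d) *\<^sub>R \<Gamma> K ?y d w) = \<Gamma> K ?y v w" for v w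
    by (rule linear_euclidean_sum[OF linear_\<Gamma>(1)[OF K(1) y], symmetric])
  have l2: "(\<Sum>d\<in>Basis. (w \<bullet> d) *\<^sub>R \<Gamma> K ?y v d) = \<Gamma> K ?y v w" for v w
    by (rule linear_euclidean_sum[OF linear_\<Gamma>(2)[OF K(1) y], symmetric])
  have n1: "nabla X Y p = (\<Sum>b\<in>Basis. X p (?c Y b) *\<^sub>R ?E b p + ?c Y b p *\<^sub>R nabla X (?E b) p)"
    by (rule trans[OF nabla_cong[OF XW YW XW ex_vf[OF YW] W(4) _ ex[OF YW]] nabla_sum2[OF W(1) E c[OF YW] XW W(4)]]) auto
  have "vcomp K (nabla X Y p) = (\<Sum>b\<in>Basis. (fd (rep K Y) ?y (rep K X ?y) \<bullet> b) *\<^sub>R b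
      + ?c Y b p *\<^sub>R (\<Sum>d\<in>Basis. ?c X d p *\<^sub>R \<Gamma> K ?y d b))"
  proof -
    have csum: "vcomp K (\<Sum>b\<in>S. h b) = (\<Sum>b\<in>S. vcomp K (h b))" for h :: "'e \<Rightarrow> 'p tvec" and S
      by (rule linear_sum[OF linear_vcomp])
    have "vcomp K (?E b p) = b" for b unfolding chart_field_def by (rule vcomp_coord_vec[OF K])
    moreover have "vcomp K (nabla (?E d) (?E b) p) = \<Gamma> K ?y d b" for d b by (simp add: \<Gamma>_def rep_def)
    ultimately show ?thesis by (simp add: n1 XE act csum vcomp_add vcomp_scaleR)
  qed
  also have "\<dots> = fd (rep K Y) ?y (rep K X ?y) + (\<Sum>b\<in>Basis. (rep K Y ?y \<bullet> b) *\<^sub>R \<Gamma> K ?y (rep K X ?y) b)"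
    by (simp only: sum.distrib euclidean_representation l1)
  also have "\<dots> = fd (rep K Y) ?y (rep K X ?y) + \<Gamma> K ?y (rep K X ?y) (rep K Y ?y)"
    by (simp only: l2)
  finally show ?thesis by (simp add: rep_def)
qed

lemma fd_rep_const:
  assumes K: "K \<in> M" and y: "y \<in> snd K ` fst K"
  shows "rep K (chart_field K (\<lambda>_. u)) y = u" "fd (rep K (chart_field K (\<lambda>_. u))) y = (\<lambda>_. 0)"
  using rep_chart_field[OF K y] fd_cong[OF open_img_fst[OF K] y, of "rep K (chart_field K (\<lambda>_. u))" "\<lambda>_. u"]
  by (auto simp: rep_chart_field[OF K])

lemma bracket_const:
  assumes K: "K \<in> M" and p: "p \<in> fst K"
  shows "bracket M (chart_field K (\<lambda>_. u)) (chart_field K (\<lambda>_. v)) p = 0"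
proof -
  have y: "snd K p \<in> snd K ` fst K" using p by blast
  note E = chart_field_const_vf[OF K fst_opn[OF K] order_refl]
  show ?thesis
    using linear_0[OF linear_coord_vec[OF K p]]
    by (simp add: bracket_chart[OF K order_refl E E p] fd_rep_const[OF K y])
qed

text \<open>Coordinate fields commute, so absence of torsion is symmetry of the Christoffel symbols.\<close>

lemma \<Gamma>_symmetric:
  assumes sym: "symmetric_connection M nabla" and K: "K \<in> M" and y: "y \<in> snd K ` fst K"
  shows "\<Gamma> K y u v = \<Gamma> K y v u"
proof -
  obtain p where p: "p \<in> fst K" "y = snd K p" using y by blast
  note E = chart_field_const_vf[OF K fst_opn[OF K] order_refl]
  have "nabla (chart_field K (\<lambda>_. u)) (chart_field K (\<lambda>_. v)) p - nabla (chart_field K (\<lambda>_. v)) (chart_field K (\<lambda>_. u)) p = 0"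
    using sym E p bracket_const[OF K p(1)] unfolding symmetric_connection_def by metis
  then show ?thesis by (simp add: \<Gamma>_def rep_def p chart_inv_left[OF K])
qed

lemma \<Gamma>_parallel:
  assumes par: "parallel_field M nabla xi" and xi: "xi \<in> vfields M (points M)"
    and K: "K \<in> M" and y: "y \<in> snd K ` fst K"
  shows "fd (rep K xi) y u + \<Gamma> K y u (rep K xi y) = 0"
proof -
  obtain p where p: "p \<in> fst K" "y = snd K p" using y by blast
  note E = chart_field_const_vf[OF K fst_opn[OF K] order_refl]
  have xi': "xi \<in> vfields M (fst K)"
    by (rule vf_restrict[OF xi fst_opn[OF K]]) (use K in \<open>auto simp: points_def\<close>)
  have "nabla (chart_field K (\<lambda>_. u)) xi p = 0" using par E p unfolding parallel_field_def by blast
  then show ?thesis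
    using nabla_rep[OF E xi' p(1) K p(1), of u] fd_rep_const[OF K y]
    by (simp add: p rep_def chart_inv_left[OF K] vcomp_zero)
qed

text \<open>The components of \<open>R(u, v) w\<close>.\<close>

definition curv :: "('p, 'e) chart \<Rightarrow> 'e \<Rightarrow> 'e \<Rightarrow> 'e \<Rightarrow> 'e \<Rightarrow> 'e"
  where "curv K y u v w = fd (\<lambda>y. \<Gamma> K y v w) y u - fd (\<lambda>y. \<Gamma> K y u w) y v
    + \<Gamma> K y u (\<Gamma> K y v w) - \<Gamma> K y v (\<Gamma> K y u w)"

lemma curv_flat:
  assumes fl: "flat M nabla" and K: "K \<in> M" and y: "y \<in> snd K ` fst K"
  shows "curv K y u v w = 0"
proof -
  obtain p where p: "p \<in> fst K" "y = snd K p" using y by blast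
  note E = chart_field_const_vf[OF K fst_opn[OF K] order_refl]
  let ?E = "\<lambda>u. chart_field K (\<lambda>_. u)"
  have rn: "rep K (nabla (?E u) (?E v)) = (\<lambda>y. \<Gamma> K y u v)" for u v by (simp add: \<Gamma>_def fun_eq_iff)
  have 2: "rep K (nabla (?E u) (nabla (?E v) (?E w))) y = fd (\<lambda>y. \<Gamma> K y v w) y u + \<Gamma> K y u (\<Gamma> K y v w)" for u v w
    using nabla_rep[OF E nabla_vf[OF E E] p(1) K p(1), of u v w] fd_rep_const[OF K y] by (simp add: p rn)
  have f0: "rep K (nabla (bracket M (?E u) (?E v)) (?E w)) y = 0"
    using nabla_rep[OF bracket_vf[OF E E] E p(1) K p(1), of u v w] fd_rep_const[OF K y]
      linear_0[OF linear_\<Gamma>(1)[OF K y]]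
    by (simp add: p rep_def chart_inv_left[OF K] bracket_const[OF K] vcomp_zero)
  have "nabla (?E u) (nabla (?E v) (?E w)) p - nabla (?E v) (nabla (?E u) (?E w)) p
      - nabla (bracket M (?E u) (?E v)) (?E w) p = 0"
    using fl E p unfolding flat_def by blast
  then have f1: "rep K (nabla (?E u) (nabla (?E v) (?E w))) y - rep K (nabla (?E v) (nabla (?E u) (?E w))) y
      - rep K (nabla (bracket M (?E u) (?E v)) (?E w)) y = 0"
    by (simp add: rep_def p chart_inv_left[OF K] vcomp_diff[symmetric] vcomp_zero)
  show ?thesis using f1 unfolding f0 2 curv_def by (simp add: algebra_simps)
qed

end

section \<open>The cotangent bundle\<close>

context smooth_space
begin

definition covec :: "('p, 'e) chart \<Rightarrow> 'p \<Rightarrow> 'e \<Rightarrow> 'p covec"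
  where "covec K p w = (\<lambda>v. if v \<in> tangent_space M p then w \<bullet> vcomp K v else 0)"

definition covcomp :: "('p, 'e) chart \<Rightarrow> 'p \<Rightarrow> 'p covec \<Rightarrow> 'e"
  where "covcomp K p \<alpha> = (\<Sum>b\<in>Basis. \<alpha> (coord_vec M K p b) *\<^sub>R b)"

lemma covec_cotangent: "covec K p w \<in> cotangent_space M p" if "K \<in> M" "p \<in> fst K"
proof -
  have "p \<in> points M" using that by (auto simp: points_def)
  then show ?thesis
    by (auto simp: cotangent_space_def covec_def lin_on_def tangent_lin vcomp_add vcomp_scaleR inner_add_right)
qed

lemma covec_coord_vec:
  "K \<in> M \<Longrightarrow> p \<in> fst K \<Longrightarrow> covec K p w (coord_vec M K p v) = w \<bullet> v"
  by (simp add: covec_def coord_vec_tangent vcomp_coord_vec)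

lemma covcomp_covec: "K \<in> M \<Longrightarrow> p \<in> fst K \<Longrightarrow> covcomp K p (covec K p w) = w"
  by (simp add: covcomp_def covec_coord_vec euclidean_representation)

lemma covector_coord:
  assumes "K \<in> M" "p \<in> fst K" "\<alpha> \<in> cotangent_space M p"
  shows "\<alpha> (coord_vec M K p v) = covcomp K p \<alpha> \<bullet> v"
proof -
  note lin = covector_lin[OF assms(3), unfolded lin_on_def, rule_format, OF coord_vec_tangent[OF assms(1,2)] coord_vec_tangent[OF assms(1,2)]]
  have "linear (\<lambda>v. \<alpha> (coord_vec M K p v))"
  proof (rule linearI)
    show "\<alpha> (coord_vec M K p (u + v)) = \<alpha> (coord_vec M K p u) + \<alpha> (coord_vec M K p v)" for u v
      using lin[of 1 u 1 v] coord_vec_lin[OF assms(1,2), of 1 u 1 v] by simp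
    show "\<alpha> (coord_vec M K p (r *\<^sub>R v)) = r *\<^sub>R \<alpha> (coord_vec M K p v)" for r v
      using lin[of r v 0 v] coord_vec_lin[OF assms(1,2), of r v 0 v] by simp
  qed
  then have "\<alpha> (coord_vec M K p v) = (\<Sum>b\<in>Basis. (v \<bullet> b) *\<^sub>R \<alpha> (coord_vec M K p b))"
    by (rule linear_euclidean_sum)
  also have "\<dots> = covcomp K p \<alpha> \<bullet> v"
    unfolding covcomp_def inner_sum_left by (rule sum.cong) (simp_all add: inner_commute[of _ v])
  finally show ?thesis .
qed

lemma covector_apply:
  "K \<in> M \<Longrightarrow> p \<in> fst K \<Longrightarrow> \<alpha> \<in> cotangent_space M p \<Longrightarrow> v \<in> tangent_space M p \<Longrightarrow>
    \<alpha> v = covcomp K p \<alpha> \<bullet> vcomp K v"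
  using covector_coord[of K p \<alpha> "vcomp K v"] by (simp add: coord_vec_vcomp)

lemma covec_covcomp: "K \<in> M \<Longrightarrow> p \<in> fst K \<Longrightarrow> \<alpha> \<in> cotangent_space M p \<Longrightarrow> covec K p (covcomp K p \<alpha>) = \<alpha>"
  by (rule ext) (simp add: covec_def covector_apply[symmetric], simp add: cotangent_space_def)

abbreviation "TM \<equiv> cotangent_atlas M"
abbreviation "TC \<equiv> cotangent_chart M"

lemma TC_in: "K \<in> M \<Longrightarrow> TC K \<in> TM" by (simp add: cotangent_atlas_def)

lemma fst_TC: "(x, w) \<in> fst (TC K) \<longleftrightarrow> x \<in> fst K \<and> w \<in> cotangent_space M x"
  by (simp add: cotangent_chart_def cotangent_over_def)

lemma fst_TC': "q \<in> fst (TC K) \<longleftrightarrow> fst q \<in> fst K \<and> snd q \<in> cotangent_space M (fst q)"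
  by (cases q) (simp add: fst_TC)

lemma snd_TC: "snd (TC K) q = (snd K (fst q), covcomp K (fst q) (snd q))"
  by (cases q) (simp add: cotangent_chart_def covcomp_def)

lemma TC_surj:
  assumes K: "K \<in> M" "p \<in> fst K"
  shows "(p, covec K p w) \<in> fst (TC K)" "snd (TC K) (p, covec K p w) = (snd K p, w)"
  using K by (simp_all add: fst_TC covec_cotangent snd_TC covcomp_covec)

lemma inj_TC: "K \<in> M \<Longrightarrow> inj_on (snd (TC K)) (fst (TC K))"
proof (rule inj_onI)
  fix q q' assume K: "K \<in> M" and q: "q \<in> fst (TC K)" "q' \<in> fst (TC K)" and eq: "snd (TC K) q = snd (TC K) q'"
  have x: "fst q = fst q'"
    using eq q chart_inv_left[OF K] by (metis fst_TC' snd_TC fst_conv)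
  moreover have "snd q = snd q'"
    using eq q covec_covcomp[OF K] by (metis fst_TC' snd_TC snd_conv x)
  ultimately show "q = q'" by (simp add: prod_eq_iff)
qed

lemma chart_inv_TC:
  assumes K: "K \<in> M" and y: "y \<in> snd K ` fst K"
  shows "chart_inv (TC K) (y, w) = (chart_inv K y, covec K (chart_inv K y) w)"
proof -
  have "chart_inv K y \<in> fst K" "snd K (chart_inv K y) = y" using chart_inv_right[OF K y] by auto
  then show ?thesis
    using TC_surj[OF K, of "chart_inv K y" w] inv_into_f_f[OF inj_TC[OF K]] by (metis chart_inv_def)
qed

lemma TC_image:
  assumes K: "K \<in> M" and W: "W \<subseteq> fst K"
  shows "snd (TC K) ` (cotangent_over M W) = (snd K ` W) \<times> UNIV"
proof (intro subset_antisym subsetI)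
  fix z assume "z \<in> snd (TC K) ` (cotangent_over M W)"
  then show "z \<in> (snd K ` W) \<times> UNIV" by (auto simp: snd_TC cotangent_over_def)
next
  fix z assume "z \<in> (snd K ` W) \<times> (UNIV :: 'e set)"
  then obtain p w where p: "p \<in> W" "z = (snd K p, w)" by auto
  then have "z = snd (TC K) (p, covec K p w)" "(p, covec K p w) \<in> cotangent_over M W"
    using TC_surj(2)[OF K, of p w] W K by (auto simp: cotangent_over_def covec_cotangent)
  then show "z \<in> snd (TC K) ` (cotangent_over M W)" by blast
qed

lemma fst_TC_over: "fst (TC K) = cotangent_over M (fst K)"
  by (simp add: cotangent_chart_def)

lemma cotangent_over_Int: "cotangent_over M U \<inter> cotangent_over M V = cotangent_over M (U \<inter> V)"
  by (auto simp: cotangent_over_def)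

text \<open>The fibre part of a change of induced charts is the transpose of the derivative of the
  inverse change of charts on the base.\<close>

lemma smooth_cotangent_atlas: "smooth_atlas TM"
  unfolding smooth_atlas_def
proof (intro conjI ballI)
  fix C assume "C \<in> TM"
  then obtain K where K: "K \<in> M" "C = TC K" by (auto simp: cotangent_atlas_def)
  show "inj_on (snd C) (fst C)" by (simp add: K inj_TC)
  show "open (snd C ` fst C)" using open_img_fst[OF K(1)]
    by (simp add: K fst_TC_over TC_image[OF K(1) order_refl] open_Times)
next
  fix C D assume "C \<in> TM" "D \<in> TM"
  then obtain K L where K: "K \<in> M" "C = TC K" and L: "L \<in> M" "D = TC L" by (auto simp: cotangent_atlas_def)
  have im: "snd C ` (fst C \<inter> fst D) = (snd K ` (fst K \<inter> fst L)) \<times> UNIV"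
    using TC_image[OF K(1), of "fst K \<inter> fst L"] by (simp add: K L fst_TC_over cotangent_over_Int)
  note oK = transition(1)[OF K(1) L(1)]
  show o: "open (snd C ` (fst C \<inter> fst D))" using oK by (simp add: im open_Times)
  let ?S = "(snd K ` (fst K \<inter> fst L)) \<times> (UNIV :: 'e set)"
  let ?\<tau> = "\<lambda>y. snd L (chart_inv K y)" and ?\<sigma> = "\<lambda>y. snd K (chart_inv L y)"
  have oS: "open ?S" using oK by (simp add: open_Times)
  have s1: "C_infinity ?S (\<lambda>z. ?\<tau> (fst z))"
    by (rule C_infinity_compose[OF oS oK _ _ transition(2)[OF K(1) L(1)]])
       (auto intro: C_infinity_linear[OF bounded_linear_fst oS])
  have s2: "C_infinity ?S (\<lambda>z. fd ?\<sigma> (?\<tau> (fst z)) b)" for b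
    by (rule C_infinity_compose[OF oS transition(1)[OF L(1) K(1)] _ s1])
       (auto intro!: C_infinity_fd transition[OF L(1) K(1)] simp: chart_inv_left[OF K(1)])
  have "C_infinity ?S (\<lambda>z. (?\<tau> (fst z), \<Sum>b\<in>Basis. (snd z \<bullet> fd ?\<sigma> (?\<tau> (fst z)) b) *\<^sub>R b))"
    by (intro C_infinity_Pair oS s1 s2 C_infinity_sum C_infinity_scaleR C_infinity_inner C_infinity_const
        C_infinity_linear[OF bounded_linear_snd])
  then show "C_infinity (snd C ` (fst C \<inter> fst D)) (snd D \<circ> chart_inv C)"
    unfolding im
  proof (rule C_infinity_cong[OF oS])
    fix z assume "z \<in> ?S"
    then obtain p w where p: "p \<in> fst K" "p \<in> fst L" "z = (snd K p, w)" by auto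
    have "covec K p w (coord_vec M L p b) = w \<bullet> fd ?\<sigma> (snd L p) b" for b
      unfolding coord_vec_change[OF K(1) p(1) L(1) p(2)] by (rule covec_coord_vec[OF K(1) p(1)])
    then show "(snd D \<circ> chart_inv C) z =
        (?\<tau> (fst z), \<Sum>b\<in>Basis. (snd z \<bullet> fd ?\<sigma> (?\<tau> (fst z)) b) *\<^sub>R b)"
      using p by (simp add: K L chart_inv_TC[OF K(1)] snd_TC chart_inv_left[OF K(1)] covcomp_def)
  qed
qed

end

locale cotangent_bundle = connection_space M nabla for M :: "('p, 'e::euclidean_space) atlas" and nabla :: "'p connection"

sublocale cotangent_bundle \<subseteq> T: smooth_space "cotangent_atlas M"
  by unfold_locales (rule smooth_cotangent_atlas)

context cotangent_bundle
begin

lemma points_TM: "points TM = cotangent_over M (points M)"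
  by (auto simp: points_def cotangent_atlas_def fst_TC_over cotangent_over_def)

lemma opn_over: "opn U \<Longrightarrow> T.opn (cotangent_over M U)"
  unfolding T.opn_iff
proof (intro conjI ballI)
  assume U: "opn U"
  show "cotangent_over M U \<subseteq> points TM" using opn_sub[OF U] by (auto simp: points_TM cotangent_over_def)
  fix C assume "C \<in> TM"
  then obtain K where K: "K \<in> M" "C = TC K" by (auto simp: cotangent_atlas_def)
  show "open (snd C ` (cotangent_over M U \<inter> fst C))"
    using TC_image[OF K(1), of "U \<inter> fst K"] open_img_Int[OF U K(1)]
    by (simp add: K fst_TC_over cotangent_over_Int open_Times)
qed

lemma TC_coord:
  assumes K: "K \<in> M" and q: "q \<in> fst (TC K)"
  shows "fst q \<in> fst K" "snd q \<in> cotangent_space M (fst q)" "chart_inv (TC K) (snd (TC K) q) = q"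
    "chart_inv K (fst (snd (TC K) q)) = fst q" "fst (snd (TC K) q) \<in> snd K ` fst K"
  using q T.chart_inv_left[OF TC_in[OF K] q] chart_inv_left[OF K] by (auto simp: fst_TC' snd_TC)

lemma vlift_chart:
  assumes K: "K \<in> M" and V: "V \<subseteq> fst K" and Z: "Z \<in> vfields M V"
  shows "C_infinity ((snd K ` V) \<times> UNIV) (\<lambda>z. snd z \<bullet> rep K Z (fst z))"
    "\<And>z. z \<in> (snd K ` V) \<times> UNIV \<Longrightarrow> vlift Z (chart_inv (TC K) z) = snd z \<bullet> rep K Z (fst z)"
    "vlift Z \<in> smooth_funs TM (cotangent_over M V)"
proof -
  have oV: "open (snd K ` V)" by (rule open_img[OF K vf_opn[OF Z] V])
  then have o: "open ((snd K ` V) \<times> (UNIV :: 'e set))" by (simp add: open_Times)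
  show 1: "C_infinity ((snd K ` V) \<times> UNIV) (\<lambda>z. snd z \<bullet> rep K Z (fst z))"
    by (intro C_infinity_inner o C_infinity_linear[OF bounded_linear_snd]
        C_infinity_compose[OF o oV _ C_infinity_linear[OF bounded_linear_fst o] vf_rep[OF Z K vf_opn[OF Z]]]) (use V in auto)
  show 2: "vlift Z (chart_inv (TC K) z) = snd z \<bullet> rep K Z (fst z)" if "z \<in> (snd K ` V) \<times> UNIV" for z
  proof -
    obtain p w where p: "p \<in> V" "z = (snd K p, w)" using \<open>z \<in> _\<close> by auto
    then have pK: "p \<in> fst K" using V by auto
    have "vlift Z (chart_inv (TC K) z) = covec K p w (Z p)"
      using pK by (simp add: p chart_inv_TC[OF K] chart_inv_left[OF K] vlift_def)
    also have "\<dots> = w \<bullet> vcomp K (Z p)" by (simp add: covec_def vf_tangent[OF Z p(1)])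
    finally show ?thesis using pK by (simp add: p rep_def chart_inv_left[OF K])
  qed
  have V': "cotangent_over M V \<subseteq> fst (TC K)" using V by (auto simp: fst_TC_over cotangent_over_def)
  show "vlift Z \<in> smooth_funs TM (cotangent_over M V)"
    by (rule T.sf_chart[OF TC_in[OF K] opn_over[OF vf_opn[OF Z]] V'])
       (simp only: TC_image[OF K V], rule C_infinity_cong[OF o 1], rule 2)
qed

text \<open>In induced coordinates \<open>Z\<^sup>V\<close> is \<open>(y, w) \<mapsto> w \<bullet> Z(y)\<close>. Lifts of fields are recognised by their action
  on these functions.\<close>

lemma coord_vec_vlift:
  assumes K: "K \<in> M" and V: "V \<subseteq> fst K" and Z: "Z \<in> vfields M V" and q: "q \<in> cotangent_over M V"
    and z: "snd (TC K) q = (y, w)"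
  shows "coord_vec TM (TC K) q (u, \<beta>) (vlift Z) = \<beta> \<bullet> rep K Z y + w \<bullet> fd (rep K Z) y u"
proof -
  let ?S = "(snd K ` V) \<times> (UNIV :: 'e set)"
  have oV: "open (snd K ` V)" by (rule open_img[OF K vf_opn[OF Z] V])
  then have o: "open ?S" by (simp add: open_Times)
  have qK: "q \<in> fst (TC K)" using q V by (auto simp: fst_TC_over cotangent_over_def)
  have yS: "(y, w) \<in> ?S" "y \<in> snd K ` V" using q z by (auto simp: snd_TC cotangent_over_def)
  have "coord_vec TM (TC K) q (u, \<beta>) (vlift Z) = fd (\<lambda>z. vlift Z (chart_inv (TC K) z)) (y, w) (u, \<beta>)"
    by (simp add: T.coord_vec_apply[OF T.smooth_nearI[OF vlift_chart(3)[OF K V Z] q]] z)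
  also have "\<dots> = fd (\<lambda>z. snd z \<bullet> rep K Z (fst z)) (y, w) (u, \<beta>)"
    by (rule fun_cong[OF fd_cong[OF o yS(1) vlift_chart(2)[OF K V Z]]])
  also have "\<dots> = w \<bullet> fd (rep K Z) y u + \<beta> \<bullet> rep K Z y"
  proof -
    have r: "(rep K Z has_derivative fd (rep K Z) y) (at (fst (y, w)))"
      using C_infinity_has_derivative[OF vf_rep[OF Z K vf_opn[OF Z]] oV yS(2)] V by auto
    have f: "(fst has_derivative fst) (at (y, w))" and g: "(snd has_derivative snd) (at (y, w))"
      by (auto intro!: derivative_eq_intros)
    show ?thesis
      using fd_eq[OF has_derivative_inner[OF g has_derivative_compose[OF f r]]] by simp
  qed
  finally show ?thesis by simp
qed

lemma vertical_vec_chart: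
  assumes K: "K \<in> M" and q: "q \<in> fst (TC K)" and \<beta>: "\<beta> \<in> cotangent_space M (fst q)"
  shows "vertical_vec M q \<beta> = coord_vec TM (TC K) q (0, covcomp K (fst q) \<beta>)"
proof
  fix F
  show "vertical_vec M q \<beta> F = coord_vec TM (TC K) q (0, covcomp K (fst q) \<beta>) F"
  proof (cases "smooth_near TM q F")
    case True
    let ?F = "\<lambda>z. F (chart_inv (TC K) z)" and ?z = "snd (TC K) q"
    let ?\<gamma> = "\<lambda>s. (fst ?z, snd ?z + s *\<^sub>R covcomp K (fst q) \<beta>)"
    have pK: "fst q \<in> fst K" and sq: "snd q \<in> cotangent_space M (fst q)" using q by (auto simp: fst_TC')
    have eq: "F (fst q, snd q + s *\<^sub>R \<beta>) = ?F (?\<gamma> s)" for s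
    proof -
      have in_q: "(fst q, snd q + s *\<^sub>R \<beta>) \<in> fst (TC K)"
        using sq \<beta> pK by (auto simp: fst_TC cotangent_space_def lin_on_def scaleR_fun_def algebra_simps)
      have "snd (TC K) (fst q, snd q + s *\<^sub>R \<beta>) = ?\<gamma> s"
        by (simp add: snd_TC covcomp_def scaleR_fun_def scaleR_left_distrib sum.distrib scaleR_sum_right)
      then show ?thesis using T.chart_inv_left[OF TC_in[OF K] in_q] by simp
    qed
    have F: "(?F has_derivative fd ?F ?z) (at (?\<gamma> 0))"
      using T.near_has_derivative[OF True TC_in[OF K] q] by simp
    have \<gamma>: "(?\<gamma> has_derivative (\<lambda>s. s *\<^sub>R (0, covcomp K (fst q) \<beta>))) (at 0)"
      by (rule has_derivative_eq_rhs[OF has_derivative_Pair[OF has_derivative_const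
          has_derivative_add[OF has_derivative_const has_derivative_scaleR_left[OF has_derivative_ident]]]]) auto
    have "((\<lambda>s. ?F (?\<gamma> s)) has_derivative (\<lambda>s. fd ?F ?z (s *\<^sub>R (0, covcomp K (fst q) \<beta>)))) (at 0)"
      by (rule has_derivative_compose[OF \<gamma> F])
    then have "((\<lambda>s. ?F (?\<gamma> s)) has_real_derivative fd ?F ?z (0, covcomp K (fst q) \<beta>)) (at 0)"
      unfolding has_field_derivative_def
      by (rule has_derivative_eq_rhs) (auto simp: linear_scale[OF has_derivative_linear[OF F]] simp del: scaleR_Pair)
    then have "deriv (\<lambda>s. F (fst q, snd q + s *\<^sub>R \<beta>)) 0 = fd ?F ?z (0, covcomp K (fst q) \<beta>)"
      unfolding eq by (rule DERIV_imp_deriv)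
    then show ?thesis by (simp add: vertical_vec_def True T.coord_vec_apply[OF True])
  qed (simp add: vertical_vec_def coord_vec_def)
qed

lemma const_form:
  assumes K: "K \<in> M"
  shows "(\<lambda>p. covec K p \<beta>) \<in> one_forms M (fst K)"
  unfolding one_forms_def
proof (intro CollectI conjI ballI allI impI fst_opn[OF K] covec_cotangent[OF K])
  fix V X assume V: "V \<subseteq> fst K" and X: "X \<in> vfields M V"
  note o = open_img[OF K vf_opn[OF X] V]
  have "(\<lambda>q. \<beta> \<bullet> rep K X (snd K q)) \<in> smooth_funs M V"
    by (intro sf_of_chart[OF K vf_opn[OF X] V] C_infinity_inner C_infinity_const o vf_rep[OF X K vf_opn[OF X]]) (use V in auto)
  then show "(\<lambda>p. covec K p \<beta> (X p)) \<in> smooth_funs M V"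
    by (rule sf_cong) (use V in \<open>auto simp: covec_def vf_tangent[OF X] rep_def chart_inv_left[OF K]\<close>)
qed

text \<open>The components of a coordinate field are constant, so its complete lift has no vertical part in
  the induced chart.\<close>

lemma complete_lift_const:
  assumes K: "K \<in> M"
  shows "complete_lift M (fst K) (chart_field K (\<lambda>_. u)) (T.chart_field (TC K) (\<lambda>_. (u, 0)))"
  unfolding complete_lift_def
proof (intro conjI allI impI ballI)
  show "T.chart_field (TC K) (\<lambda>_. (u, 0)) \<in> vfields TM (cotangent_over M (fst K))"
    by (rule T.chart_field_const_vf[OF TC_in[OF K] opn_over[OF fst_opn[OF K]]]) (simp add: fst_TC_over)
  fix V Z q assume V: "V \<subseteq> fst K" and Z: "Z \<in> vfields M V" and q: "q \<in> cotangent_over M V"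
  obtain y w where z: "snd (TC K) q = (y, w)" by fastforce
  have qK: "q \<in> fst (TC K)" using q V by (auto simp: fst_TC_over cotangent_over_def)
  note qc = TC_coord[OF K qK, unfolded z, simplified]
  have pV: "fst q \<in> V" using q by (auto simp: cotangent_over_def)
  have yp: "y = snd K (fst q)" and wp: "w = covcomp K (fst q) (snd q)" using z by (auto simp: snd_TC)
  note E = chart_field_const_vf[OF K vf_opn[OF Z] V]
  have "bracket M (chart_field K (\<lambda>_. u)) Z (fst q) = coord_vec M K (fst q) (fd (rep K Z) y u)"
    using bracket_chart[OF K V E Z pV] fd_rep_const[OF K qc(5)] by (simp add: yp)
  then show "T.chart_field (TC K) (\<lambda>_. (u, 0)) q (vlift Z) = vlift (bracket M (chart_field K (\<lambda>_. u)) Z) q"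
    using coord_vec_vlift[OF K V Z q z, of u 0] covector_coord[OF K qc(1,2)]
    by (simp add: T.chart_field_def vlift_def split_beta wp)
qed

text \<open>The transpose of \<open>u \<mapsto> \<Gamma>(u, h)\<close> applied to \<open>w\<close>; these are the components of \<open>C(\<nabla>X)\<close> for a
  coordinate field \<open>X\<close> with components \<open>h\<close>.\<close>

definition dual_chr :: "('p, 'e) chart \<Rightarrow> 'e \<Rightarrow> 'e \<Rightarrow> 'e \<Rightarrow> 'e"
  where "dual_chr K y w h = (\<Sum>b\<in>Basis. (w \<bullet> \<Gamma> K y b h) *\<^sub>R b)"

lemma dual_chr_inner:
  assumes "K \<in> M" "y \<in> snd K ` fst K"
  shows "dual_chr K y w h \<bullet> z = w \<bullet> \<Gamma> K y z h"
proof -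
  have "w \<bullet> \<Gamma> K y z h = w \<bullet> (\<Sum>b\<in>Basis. (z \<bullet> b) *\<^sub>R \<Gamma> K y b h)"
    using linear_euclidean_sum[OF linear_\<Gamma>(1)[OF assms], of z h] by simp
  also have "\<dots> = dual_chr K y w h \<bullet> z"
    unfolding dual_chr_def inner_sum_left inner_sum_right by (rule sum.cong) (simp_all add: inner_commute[of _ z])
  finally show ?thesis ..
qed

lemma C_lift_const:
  assumes K: "K \<in> M"
  shows "C_lift M (fst K) (\<lambda>Z. nabla Z (chart_field K (\<lambda>_. u)))
    (T.chart_field (TC K) (\<lambda>z. (0, dual_chr K (fst z) (snd z) u)))"
  unfolding C_lift_def
proof (intro conjI allI impI ballI)
  let ?S = "snd K ` fst K \<times> (UNIV :: 'e set)"
  have o: "open ?S" by (simp add: open_Times open_img_fst[OF K])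
  have g: "C_infinity ?S (\<lambda>z. \<Gamma> K (fst z) b u)" for b
    by (rule C_infinity_compose[OF o open_img_fst[OF K] _ C_infinity_linear[OF bounded_linear_fst o] smooth_\<Gamma>[OF K]]) auto
  have "C_infinity (snd (TC K) ` cotangent_over M (fst K)) (\<lambda>z. (0::'e, dual_chr K (fst z) (snd z) u))"
    unfolding TC_image[OF K order_refl] dual_chr_def
    by (intro C_infinity_Pair o C_infinity_const C_infinity_sum C_infinity_scaleR C_infinity_inner g
        C_infinity_linear[OF bounded_linear_snd])
  then show "T.chart_field (TC K) (\<lambda>z. (0, dual_chr K (fst z) (snd z) u)) \<in> vfields TM (cotangent_over M (fst K))"
    by (intro T.chart_field_vf[OF TC_in[OF K] opn_over[OF fst_opn[OF K]]]) (simp_all add: fst_TC_over)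
  fix V Z q assume V: "V \<subseteq> fst K" and Z: "Z \<in> vfields M V" and q: "q \<in> cotangent_over M V"
  obtain y w where z: "snd (TC K) q = (y, w)" by fastforce
  have qK: "q \<in> fst (TC K)" using q V by (auto simp: fst_TC_over cotangent_over_def)
  note qc = TC_coord[OF K qK, unfolded z, simplified]
  have pV: "fst q \<in> V" using q by (auto simp: cotangent_over_def)
  have yp: "y = snd K (fst q)" and wp: "w = covcomp K (fst q) (snd q)" using z by (auto simp: snd_TC)
  note E = chart_field_const_vf[OF K vf_opn[OF Z] V]
  have "rep K (nabla Z (chart_field K (\<lambda>_. u))) y = \<Gamma> K y (rep K Z y) u"
    using nabla_rep[OF Z E pV K qc(1)] fd_rep_const[OF K qc(5)] by (simp add: yp)
  then have "snd q (nabla Z (chart_field K (\<lambda>_. u)) (fst q)) = w \<bullet> \<Gamma> K y (rep K Z y) u"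
    using covector_apply[OF K qc(1,2) vf_tangent[OF nabla_vf[OF Z E] pV]] qc(4) by (simp add: wp rep_def)
  moreover have "T.chart_field (TC K) (\<lambda>z. (0, dual_chr K (fst z) (snd z) u)) q (vlift Z) = dual_chr K y w u \<bullet> rep K Z y"
    using coord_vec_vlift[OF K V Z q z, of 0 "dual_chr K y w u"]
      linear_0[OF linear_fd[OF vf_rep[OF Z K vf_opn[OF Z]] open_img[OF K vf_opn[OF Z] V], of y]] V pV
    by (auto simp: T.chart_field_def z yp)
  ultimately show "T.chart_field (TC K) (\<lambda>z. (0, dual_chr K (fst z) (snd z) u)) q (vlift Z) = vlift (nabla Z (chart_field K (\<lambda>_. u))) q"
    by (simp add: vlift_def split_beta dual_chr_inner[OF K qc(5)])
qed

end

section \<open>The natural Riemann extension in adapted components\<close>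

definition gradient :: "('e::euclidean_space \<Rightarrow> real) \<Rightarrow> 'e \<Rightarrow> 'e"
  where "gradient F y = (\<Sum>b\<in>Basis. fd F y b *\<^sub>R b)"

lemma gradient_inner: "linear (fd F y) \<Longrightarrow> gradient F y \<bullet> u = fd F y u"
  unfolding gradient_def inner_sum_left
  by (subst linear_euclidean_sum[of "fd F y" u]) (simp_all add: inner_commute[of _ u] mult.commute)

locale riemann_extension = cotangent_bundle M nabla for M :: "('p, 'e::euclidean_space) atlas" and nabla :: "'p connection" +
  fixes a b :: real
    and G :: "'p cot \<Rightarrow> 'p cot tvec \<Rightarrow> 'p cot tvec \<Rightarrow> real"
    and P :: "'p cot \<Rightarrow> 'p cot tvec \<Rightarrow> 'p cot tvec"
  assumes a_pos: "a > 0"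
    and symmetric: "symmetric_connection M nabla"
    and ext: "natural_riemann_extension M nabla a b G"
    and pc: "natural_paracomplex M nabla a b P"
begin

definition \<kappa> :: real where "\<kappa> = b / (2 * a)"

abbreviation yy :: "('p, 'e) chart \<Rightarrow> 'p cot \<Rightarrow> 'e" where "yy K q \<equiv> snd K (fst q)"
abbreviation ww :: "('p, 'e) chart \<Rightarrow> 'p cot \<Rightarrow> 'e" where "ww K q \<equiv> covcomp K (fst q) (snd q)"

text \<open>Components of a tangent vector of the cotangent bundle in a frame adapted to \<open>P\<close>: the eigenbundle
  for \<open>1\<close> is given by \<open>vv = 0\<close>, the vertical eigenbundle for \<open>-1\<close> by \<open>hh = 0\<close>. Both are null, which
  determines the terms with \<open>\<Gamma>\<close> and \<open>\<kappa>\<close>.\<close>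

definition hh :: "('p, 'e) chart \<Rightarrow> 'p cot tvec \<Rightarrow> 'e"
  where "hh K u = fst (vcomp (TC K) u)"

definition vv :: "('p, 'e) chart \<Rightarrow> 'p cot \<Rightarrow> 'p cot tvec \<Rightarrow> 'e"
  where "vv K q u = snd (vcomp (TC K) u) - dual_chr K (yy K q) (ww K q) (hh K u)
    + (\<kappa> * (ww K q \<bullet> hh K u)) *\<^sub>R ww K q"

lemma yy_in: "K \<in> M \<Longrightarrow> q \<in> fst (TC K) \<Longrightarrow> yy K q \<in> snd K ` fst K"
  by (simp add: fst_TC')

lemma linear_dual_chr:
  assumes "K \<in> M" "y \<in> snd K ` fst K"
  shows "linear (dual_chr K y w)"
  by (rule linearI; simp add: dual_chr_def linear_add[OF linear_\<Gamma>(2)[OF assms]] linear_scale[OF linear_\<Gamma>(2)[OF assms]]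
      inner_add_right scaleR_left_distrib sum.distrib scaleR_sum_right)

lemma linear_hh: "linear (hh K)"
  by (rule linearI) (simp_all only: hh_def vcomp_add vcomp_scaleR fst_add fst_scaleR)

lemma linear_vv: "K \<in> M \<Longrightarrow> q \<in> fst (TC K) \<Longrightarrow> linear (vv K q)"
  using linear_dual_chr[OF _ yy_in] linear_hh[of K]
  by (intro linearI)
     (simp_all only: vv_def vcomp_add vcomp_scaleR snd_add snd_scaleR linear_add linear_scale
       inner_add_right inner_scaleR_right scaleR_left_distrib distrib_left scaleR_right_distrib
       scaleR_right_diff_distrib scaleR_scaleR,
      simp_all add: algebra_simps)

context
  fixes K q
  assumes K: "K \<in> M" and q: "q \<in> fst (TC K)"
begin

lemmas TCq = TC_in[OF K] q
lemmas yq = yy_in[OF K q]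

lemma hh_coord: "hh K (coord_vec TM (TC K) q (h, A)) = h"
  by (simp add: hh_def T.vcomp_coord_vec[OF TCq])

lemma vv_coord: "vv K q (coord_vec TM (TC K) q (h, A)) =
    A - dual_chr K (yy K q) (ww K q) h + (\<kappa> * (ww K q \<bullet> h)) *\<^sub>R ww K q"
  by (simp add: vv_def hh_coord T.vcomp_coord_vec[OF TCq])

definition of_parts :: "'e \<Rightarrow> 'e \<Rightarrow> 'p cot tvec"
  where "of_parts h v = coord_vec TM (TC K) q
    (h, v + dual_chr K (yy K q) (ww K q) h - (\<kappa> * (ww K q \<bullet> h)) *\<^sub>R ww K q)"

lemma of_parts_simps: "hh K (of_parts h v) = h" "vv K q (of_parts h v) = v" "of_parts h v \<in> tangent_space TM q"
  using TCq by (auto simp: of_parts_def hh_coord vv_coord)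

lemma tangent_coord: "u \<in> tangent_space TM q \<Longrightarrow> \<exists>h A. u = coord_vec TM (TC K) q (h, A)"
  using T.tangent_space_chart[OF TCq] by auto

lemma adapted_eqI:
  assumes "u \<in> tangent_space TM q" "v \<in> tangent_space TM q" "hh K u = hh K v" "vv K q u = vv K q v"
  shows "u = v"
proof -
  obtain h A where u: "u = coord_vec TM (TC K) q (h, A)" using tangent_coord[OF assms(1)] by blast
  obtain k B where v: "v = coord_vec TM (TC K) q (k, B)" using tangent_coord[OF assms(2)] by blast
  show ?thesis using assms(3,4) by (simp add: u v hh_coord vv_coord)
qed

lemma form_vlift_const: "form_vlift M (\<lambda>p. covec K p \<beta>) q = coord_vec TM (TC K) q (0, \<beta>)"
  using vertical_vec_chart[OF K q covec_cotangent] TC_coord(1)[OF K q]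
  by (simp add: form_vlift_def K covcomp_covec)

lemma liouville_coord: "liouville M q = coord_vec TM (TC K) q (0, ww K q)"
  unfolding liouville_def by (rule vertical_vec_chart[OF K q TC_coord(2)[OF K q]])

lemma q_over: "q \<in> cotangent_over M (fst K)"
  using q by (simp add: fst_TC_over)

lemma q_point: "q \<in> points TM"
  using TCq by (auto simp: points_def)

lemma vlift_const: "vlift (chart_field K (\<lambda>_. u)) q = ww K q \<bullet> u"
  using covector_coord[OF K TC_coord(1,2)[OF K q]] by (simp add: vlift_def split_beta chart_field_def)

lemma snd_q_nabla: "snd q (nabla (chart_field K (\<lambda>_. u)) (chart_field K (\<lambda>_. v)) (fst q)) = ww K q \<bullet> \<Gamma> K (yy K q) u v"
proof -
  note E = chart_field_const_vf[OF K fst_opn[OF K] order_refl]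
  show ?thesis
    using covector_apply[OF K TC_coord(1,2)[OF K q] vf_tangent[OF nabla_vf[OF E E] TC_coord(1)[OF K q]]]
    by (simp add: \<Gamma>_def rep_def chart_inv_left[OF K TC_coord(1)[OF K q]])
qed

lemma G_lin:
  assumes "u \<in> tangent_space TM q" "v \<in> tangent_space TM q" "w \<in> tangent_space TM q"
  shows "G q (r *\<^sub>R u + s *\<^sub>R v) w = r * G q u w + s * G q v w"
    "G q w (r *\<^sub>R u + s *\<^sub>R v) = r * G q w u + s * G q w v"
  using ext q_point assms
  by (auto simp: natural_riemann_extension_def pseudo_riemannian_metric_def tensor02_def lin_on_def)

lemma G_sym: "u \<in> tangent_space TM q \<Longrightarrow> v \<in> tangent_space TM q \<Longrightarrow> G q u v = G q v u"
  using ext q_point by (auto simp: natural_riemann_extension_def pseudo_riemannian_metric_def)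

text \<open>Lifts of coordinate fields and of constant forms span the tangent spaces, so the prescribed
  products of lifts determine the metric.\<close>

lemma G_coord: "G q (coord_vec TM (TC K) q (u, \<alpha>)) (coord_vec TM (TC K) q (v, \<beta>)) =
    - 2 * a * (ww K q \<bullet> \<Gamma> K (yy K q) u v) + b * (ww K q \<bullet> u) * (ww K q \<bullet> v) + a * (\<alpha> \<bullet> v) + a * (\<beta> \<bullet> u)"
proof -
  let ?c = "coord_vec TM (TC K) q"
  note E = chart_field_const_vf[OF K fst_opn[OF K] order_refl]
  have c: "?c x \<in> tangent_space TM q" for x using TCq by auto
  have split: "?c (u, \<alpha>) = 1 *\<^sub>R ?c (u, 0) + 1 *\<^sub>R ?c (0, \<alpha>)" for u \<alpha>
    unfolding T.coord_vec_lin[OF TCq, symmetric] by simp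
  have E': "T.chart_field (TC K) (\<lambda>_. x) q = ?c x" for x by (simp add: T.chart_field_def)
  have ext1: "\<And>U X Y XC YC. X \<in> vfields M U \<Longrightarrow> Y \<in> vfields M U \<Longrightarrow> complete_lift M U X XC \<Longrightarrow>
      complete_lift M U Y YC \<Longrightarrow> q \<in> cotangent_over M U \<Longrightarrow> G q (XC q) (YC q) =
      - a * snd q (nabla X Y (fst q) + nabla Y X (fst q)) + b * vlift X q * vlift Y q"
    and ext2: "\<And>U X XC \<alpha>. X \<in> vfields M U \<Longrightarrow> complete_lift M U X XC \<Longrightarrow> \<alpha> \<in> one_forms M U \<Longrightarrow>
      q \<in> cotangent_over M U \<Longrightarrow> G q (XC q) (form_vlift M \<alpha> q) = a * \<alpha> (fst q) (X (fst q))"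
    and ext3: "\<And>U \<alpha> \<beta>. \<alpha> \<in> one_forms M U \<Longrightarrow> \<beta> \<in> one_forms M U \<Longrightarrow>
      q \<in> cotangent_over M U \<Longrightarrow> G q (form_vlift M \<alpha> q) (form_vlift M \<beta> q) = 0"
    using ext unfolding natural_riemann_extension_def by blast+
  have hor: "G q (?c (u, 0)) (?c (v, 0)) = - 2 * a * (ww K q \<bullet> \<Gamma> K (yy K q) u v) + b * (ww K q \<bullet> u) * (ww K q \<bullet> v)" for u v
  proof -
    have "snd q (1 *\<^sub>R nabla (chart_field K (\<lambda>_. u)) (chart_field K (\<lambda>_. v)) (fst q) + 1 *\<^sub>R nabla (chart_field K (\<lambda>_. v)) (chart_field K (\<lambda>_. u)) (fst q))
        = 2 * (ww K q \<bullet> \<Gamma> K (yy K q) u v)"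
      using covector_lin[OF TC_coord(2)[OF K q]] vf_tangent[OF nabla_vf[OF E E] TC_coord(1)[OF K q]]
        snd_q_nabla[of u v] snd_q_nabla[of v u] \<Gamma>_symmetric[OF symmetric K yq, of u v]
      by (simp only: lin_on_def; simp)
    then show ?thesis
      using ext1[OF E E complete_lift_const[OF K] complete_lift_const[OF K] q_over, of u v]
      by (simp only: E' vlift_const scaleR_one; simp)
  qed
  have mix: "G q (?c (u, 0)) (?c (0, \<beta>)) = a * (\<beta> \<bullet> u)" for u \<beta>
    using ext2[OF E complete_lift_const[OF K] const_form[OF K] q_over, of u \<beta>] TC_coord(1)[OF K q]
    by (simp only: E' form_vlift_const; simp add: chart_field_def covec_coord_vec K)
  have ver: "G q (?c (0, \<alpha>)) (?c (0, \<beta>)) = 0" for \<alpha> \<beta>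
    using ext3[OF const_form[OF K] const_form[OF K] q_over] by (simp only: form_vlift_const)
  have "G q (?c (u, \<alpha>)) (?c (v, \<beta>)) = G q (?c (u, 0)) (?c (v, 0)) + G q (?c (u, 0)) (?c (0, \<beta>))
      + (G q (?c (0, \<alpha>)) (?c (v, 0)) + G q (?c (0, \<alpha>)) (?c (0, \<beta>)))"
    unfolding split[of u \<alpha>] split[of v \<beta>]
    using G_lin(1)[OF c c T.tangent_lin[OF q_point c c], where r = 1 and s = 1]
      G_lin(2)[OF c c c, where r = 1 and s = 1] by (simp only: mult_1)
  then show ?thesis using G_sym[OF c c, of "(0, \<alpha>)" "(v, 0)"] by (simp add: hor mix ver)
qed

text \<open>The Christoffel symbols and the quadratic term with \<open>b\<close> are absorbed by \<open>vv\<close>, which is why this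
  frame is chosen.\<close>

lemma G_adapted:
  assumes "u \<in> tangent_space TM q" "v \<in> tangent_space TM q"
  shows "G q u v = a * (vv K q u \<bullet> hh K v + vv K q v \<bullet> hh K u)"
proof -
  obtain h A where u: "u = coord_vec TM (TC K) q (h, A)" using tangent_coord[OF assms(1)] by blast
  obtain k B where v: "v = coord_vec TM (TC K) q (k, B)" using tangent_coord[OF assms(2)] by blast
  have "b = 2 * a * \<kappa>" using a_pos by (simp add: \<kappa>_def)
  then show ?thesis
    using \<Gamma>_symmetric[OF symmetric K yq, of h k]
    by (simp add: u v G_coord hh_coord vv_coord dual_chr_inner[OF K yq] inner_add_left inner_diff_left algebra_simps)
qed

lemma P_tangent: "u \<in> tangent_space TM q \<Longrightarrow> P q u \<in> tangent_space TM q"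
  using pc q_point unfolding natural_paracomplex_def tensor11_def by blast

lemma P_adapted:
  assumes "u \<in> tangent_space TM q"
  shows "hh K (P q u) = hh K u" "vv K q (P q u) = - vv K q u"
proof -
  let ?c = "coord_vec TM (TC K) q"
  obtain h A where u: "u = ?c (h, A)" using tangent_coord[OF assms(1)] by blast
  have c: "?c x \<in> tangent_space TM q" for x using TCq by auto
  note E = chart_field_const_vf[OF K fst_opn[OF K] order_refl]
  have P1: "\<And>U X XC CT. X \<in> vfields M U \<Longrightarrow> complete_lift M U X XC \<Longrightarrow> C_lift M U (\<lambda>Z. nabla Z X) CT \<Longrightarrow>
       q \<in> cotangent_over M U \<Longrightarrow> P q (XC q) = XC q + 2 *\<^sub>R CT q - (b / a * vlift X q) *\<^sub>R liouville M q"
    and P2: "\<And>U \<alpha>. \<alpha> \<in> one_forms M U \<Longrightarrow> q \<in> cotangent_over M U \<Longrightarrow> P q (form_vlift M \<alpha> q) = - form_vlift M \<alpha> q"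
    and P3: "lin_on (tangent_space TM q) (P q)"
    using pc q_point unfolding natural_paracomplex_def tensor11_def by blast+
  have hor: "P q (?c (h, 0)) = ?c (h, 0) + 2 *\<^sub>R ?c (0, dual_chr K (yy K q) (ww K q) h) - (2 * \<kappa> * (ww K q \<bullet> h)) *\<^sub>R ?c (0, ww K q)"
    using P1[OF E complete_lift_const[OF K] C_lift_const[OF K] q_over, of h]
    by (simp only: T.chart_field_def vlift_const liouville_coord snd_TC fst_conv snd_conv) (simp add: \<kappa>_def)
  have ver: "P q (?c (0, A)) = - ?c (0, A)"
    using P2[OF const_form[OF K] q_over] by (simp only: form_vlift_const)
  have "u = 1 *\<^sub>R ?c (h, 0) + 1 *\<^sub>R ?c (0, A)"
    unfolding T.coord_vec_lin[OF TCq, symmetric] by (simp add: u)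
  then have "P q u = 1 *\<^sub>R P q (?c (h, 0)) + 1 *\<^sub>R P q (?c (0, A))"
    using P3[unfolded lin_on_def, rule_format, OF c c] by (simp only:)
  then have Pu: "P q u = ?c (h, 0) + 2 *\<^sub>R ?c (0, dual_chr K (yy K q) (ww K q) h) - (2 * \<kappa> * (ww K q \<bullet> h)) *\<^sub>R ?c (0, ww K q) - ?c (0, A)"
    by (simp only: hor ver scaleR_one add_uminus_conv_diff)
  note lin = linear_diff[OF linear_hh] linear_add[OF linear_hh] linear_scale[OF linear_hh]
    linear_diff[OF linear_vv[OF K q]] linear_add[OF linear_vv[OF K q]] linear_scale[OF linear_vv[OF K q]]
  note g0 = linear_0[OF linear_dual_chr[OF K yq]]
  show "hh K (P q u) = hh K u" unfolding Pu lin hh_coord by (simp add: u hh_coord)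
  let ?g = "dual_chr K (yy K q) (ww K q) h" and ?w = "(\<kappa> * (ww K q \<bullet> h)) *\<^sub>R ww K q"
  have two: "(2 * \<kappa> * (ww K q \<bullet> h)) *\<^sub>R ww K q = ?w + ?w" by (simp add: scaleR_left_distrib[symmetric])
  show "vv K q (P q u) = - vv K q u"
    unfolding Pu lin vv_coord g0 by (simp add: u vv_coord two scaleR_2)
qed

text \<open>Constant fields \<open>Z\<close> detect the vertical components of the lift, fields \<open>(y \<bullet> c) w\<close> then detect the
  horizontal ones. All functions \<open>Z\<^sup>V\<close> are zero on the zero section, so their derivatives carry no
  horizontal information there.\<close>

lemma complete_lift_coord:
  assumes xiC: "complete_lift M (points M) xi xiC" and xi: "xi \<in> vfields M (points M)"
    and par: "parallel_field M nabla xi" and w: "ww K q \<noteq> 0"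
  shows "xiC q = coord_vec TM (TC K) q (rep K xi (yy K q), dual_chr K (yy K q) (ww K q) (rep K xi (yy K q)))"
proof -
  let ?y = "yy K q" and ?w = "ww K q" and ?c = "coord_vec TM (TC K) q"
  have z: "snd (TC K) q = (?y, ?w)" by (rule snd_TC)
  have sub: "fst K \<subseteq> points M" using K by (auto simp: points_def)
  have qM: "q \<in> cotangent_over M (points M)" using q_over sub by (auto simp: cotangent_over_def)
  have "xiC q \<in> tangent_space TM q"
    using xiC qM T.vf_tangent unfolding complete_lift_def by blast
  then obtain h A where hA: "xiC q = ?c (h, A)" using tangent_coord by blast
  have xiK: "xi \<in> vfields M (fst K)" by (rule vf_restrict[OF xi fst_opn[OF K] sub])
  note o = open_img_fst[OF K] and pK = TC_coord(1)[OF K q]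
  have key: "A \<bullet> V ?y + ?w \<bullet> fd V ?y h = ?w \<bullet> (fd V ?y (rep K xi ?y) - fd (rep K xi) ?y (V ?y))"
    if V: "C_infinity (snd K ` fst K) V" for V
  proof -
    have Z: "chart_field K V \<in> vfields M (fst K)" by (rule chart_field_vf[OF K fst_opn[OF K] order_refl V])
    have rV: "rep K (chart_field K V) ?y = V ?y" "fd (rep K (chart_field K V)) ?y = fd V ?y"
      using rep_chart_field[OF K] yq by (auto intro!: fd_cong[OF o yq])
    have "xiC q (vlift (chart_field K V)) = vlift (bracket M xi (chart_field K V)) q"
      using xiC Z sub q_over unfolding complete_lift_def by blast
    moreover have "xiC q (vlift (chart_field K V)) = A \<bullet> V ?y + ?w \<bullet> fd V ?y h"
      unfolding hA coord_vec_vlift[OF K order_refl Z q_over z] rV by simp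
    moreover have "vlift (bracket M xi (chart_field K V)) q = ?w \<bullet> (fd V ?y (rep K xi ?y) - fd (rep K xi) ?y (V ?y))"
      unfolding vlift_def split_beta bracket_chart[OF K order_refl xiK Z pK] rV
      by (rule covector_coord[OF K pK TC_coord(2)[OF K q]])
    ultimately show ?thesis by simp
  qed
  have A: "A \<bullet> v = dual_chr K ?y ?w (rep K xi ?y) \<bullet> v" for v
    using key[of "\<lambda>_. v"] \<Gamma>_parallel[OF par xi K yq, of v]
    by (simp add: C_infinity_const[OF o] dual_chr_inner[OF K yq] add_eq_0_iff)
  have h: "h = rep K xi ?y"
  proof (rule euclidean_eqI)
    fix c :: 'e
    \<comment> \<open>The factor \<open>y \<bullet> c\<close> has derivative \<open>h \<bullet> c\<close> in the direction of the horizontal part of the lift.\<close>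
    let ?V = "\<lambda>y. (y \<bullet> c) *\<^sub>R ?w"
    have V: "C_infinity (snd K ` fst K) ?V"
      by (intro C_infinity_scaleR C_infinity_inner C_infinity_ident C_infinity_const o)
    have dV: "fd ?V ?y = (\<lambda>u. (u \<bullet> c) *\<^sub>R ?w)"
      by (rule fd_eq) (auto intro!: derivative_eq_intros)
    have "fd (rep K xi) ?y (?V ?y) = (?y \<bullet> c) *\<^sub>R fd (rep K xi) ?y ?w"
      by (rule linear_scale[OF linear_fd[OF vf_rep[OF xiK K fst_opn[OF K]] o yq]]) simp
    then have "?w \<bullet> ((h \<bullet> c) *\<^sub>R ?w) = ?w \<bullet> ((rep K xi ?y \<bullet> c) *\<^sub>R ?w)"
      using key[OF V] key[of "\<lambda>_. ?w"] C_infinity_const[OF o, of ?w]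
      by (simp add: dV inner_diff_right)
    then show "h \<bullet> c = rep K xi ?y \<bullet> c" using w by simp
  qed
  have "A = dual_chr K ?y ?w (rep K xi ?y)" using A by (metis inner_commute vector_eq_rdot)
  then show ?thesis by (simp add: hA h)
qed

lemma differential_coord:
  assumes f: "f \<in> smooth_funs M (points M)"
  shows "differential M f (fst q) \<in> cotangent_space M (fst q)"
    "covcomp K (fst q) (differential M f (fst q)) = gradient (\<lambda>y. f (chart_inv K y)) (yy K q)"
proof -
  have p: "fst q \<in> fst K" "fst q \<in> points M" using TC_coord(1)[OF K q] K by (auto simp: points_def)
  show "differential M f (fst q) \<in> cotangent_space M (fst q)"
    using tangent_lin[OF p(2)] by (auto simp: cotangent_space_def differential_def lin_on_def scaleR_fun_def)
  show "covcomp K (fst q) (differential M f (fst q)) = gradient (\<lambda>y. f (chart_inv K y)) (yy K q)"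
    by (simp add: covcomp_def gradient_def differential_def coord_vec_tangent[OF K p(1)]
        coord_vec_apply[OF smooth_nearI[OF f p(2)]])
qed

lemma vlift_xi:
  assumes xi: "xi \<in> vfields M (points M)"
  shows "vlift xi q = ww K q \<bullet> rep K xi (yy K q)"
proof -
  have p: "fst q \<in> fst K" "fst q \<in> points M" using TC_coord(1)[OF K q] K by (auto simp: points_def)
  show ?thesis
    using covector_apply[OF K p(1) TC_coord(2)[OF K q] vf_tangent[OF xi p(2)]]
    by (simp add: vlift_def split_beta rep_def chart_inv_left[OF K p(1)])
qed

lemma normal_adapted:
  assumes xiC: "complete_lift M (points M) xi xiC" and xi: "xi \<in> vfields M (points M)"
    and par: "parallel_field M nabla xi" and f: "f \<in> smooth_funs M (points M)"
    and s: "s = ww K q \<bullet> rep K xi (yy K q)" "s \<noteq> 0"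
  defines "N \<equiv> hypersurface_normal M a b xi xiC f q"
  shows "N \<in> tangent_space TM q" "hh K N = (1 / (sqrt b * s)) *\<^sub>R rep K xi (yy K q)"
    "vv K q N = (1 / (sqrt b * s)) *\<^sub>R (gradient (\<lambda>y. f (chart_inv K y)) (yy K q) - (\<kappa> * s) *\<^sub>R ww K q)"
proof -
  let ?c = "coord_vec TM (TC K) q" and ?y = "yy K q" and ?w = "ww K q"
  let ?df = "gradient (\<lambda>y. f (chart_inv K y)) ?y"
  have w0: "?w \<noteq> 0" using s by auto
  have form: "form_vlift M (differential M f) q = ?c (0, ?df)"
    unfolding form_vlift_def vertical_vec_chart[OF K q differential_coord(1)[OF f]] differential_coord(2)[OF f] ..
  have N: "N = (1 / (sqrt b * s)) *\<^sub>R (?c (rep K xi ?y, dual_chr K ?y ?w (rep K xi ?y)) - (2 * \<kappa> * s) *\<^sub>R ?c (0, ?w) + ?c (0, ?df))"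
    unfolding N_def hypersurface_normal_def vlift_xi[OF xi] s(1)[symmetric] liouville_coord form
      complete_lift_coord[OF xiC xi par w0] by (simp add: \<kappa>_def)
  have c: "?c x \<in> tangent_space TM q" for x using TCq by auto
  show "N \<in> tangent_space TM q"
    unfolding N using T.subspace_tangent_space[OF q_point] c by (intro subspace_scale subspace_add subspace_diff)
  note lin = linear_diff[OF linear_hh] linear_add[OF linear_hh] linear_scale[OF linear_hh]
    linear_diff[OF linear_vv[OF K q]] linear_add[OF linear_vv[OF K q]] linear_scale[OF linear_vv[OF K q]]
  note g0 = linear_0[OF linear_dual_chr[OF K yq]]
  show "hh K N = (1 / (sqrt b * s)) *\<^sub>R rep K xi ?y" unfolding N lin hh_coord by simp
  show "vv K q N = (1 / (sqrt b * s)) *\<^sub>R (?df - (\<kappa> * s) *\<^sub>R ?w)"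
  proof -
    have two: "(2 * \<kappa> * s) *\<^sub>R ?w = (\<kappa> * s) *\<^sub>R ?w + (\<kappa> * s) *\<^sub>R ?w" by (simp add: scaleR_left_distrib[symmetric])
    show ?thesis unfolding N lin vv_coord g0 s(1)[symmetric] by (simp add: two)
  qed
qed

end

end

section \<open>Calculus along a parametrised hypersurface of the cotangent bundle\<close>

text \<open>A piece of the base manifold in a chart: Christoffel symbols, a parallel vector field \<open>\<xi>\<close> and a
  first integral \<open>F\<close> of it.\<close>

locale base_calculus =
  fixes B :: "'e::euclidean_space set" and \<Gamma> :: "'e \<Rightarrow> 'e \<Rightarrow> 'e \<Rightarrow> 'e" and \<xi> :: "'e \<Rightarrow> 'e" and F :: "'e \<Rightarrow> real"
  assumes open_B: "open B"
    and smooth_\<Gamma>: "C_infinity B (\<lambda>y. \<Gamma> y u v)"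
    and linear_\<Gamma>1: "y \<in> B \<Longrightarrow> linear (\<lambda>u. \<Gamma> y u v)"
    and linear_\<Gamma>2: "y \<in> B \<Longrightarrow> linear (\<Gamma> y u)"
    and sym_\<Gamma>: "y \<in> B \<Longrightarrow> \<Gamma> y u v = \<Gamma> y v u"
    and smooth_\<xi>: "C_infinity B \<xi>"
    and smooth_F: "C_infinity B F"
    and par: "y \<in> B \<Longrightarrow> fd \<xi> y u + \<Gamma> y u (\<xi> y) = 0"
    and F_\<xi>: "y \<in> B \<Longrightarrow> fd F y (\<xi> y) = 0"
begin

definition R :: "'e \<Rightarrow> 'e \<Rightarrow> 'e \<Rightarrow> 'e \<Rightarrow> 'e"
  where "R y u v z = fd (\<lambda>y. \<Gamma> y v z) y u - fd (\<lambda>y. \<Gamma> y u z) y v + \<Gamma> y u (\<Gamma> y v z) - \<Gamma> y v (\<Gamma> y u z)"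

definition Hess :: "'e \<Rightarrow> 'e \<Rightarrow> 'e \<Rightarrow> real"
  where "Hess y u z = fd (\<lambda>y. fd F y z) y u - fd F y (\<Gamma> y u z)"

lemma fd_\<Gamma>_sym: "y \<in> B \<Longrightarrow> fd (\<lambda>y. \<Gamma> y u v) y h = fd (\<lambda>y. \<Gamma> y v u) y h"
  by (rule fun_cong[OF fd_cong[OF open_B]]) (auto intro: sym_\<Gamma>)

lemma R_skew: "R y u v z = - R y v u z"
  by (simp add: R_def)

lemma R_bianchi: "y \<in> B \<Longrightarrow> R y u v z + R y v z u + R y z u v = 0"
  unfolding R_def
  using fd_\<Gamma>_sym[of y u v] fd_\<Gamma>_sym[of y v z] fd_\<Gamma>_sym[of y u z] sym_\<Gamma>[of y u v] sym_\<Gamma>[of y v z] sym_\<Gamma>[of y u z]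
  by simp

lemma linear_fd_param:
  assumes "\<And>y. y \<in> B \<Longrightarrow> linear (L y)" "\<And>u. C_infinity B (\<lambda>y. L y u)" "y \<in> B"
  shows "linear (\<lambda>u. fd (\<lambda>y. L y u) y h)"
proof (rule linearI)
  note d = C_infinity_has_derivative[OF assms(2) open_B assms(3)]
  show "fd (\<lambda>y. L y (u + v)) y h = fd (\<lambda>y. L y u) y h + fd (\<lambda>y. L y v) y h" for u v
    using fd_cong[OF open_B assms(3), of "\<lambda>y. L y (u + v)" "\<lambda>y. L y u + L y v"]
      fd_eq[OF has_derivative_add[OF d d], of u v] by (simp add: linear_add[OF assms(1)])
  show "fd (\<lambda>y. L y (r *\<^sub>R u)) y h = r *\<^sub>R fd (\<lambda>y. L y u) y h" for r u
    using fd_cong[OF open_B assms(3), of "\<lambda>y. L y (r *\<^sub>R u)" "\<lambda>y. r *\<^sub>R L y u"]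
      fd_eq[OF has_derivative_scaleR_right[OF d], of r u] by (simp add: linear_scale[OF assms(1)])
qed

lemma linear_fd_base: "C_infinity B f \<Longrightarrow> y \<in> B \<Longrightarrow> linear (fd f y)"
  by (rule linear_fd[OF _ open_B])

lemma R_linear:
  assumes y: "y \<in> B"
  shows "linear (\<lambda>u. R y u v z)" "linear (\<lambda>v. R y u v z)" "linear (R y u v)"
proof -
  note l = linear_add linear_scale
  note l1 = l[OF linear_\<Gamma>1[OF y]] and l2 = l[OF linear_\<Gamma>2[OF y]] and l3 = l[OF linear_fd_base[OF smooth_\<Gamma> y]]
    and l4 = l[OF linear_fd_param[OF linear_\<Gamma>1 smooth_\<Gamma> y]] and l5 = l[OF linear_fd_param[OF linear_\<Gamma>2 smooth_\<Gamma> y]]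
  show "linear (\<lambda>u. R y u v z)" "linear (\<lambda>v. R y u v z)" "linear (R y u v)"
    by (auto intro!: linearI simp: R_def l1 l2 l3 l4 l5 algebra_simps)
qed

text \<open>Differentiate \<open>\<nabla>\<xi> = 0\<close> and use the symmetry of second derivatives.\<close>

lemma R_\<xi>:
  assumes y: "y \<in> B"
  shows "R y u v (\<xi> y) = 0"
proof -
  have d2: "fd (\<lambda>y. fd \<xi> y v) y u = - fd (\<lambda>z. \<Gamma> z v (\<xi> y)) y u + \<Gamma> y v (\<Gamma> y u (\<xi> y))" for u v
  proof -
    have "fd (\<lambda>y. fd \<xi> y v) y u = fd (\<lambda>y. - \<Gamma> y v (\<xi> y)) y u"
      by (rule fun_cong[OF fd_cong[OF open_B y]]) (use par in \<open>auto simp: eq_neg_iff_add_eq_0\<close>)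
    also have "\<dots> = - fd (\<lambda>y. \<Gamma> y v (\<xi> y)) y u"
    proof -
      have "C_infinity B (\<lambda>y. \<Gamma> y v (\<xi> y))"
        by (rule C_infinity_linear_family[OF open_B smooth_\<xi> smooth_\<Gamma> linear_\<Gamma>2])
      then show ?thesis
        using fd_eq[OF has_derivative_minus[OF C_infinity_has_derivative[OF _ open_B y]], of "\<lambda>y. \<Gamma> y v (\<xi> y)"] by simp
    qed
    also have "\<dots> = - (fd (\<lambda>z. \<Gamma> z v (\<xi> y)) y u + \<Gamma> y v (fd \<xi> y u))"
      by (simp add: fd_linear_family[OF open_B smooth_\<xi> smooth_\<Gamma> linear_\<Gamma>2 y])
    also have "fd \<xi> y u = - \<Gamma> y u (\<xi> y)" using par[OF y, of u] by (simp add: eq_neg_iff_add_eq_0)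
    finally show ?thesis by (simp add: linear_neg[OF linear_\<Gamma>2[OF y]])
  qed
  show ?thesis using mixed_derivatives_commute[OF open_B smooth_\<xi> y, of u v]
    unfolding R_def d2 by (simp add: algebra_simps)
qed

lemma Hess_sym: "y \<in> B \<Longrightarrow> Hess y u z = Hess y z u"
  unfolding Hess_def using mixed_derivatives_commute_real[OF open_B smooth_F, of y u z] sym_\<Gamma>[of y u z] by simp

lemma Hess_linear: "y \<in> B \<Longrightarrow> linear (Hess y u)" "y \<in> B \<Longrightarrow> linear (\<lambda>u. Hess y u z)"
proof -
  assume y: "y \<in> B"
  note l = linear_add linear_scale
  note l1 = l[OF linear_\<Gamma>1[OF y]] l[OF linear_\<Gamma>2[OF y]] l[OF linear_fd_base[OF smooth_F y]]
    l[OF linear_fd_base[OF C_infinity_fd[OF open_B smooth_F] y]]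
    l[OF linear_fd_param[OF linear_fd_base[OF smooth_F] C_infinity_fd[OF open_B smooth_F] y]]
  show "linear (Hess y u)" "linear (\<lambda>u. Hess y u z)"
    by (auto intro!: linearI simp: Hess_def l1 algebra_simps)
qed

text \<open>Differentiate \<open>\<xi> F = 0\<close> and use \<open>\<nabla>\<xi> = 0\<close>.\<close>

lemma Hess_\<xi>:
  assumes y: "y \<in> B"
  shows "Hess y u (\<xi> y) = 0"
proof -
  have "fd (\<lambda>y. fd F y (\<xi> y)) y u = 0"
    using fd_cong[OF open_B y, of "\<lambda>y. fd F y (\<xi> y)" "\<lambda>_. 0"] F_\<xi> by simp
  then have "fd (\<lambda>z. fd F z (\<xi> y)) y u + fd F y (fd \<xi> y u) = 0"
    by (simp add: fd_linear_family[OF open_B smooth_\<xi> C_infinity_fd[OF open_B smooth_F] linear_fd_base[OF smooth_F] y])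
  moreover have "fd \<xi> y u = - \<Gamma> y u (\<xi> y)" using par[OF y, of u] by (simp add: eq_neg_iff_add_eq_0)
  ultimately show ?thesis by (simp add: Hess_def linear_neg[OF linear_fd_base[OF smooth_F y]])
qed

end

text \<open>A piece \<open>y \<mapsto> (x(y), w(y))\<close> of the hypersurface in induced coordinates. A tangent vector field is a
  function from \<open>\<Omega>\<close> to the parameter space.\<close>

locale surface_calculus = base_calculus B \<Gamma> \<xi> F
  for B :: "'e::euclidean_space set" and \<Gamma> \<xi> F +
  fixes \<Omega> :: "'h::euclidean_space set" and x w :: "'h \<Rightarrow> 'e" and a b t :: real
  assumes open_\<Omega>: "open \<Omega>"
    and smooth_x: "C_infinity \<Omega> x" and smooth_w: "C_infinity \<Omega> w"
    and x_in: "y \<in> \<Omega> \<Longrightarrow> x y \<in> B"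
    and level: "y \<in> \<Omega> \<Longrightarrow> w y \<bullet> \<xi> (x y) + F (x y) = t"
    and s_nonzero: "y \<in> \<Omega> \<Longrightarrow> w y \<bullet> \<xi> (x y) \<noteq> 0"
    and a_pos: "a > 0" and b_pos: "b > 0"
begin

definition \<kappa> :: real where "\<kappa> = b / (2 * a)"

definition s :: "'h \<Rightarrow> real" where "s y = w y \<bullet> \<xi> (x y)"

definition dual_\<Gamma> :: "'e \<Rightarrow> 'e \<Rightarrow> 'e \<Rightarrow> 'e"
  where "dual_\<Gamma> y v h = (\<Sum>c\<in>Basis. (v \<bullet> \<Gamma> y c h) *\<^sub>R c)"

lemma dual_\<Gamma>_inner:
  assumes "y \<in> B"
  shows "dual_\<Gamma> y v h \<bullet> z = v \<bullet> \<Gamma> y z h"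
proof -
  have "v \<bullet> \<Gamma> y z h = v \<bullet> (\<Sum>c\<in>Basis. (z \<bullet> c) *\<^sub>R \<Gamma> y c h)"
    using linear_euclidean_sum[OF linear_\<Gamma>1[OF assms], of z h] by simp
  also have "\<dots> = dual_\<Gamma> y v h \<bullet> z"
    unfolding dual_\<Gamma>_def inner_sum_left inner_sum_right by (rule sum.cong) (simp_all add: inner_commute[of _ z])
  finally show ?thesis ..
qed

text \<open>Horizontal and vertical component of the tangent vector \<open>X(y)\<close> of the parametrisation.\<close>

definition hor :: "('h \<Rightarrow> 'h) \<Rightarrow> 'h \<Rightarrow> 'e"
  where "hor X y = fd x y (X y)"

definition ver :: "('h \<Rightarrow> 'h) \<Rightarrow> 'h \<Rightarrow> 'e"
  where "ver X y = fd w y (X y) - dual_\<Gamma> (x y) (w y) (hor X y) + (\<kappa> * (w y \<bullet> hor X y)) *\<^sub>R w y"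

text \<open>The ambient metric in adapted components.\<close>

definition met :: "'e \<Rightarrow> 'e \<Rightarrow> 'e \<Rightarrow> 'e \<Rightarrow> real"
  where "met h v k l = a * (v \<bullet> k + l \<bullet> h)"

text \<open>The 1-form \<open>\<eta>\<close>, from which \<open>tangency\<close> has eliminated the vertical component of \<open>X\<close>.\<close>

definition eta :: "('h \<Rightarrow> 'h) \<Rightarrow> 'h \<Rightarrow> real"
  where "eta X y = sqrt b * (w y \<bullet> hor X y) - 2 * a / (sqrt b * s y) * fd F (x y) (hor X y)"

text \<open>Adapted components \<open>(nh, nv)\<close> of the unit normal.\<close>

definition nh :: "'h \<Rightarrow> 'e" where "nh y = (1 / (sqrt b * s y)) *\<^sub>R \<xi> (x y)"

definition nv :: "'h \<Rightarrow> 'e"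
  where "nv y = (1 / (sqrt b * s y)) *\<^sub>R (gradient F (x y) - (\<kappa> * s y) *\<^sub>R w y)"

definition lie :: "('h \<Rightarrow> 'h) \<Rightarrow> ('h \<Rightarrow> 'h) \<Rightarrow> 'h \<Rightarrow> 'h"
  where "lie X Y y = fd Y y (X y) - fd X y (Y y)"

lemma smooth_base: "C_infinity B f \<Longrightarrow> C_infinity \<Omega> (\<lambda>y. f (x y))"
  by (rule C_infinity_compose[OF open_\<Omega> open_B _ smooth_x]) (auto simp: x_in)

lemma smooth_s: "C_infinity \<Omega> s"
  unfolding s_def[abs_def] by (intro C_infinity_inner open_\<Omega> smooth_w smooth_base smooth_\<xi>)

lemma smooth_gradient: "C_infinity B (gradient F)"
  unfolding gradient_def[abs_def]
  by (intro C_infinity_sum C_infinity_scaleR C_infinity_const C_infinity_fd open_B smooth_F)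

lemma gradient_F: "y \<in> B \<Longrightarrow> gradient F y \<bullet> u = fd F y u"
  by (rule gradient_inner[OF linear_fd_base[OF smooth_F]])

lemma smooth_dual_\<Gamma>:
  assumes "C_infinity \<Omega> h"
  shows "C_infinity \<Omega> (\<lambda>y. dual_\<Gamma> (x y) (w y) (h y))"
  unfolding dual_\<Gamma>_def
  by (intro C_infinity_sum C_infinity_scaleR C_infinity_inner C_infinity_const open_\<Omega> smooth_w
      C_infinity_linear_family[OF open_\<Omega> assms smooth_base[OF smooth_\<Gamma>] linear_\<Gamma>2[OF x_in]])

lemma smooth_hor: "C_infinity \<Omega> X \<Longrightarrow> C_infinity \<Omega> (hor X)"
  unfolding hor_def[abs_def] by (rule C_infinity_fd_along[OF open_\<Omega> smooth_x])

lemma smooth_ver: "C_infinity \<Omega> X \<Longrightarrow> C_infinity \<Omega> (ver X)"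
  unfolding ver_def[abs_def]
  by (intro C_infinity_add C_infinity_diff C_infinity_scaleR C_infinity_mult C_infinity_inner C_infinity_const
      C_infinity_fd_along smooth_dual_\<Gamma> smooth_hor open_\<Omega> smooth_w)

lemma smooth_dF: "C_infinity \<Omega> h \<Longrightarrow> C_infinity \<Omega> (\<lambda>y. fd F (x y) (h y))"
  by (rule C_infinity_linear_family[OF open_\<Omega> _ smooth_base[OF C_infinity_fd[OF open_B smooth_F]] linear_fd_base[OF smooth_F x_in]])

lemma smooth_c: "C_infinity \<Omega> (\<lambda>y. r / (sqrt b * s y))"
  by (intro C_infinity_divide C_infinity_mult C_infinity_const smooth_s open_\<Omega>)
     (use b_pos s_nonzero in \<open>simp add: s_def\<close>)

lemma smooth_eta: "C_infinity \<Omega> X \<Longrightarrow> C_infinity \<Omega> (eta X)"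
  unfolding eta_def[abs_def]
  by (intro C_infinity_diff C_infinity_mult C_infinity_inner C_infinity_const smooth_c smooth_dF smooth_hor
      open_\<Omega> smooth_w)

lemma smooth_nh: "C_infinity \<Omega> nh"
  unfolding nh_def[abs_def] by (intro C_infinity_scaleR smooth_c smooth_base smooth_\<xi> open_\<Omega>)

lemma smooth_nv: "C_infinity \<Omega> nv"
  unfolding nv_def[abs_def]
  by (intro C_infinity_scaleR C_infinity_diff C_infinity_mult C_infinity_const smooth_c smooth_base
      smooth_gradient open_\<Omega> smooth_s smooth_w)

lemma nv_inner: "y \<in> \<Omega> \<Longrightarrow> nv y \<bullet> k = (fd F (x y) k - \<kappa> * s y * (w y \<bullet> k)) / (sqrt b * s y)"
  by (simp add: nv_def inner_diff_left gradient_F[OF x_in])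

lemma fd_base: "C_infinity B f \<Longrightarrow> y \<in> \<Omega> \<Longrightarrow> fd (\<lambda>y. f (x y)) y v = fd f (x y) (fd x y v)"
  by (rule fun_cong[OF fd_eq[OF has_derivative_compose[OF C_infinity_has_derivative[OF smooth_x open_\<Omega>]
      C_infinity_has_derivative[OF _ open_B x_in]]]])

text \<open>The derivative of the equation \<open>s + F = t\<close> of the hypersurface.\<close>

lemma fd_s: "y \<in> \<Omega> \<Longrightarrow> fd s y v = - fd F (x y) (fd x y v)"
proof -
  assume y: "y \<in> \<Omega>"
  have "fd s y v = fd (\<lambda>y. t - F (x y)) y v"
    by (rule fun_cong[OF fd_cong[OF open_\<Omega> y]]) (use level in \<open>auto simp: s_def eq_diff_eq\<close>)
  also have "\<dots> = - fd (\<lambda>y. F (x y)) y v"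
    using fd_eq[OF has_derivative_diff[OF has_derivative_const C_infinity_has_derivative[OF smooth_base[OF smooth_F] open_\<Omega> y]]]
    by simp
  finally show ?thesis by (simp add: fd_base[OF smooth_F y])
qed

lemma tangency:
  assumes y: "y \<in> \<Omega>"
  shows "ver X y \<bullet> \<xi> (x y) = \<kappa> * s y * (w y \<bullet> hor X y) - fd F (x y) (hor X y)"
proof -
  note xB = x_in[OF y]
  have "fd s y (X y) = w y \<bullet> fd (\<lambda>y. \<xi> (x y)) y (X y) + fd w y (X y) \<bullet> \<xi> (x y)"
    unfolding s_def[abs_def]
    using fd_eq[OF has_derivative_inner[OF C_infinity_has_derivative[OF smooth_w open_\<Omega> y]
          C_infinity_has_derivative[OF smooth_base[OF smooth_\<xi>] open_\<Omega> y]]] by simp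
  moreover have "fd (\<lambda>y. \<xi> (x y)) y (X y) = - \<Gamma> (x y) (hor X y) (\<xi> (x y))"
    using par[OF xB, of "hor X y"] by (simp add: fd_base[OF smooth_\<xi> y] hor_def eq_neg_iff_add_eq_0)
  ultimately have "fd w y (X y) \<bullet> \<xi> (x y) = w y \<bullet> \<Gamma> (x y) (hor X y) (\<xi> (x y)) - fd F (x y) (hor X y)"
    by (simp add: fd_s[OF y] hor_def)
  then show ?thesis
    using sym_\<Gamma>[OF xB, of "hor X y" "\<xi> (x y)"]
    by (simp add: ver_def inner_add_left inner_diff_left dual_\<Gamma>_inner[OF xB] s_def)
qed

lemma met_normal:
  assumes y: "y \<in> \<Omega>"
  shows "met (nh y) (nv y) (hor X y) (ver X y) = 0"
  by (simp add: met_def nv_inner[OF y] nh_def tangency[OF y] flip: add_divide_distrib)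

text \<open>The Levi-Civita connection of the ambient metric, pulled back along the parametrisation:
  \<open>cderiv X p r k l\<close> is the product with \<open>(k, l)\<close> of the derivative in the direction \<open>X\<close> of the field
  with components \<open>(p, r)\<close>.\<close>

definition S :: "'h \<Rightarrow> 'e \<Rightarrow> 'e \<Rightarrow> 'e"
  where "S y u z = \<Gamma> (x y) u z - \<kappa> *\<^sub>R ((w y \<bullet> z) *\<^sub>R u + (w y \<bullet> u) *\<^sub>R z)"

definition cderiv :: "('h \<Rightarrow> 'h) \<Rightarrow> ('h \<Rightarrow> 'e) \<Rightarrow> ('h \<Rightarrow> 'e) \<Rightarrow> 'e \<Rightarrow> 'e \<Rightarrow> 'h \<Rightarrow> real"
  where "cderiv X p r k l y = a * (fd r y (X y) \<bullet> k - r y \<bullet> S y (hor X y) k - w y \<bullet> R (x y) (p y) k (hor X y)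
    + l \<bullet> (fd p y (X y) + S y (hor X y) (p y)))"

text \<open>The curvature terms of the two summands cancel, since \<open>R\<close> is skew in its first arguments.\<close>

lemma cderiv_metric:
  assumes y: "y \<in> \<Omega>" and sm: "C_infinity \<Omega> p" "C_infinity \<Omega> r" "C_infinity \<Omega> p'" "C_infinity \<Omega> r'"
  shows "fd (\<lambda>y. met (p y) (r y) (p' y) (r' y)) y (X y) = cderiv X p r (p' y) (r' y) y + cderiv X p' r' (p y) (r y) y"
proof -
  note d = sm[THEN C_infinity_has_derivative[OF _ open_\<Omega> y]]
  have "fd (\<lambda>y. met (p y) (r y) (p' y) (r' y)) y (X y) =
      a * (r y \<bullet> fd p' y (X y) + fd r y (X y) \<bullet> p' y + (r' y \<bullet> fd p y (X y) + fd r' y (X y) \<bullet> p y))"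
    unfolding met_def
    using fd_eq[OF has_derivative_mult_right[OF has_derivative_add[OF has_derivative_inner[OF d(2,3)] has_derivative_inner[OF d(4,1)]]]]
    by simp
  then show ?thesis
    using R_skew[of "x y" "p y" "p' y"] by (simp add: cderiv_def inner_add_right algebra_simps)
qed

lemma fd_hor:
  assumes y: "y \<in> \<Omega>" and Y: "C_infinity \<Omega> Y"
  shows "fd (hor Y) y v = fd (\<lambda>z. fd x z (Y y)) y v + fd x y (fd Y y v)"
  unfolding hor_def[abs_def]
  by (rule fd_linear_family[OF open_\<Omega> Y C_infinity_fd[OF open_\<Omega> smooth_x] linear_fd[OF smooth_x open_\<Omega>] y])

lemma hor_lie:
  assumes y: "y \<in> \<Omega>" and X: "C_infinity \<Omega> X" and Y: "C_infinity \<Omega> Y"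
  shows "hor (lie X Y) y = fd (hor Y) y (X y) - fd (hor X) y (Y y)"
  using mixed_derivatives_commute[OF open_\<Omega> smooth_x y, of "X y" "Y y"]
  by (simp add: fd_hor[OF y X] fd_hor[OF y Y] hor_def lie_def linear_diff[OF linear_fd[OF smooth_x open_\<Omega> y]])

lemma fd_ver:
  assumes y: "y \<in> \<Omega>" and Y: "C_infinity \<Omega> Y"
  shows "fd (ver Y) y v \<bullet> k = (fd (\<lambda>z. fd w z (Y y)) y v + fd w y (fd Y y v)) \<bullet> k
    - fd w y v \<bullet> \<Gamma> (x y) k (hor Y y) - w y \<bullet> fd (\<lambda>z. \<Gamma> z k (hor Y y)) (x y) (fd x y v)
    - w y \<bullet> \<Gamma> (x y) k (fd (hor Y) y v)
    + \<kappa> * ((fd w y v \<bullet> hor Y y + w y \<bullet> fd (hor Y) y v) * (w y \<bullet> k) + (w y \<bullet> hor Y y) * (fd w y v \<bullet> k))"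
proof -
  note D = C_infinity_has_derivative[OF _ open_\<Omega> y]
  note h = smooth_hor[OF Y]
  have sG: "C_infinity \<Omega> (\<lambda>y. \<Gamma> (x y) k (hor Y y))"
    by (rule C_infinity_linear_family[OF open_\<Omega> h smooth_base[OF smooth_\<Gamma>] linear_\<Gamma>2[OF x_in]])
  have dG: "fd (\<lambda>y. \<Gamma> (x y) k (hor Y y)) y v =
      fd (\<lambda>z. \<Gamma> z k (hor Y y)) (x y) (fd x y v) + \<Gamma> (x y) k (fd (hor Y) y v)"
    using fd_linear_family[OF open_\<Omega> h smooth_base[OF smooth_\<Gamma>] linear_\<Gamma>2[OF x_in] y, of k v]
      fd_base[OF smooth_\<Gamma> y, of k "hor Y y" v] by simp
  have sw: "C_infinity \<Omega> (\<lambda>y. fd w y (Y y))" by (rule C_infinity_fd_along[OF open_\<Omega> smooth_w Y])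
  have dw: "fd (\<lambda>y. fd w y (Y y)) y v = fd (\<lambda>z. fd w z (Y y)) y v + fd w y (fd Y y v)"
    by (rule fd_linear_family[OF open_\<Omega> Y C_infinity_fd[OF open_\<Omega> smooth_w] linear_fd[OF smooth_w open_\<Omega>] y])
  have "fd (ver Y) y v \<bullet> k = fd (\<lambda>y. ver Y y \<bullet> k) y v"
    by (rule fd_inner_left[OF smooth_ver[OF Y] open_\<Omega> y, symmetric])
  also have "\<dots> = fd (\<lambda>y. fd w y (Y y) \<bullet> k - w y \<bullet> \<Gamma> (x y) k (hor Y y) + \<kappa> * ((w y \<bullet> hor Y y) * (w y \<bullet> k))) y v"
    by (rule fun_cong[OF fd_cong[OF open_\<Omega> y]])
       (simp add: ver_def inner_add_left inner_diff_left dual_\<Gamma>_inner[OF x_in] mult.assoc)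
  also have "\<dots> = fd (\<lambda>y. fd w y (Y y)) y v \<bullet> k
      - (w y \<bullet> fd (\<lambda>y. \<Gamma> (x y) k (hor Y y)) y v + fd w y v \<bullet> \<Gamma> (x y) k (hor Y y))
      + \<kappa> * ((w y \<bullet> hor Y y) * (fd w y v \<bullet> k) + (w y \<bullet> fd (hor Y) y v + fd w y v \<bullet> hor Y y) * (w y \<bullet> k))"
    using fd_eq[OF has_derivative_add[OF has_derivative_diff[OF has_derivative_inner_left[OF D[OF sw], of k]
          has_derivative_inner[OF D[OF smooth_w] D[OF sG]]]
          has_derivative_mult_right[OF has_derivative_mult[OF has_derivative_inner[OF D[OF smooth_w] D[OF h]]
            has_derivative_inner_left[OF D[OF smooth_w], of k]], of \<kappa>]]] by simp
  finally show ?thesis unfolding dw dG by (simp add: inner_add_right algebra_simps)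
qed

lemma fd_w:
  "y \<in> \<Omega> \<Longrightarrow> fd w y (X y) \<bullet> k = ver X y \<bullet> k + w y \<bullet> \<Gamma> (x y) k (hor X y) - \<kappa> * (w y \<bullet> hor X y) * (w y \<bullet> k)"
  by (simp add: ver_def inner_add_left inner_diff_left dual_\<Gamma>_inner[OF x_in])

text \<open>In the vertical component the derivatives of the Christoffel symbols add up to a curvature term,
  and the Bianchi identity identifies it with the one in \<open>cderiv\<close>.\<close>

lemma cderiv_torsion_free:
  assumes y: "y \<in> \<Omega>" and X: "C_infinity \<Omega> X" and Y: "C_infinity \<Omega> Y"
  shows "cderiv X (hor Y) (ver Y) k l y - cderiv Y (hor X) (ver X) k l y = met (hor (lie X Y) y) (ver (lie X Y) y) k l"
proof -
  note xB = x_in[OF y]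
  let ?X = "hor X y" and ?Y = "hor Y y" and ?k = "w y \<bullet> k"
  have hb: "fd (hor Y) y (X y) = hor (lie X Y) y + fd (hor X) y (Y y)"
    by (simp add: hor_lie[OF y X Y])
  have mw: "fd (\<lambda>z. fd w z (Y y)) y (X y) = fd (\<lambda>z. fd w z (X y)) y (Y y)"
    by (rule mixed_derivatives_commute[OF open_\<Omega> smooth_w y])
  have wb: "fd w y (lie X Y y) = fd w y (fd Y y (X y)) - fd w y (fd X y (Y y))"
    by (simp add: lie_def linear_diff[OF linear_fd[OF smooth_w open_\<Omega> y]])
  have vb: "ver (lie X Y) y \<bullet> k = fd w y (fd Y y (X y)) \<bullet> k - fd w y (fd X y (Y y)) \<bullet> k
      - w y \<bullet> \<Gamma> (x y) k (hor (lie X Y) y) + \<kappa> * (w y \<bullet> hor (lie X Y) y) * ?k"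
    unfolding ver_def wb by (simp add: inner_add_left inner_diff_left dual_\<Gamma>_inner[OF xB])
  have symS: "S y ?X ?Y = S y ?Y ?X" using sym_\<Gamma>[OF xB, of ?X ?Y] by (simp add: S_def add.commute)
  have bianchi: "w y \<bullet> R (x y) ?X ?Y k + w y \<bullet> R (x y) ?Y k ?X - w y \<bullet> R (x y) ?X k ?Y = 0"
    using R_bianchi[OF xB, of ?X ?Y k] R_skew[of "x y" k ?X ?Y]
    by (metis (no_types, opaque_lifting) add_uminus_conv_diff inner_add_right inner_minus_right inner_zero_right)
  have curv_at: "w y \<bullet> R (x y) ?X ?Y k = w y \<bullet> fd (\<lambda>z. \<Gamma> z k ?Y) (x y) ?X - w y \<bullet> fd (\<lambda>z. \<Gamma> z k ?X) (x y) ?Y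
      + w y \<bullet> \<Gamma> (x y) ?X (\<Gamma> (x y) k ?Y) - w y \<bullet> \<Gamma> (x y) ?Y (\<Gamma> (x y) k ?X)"
    using fd_\<Gamma>_sym[OF xB, of k ?Y ?X] fd_\<Gamma>_sym[OF xB, of k ?X ?Y] sym_\<Gamma>[OF xB, of k ?X] sym_\<Gamma>[OF xB, of k ?Y]
    by (simp add: R_def inner_add_right inner_diff_right)
  have G: "w y \<bullet> \<Gamma> (x y) (\<Gamma> (x y) k u) z = w y \<bullet> \<Gamma> (x y) z (\<Gamma> (x y) k u)" for u z
    using sym_\<Gamma>[OF xB] by simp
  have SX: "r \<bullet> S y u k = r \<bullet> \<Gamma> (x y) k u - \<kappa> * (?k * (r \<bullet> u) + (w y \<bullet> u) * (r \<bullet> k))" for r u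
    using sym_\<Gamma>[OF xB, of u k] by (simp add: S_def inner_diff_right inner_add_right)
  have "cderiv X (hor Y) (ver Y) k l y - cderiv Y (hor X) (ver X) k l y = a * (
      (fd (ver Y) y (X y) \<bullet> k - ver Y y \<bullet> S y ?X k - w y \<bullet> R (x y) ?Y k ?X)
      - (fd (ver X) y (Y y) \<bullet> k - ver X y \<bullet> S y ?Y k - w y \<bullet> R (x y) ?X k ?Y)
      + l \<bullet> hor (lie X Y) y)"
    unfolding cderiv_def symS hb by (simp add: inner_add_right algebra_simps)
  also have "(fd (ver Y) y (X y) \<bullet> k - ver Y y \<bullet> S y ?X k - w y \<bullet> R (x y) ?Y k ?X)
      - (fd (ver X) y (Y y) \<bullet> k - ver X y \<bullet> S y ?Y k - w y \<bullet> R (x y) ?X k ?Y) = ver (lie X Y) y \<bullet> k"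
    unfolding fd_ver[OF y X] fd_ver[OF y Y] mw vb fd_w[OF y] SX hb
      linear_add[OF linear_\<Gamma>2[OF xB]] G
    using bianchi curv_at sym_\<Gamma>[OF xB, of ?X ?Y]
    by (simp add: inner_add_left inner_add_right algebra_simps flip: hor_def)
  finally show ?thesis by (simp add: met_def)
qed

text \<open>A bilinear operation on fields that is metric and torsion free is unique, since the
  difference of two is symmetric in its first two and skew in its last two arguments.\<close>

lemma cderiv_unique:
  assumes y: "y \<in> \<Omega>" 
    and met: "\<And>X Y Z. C_infinity \<Omega> X \<Longrightarrow> C_infinity \<Omega> Y \<Longrightarrow> C_infinity \<Omega> Z \<Longrightarrow>
      fd (\<lambda>y. met (hor Y y) (ver Y y) (hor Z y) (ver Z y)) y (X y) = nab X Y Z + nab X Z Y"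
    and tor: "\<And>X Y Z. C_infinity \<Omega> X \<Longrightarrow> C_infinity \<Omega> Y \<Longrightarrow> C_infinity \<Omega> Z \<Longrightarrow>
      nab X Y Z - nab Y X Z = met (hor (lie X Y) y) (ver (lie X Y) y) (hor Z y) (ver Z y)"
    and sm: "C_infinity \<Omega> X" "C_infinity \<Omega> Y" "C_infinity \<Omega> Z"
  shows "nab X Y Z = cderiv X (hor Y) (ver Y) (hor Z y) (ver Z y) y"
proof -
  \<comment> \<open>The cyclic use of both symmetries returns to \<open>d X Y Z\<close> with the opposite sign.\<close>
  define d where "d X Y Z = nab X Y Z - cderiv X (hor Y) (ver Y) (hor Z y) (ver Z y) y" for X Y Z
  have skew: "d X Y Z = - d X Z Y" if "C_infinity \<Omega> X" "C_infinity \<Omega> Y" "C_infinity \<Omega> Z" for X Y Z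
    using met[OF that] cderiv_metric[OF y smooth_hor[OF that(2)] smooth_ver[OF that(2)] smooth_hor[OF that(3)] smooth_ver[OF that(3)], of X]
    by (simp add: d_def)
  have symm: "d X Y Z = d Y X Z" if "C_infinity \<Omega> X" "C_infinity \<Omega> Y" "C_infinity \<Omega> Z" for X Y Z
    using tor[OF that] cderiv_torsion_free[OF y that(1,2), of "hor Z y" "ver Z y"] by (simp add: d_def)
  have "d X Y Z = 0"
    using skew[OF sm] symm[OF sm(1,3,2)] skew[OF sm(3,1,2)] symm[OF sm(3,2,1)] skew[OF sm(2,3,1)] symm[OF sm(2,1,3)]
    by linarith
  then show ?thesis by (simp add: d_def)
qed

text \<open>The second fundamental form, in the form that shows the classes.\<close>

definition H :: "('h \<Rightarrow> 'h) \<Rightarrow> ('h \<Rightarrow> 'h) \<Rightarrow> 'h \<Rightarrow> real"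
  where "H X Z y = sqrt b / (2 * a) * (met (hor X y) (ver X y) (hor Z y) (ver Z y) + eta X y * eta Z y)
    - a / (sqrt b * s y) * (Hess (x y) (hor X y) (hor Z y)
        + 2 / s y * fd F (x y) (hor X y) * fd F (x y) (hor Z y)
        + w y \<bullet> R (x y) (hor Z y) (\<xi> (x y)) (hor X y))"

lemma fd_gradient: "y \<in> B \<Longrightarrow> fd (gradient F) y u \<bullet> k = fd (\<lambda>y. fd F y k) y u"
  using fd_inner_left[OF smooth_gradient open_B, of y k u]
    fd_cong[OF open_B, of y "\<lambda>y. gradient F y \<bullet> k" "\<lambda>y. fd F y k"] gradient_F by simp

text \<open>The normal is a multiple of the gradient of the function that defines the hypersurface, so this is
  a Hessian computation. The derivative of the factor \<open>1 / (sqrt b * s)\<close> drops out, as the normal is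
  orthogonal to \<open>Z\<close>; the mixed products of \<open>w\<close> and \<open>dF\<close> are collected in \<open>eta X y * eta Z y\<close>.\<close>

lemma cderiv_normal:
  assumes y: "y \<in> \<Omega>" and Z: "C_infinity \<Omega> Z"
  shows "cderiv X nh nv (hor Z y) (ver Z y) y = - H X Z y"
proof -
  note xB = x_in[OF y] and D = C_infinity_has_derivative[OF _ open_\<Omega> y]
  define c where "c y = 1 / (sqrt b * s y)" for y
  \<comment> \<open>The vertical component of the normal before normalisation.\<close>
  define \<nu> where "\<nu> y = gradient F (x y) - (\<kappa> * s y) *\<^sub>R w y" for y
  have sc: "C_infinity \<Omega> c" unfolding c_def[abs_def] by (rule smooth_c)
  have s\<nu>: "C_infinity \<Omega> \<nu>"
    unfolding \<nu>_def[abs_def]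
    by (intro C_infinity_scaleR C_infinity_diff C_infinity_mult C_infinity_const smooth_base
        smooth_gradient open_\<Omega> smooth_s smooth_w)
  have s\<xi>: "C_infinity \<Omega> (\<lambda>y. \<xi> (x y))" by (rule smooth_base[OF smooth_\<xi>])
  have n: "nh = (\<lambda>y. c y *\<^sub>R \<xi> (x y))" "nv = (\<lambda>y. c y *\<^sub>R \<nu> y)"
    by (auto simp: nh_def nv_def c_def \<nu>_def)
  let ?h = "hor X y" and ?k = "hor Z y" and ?l = "ver Z y" and ?dc = "fd c y (X y)"
  have dnh: "fd nh y (X y) = ?dc *\<^sub>R \<xi> (x y) + c y *\<^sub>R fd \<xi> (x y) ?h"
    unfolding n using fd_eq[OF has_derivative_scaleR[OF D[OF sc] D[OF s\<xi>]]]
    by (simp add: fd_base[OF smooth_\<xi> y] hor_def)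
  have dnv: "fd nv y (X y) = ?dc *\<^sub>R \<nu> y + c y *\<^sub>R fd \<nu> y (X y)"
    unfolding n using fd_eq[OF has_derivative_scaleR[OF D[OF sc] D[OF s\<nu>]]] by simp
  have d\<nu>: "fd \<nu> y (X y) = fd (gradient F) (x y) ?h - (\<kappa> * s y) *\<^sub>R fd w y (X y) + (\<kappa> * fd F (x y) ?h) *\<^sub>R w y"
    unfolding \<nu>_def[abs_def]
    using fd_eq[OF has_derivative_diff[OF D[OF smooth_base[OF smooth_gradient]]
          has_derivative_scaleR[OF has_derivative_mult_right[OF D[OF smooth_s], of \<kappa>] D[OF smooth_w]]]]
    by (simp add: fd_base[OF smooth_gradient y] fd_s[OF y] hor_def)
  have \<nu>k: "\<nu> y \<bullet> k = fd F (x y) k - \<kappa> * s y * (w y \<bullet> k)" for k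
    by (simp add: \<nu>_def inner_diff_left gradient_F[OF xB])
  have l\<xi>: "?l \<bullet> \<xi> (x y) = \<kappa> * s y * (w y \<bullet> ?k) - fd F (x y) ?k" by (rule tangency[OF y])
  have d\<xi>: "fd \<xi> (x y) ?h = - \<Gamma> (x y) ?h (\<xi> (x y))"
    using par[OF xB, of ?h] by (simp add: eq_neg_iff_add_eq_0)
  have w\<xi>: "w y \<bullet> \<xi> (x y) = s y" by (simp add: s_def)
  have s0: "s y \<noteq> 0" using s_nonzero[OF y] by (simp add: s_def)
  have Rc: "w y \<bullet> R (x y) (c y *\<^sub>R \<xi> (x y)) ?k ?h = - c y * (w y \<bullet> R (x y) ?k (\<xi> (x y)) ?h)"
    using linear_scale[OF R_linear(1)[OF xB]] R_skew[of "x y" "\<xi> (x y)" ?k ?h] by simp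
  have Sc: "S y ?h (c y *\<^sub>R \<xi> (x y)) = c y *\<^sub>R S y ?h (\<xi> (x y))"
    by (simp add: S_def linear_scale[OF linear_\<Gamma>2[OF xB]] scaleR_diff_right scaleR_add_right mult.commute mult.left_commute)
  have "cderiv X nh nv ?k ?l y = a * ?dc * (\<nu> y \<bullet> ?k + ?l \<bullet> \<xi> (x y)) + a * c y * (fd \<nu> y (X y) \<bullet> ?k
      - \<nu> y \<bullet> S y ?h ?k + w y \<bullet> R (x y) ?k (\<xi> (x y)) ?h + ?l \<bullet> (fd \<xi> (x y) ?h + S y ?h (\<xi> (x y))))"
    unfolding cderiv_def dnh dnv
    by (simp add: n Rc Sc inner_add_left inner_add_right algebra_simps)
  also have "\<nu> y \<bullet> ?k + ?l \<bullet> \<xi> (x y) = 0" by (simp add: \<nu>k l\<xi>)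
  also have "?l \<bullet> (fd \<xi> (x y) ?h + S y ?h (\<xi> (x y))) = - \<kappa> * (s y * (?l \<bullet> ?h) + (w y \<bullet> ?h) * (?l \<bullet> \<xi> (x y)))"
    by (simp add: d\<xi> S_def w\<xi> inner_add_right inner_diff_right)
  also have "fd \<nu> y (X y) \<bullet> ?k = fd (\<lambda>y. fd F y ?k) (x y) ?h - \<kappa> * s y * (fd w y (X y) \<bullet> ?k) + \<kappa> * fd F (x y) ?h * (w y \<bullet> ?k)"
    by (simp add: d\<nu> inner_add_left inner_diff_left fd_gradient[OF xB])
  finally have 1: "cderiv X nh nv ?k ?l y = a * c y * (Hess (x y) ?h ?k + w y \<bullet> R (x y) ?k (\<xi> (x y)) ?h
      - \<kappa> * s y * (ver X y \<bullet> ?k + ?l \<bullet> ?h) + 2 * \<kappa> * (w y \<bullet> ?k) * fd F (x y) ?h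
      + 2 * \<kappa> * (w y \<bullet> ?h) * fd F (x y) ?k - 2 * \<kappa>\<^sup>2 * s y * (w y \<bullet> ?h) * (w y \<bullet> ?k))"
    unfolding fd_w[OF y] l\<xi> \<nu>k S_def Hess_def
    using sym_\<Gamma>[OF xB, of ?h ?k]
    by (simp add: linear_diff[OF linear_fd_base[OF smooth_F xB]] linear_add[OF linear_fd_base[OF smooth_F xB]]
        linear_scale[OF linear_fd_base[OF smooth_F xB]] inner_diff_right inner_add_right
        algebra_simps power2_eq_square)
  have alg: "a * (1 / (q * s)) * (Hs + Rr - \<kappa> * s * (vk + lh) + 2 * \<kappa> * wk * Fh + 2 * \<kappa> * wh * Fk - 2 * \<kappa>\<^sup>2 * s * wh * wk)
     = - (q / (2 * a) * (a * (vk + lh) + (q * wh - 2 * a / (q * s) * Fh) * (q * wk - 2 * a / (q * s) * Fk))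
       - a / (q * s) * (Hs + 2 / s * Fh * Fk + Rr))"
    if "q \<noteq> 0" "s \<noteq> 0" "a \<noteq> 0" "\<kappa> = q\<^sup>2 / (2 * a)" for q s \<kappa> Hs Rr vk lh wk Fh wh Fk a :: real
    using that(1-3) unfolding that(4) by (simp add: field_simps power2_eq_square)
  have "sqrt b \<noteq> 0" "a \<noteq> 0" "\<kappa> = (sqrt b)\<^sup>2 / (2 * a)" using a_pos b_pos by (auto simp: \<kappa>_def)
  from alg[OF this(1) s0 this(2,3)] show ?thesis unfolding 1 H_def met_def eta_def c_def by blast
qed

text \<open>The Leibniz rule for the field \<open>P Y - \<eta>(Y) N\<close>, where \<open>Y\<close> has components \<open>(p, r)\<close> and \<open>P Y\<close> has
  components \<open>(p, - r)\<close>.\<close>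

lemma cderiv_lin_field:
  assumes y: "y \<in> \<Omega>" and sm: "C_infinity \<Omega> p" "C_infinity \<Omega> r" "C_infinity \<Omega> e"
    and eq: "\<And>y. y \<in> \<Omega> \<Longrightarrow> p' y = p y - e y *\<^sub>R nh y" "\<And>y. y \<in> \<Omega> \<Longrightarrow> r' y = - r y - e y *\<^sub>R nv y"
  shows "cderiv X p' r' k l y = cderiv X p (\<lambda>y. - r y) k l y - fd e y (X y) * met (nh y) (nv y) k l - e y * cderiv X nh nv k l y"
proof -
  note xB = x_in[OF y] and D = C_infinity_has_derivative[OF _ open_\<Omega> y]
  have p: "fd p' y v = fd p y v - (fd e y v *\<^sub>R nh y + e y *\<^sub>R fd nh y v)" for v
    using fd_cong[OF open_\<Omega> y, of p' "\<lambda>y. p y - e y *\<^sub>R nh y"] eq(1)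
      fd_eq[OF has_derivative_diff[OF D[OF sm(1)] has_derivative_scaleR[OF D[OF sm(3)] D[OF smooth_nh]]]]
    by (simp add: add.commute)
  have r: "fd r' y v = fd (\<lambda>y. - r y) y v - (fd e y v *\<^sub>R nv y + e y *\<^sub>R fd nv y v)" for v
    using fd_cong[OF open_\<Omega> y, of r' "\<lambda>y. - r y - e y *\<^sub>R nv y"] eq(2)
      fd_eq[OF has_derivative_minus[OF D[OF sm(2)]]]
      fd_eq[OF has_derivative_diff[OF has_derivative_minus[OF D[OF sm(2)]] has_derivative_scaleR[OF D[OF sm(3)] D[OF smooth_nv]]]]
    by (simp add: add.commute)
  have Sd: "S y h (u - c *\<^sub>R z) = S y h u - c *\<^sub>R S y h z" for h u z c
    by (simp add: S_def linear_diff[OF linear_\<Gamma>2[OF xB]] linear_scale[OF linear_\<Gamma>2[OF xB]]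
        inner_diff_right scaleR_diff_right scaleR_add_right scaleR_left_diff_distrib algebra_simps)
  have Rd: "R (x y) (u - c *\<^sub>R z) k h = R (x y) u k h - c *\<^sub>R R (x y) z k h" for h u z c
    by (simp add: linear_diff[OF R_linear(1)[OF xB]] linear_scale[OF R_linear(1)[OF xB]])
  show ?thesis
    unfolding cderiv_def met_def p r eq[OF y] Sd Rd
    by (simp add: inner_diff_left inner_diff_right inner_add_left inner_add_right algebra_simps)
qed

text \<open>The covariant derivative of \<open>\<phi>\<close>: the curvature term is the covariant derivative of the
  ambient para-complex structure, the rest comes from the second fundamental form.\<close>

lemma cderiv_phi:
  assumes y: "y \<in> \<Omega>" and sm: "C_infinity \<Omega> X" "C_infinity \<Omega> Y" "C_infinity \<Omega> Z"
    and Y': "\<And>y. y \<in> \<Omega> \<Longrightarrow> hor Y' y = hor Y y - eta Y y *\<^sub>R nh y" "\<And>y. y \<in> \<Omega> \<Longrightarrow> ver Y' y = - ver Y y - eta Y y *\<^sub>R nv y"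
    and Z': "hor Z' y = hor Z y - eta Z y *\<^sub>R nh y" "ver Z' y = - ver Z y - eta Z y *\<^sub>R nv y"
  shows "cderiv X (hor Y') (ver Y') (hor Z y) (ver Z y) y + cderiv X (hor Y) (ver Y) (hor Z' y) (ver Z' y) y =
    - 2 * a * (w y \<bullet> R (x y) (hor Y y) (hor Z y) (hor X y)) + eta Y y * H X Z y - eta Z y * H X Y y"
proof -
  note xB = x_in[OF y] and D = C_infinity_has_derivative[OF _ open_\<Omega> y]
  have 1: "cderiv X (hor Y') (ver Y') (hor Z y) (ver Z y) y =
      cderiv X (hor Y) (\<lambda>y. - ver Y y) (hor Z y) (ver Z y) y + eta Y y * H X Z y"
    using cderiv_lin_field[OF y smooth_hor[OF sm(2)] smooth_ver[OF sm(2)] smooth_eta[OF sm(2)] Y', of X "hor Z y" "ver Z y"]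
    by (simp add: met_normal[OF y] cderiv_normal[OF y sm(3)])
  have lin2: "cderiv X p r (k - e *\<^sub>R k') (- l - e *\<^sub>R l') y = cderiv X p r k (- l) y - e * cderiv X p r k' l' y" for p r k l k' l' e
  proof -
    have Sd: "S y h (u - c *\<^sub>R z) = S y h u - c *\<^sub>R S y h z" for h u z c
      by (simp add: S_def linear_diff[OF linear_\<Gamma>2[OF xB]] linear_scale[OF linear_\<Gamma>2[OF xB]]
          inner_diff_right scaleR_diff_right scaleR_add_right scaleR_left_diff_distrib algebra_simps)
    have Rd: "R (x y) v (u - c *\<^sub>R z) h = R (x y) v u h - c *\<^sub>R R (x y) v z h" for h u z c v
      by (simp add: linear_diff[OF R_linear(2)[OF xB]] linear_scale[OF R_linear(2)[OF xB]])
    show ?thesis unfolding cderiv_def Sd Rd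
      by (simp add: inner_diff_left inner_diff_right inner_add_left inner_add_right algebra_simps)
  qed
  have "fd (\<lambda>y. met (hor Y y) (ver Y y) (nh y) (nv y)) y (X y) = 0"
    using fd_cong[OF open_\<Omega> y, of "\<lambda>y. met (hor Y y) (ver Y y) (nh y) (nv y)" "\<lambda>_. 0"] met_normal[of _ Y]
    by (simp add: met_def inner_commute add.commute)
  then have 2: "cderiv X (hor Y) (ver Y) (nh y) (nv y) y = H X Y y"
    using cderiv_metric[OF y smooth_hor[OF sm(2)] smooth_ver[OF sm(2)] smooth_nh smooth_nv, of X]
    by (simp add: cderiv_normal[OF y sm(2)])
  have 3: "cderiv X (hor Y) (\<lambda>y. - ver Y y) k l y + cderiv X (hor Y) (ver Y) k (- l) y = - 2 * a * (w y \<bullet> R (x y) (hor Y y) k (hor X y))" for k l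
    using fd_eq[OF has_derivative_minus[OF D[OF smooth_ver[OF sm(2)]]]]
    by (simp add: cderiv_def algebra_simps)
  show ?thesis unfolding 1 Z' lin2 2 using 3[of "hor Z y" "ver Z y"] by simp
qed

text \<open>As \<open>ds = - dF\<close> along the hypersurface, \<open>\<eta>\<close> is \<open>sqrt b\<close> times the canonical 1-form \<open>w \<bullet> dx\<close> plus a
  multiple of \<open>ds / s\<close>, which is closed.\<close>

lemma eta_exterior_derivative:
  assumes y: "y \<in> \<Omega>" and X: "C_infinity \<Omega> X" and Y: "C_infinity \<Omega> Y"
  shows "fd (eta Y) y (X y) - fd (eta X) y (Y y) - eta (lie X Y) y
    = sqrt b * (ver X y \<bullet> hor Y y - ver Y y \<bullet> hor X y)"
proof -
  note xB = x_in[OF y] and D = C_infinity_has_derivative[OF _ open_\<Omega> y]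
  have s0: "s y \<noteq> 0" using s_nonzero[OF y] by (simp add: s_def)
  define c where "c = 2 * a / sqrt b"
  have eta_s: "eta Z z = sqrt b * (w z \<bullet> hor Z z) + c * (fd s z (Z z) / s z)" if "z \<in> \<Omega>" for Z z
    by (simp add: eta_def fd_s[OF that] hor_def c_def)
  have d: "fd (eta Z) y v = sqrt b * (w y \<bullet> fd (hor Z) y v + fd w y v \<bullet> hor Z y)
      + c * (((fd (\<lambda>z. fd s z (Z y)) y v + fd s y (fd Z y v)) * s y - fd s y (Z y) * fd s y v) / (s y * s y))"
    if Z: "C_infinity \<Omega> Z" for Z v
  proof -
    have ss: "C_infinity \<Omega> (\<lambda>z. fd s z (Z z))" by (rule C_infinity_fd_along[OF open_\<Omega> smooth_s Z])
    have ds: "fd (\<lambda>z. fd s z (Z z)) y v = fd (\<lambda>z. fd s z (Z y)) y v + fd s y (fd Z y v)"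
      by (rule fd_linear_family[OF open_\<Omega> Z C_infinity_fd[OF open_\<Omega> smooth_s] linear_fd[OF smooth_s open_\<Omega>] y])
    have "fd (eta Z) y = fd (\<lambda>z. sqrt b * (w z \<bullet> hor Z z) + c * (fd s z (Z z) / s z)) y"
      by (rule fd_cong[OF open_\<Omega> y eta_s])
    then show ?thesis
      using fd_eq[OF has_derivative_add[OF has_derivative_mult_right[OF has_derivative_inner[OF D[OF smooth_w] D[OF smooth_hor[OF Z]]], of "sqrt b"]
          has_derivative_mult_right[OF has_derivative_divide'[OF D[OF ss] D[OF smooth_s] s0], of c]]]
      by (simp add: ds)
  qed
  have w\<Gamma>: "w y \<bullet> \<Gamma> (x y) (hor Y y) (hor X y) = w y \<bullet> \<Gamma> (x y) (hor X y) (hor Y y)"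
    using sym_\<Gamma>[OF xB] by simp
  have wh: "w y \<bullet> hor (lie X Y) y = w y \<bullet> fd (hor Y) y (X y) - w y \<bullet> fd (hor X) y (Y y)"
    by (simp add: hor_lie[OF y X Y] inner_diff_right)
  have sb: "fd s y (lie X Y y) = fd s y (fd Y y (X y)) - fd s y (fd X y (Y y))"
    by (simp add: lie_def linear_diff[OF linear_fd[OF smooth_s open_\<Omega> y]])
  have ms: "fd (\<lambda>z. fd s z (Y y)) y (X y) = fd (\<lambda>z. fd s z (X y)) y (Y y)"
    by (rule mixed_derivatives_commute_real[OF open_\<Omega> smooth_s y])
  have fw: "fd w y (X y) \<bullet> hor Y y - fd w y (Y y) \<bullet> hor X y = ver X y \<bullet> hor Y y - ver Y y \<bullet> hor X y"
    by (simp add: fd_w[OF y] w\<Gamma>)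
  have "fd (eta Y) y (X y) - fd (eta X) y (Y y) - eta (lie X Y) y
    = sqrt b * (fd w y (X y) \<bullet> hor Y y - fd w y (Y y) \<bullet> hor X y)"
    unfolding d[OF X] d[OF Y] eta_s[OF y] wh sb ms using s0 by (simp add: field_simps)
  then show ?thesis by (simp add: fw)
qed

end

section \<open>The hypersurface\<close>

locale level_hypersurface = riemann_extension M nabla a b G P
  for M :: "('p, 'e::euclidean_space) atlas" and nabla :: "'p connection" and a b :: real
    and G :: "'p cot \<Rightarrow> 'p cot tvec \<Rightarrow> 'p cot tvec \<Rightarrow> real"
    and P :: "'p cot \<Rightarrow> 'p cot tvec \<Rightarrow> 'p cot tvec" +
  fixes xi :: "'p vfield" and xiC :: "'p cot vfield" and f :: "'p \<Rightarrow> real" and t :: real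
    and B :: "('p cot, 'h::euclidean_space) atlas" and N :: "'p cot vfield"
    and D :: "'p cot connection"
  assumes nonempty: "points M \<noteq> {}" and dim2: "DIM('e) \<ge> 2"
    and xi: "xi \<in> vfields M (points M)" and xi_nz: "\<forall>x\<in>points M. xi x \<noteq> 0"
    and xi_par: "parallel_field M nabla xi"
    and f: "f \<in> smooth_funs M (points M)" and f_t: "\<forall>x\<in>points M. f x \<noteq> t"
    and b_pos: "b > 0"
    and xiC: "complete_lift M (points M) xi xiC"
    and emb: "embedded_submanifold (cotangent_atlas M) B"
    and points_B: "points B = hypersurface M xi f t"
    and dim_h: "DIM('h) = 2 * DIM('e) - 1"
    and N: "N = hypersurface_normal M a b xi xiC f"
    and unit: "timelike_unit_normal (cotangent_atlas M) B G N"
    and lc: "levi_civita B (induced_metric (cotangent_atlas M) G) D"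

sublocale level_hypersurface \<subseteq> L: connection_space B D
  using emb lc by unfold_locales
    (auto simp: embedded_submanifold_def smooth_manifold_def levi_civita_def symmetric_connection_def)

context level_hypersurface
begin

abbreviation "ic \<equiv> incl TM"
abbreviation "tp \<equiv> tangent_part TM B"
abbreviation "g \<equiv> induced_metric TM G"

definition xibar :: "'p cot vfield" where "xibar = (\<lambda>q. tp q (P q (N q)))"

definition eta :: "'p cot \<Rightarrow> 'p cot covec"
  where "eta = (\<lambda>q v. if v \<in> tangent_space B q then G q (ic q v) (P q (N q)) else 0)"

definition phi :: "'p cot \<Rightarrow> 'p cot tvec \<Rightarrow> 'p cot tvec"
  where "phi = (\<lambda>q v. tp q (P q (ic q v) - eta q v *\<^sub>R N q))"

subsection \<open>The inclusion in charts\<close>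

lemma opn_B: "T.opn U \<Longrightarrow> L.opn (U \<inter> points B)"
  using emb by (auto simp: embedded_submanifold_def openin_subtopology)

lemma points_B_TM: "points B \<subseteq> points TM"
  using emb by (simp add: embedded_submanifold_def)

lemma chart_at:
  assumes "q \<in> points TM"
  obtains K where "K \<in> M" "q \<in> fst (TC K)"
  using T.point_chart[OF assms] by (auto simp: cotangent_atlas_def)

lemma opn_pair: "C \<in> B \<Longrightarrow> K \<in> M \<Longrightarrow> L.opn (fst C \<inter> fst (TC K))"
proof -
  assume C: "C \<in> B" and K: "K \<in> M"
  have "fst C \<subseteq> points B" using C by (auto simp: points_def)
  then have "fst C \<inter> fst (TC K) = fst C \<inter> (fst (TC K) \<inter> points B)" by blast
  then show ?thesis using L.fst_opn[OF C] opn_B[OF T.fst_opn[OF TC_in[OF K]]] by auto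
qed

text \<open>The hypersurface, parametrised by a chart \<open>C\<close> of its own, in the induced coordinates of \<open>K\<close>.\<close>

definition iota :: "('p cot, 'h) chart \<Rightarrow> ('p, 'e) chart \<Rightarrow> 'h \<Rightarrow> 'e \<times> 'e"
  where "iota C K y = snd (TC K) (chart_inv C y)"

lemma smooth_iota:
  assumes "C \<in> B" "K \<in> M" "W \<subseteq> fst C \<inter> fst (TC K)"
  shows "C_infinity (snd C ` W) (iota C K)"
proof -
  have "C_infinity (snd C ` (fst C \<inter> fst (TC K))) (snd (TC K) \<circ> chart_inv C)"
    using emb assms(1) TC_in[OF assms(2)] unfolding embedded_submanifold_def by blast
  moreover have "snd (TC K) \<circ> chart_inv C = iota C K" by (simp add: iota_def fun_eq_iff)
  ultimately show ?thesis using C_infinity_subset[OF _ image_mono[OF assms(3)]] by simp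
qed

lemma iota_comp_smooth:
  assumes C: "C \<in> B" and K: "K \<in> M" and W: "L.opn W" "W \<subseteq> fst C \<inter> fst (TC K)"
    and F: "F \<in> smooth_funs TM U" and WU: "W \<subseteq> U"
  shows "C_infinity (snd C ` W) (\<lambda>y. F (chart_inv C y))"
    "y \<in> snd C ` W \<Longrightarrow> fd (\<lambda>y. F (chart_inv C y)) y v =
      fd (\<lambda>z. F (chart_inv (TC K) z)) (iota C K y) (fd (iota C K) y v)"
proof -
  note o = L.open_img[OF C W(1)] and TK = TC_in[OF K]
  have WC: "W \<subseteq> fst C" using W by auto
  let ?T = "snd (TC K) ` (U \<inter> fst (TC K))" and ?F = "\<lambda>z. F (chart_inv (TC K) z)"
  have oT: "open ?T" by (rule T.open_img_Int[OF T.sf_opn[OF F] TK])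
  have FT: "C_infinity ?T ?F" by (rule T.sf_img[OF F TK order_refl])
  have sub: "iota C K ` (snd C ` W) \<subseteq> ?T"
  proof
    fix z assume "z \<in> iota C K ` (snd C ` W)"
    then obtain q where q: "q \<in> W" "z = iota C K (snd C q)" by blast
    have "q \<in> fst C" "q \<in> U \<inter> fst (TC K)" using q(1) W(2) WU by auto
    then show "z \<in> ?T" using q(2) L.chart_inv_left[OF C] by (simp add: iota_def)
  qed
  have eq: "F (chart_inv C y) = ?F (iota C K y)" if "y \<in> snd C ` W" for y
  proof -
    obtain q where q: "q \<in> W" "y = snd C q" using \<open>y \<in> snd C ` W\<close> by auto
    then have "q \<in> fst C" "q \<in> fst (TC K)" using W(2) by auto
    then show ?thesis using q L.chart_inv_left[OF C] T.chart_inv_left[OF TK] by (simp add: iota_def)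
  qed
  note si = smooth_iota[OF C K W(2)]
  show "C_infinity (snd C ` W) (\<lambda>y. F (chart_inv C y))"
    by (rule C_infinity_cong[OF o[OF WC] C_infinity_compose[OF o[OF WC] oT sub si FT] eq])
  show "fd (\<lambda>y. F (chart_inv C y)) y v = fd ?F (iota C K y) (fd (iota C K) y v)" if y: "y \<in> snd C ` W"
  proof -
    have "fd (\<lambda>y. F (chart_inv C y)) y v = fd (\<lambda>y. ?F (iota C K y)) y v"
      by (rule fun_cong[OF fd_cong[OF o[OF WC] y eq]])
    also have "\<dots> = fd ?F (iota C K y) (fd (iota C K) y v)"
      by (rule fun_cong[OF fd_eq[OF has_derivative_compose[OF C_infinity_has_derivative[OF si o[OF WC] y]
          C_infinity_has_derivative[OF FT oT]]]]) (use sub y in blast)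
    finally show ?thesis .
  qed
qed

lemma sf_B:
  assumes F: "F \<in> smooth_funs TM U"
  shows "F \<in> smooth_funs B (U \<inter> points B)"
proof (rule L.sf_local[OF opn_B[OF T.sf_opn[OF F]]])
  fix q assume q: "q \<in> U \<inter> points B"
  obtain C where C: "C \<in> B" "q \<in> fst C" using L.point_chart q by blast
  obtain K where K: "K \<in> M" "q \<in> fst (TC K)" using chart_at q points_B_TM by blast
  let ?W = "(U \<inter> points B) \<inter> (fst C \<inter> fst (TC K))"
  have W: "L.opn ?W" using opn_B[OF T.sf_opn[OF F]] opn_pair[OF C(1) K(1)] by auto
  have FW: "F \<in> smooth_funs B ?W"
    by (rule L.sf_chart[OF C(1) W _ iota_comp_smooth(1)[OF C(1) K(1) W _ F]]) auto
  show "\<exists>W. q \<in> W \<and> F \<in> smooth_funs B W"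
    by (intro exI[of _ ?W] conjI FW) (use q C K in auto)
qed

lemma incl_coord_vec:
  assumes C: "C \<in> B" "q \<in> fst C" and K: "K \<in> M" "q \<in> fst (TC K)"
  shows "ic q (coord_vec B C q u) = coord_vec TM (TC K) q (fd (iota C K) (snd C q) u)"
proof
  fix F
  show "ic q (coord_vec B C q u) F = coord_vec TM (TC K) q (fd (iota C K) (snd C q) u) F"
  proof (cases "smooth_near TM q F")
    case True
    then obtain U where U: "q \<in> U" "F \<in> smooth_funs TM U" by (auto simp: smooth_near_def)
    have qB: "q \<in> points B" using C by (auto simp: points_def)
    have near: "smooth_near B q F" using L.smooth_nearI[OF sf_B[OF U(2)]] U(1) qB by auto
    let ?W = "(U \<inter> points B) \<inter> (fst C \<inter> fst (TC K))"
    have W: "L.opn ?W" using opn_B[OF T.sf_opn[OF U(2)]] opn_pair[OF C(1) K(1)] by auto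
    have i: "iota C K (snd C q) = snd (TC K) q" by (simp add: iota_def L.chart_inv_left[OF C])
    have "fd (\<lambda>y. F (chart_inv C y)) (snd C q) u =
        fd (\<lambda>z. F (chart_inv (TC K) z)) (snd (TC K) q) (fd (iota C K) (snd C q) u)"
      unfolding i[symmetric]
      by (rule iota_comp_smooth(2)[OF C(1) K(1) W _ U(2)]) (use U(1) qB C K in auto)
    then show ?thesis using True by (simp add: incl_def L.coord_vec_apply[OF near] T.coord_vec_apply[OF True])
  qed (simp add: incl_def coord_vec_def)
qed

lemma linear_incl: "linear (ic q)"
  by (rule linearI) (auto simp: incl_def fun_eq_iff scaleR_fun_def)

lemma incl_inj: "q \<in> points B \<Longrightarrow> inj_on (ic q) (tangent_space B q)"
  using emb by (simp add: embedded_submanifold_def)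

lemma incl_tangent:
  assumes "q \<in> points B" "v \<in> tangent_space B q"
  shows "ic q v \<in> tangent_space TM q"
proof -
  obtain C where C: "C \<in> B" "q \<in> fst C" using L.point_chart assms(1) by blast
  obtain K where K: "K \<in> M" "q \<in> fst (TC K)" using chart_at assms(1) points_B_TM by blast
  obtain u where "v = coord_vec B C q u" using assms(2) L.tangent_space_chart[OF C] by auto
  then show ?thesis using incl_coord_vec[OF C K] TC_in[OF K(1)] K(2) by auto
qed

lemma inj_fd_iota:
  assumes C: "C \<in> B" "q \<in> fst C" and K: "K \<in> M" "q \<in> fst (TC K)"
  shows "inj (fd (iota C K) (snd C q))"
proof (rule injI)
  fix u v assume "fd (iota C K) (snd C q) u = fd (iota C K) (snd C q) v"
  then have e: "ic q (coord_vec B C q u) = ic q (coord_vec B C q v)" by (simp add: incl_coord_vec[OF C K])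
  have qB: "q \<in> points B" using C by (auto simp: points_def)
  have "coord_vec B C q u = coord_vec B C q v"
    by (rule inj_onD[OF incl_inj[OF qB] e L.coord_vec_tangent[OF C] L.coord_vec_tangent[OF C]])
  then show "u = v" using L.vcomp_coord_vec[OF C] by metis
qed

subsection \<open>Pointwise description\<close>

abbreviation xr :: "('p, 'e) chart \<Rightarrow> 'p cot \<Rightarrow> 'e" where "xr K q \<equiv> rep K xi (yy K q)"
abbreviation FK :: "('p, 'e) chart \<Rightarrow> 'e \<Rightarrow> real" where "FK K \<equiv> \<lambda>y. f (chart_inv K y)"
abbreviation ss :: "('p, 'e) chart \<Rightarrow> 'p cot \<Rightarrow> real" where "ss K q \<equiv> ww K q \<bullet> xr K q"
abbreviation dF :: "('p, 'e) chart \<Rightarrow> 'p cot \<Rightarrow> 'e \<Rightarrow> real" where "dF K q \<equiv> fd (FK K) (yy K q)"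
definition nh :: "('p, 'e) chart \<Rightarrow> 'p cot \<Rightarrow> 'e" where "nh K q = (1 / (sqrt b * ss K q)) *\<^sub>R xr K q"
definition nv :: "('p, 'e) chart \<Rightarrow> 'p cot \<Rightarrow> 'e"
  where "nv K q = (1 / (sqrt b * ss K q)) *\<^sub>R (gradient (FK K) (yy K q) - (\<kappa> * ss K q) *\<^sub>R ww K q)"
abbreviation ih :: "('p, 'e) chart \<Rightarrow> 'p cot \<Rightarrow> 'p cot tvec \<Rightarrow> 'e" where "ih K q v \<equiv> hh K (ic q v)"
abbreviation iv :: "('p, 'e) chart \<Rightarrow> 'p cot \<Rightarrow> 'p cot tvec \<Rightarrow> 'e" where "iv K q v \<equiv> vv K q (ic q v)"

lemma chart_points: "K \<in> M \<Longrightarrow> fst K \<subseteq> points M"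
  by (auto simp: points_def)

lemma smooth_FK: "K \<in> M \<Longrightarrow> C_infinity (snd K ` fst K) (FK K)"
  by (rule sf_img[OF f]) (auto simp: chart_points)

lemma smooth_xi: "K \<in> M \<Longrightarrow> C_infinity (snd K ` fst K) (rep K xi)"
  by (rule vf_rep[OF xi]) (auto simp: chart_points fst_opn)

lemma linear_dF: "K \<in> M \<Longrightarrow> y \<in> snd K ` fst K \<Longrightarrow> linear (fd (FK K) y)"
  by (rule linear_fd[OF smooth_FK open_img_fst])

lemma xr_nonzero: "K \<in> M \<Longrightarrow> y \<in> snd K ` fst K \<Longrightarrow> rep K xi y \<noteq> 0"
proof
  assume K: "K \<in> M" and y: "y \<in> snd K ` fst K" and 0: "rep K xi y = 0"
  obtain p where p: "p \<in> fst K" "y = snd K p" using y by auto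
  have "xi p = coord_vec M K p (rep K xi y)"
    using chart_field_rep[OF K p(1), of xi] vf_tangent[OF xi] p chart_points[OF K] by (auto simp: chart_field_def)
  then have "xi p = 0" by (simp add: 0 linear_0[OF linear_coord_vec[OF K p(1)]])
  then show False using xi_nz p(1) chart_points[OF K] by auto
qed

lemma in_B_iff:
  assumes K: "K \<in> M" and q: "q \<in> fst (TC K)"
  shows "q \<in> points B \<longleftrightarrow> ss K q + FK K (yy K q) = t"
proof -
  have "q \<in> points TM" by (rule q_point[OF K q])
  moreover have "snd q (xi (fst q)) = ss K q" using vlift_xi[OF K q xi] by (simp add: vlift_def split_beta)
  ultimately show ?thesis using TC_coord[OF K q] chart_inv_left[OF K] by (simp add: points_B hypersurface_def)
qed

lemma ss_nonzero: "q \<in> points B \<Longrightarrow> K \<in> M \<Longrightarrow> q \<in> fst (TC K) \<Longrightarrow> ss K q \<noteq> 0"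
  using in_B_iff[of K q] f_t TC_coord(1)[of K q] chart_points[of K] chart_inv_left[of K "fst q"] by auto

lemma N_adapted:
  assumes "q \<in> points B" "K \<in> M" "q \<in> fst (TC K)"
  shows "N q \<in> tangent_space TM q" "hh K (N q) = nh K q" "vv K q (N q) = nv K q"
  using normal_adapted[OF assms(2,3) xiC xi xi_par f refl ss_nonzero[OF assms]] by (simp_all add: N nh_def nv_def)

lemma grad_FK: "K \<in> M \<Longrightarrow> q \<in> fst (TC K) \<Longrightarrow> gradient (FK K) (yy K q) \<bullet> u = dF K q u"
  by (rule gradient_inner[OF linear_dF[OF _ yy_in]])

lemma nv_inner: "K \<in> M \<Longrightarrow> q \<in> fst (TC K) \<Longrightarrow> nv K q \<bullet> k = (dF K q k - \<kappa> * ss K q * (ww K q \<bullet> k)) / (sqrt b * ss K q)"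
  by (simp add: nv_def inner_diff_left grad_FK)

lemma sb_pos: "sqrt b > 0" "sqrt b * sqrt b = b" "sqrt b \<noteq> 0" using b_pos by auto

lemma \<kappa>_eq: "2 * a * \<kappa> = b" using a_pos by (simp add: \<kappa>_def)

text \<open>Since \<open>N\<close> has square \<open>-1\<close>, the function \<open>f\<close> is a first integral of \<open>\<xi>\<close>: every point of \<open>M\<close> lies
  under a point of the hypersurface.\<close>

lemma dF_xi:
  assumes K: "K \<in> M" and y: "y \<in> snd K ` fst K"
  shows "fd (FK K) y (rep K xi y) = 0"
proof -
  obtain p where p: "p \<in> fst K" "y = snd K p" using y by auto
  let ?\<xi> = "rep K xi y"
  have \<xi>0: "?\<xi> \<bullet> ?\<xi> \<noteq> 0" using xr_nonzero[OF K y] by simp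
  \<comment> \<open>The covector proportional to \<open>\<xi>\<close> that lies on the hypersurface.\<close>
  define q where "q = (p, covec K p (((t - f p) / (?\<xi> \<bullet> ?\<xi>)) *\<^sub>R ?\<xi>))"
  have q: "q \<in> fst (TC K)" and yq: "yy K q = y" and wq: "ww K q = ((t - f p) / (?\<xi> \<bullet> ?\<xi>)) *\<^sub>R ?\<xi>"
    using TC_surj[OF K p(1)] p by (auto simp: q_def snd_TC)
  have sq: "ss K q = t - f p" using \<xi>0 by (simp add: yq wq)
  have qB: "q \<in> points B" using in_B_iff[OF K q] chart_inv_left[OF K p(1)] by (simp only: sq) (simp add: yq p)
  note Nq = N_adapted[OF qB K q] and s0 = ss_nonzero[OF qB K q]
  have "G q (N q) (N q) = - 1" using unit qB by (simp add: timelike_unit_normal_def)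
  then have "2 * a * (nv K q \<bullet> nh K q) = - 1"
    unfolding G_adapted[OF K q Nq(1,1)] Nq(2,3) by simp
  then have e: "2 * a * ((dF K q (nh K q) - \<kappa> * ss K q * (ww K q \<bullet> nh K q)) / (sqrt b * ss K q)) = - 1"
    unfolding nv_inner[OF K q] .
  have "dF K q (nh K q) = dF K q (xr K q) / (sqrt b * ss K q)"
    using linear_scale[OF linear_dF[OF K yy_in[OF K q]]] by (simp add: nh_def)
  moreover have "ww K q \<bullet> nh K q = 1 / sqrt b" using s0 by (simp add: nh_def)
  ultimately have "2 * a * ((dF K q (xr K q) / (sqrt b * ss K q) - \<kappa> * ss K q / sqrt b) / (sqrt b * ss K q)) = - 1"
    using e by simp
  moreover have "2 * a * ((d / (c * s) - k * s / c) / (c * s)) = - 1 \<Longrightarrow>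
      2 * a * (d - k * s\<^sup>2) = - (c * c) * s\<^sup>2" if "c \<noteq> 0" "s \<noteq> 0" for d c s k :: real
    using that by (simp add: field_simps power2_eq_square)
  ultimately have "2 * a * (dF K q (xr K q) - \<kappa> * (ss K q)\<^sup>2) = - (sqrt b * sqrt b) * (ss K q)\<^sup>2"
    using s0 sb_pos(3) by blast
  then have "2 * a * dF K q (xr K q) = (2 * a * \<kappa>) * (ss K q)\<^sup>2 - b * (ss K q)\<^sup>2"
    unfolding sb_pos(2) by (simp add: algebra_simps)
  then show ?thesis using a_pos by (simp add: \<kappa>_eq yq)
qed

context
  fixes q K
  assumes qB: "q \<in> points B" and K: "K \<in> M" and q: "q \<in> fst (TC K)"
begin

lemmas s0 = ss_nonzero[OF qB K q]
lemmas yq' = yy_in[OF K q]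
lemmas Nq = N_adapted[OF qB K q]
lemmas lin_dF = linear_dF[OF K yq']

lemma dF_nh: "dF K q (nh K q) = 0"
  using linear_scale[OF lin_dF] dF_xi[OF K yq'] by (simp add: nh_def)

lemma ww_nh: "ww K q \<bullet> nh K q = 1 / sqrt b"
  using s0 by (simp add: nh_def)

lemma nv_xi: "nv K q \<bullet> xr K q = - \<kappa> * ss K q / sqrt b"
  unfolding nv_inner[OF K q] dF_xi[OF K yq'] using s0 by simp

lemma nv_nh: "2 * a * (nv K q \<bullet> nh K q) = - 1"
  using unit qB G_adapted[OF K q Nq(1,1)] by (simp only: timelike_unit_normal_def Nq(2,3)) (auto simp: algebra_simps)

lemma ver_xi:
  assumes v: "v \<in> tangent_space B q"
  shows "iv K q v \<bullet> xr K q = \<kappa> * ss K q * (ww K q \<bullet> ih K q v) - dF K q (ih K q v)"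
proof -
  have "G q (ic q v) (N q) = 0" using unit qB v by (simp add: timelike_unit_normal_def)
  then have "iv K q v \<bullet> nh K q + nv K q \<bullet> ih K q v = 0"
    using a_pos unfolding G_adapted[OF K q incl_tangent[OF qB v] Nq(1)] Nq(2,3) by simp
  then have "(iv K q v \<bullet> xr K q + (dF K q (ih K q v) - \<kappa> * ss K q * (ww K q \<bullet> ih K q v))) / (sqrt b * ss K q) = 0"
    unfolding nv_inner[OF K q] by (simp add: nh_def add_divide_distrib)
  then show ?thesis using s0 sb_pos(3) by simp
qed

text \<open>Conversely, for reasons of dimension, every vector satisfying the linearised equation of the
  hypersurface is tangent to it.\<close>

lemma in_incl_image:
  assumes u: "u \<in> tangent_space TM q"
    and eq: "vv K q u \<bullet> xr K q = \<kappa> * ss K q * (ww K q \<bullet> hh K u) - dF K q (hh K u)"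
  shows "\<exists>v\<in>tangent_space B q. ic q v = u"
proof -
  obtain C where C: "C \<in> B" "q \<in> fst C" using L.point_chart qB by blast
  note TKq = TC_in[OF K] q
  \<comment> \<open>The linearised equation of the hypersurface; its kernel and the tangent space have equal dimension.\<close>
  define l where "l z = vv K q (coord_vec TM (TC K) q z) \<bullet> xr K q
      - \<kappa> * ss K q * (ww K q \<bullet> hh K (coord_vec TM (TC K) q z)) + dF K q (hh K (coord_vec TM (TC K) q z))" for z
  note ll = linear_add linear_scale
  have linl: "linear l"
    by (rule linearI) (simp_all add: l_def ll[OF T.linear_coord_vec[OF TKq]] ll[OF linear_hh] ll[OF linear_vv[OF K q]]
        ll[OF lin_dF] inner_add_left inner_add_right algebra_simps)
  define c where "c = (\<Sum>e\<in>Basis. l e *\<^sub>R e)"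
  have lc: "l z = c \<bullet> z" for z
    unfolding c_def inner_sum_left by (subst linear_euclidean_sum[OF linl, of z]) (simp add: inner_commute[of _ z] mult.commute)
  have "l (0, xr K q) = xr K q \<bullet> xr K q"
    by (simp add: l_def hh_coord[OF K q] vv_coord[OF K q] linear_0[OF linear_dual_chr[OF K yq']] linear_0[OF lin_dF])
  then have "c \<noteq> 0" using xr_nonzero[OF K yq'] lc[of "(0, xr K q)"] by auto
  then have dimk: "dim {z. c \<bullet> z = 0} = 2 * DIM('e) - 1" by (simp add: dim_hyperplane)
  let ?L = "fd (iota C K) (snd C q)"
  have W: "L.opn (fst C \<inter> fst (TC K))" by (rule opn_pair[OF C(1) K])
  have linL: "linear ?L"
    by (rule linear_fd[OF smooth_iota[OF C(1) K order_refl] L.open_img[OF C(1) W]]) (use C q in auto)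
  have "range ?L \<subseteq> {z. c \<bullet> z = 0}"
  proof
    fix z assume "z \<in> range ?L"
    then obtain v where v: "z = ?L v" by auto
    have "l z = 0"
      using ver_xi[OF L.coord_vec_tangent[OF C, of v]] unfolding incl_coord_vec[OF C K q] v l_def by simp
    then show "z \<in> {z. c \<bullet> z = 0}" by (simp add: lc)
  qed
  moreover have "dim (range ?L) = 2 * DIM('e) - 1"
    using dim_image_eq[OF linL, of UNIV] inj_fd_iota[OF C K q] by (simp add: dim_h)
  ultimately have "range ?L = {z. c \<bullet> z = 0}"
    by (intro subspace_dim_equal) (auto simp: dimk subspace_hyperplane intro: linear_subspace_image[OF linL])
  moreover obtain z where z: "u = coord_vec TM (TC K) q z" using u T.tangent_space_chart[OF TKq] by auto
  moreover have "c \<bullet> z = 0" using eq unfolding lc[symmetric] l_def z[symmetric] by simp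
  ultimately obtain v where "z = ?L v" by auto
  then have "ic q (coord_vec B C q v) = u" by (simp add: incl_coord_vec[OF C K q] z)
  then show ?thesis using L.coord_vec_tangent[OF C] by blast
qed

lemma tp_incl:
  assumes u: "u \<in> tangent_space TM q"
    and eq: "vv K q u \<bullet> xr K q = \<kappa> * ss K q * (ww K q \<bullet> hh K u) - dF K q (hh K u)"
  shows "tp q u \<in> tangent_space B q" "ic q (tp q u) = u"
proof -
  have "u \<in> ic q ` tangent_space B q" using in_incl_image[OF u eq] by blast
  then show "tp q u \<in> tangent_space B q" "ic q (tp q u) = u"
    unfolding tangent_part_def by (rule inv_into_into, rule f_inv_into_f)
qed

lemma B_eqI:
  assumes "u \<in> tangent_space B q" "v \<in> tangent_space B q" "ih K q u = ih K q v" "iv K q u = iv K q v"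
  shows "u = v"
  by (rule inj_onD[OF incl_inj[OF qB] adapted_eqI[OF K q incl_tangent[OF qB assms(1)]
          incl_tangent[OF qB assms(2)] assms(3,4)] assms(1,2)])

lemma g_adapted:
  assumes "u \<in> tangent_space B q" "v \<in> tangent_space B q"
  shows "g q u v = a * (iv K q u \<bullet> ih K q v + iv K q v \<bullet> ih K q u)"
  using G_adapted[OF K q] incl_tangent[OF qB] assms by (simp add: induced_metric_def)

lemma PN: "P q (N q) \<in> tangent_space TM q" "hh K (P q (N q)) = nh K q" "vv K q (P q (N q)) = - nv K q"
  using P_tangent[OF K q Nq(1)] P_adapted[OF K q Nq(1)] Nq by auto

text \<open>Orthogonality to \<open>N\<close> determines the sum of the two products, and the definition of \<open>\<eta>\<close> by \<open>P N\<close>,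
  which differs from \<open>N\<close> by the sign of the vertical component, determines their difference.\<close>

lemma eta_halves:
  assumes v: "v \<in> tangent_space B q"
  shows "2 * a * (iv K q v \<bullet> nh K q) = eta q v" "2 * a * (nv K q \<bullet> ih K q v) = - eta q v"
proof -
  have "G q (ic q v) (N q) = 0" using unit qB v by (simp add: timelike_unit_normal_def)
  then have "iv K q v \<bullet> nh K q + nv K q \<bullet> ih K q v = 0"
    using a_pos unfolding G_adapted[OF K q incl_tangent[OF qB v] Nq(1)] Nq(2,3) by simp
  then have 1: "nv K q \<bullet> ih K q v = - (iv K q v \<bullet> nh K q)" by linarith
  have 2: "eta q v = a * (iv K q v \<bullet> nh K q - nv K q \<bullet> ih K q v)"
    using v unfolding eta_def G_adapted[OF K q incl_tangent[OF qB v] PN(1)] PN(2,3) by simp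
  then show "2 * a * (iv K q v \<bullet> nh K q) = eta q v" "2 * a * (nv K q \<bullet> ih K q v) = - eta q v"
    unfolding 2 1 by (simp_all add: algebra_simps)
qed

lemma eta_adapted:
  assumes v: "v \<in> tangent_space B q"
  shows "eta q v = sqrt b * (ww K q \<bullet> ih K q v) - 2 * a / (sqrt b * ss K q) * dF K q (ih K q v)"
proof -
  have "eta q v = - (2 * a * ((dF K q (ih K q v) - \<kappa> * ss K q * (ww K q \<bullet> ih K q v)) / (sqrt b * ss K q)))"
    using eta_halves(2)[OF v] nv_inner[OF K q] by simp
  also have "\<dots> = (2 * a * \<kappa>) * (ww K q \<bullet> ih K q v) / sqrt b - 2 * a / (sqrt b * ss K q) * dF K q (ih K q v)"
    using s0 sb_pos(3) by (simp add: field_simps)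
  also have "(2 * a * \<kappa>) * (ww K q \<bullet> ih K q v) / sqrt b = sqrt b * (ww K q \<bullet> ih K q v)"
    unfolding \<kappa>_eq using sb_pos by (simp add: field_simps)
  finally show ?thesis .
qed

lemma xibar_adapted: "xibar q \<in> tangent_space B q" "ih K q (xibar q) = nh K q" "iv K q (xibar q) = - nv K q"
proof -
  have "vv K q (P q (N q)) \<bullet> xr K q = \<kappa> * ss K q * (ww K q \<bullet> hh K (P q (N q))) - dF K q (hh K (P q (N q)))"
    unfolding PN(2,3) inner_minus_left nv_xi dF_nh ww_nh by simp
  note * = tp_incl[OF PN(1) this]
  show "xibar q \<in> tangent_space B q" "ih K q (xibar q) = nh K q" "iv K q (xibar q) = - nv K q"
    unfolding xibar_def using *(1) by (simp_all only: *(2) PN(2,3))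
qed

lemma eta_xibar: "eta q (xibar q) = 1"
  unfolding eta_adapted[OF xibar_adapted(1)] xibar_adapted(2) dF_nh ww_nh using sb_pos by simp

lemma phi_adapted:
  assumes v: "v \<in> tangent_space B q"
  shows "phi q v \<in> tangent_space B q" "ih K q (phi q v) = ih K q v - eta q v *\<^sub>R nh K q"
    "iv K q (phi q v) = - iv K q v - eta q v *\<^sub>R nv K q"
proof -
  let ?u = "P q (ic q v) - eta q v *\<^sub>R N q"
  note iv = incl_tangent[OF qB v]
  have u: "?u \<in> tangent_space TM q"
    by (intro subspace_diff subspace_scale T.subspace_tangent_space q_point[OF K q] P_tangent[OF K q iv] Nq(1))
  have h: "hh K ?u = ih K q v - eta q v *\<^sub>R nh K q"
    by (simp only: linear_diff[OF linear_hh] linear_scale[OF linear_hh] P_adapted[OF K q iv] Nq(2))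
  have v': "vv K q ?u = - iv K q v - eta q v *\<^sub>R nv K q"
    by (simp only: linear_diff[OF linear_vv[OF K q]] linear_scale[OF linear_vv[OF K q]] P_adapted[OF K q iv] Nq(3))
  have e: "eta q v * (\<kappa> * ss K q / sqrt b) = \<kappa> * ss K q * (ww K q \<bullet> ih K q v) - dF K q (ih K q v)"
  proof -
    have "2 * a * (\<kappa> * ss K q * (ww K q \<bullet> ih K q v) - dF K q (ih K q v)) = 2 * a * (iv K q v \<bullet> nh K q) * (sqrt b * ss K q)"
      using ver_xi[OF v] s0 sb_pos(3) by (simp add: nh_def)
    also have "\<dots> = eta q v * (sqrt b * ss K q)" unfolding eta_halves(1)[OF v] ..
    also have "\<dots> = 2 * a * (eta q v * (\<kappa> * ss K q / sqrt b))"
    proof -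
      have "2 * a * (eta q v * (\<kappa> * ss K q / sqrt b)) = (2 * a * \<kappa>) * eta q v * ss K q / sqrt b" by simp
      also have "\<dots> = eta q v * (sqrt b * ss K q)" unfolding \<kappa>_eq using sb_pos by (simp add: field_simps)
      finally show ?thesis ..
    qed
    finally have "2 * a * (\<kappa> * ss K q * (ww K q \<bullet> ih K q v) - dF K q (ih K q v)) = 2 * a * (eta q v * (\<kappa> * ss K q / sqrt b))" .
    moreover have "2 * a \<noteq> 0" using a_pos by simp
    ultimately show ?thesis by (metis mult_left_cancel)
  qed
  have "vv K q ?u \<bullet> xr K q = - (\<kappa> * ss K q * (ww K q \<bullet> ih K q v) - dF K q (ih K q v)) + eta q v * (\<kappa> * ss K q / sqrt b)"
    unfolding v' inner_diff_left inner_minus_left inner_scaleR_left nv_xi ver_xi[OF v] by simp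
  moreover have "\<kappa> * ss K q * (ww K q \<bullet> hh K ?u) - dF K q (hh K ?u)
      = \<kappa> * ss K q * (ww K q \<bullet> ih K q v) - dF K q (ih K q v) - eta q v * (\<kappa> * ss K q / sqrt b)"
    unfolding h inner_diff_right linear_diff[OF lin_dF] inner_scaleR_right[of _ "eta q v"] linear_scale[OF lin_dF, of "eta q v"] ww_nh dF_nh
    by (simp add: algebra_simps)
  ultimately have "vv K q ?u \<bullet> xr K q = \<kappa> * ss K q * (ww K q \<bullet> hh K ?u) - dF K q (hh K ?u)"
    using e by simp
  note * = tp_incl[OF u this]
  show "phi q v \<in> tangent_space B q" "ih K q (phi q v) = ih K q v - eta q v *\<^sub>R nh K q"
    "iv K q (phi q v) = - iv K q v - eta q v *\<^sub>R nv K q"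
    unfolding phi_def using *(1) by (simp_all only: *(2) h v')
qed

lemma linear_ih: "linear (ih K q)"
  using linear_compose[OF linear_incl linear_hh] by (simp add: o_def)

lemma linear_iv: "linear (iv K q)"
  using linear_compose[OF linear_incl linear_vv[OF K q]] by (simp add: o_def)

lemma eta_lin:
  assumes "u \<in> tangent_space B q" "v \<in> tangent_space B q"
  shows "eta q (r *\<^sub>R u + s *\<^sub>R v) = r * eta q u + s * eta q v"
  unfolding eta_adapted[OF L.tangent_lin[OF qB assms]] eta_adapted[OF assms(1)] eta_adapted[OF assms(2)]
  by (simp add: linear_add[OF linear_ih] linear_scale[OF linear_ih] linear_add[OF lin_dF] linear_scale[OF lin_dF]
      inner_add_right algebra_simps add_divide_distrib)

lemma eta_phi: "v \<in> tangent_space B q \<Longrightarrow> eta q (phi q v) = 0"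
proof -
  assume v: "v \<in> tangent_space B q"
  have "eta q (phi q v) = (sqrt b * (ww K q \<bullet> ih K q v) - 2 * a / (sqrt b * ss K q) * dF K q (ih K q v))
      - eta q v * (sqrt b * (ww K q \<bullet> nh K q) - 2 * a / (sqrt b * ss K q) * dF K q (nh K q))"
    unfolding eta_adapted[OF phi_adapted(1)[OF v]] phi_adapted(2)[OF v] inner_diff_right linear_diff[OF lin_dF]
      inner_scaleR_right[of _ "eta q v"] linear_scale[OF lin_dF, of "eta q v"]
    by (simp only: right_diff_distrib mult.left_commute[of _ "eta q v"]) simp
  also have "\<dots> = 0" unfolding dF_nh ww_nh using eta_adapted[OF v] sb_pos by simp
  finally show ?thesis .
qed

lemma phi_xibar: "phi q (xibar q) = 0"
  by (rule B_eqI[OF phi_adapted(1)[OF xibar_adapted(1)]])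
     (simp_all only: phi_adapted(2,3)[OF xibar_adapted(1)] eta_xibar xibar_adapted(2,3)
       linear_0[OF linear_ih] linear_0[OF linear_iv] subspace_0[OF L.subspace_tangent_space[OF qB]]
       scaleR_one minus_minus diff_self)

lemma perp_tangent: "v \<in> tangent_space B q \<Longrightarrow> v - eta q v *\<^sub>R xibar q \<in> tangent_space B q"
  by (intro subspace_diff subspace_scale L.subspace_tangent_space[OF qB] xibar_adapted(1))

lemma phi_phi:
  assumes v: "v \<in> tangent_space B q"
  shows "phi q (phi q v) = v - eta q v *\<^sub>R xibar q"
  by (rule B_eqI[OF phi_adapted(1)[OF phi_adapted(1)[OF v]] perp_tangent[OF v]])
     (simp_all only: phi_adapted(2,3)[OF phi_adapted(1)[OF v]] phi_adapted(2,3)[OF v] eta_phi[OF v]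
       linear_diff[OF linear_ih] linear_diff[OF linear_iv] linear_scale[OF linear_ih] linear_scale[OF linear_iv]
       xibar_adapted(2,3), simp_all)

lemma g_phi_right:
  assumes u: "u \<in> tangent_space B q" and v: "v \<in> tangent_space B q"
  shows "g q u (phi q v) = a * (iv K q u \<bullet> ih K q v - iv K q v \<bullet> ih K q u)"
proof -
  have "g q u (phi q v) = a * (iv K q u \<bullet> ih K q v - iv K q v \<bullet> ih K q u)
      - eta q v * (2 * a * (iv K q u \<bullet> nh K q) + 2 * a * (nv K q \<bullet> ih K q u)) / 2"
    unfolding g_adapted[OF u phi_adapted(1)[OF v]] phi_adapted(2,3)[OF v] inner_diff_left inner_diff_right
      inner_scaleR_right[of _ "eta q v"] inner_scaleR_left[of "eta q v"] inner_minus_left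
    by (simp add: algebra_simps)
  then show ?thesis unfolding eta_halves[OF u] by simp
qed

lemma g_sym: "u \<in> tangent_space B q \<Longrightarrow> v \<in> tangent_space B q \<Longrightarrow> g q u v = g q v u"
  by (simp add: g_adapted)

lemma g_phi_left:
  assumes "u \<in> tangent_space B q" "v \<in> tangent_space B q"
  shows "g q (phi q u) v = - g q u (phi q v)"
  unfolding g_sym[OF phi_adapted(1)[OF assms(1)] assms(2)] g_phi_right[OF assms] g_phi_right[OF assms(2,1)]
  by (simp add: algebra_simps)

lemma g_lin:
  assumes "u \<in> tangent_space B q" "v \<in> tangent_space B q" "z \<in> tangent_space B q"
  shows "g q (r *\<^sub>R u + s *\<^sub>R v) z = r * g q u z + s * g q v z"
    "g q z (r *\<^sub>R u + s *\<^sub>R v) = r * g q z u + s * g q z v"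
  using assms L.tangent_lin[OF qB assms(1,2)]
  by (simp_all add: g_adapted linear_add[OF linear_ih] linear_scale[OF linear_ih] linear_add[OF linear_iv]
      linear_scale[OF linear_iv] inner_add_left inner_add_right algebra_simps)

lemma g_xibar: "v \<in> tangent_space B q \<Longrightarrow> g q v (xibar q) = eta q v"
  using xibar_adapted(1) PN(1) incl_tangent[OF qB] G_adapted[OF K q] by (simp add: eta_def induced_metric_def PN(2,3) xibar_adapted(2,3))

lemma g_phi_phi:
  assumes u: "u \<in> tangent_space B q" and v: "v \<in> tangent_space B q"
  shows "g q (phi q u) (phi q v) = - g q u v + eta q u * eta q v"
proof -
  have "g q (phi q u) (phi q v) = - g q u (1 *\<^sub>R v + (- eta q v) *\<^sub>R xibar q)"
    using g_phi_left[OF u phi_adapted(1)[OF v]] by (simp add: phi_phi[OF v])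
  also have "\<dots> = - g q u v + eta q u * eta q v"
    unfolding g_lin(2)[OF v xibar_adapted(1) u] g_xibar[OF u] by simp
  finally show ?thesis .
qed

text \<open>An arbitrary ambient vector becomes tangent after adding a multiple of \<open>N\<close>, and this does not
  change its product with \<open>u\<close>.\<close>

lemma g_nondegenerate:
  assumes u: "u \<in> tangent_space B q" and 0: "\<And>v. v \<in> tangent_space B q \<Longrightarrow> g q u v = 0"
  shows "u = 0"
proof -
  have iu: "ic q u \<in> tangent_space TM q" by (rule incl_tangent[OF qB u])
  have "iv K q u \<bullet> k + l \<bullet> ih K q u = 0" for k l
  proof -
    let ?z = "of_parts K q k l"
    \<comment> \<open>The product of \<open>?z\<close> with \<open>N\<close> is \<open>a * ?r\<close>, and \<open>N\<close> has square \<open>-1\<close>.\<close>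
    let ?r = "nv K q \<bullet> k + l \<bullet> nh K q"
    let ?z' = "?z + (a * ?r) *\<^sub>R N q"
    have z: "?z \<in> tangent_space TM q" by (rule of_parts_simps(3)[OF K q])
    have z': "?z' \<in> tangent_space TM q"
      by (intro subspace_add subspace_scale T.subspace_tangent_space q_point[OF K q] z Nq(1))
    have hz: "hh K ?z' = k + (a * ?r) *\<^sub>R nh K q" "vv K q ?z' = l + (a * ?r) *\<^sub>R nv K q"
      by (simp_all only: linear_add[OF linear_hh] linear_scale[OF linear_hh] linear_add[OF linear_vv[OF K q]]
          linear_scale[OF linear_vv[OF K q]] of_parts_simps[OF K q] Nq(2,3))
    have "nv K q \<bullet> hh K ?z' + vv K q ?z' \<bullet> nh K q = ?r + (2 * a * (nv K q \<bullet> nh K q)) * ?r"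
      unfolding hz inner_add_left inner_add_right inner_scaleR_right[of _ "a * ?r"] inner_scaleR_left[of "a * ?r"]
      by (simp add: algebra_simps)
    then have "nv K q \<bullet> hh K ?z' + vv K q ?z' \<bullet> nh K q = 0" unfolding nv_nh by simp
    then have "(vv K q ?z' \<bullet> xr K q + (dF K q (hh K ?z') - \<kappa> * ss K q * (ww K q \<bullet> hh K ?z'))) / (sqrt b * ss K q) = 0"
      unfolding nv_inner[OF K q] by (simp add: nh_def add_divide_distrib)
    then have "vv K q ?z' \<bullet> xr K q = \<kappa> * ss K q * (ww K q \<bullet> hh K ?z') - dF K q (hh K ?z')"
      using s0 sb_pos(3) by simp
    then obtain v where v: "v \<in> tangent_space B q" "ic q v = ?z'" using in_incl_image[OF z'] by blast
    have "0 = a * (iv K q u \<bullet> hh K ?z' + vv K q ?z' \<bullet> ih K q u)"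
      using 0[OF v(1)] g_adapted[OF u v(1)] by (simp add: v(2))
    also have "\<dots> = a * (iv K q u \<bullet> k + l \<bullet> ih K q u) + (a * ?r) * (2 * a * (iv K q u \<bullet> nh K q) + 2 * a * (nv K q \<bullet> ih K q u)) / 2"
      unfolding hz inner_add_left inner_add_right inner_scaleR_right[of _ "a * ?r"] inner_scaleR_left[of "a * ?r"]
      by (simp add: algebra_simps)
    finally show ?thesis unfolding eta_halves[OF u] using a_pos by simp
  qed
  from this[of "iv K q u" 0] this[of 0 "ih K q u"] have "iv K q u = 0" "ih K q u = 0" by simp_all
  then show ?thesis
    by (intro B_eqI[OF u subspace_0[OF L.subspace_tangent_space[OF qB]]])
       (simp_all only: linear_0[OF linear_ih] linear_0[OF linear_iv])
qed

end

end

context level_hypersurface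
begin

subsection \<open>Transfer to the calculus along the parametrisation\<close>

lemma base_calc:
  assumes K: "K \<in> M"
  shows "base_calculus (snd K ` fst K) (\<Gamma> K) (rep K xi) (FK K)"
  by (rule base_calculus.intro)
     (rule open_img_fst[OF K] smooth_\<Gamma>[OF K] smooth_xi[OF K] smooth_FK[OF K]
       linear_\<Gamma>(1)[OF K] linear_\<Gamma>(2)[OF K] \<Gamma>_symmetric[OF symmetric K] \<Gamma>_parallel[OF xi_par xi K] dF_xi[OF K],
       assumption?)+

lemma iota_at:
  assumes "C \<in> B" "q \<in> fst C"
  shows "iota C K (snd C q) = (yy K q, ww K q)"
  by (simp add: iota_def L.chart_inv_left[OF assms] snd_TC)

lemma W_points: "L.opn W \<Longrightarrow> q \<in> W \<Longrightarrow> q \<in> points B"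
  using L.opn_sub by blast

lemma surface_calc:
  assumes C: "C \<in> B" and K: "K \<in> M" and W: "L.opn W" "W \<subseteq> fst C \<inter> fst (TC K)"
  shows "surface_calculus (snd K ` fst K) (\<Gamma> K) (rep K xi) (FK K) (snd C ` W)
    (\<lambda>y. fst (iota C K y)) (\<lambda>y. snd (iota C K y)) a b t"
proof -
  interpret base_calculus "snd K ` fst K" "\<Gamma> K" "rep K xi" "FK K" by (rule base_calc[OF K])
  have WC: "W \<subseteq> fst C" using W(2) by blast
  note o = L.open_img[OF C W(1) WC]
  show ?thesis
  proof
    show "open (snd C ` W)" by (rule o)
    show "C_infinity (snd C ` W) (\<lambda>y. fst (iota C K y))" "C_infinity (snd C ` W) (\<lambda>y. snd (iota C K y))"
      by (intro C_infinity_fst C_infinity_snd o smooth_iota[OF C K W(2)])+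
    fix y assume "y \<in> snd C ` W"
    then obtain q where q: "q \<in> W" "y = snd C q" by blast
    have qC: "q \<in> fst C" "q \<in> fst (TC K)" using q W(2) by auto
    note i = iota_at[OF C qC(1)] and qB = W_points[OF W(1) q(1)]
    show "fst (iota C K y) \<in> snd K ` fst K" using yy_in[OF K qC(2)] by (simp add: q i)
    show "snd (iota C K y) \<bullet> rep K xi (fst (iota C K y)) + FK K (fst (iota C K y)) = t"
      using in_B_iff[OF K qC(2)] qB by (simp add: q i)
    show "snd (iota C K y) \<bullet> rep K xi (fst (iota C K y)) \<noteq> 0"
      using ss_nonzero[OF qB K qC(2)] by (simp add: q i)
  qed (rule a_pos, rule b_pos)
qed

lemma local_domain:
  assumes "L.opn U" "q \<in> U"
  obtains C K W where "C \<in> B" "K \<in> M" "L.opn W" "W \<subseteq> fst C \<inter> fst (TC K)" "q \<in> W" "W \<subseteq> U"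
proof -
  have qB: "q \<in> points B" by (rule W_points[OF assms])
  obtain C where C: "C \<in> B" "q \<in> fst C" using L.point_chart qB by blast
  obtain K where K: "K \<in> M" "q \<in> fst (TC K)" using chart_at qB points_B_TM by blast
  show ?thesis
    by (rule that[OF C(1) K(1), of "U \<inter> (fst C \<inter> fst (TC K))"])
       (use assms opn_pair[OF C(1) K(1)] C K in auto)
qed

definition curv_at :: "('p, 'e) chart \<Rightarrow> 'p cot \<Rightarrow> 'e \<Rightarrow> 'e \<Rightarrow> 'e \<Rightarrow> 'e"
  where "curv_at K q = base_calculus.R (\<Gamma> K) (yy K q)"

definition hess_at :: "('p, 'e) chart \<Rightarrow> 'p cot \<Rightarrow> 'e \<Rightarrow> 'e \<Rightarrow> real"
  where "hess_at K q = base_calculus.Hess (\<Gamma> K) (FK K) (yy K q)"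

text \<open>The summands of \<open>g((\<nabla>\<^sub>u \<phi>) v, z)\<close> as functions of vectors at one point, computed in a chart \<open>K\<close> of
  the base manifold.\<close>

definition hess_form :: "('p, 'e) chart \<Rightarrow> 'p cot \<Rightarrow> 'p cot tvec \<Rightarrow> 'p cot tvec \<Rightarrow> real"
  where "hess_form K q u v = - a / (sqrt b * ss K q) *
    (hess_at K q (ih K q u) (ih K q v) + 2 / ss K q * dF K q (ih K q u) * dF K q (ih K q v))"

definition curv_form :: "('p, 'e) chart \<Rightarrow> 'p cot \<Rightarrow> 'p cot tvec \<Rightarrow> 'p cot tvec \<Rightarrow> real"
  where "curv_form K q u v = - a / (sqrt b * ss K q) * (ww K q \<bullet> curv_at K q (ih K q v) (xr K q) (ih K q u))"

definition second_form :: "('p, 'e) chart \<Rightarrow> 'p cot \<Rightarrow> 'p cot tvec \<Rightarrow> 'p cot tvec \<Rightarrow> real"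
  where "second_form K q u v = sqrt b / (2 * a) * (g q u v + eta q u * eta q v) + hess_form K q u v + curv_form K q u v"

definition curv_term :: "('p, 'e) chart \<Rightarrow> 'p cot \<Rightarrow> 'p cot tvec \<Rightarrow> 'p cot tvec \<Rightarrow> 'p cot tvec \<Rightarrow> real"
  where "curv_term K q u v z = - 2 * a * (ww K q \<bullet> curv_at K q (ih K q v) (ih K q z) (ih K q u))"

definition F_tensor :: "('p, 'e) chart \<Rightarrow> 'p cot \<Rightarrow> 'p cot tvec \<Rightarrow> 'p cot tvec \<Rightarrow> 'p cot tvec \<Rightarrow> real"
  where "F_tensor K q u v z = curv_term K q u v z + eta q v * second_form K q u z - eta q z * second_form K q u v"

context
  fixes C K W
  assumes C: "C \<in> B" and K: "K \<in> M" and W: "L.opn W" "W \<subseteq> fst C \<inter> fst (TC K)"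
begin

interpretation sc: surface_calculus "snd K ` fst K" "\<Gamma> K" "rep K xi" "FK K" "snd C ` W"
    "\<lambda>y. fst (iota C K y)" "\<lambda>y. snd (iota C K y)" a b t
  by (rule surface_calc[OF C K W])

lemma W_sub: "W \<subseteq> fst C" "W \<subseteq> fst (TC K)" using W(2) by auto

lemma W_in: "q \<in> W \<Longrightarrow> q \<in> fst C" "q \<in> W \<Longrightarrow> q \<in> fst (TC K)" "q \<in> W \<Longrightarrow> snd C q \<in> snd C ` W" using W(2) by auto

lemmas W_pt = W_points[OF W(1)]
lemmas iota_W = iota_at[OF C W_in(1)]

lemma fd_iota:
  assumes q: "q \<in> W"
  shows "fd (\<lambda>y. fst (iota C K y)) (snd C q) u = fst (fd (iota C K) (snd C q) u)"
    "fd (\<lambda>y. snd (iota C K y)) (snd C q) u = snd (fd (iota C K) (snd C q) u)"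
  using fd_eq[OF has_derivative_fst[OF C_infinity_has_derivative[OF smooth_iota[OF C K W(2)] sc.open_\<Omega> W_in(3)[OF q]]]]
    fd_eq[OF has_derivative_snd[OF C_infinity_has_derivative[OF smooth_iota[OF C K W(2)] sc.open_\<Omega> W_in(3)[OF q]]]]
  by simp_all

lemma components_hor:
  assumes q: "q \<in> W"
  shows "ih K q (coord_vec B C q (V (snd C q))) = sc.hor V (snd C q)"
    "iv K q (coord_vec B C q (V (snd C q))) = sc.ver V (snd C q)"
proof -
  note i = incl_coord_vec[OF C W_in(1)[OF q] K W_in(2)[OF q]]
  obtain h A where hA: "fd (iota C K) (snd C q) (V (snd C q)) = (h, A)" by fastforce
  show 1: "ih K q (coord_vec B C q (V (snd C q))) = sc.hor V (snd C q)"
    unfolding i hA hh_coord[OF K W_in(2)[OF q]] sc.hor_def fd_iota[OF q] by simp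
  show "iv K q (coord_vec B C q (V (snd C q))) = sc.ver V (snd C q)"
    unfolding i hA vv_coord[OF K W_in(2)[OF q]] sc.ver_def sc.hor_def fd_iota[OF q] iota_W[OF q]
      dual_chr_def sc.dual_\<Gamma>_def \<kappa>_def sc.\<kappa>_def by simp
qed

lemma components_chart_field:
  assumes q: "q \<in> W"
  shows "ih K q (L.chart_field C V q) = sc.hor V (snd C q)" "iv K q (L.chart_field C V q) = sc.ver V (snd C q)"
  using components_hor[OF q] by (simp_all add: L.chart_field_def)

lemma components_rep:
  assumes "q \<in> W" "X q \<in> tangent_space B q"
  shows "sc.hor (rep C X) (snd C q) = ih K q (X q)" "sc.ver (rep C X) (snd C q) = iv K q (X q)"
  using components_chart_field[OF assms(1), of "rep C X"] L.chart_field_rep[of C q X] C W_in(1)[OF assms(1)] assms(2) by simp_all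

lemma components_vf:
  assumes "X \<in> vfields B W" "q \<in> W"
  shows "sc.hor (rep C X) (snd C q) = ih K q (X q)" "sc.ver (rep C X) (snd C q) = iv K q (X q)"
  by (rule components_rep[where X = X and q = q, OF assms(2) L.vf_tangent[OF assms]])+

lemma sc_s: "q \<in> W \<Longrightarrow> sc.s (snd C q) = ss K q"
  by (simp add: sc.s_def iota_W)

lemma sc_n: "q \<in> W \<Longrightarrow> sc.nh (snd C q) = nh K q" "q \<in> W \<Longrightarrow> sc.nv (snd C q) = nv K q"
  by (simp_all add: sc.nh_def sc.nv_def sc_s iota_W nh_def nv_def \<kappa>_def sc.\<kappa>_def)

lemma sc_eta:
  assumes X: "X \<in> vfields B W" and q: "q \<in> W"
  shows "sc.eta (rep C X) (snd C q) = eta q (X q)"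
  unfolding sc.eta_def components_vf[OF X q] sc_s[OF q] iota_W[OF q]
    eta_adapted[OF W_pt[OF q] K W_in(2)[OF q] L.vf_tangent[OF X q]] by simp

lemma sc_met:
  assumes X: "X \<in> vfields B W" and Y: "Y \<in> vfields B W" and q: "q \<in> W"
  shows "sc.met (sc.hor (rep C X) (snd C q)) (sc.ver (rep C X) (snd C q)) (sc.hor (rep C Y) (snd C q)) (sc.ver (rep C Y) (snd C q))
    = g q (X q) (Y q)"
  unfolding components_vf[OF X q] components_vf[OF Y q] sc.met_def
    g_adapted[OF W_pt[OF q] K W_in(2)[OF q] L.vf_tangent[OF X q] L.vf_tangent[OF Y q]] by simp

lemma smooth_rep: "X \<in> vfields B W \<Longrightarrow> C_infinity (snd C ` W) (rep C X)"
  using L.vf_rep[OF _ C W(1), of X W] W_sub by simp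

lemma chart_fun:
  assumes "C_infinity (snd C ` W) F'" "\<And>q. q \<in> W \<Longrightarrow> F' (snd C q) = F q"
  shows "F \<in> smooth_funs B W"
  by (rule L.sf_chart[OF C W(1) W_sub(1)], rule C_infinity_cong[OF sc.open_\<Omega> assms(1)])
     (use assms(2) L.chart_inv_left[OF C W_in(1)] in auto)

text \<open>The coordinates of \<open>Z\<close> solve the linear system given by the derivative of \<open>iota\<close>.\<close>

lemma field_of_components:
  assumes Z: "\<And>q. q \<in> W \<Longrightarrow> Z q \<in> tangent_space B q"
    and p: "C_infinity (snd C ` W) p" "\<And>q. q \<in> W \<Longrightarrow> ih K q (Z q) = p (snd C q)"
    and r: "C_infinity (snd C ` W) r" "\<And>q. q \<in> W \<Longrightarrow> iv K q (Z q) = r (snd C q)"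
  shows "Z \<in> vfields B W"
proof (rule L.vf_chart[OF C W(1) W_sub(1) Z])
  let ?x = "\<lambda>y. fst (iota C K y)" and ?w = "\<lambda>y. snd (iota C K y)"
  show "C_infinity (snd C ` W) (rep C Z)"
  proof (rule C_infinity_solve_injective[OF sc.open_\<Omega> smooth_iota[OF C K W(2)]])
    show "C_infinity (snd C ` W) (\<lambda>y. (p y, r y + sc.dual_\<Gamma> (?x y) (?w y) (p y) - (sc.\<kappa> * (?w y \<bullet> p y)) *\<^sub>R ?w y))"
      by (intro C_infinity_Pair C_infinity_add C_infinity_diff C_infinity_scaleR C_infinity_mult C_infinity_inner
          C_infinity_const sc.open_\<Omega> p(1) r(1) sc.smooth_dual_\<Gamma> sc.smooth_w)
    fix y assume "y \<in> snd C ` W"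
    then obtain q where q: "q \<in> W" "y = snd C q" by blast
    show "inj (fd (iota C K) y)" unfolding q by (rule inj_fd_iota[OF C W_in(1)[OF q(1)] K W_in(2)[OF q(1)]])
    have "sc.hor (rep C Z) y = p y" "sc.ver (rep C Z) y = r y"
      using components_rep[where X = Z and q = q, OF q(1) Z[OF q(1)]] p(2)[OF q(1)] r(2)[OF q(1)] by (simp_all add: q)
    then have "fst (fd (iota C K) y (rep C Z y)) = p y"
      "snd (fd (iota C K) y (rep C Z y)) - sc.dual_\<Gamma> (?x y) (?w y) (p y) + (sc.\<kappa> * (?w y \<bullet> p y)) *\<^sub>R ?w y = r y"
      unfolding sc.ver_def by (simp_all add: sc.hor_def q(2) fd_iota[OF q(1)])
    then show "fd (iota C K) y (rep C Z y) = (p y, r y + sc.dual_\<Gamma> (?x y) (?w y) (p y) - (sc.\<kappa> * (?w y \<bullet> p y)) *\<^sub>R ?w y)"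
      by (auto simp: prod_eq_iff algebra_simps)
  qed
qed

lemma eta_smooth_W: "X \<in> vfields B W \<Longrightarrow> (\<lambda>q. eta q (X q)) \<in> smooth_funs B W"
  by (rule chart_fun[OF sc.smooth_eta[OF smooth_rep]]) (auto intro: sc_eta)

lemma g_smooth_W:
  assumes X: "X \<in> vfields B W" and Y: "Y \<in> vfields B W"
  shows "(\<lambda>q. g q (X q) (Y q)) \<in> smooth_funs B W"
proof (rule chart_fun)
  note sX = smooth_rep[OF X] and sY = smooth_rep[OF Y]
  show "C_infinity (snd C ` W) (\<lambda>y. sc.met (sc.hor (rep C X) y) (sc.ver (rep C X) y) (sc.hor (rep C Y) y) (sc.ver (rep C Y) y))"
    unfolding sc.met_def
    by (intro C_infinity_mult C_infinity_const C_infinity_add C_infinity_inner sc.open_\<Omega> sc.smooth_hor sc.smooth_ver sX sY)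
qed (rule sc_met[OF X Y])

lemma xibar_vf_W: "xibar \<in> vfields B W"
  by (rule field_of_components[OF _ sc.smooth_nh _ C_infinity_minus[OF sc.open_\<Omega> sc.smooth_nv]])
     (simp_all only: xibar_adapted[OF W_pt K W_in(2)] sc_n)

lemma phi_vf_W:
  assumes X: "X \<in> vfields B W"
  shows "(\<lambda>q. phi q (X q)) \<in> vfields B W"
    "q \<in> W \<Longrightarrow> sc.hor (rep C (\<lambda>q. phi q (X q))) (snd C q) = sc.hor (rep C X) (snd C q) - sc.eta (rep C X) (snd C q) *\<^sub>R sc.nh (snd C q)"
    "q \<in> W \<Longrightarrow> sc.ver (rep C (\<lambda>q. phi q (X q))) (snd C q) = - sc.ver (rep C X) (snd C q) - sc.eta (rep C X) (snd C q) *\<^sub>R sc.nv (snd C q)"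
proof -
  note sX = smooth_rep[OF X]
  have *: "phi q (X q) \<in> tangent_space B q"
    "ih K q (phi q (X q)) = sc.hor (rep C X) (snd C q) - sc.eta (rep C X) (snd C q) *\<^sub>R sc.nh (snd C q)"
    "iv K q (phi q (X q)) = - sc.ver (rep C X) (snd C q) - sc.eta (rep C X) (snd C q) *\<^sub>R sc.nv (snd C q)" if q: "q \<in> W" for q
    using phi_adapted[OF W_pt[OF q] K W_in(2)[OF q] L.vf_tangent[OF X q]] components_vf[OF X q]
      sc_eta[OF X q] sc_n[OF q] by simp_all
  show "(\<lambda>q. phi q (X q)) \<in> vfields B W"
    by (rule field_of_components[OF *(1) _ *(2) _ *(3)])
       (assumption | intro C_infinity_diff C_infinity_minus C_infinity_scaleR sc.open_\<Omega> sc.smooth_hor sc.smooth_ver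
          sc.smooth_eta sc.smooth_nh sc.smooth_nv sX)+
  show "sc.hor (rep C (\<lambda>q. phi q (X q))) (snd C q) = sc.hor (rep C X) (snd C q) - sc.eta (rep C X) (snd C q) *\<^sub>R sc.nh (snd C q)"
    "sc.ver (rep C (\<lambda>q. phi q (X q))) (snd C q) = - sc.ver (rep C X) (snd C q) - sc.eta (rep C X) (snd C q) *\<^sub>R sc.nv (snd C q)" if q: "q \<in> W"
    using components_rep[where X = "\<lambda>q. phi q (X q)" and q = q, OF q *(1)[OF q]] *(2,3)[OF q] by simp_all
qed

lemma E_vf: "C_infinity (snd C ` W) V \<Longrightarrow> L.chart_field C V \<in> vfields B W"
  by (rule L.chart_field_vf[OF C W(1) W_sub(1)])

lemma lc_rules:
  assumes "X \<in> vfields B W" "Y \<in> vfields B W" "Z \<in> vfields B W" "q \<in> W"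
  shows "X q (\<lambda>q. g q (Y q) (Z q)) = g q (D X Y q) (Z q) + g q (Y q) (D X Z q)"
    "D X Y q - D Y X q = bracket B X Y q"
  using lc assms unfolding levi_civita_def symmetric_connection_def by blast+

text \<open>The Levi-Civita connection \<open>D\<close> is metric and torsion free by definition, so \<open>cderiv_unique\<close> applies
  to its products on fields given by component functions.\<close>

lemma nabla_is_cderiv:
  assumes X: "X \<in> vfields B W" and Y: "Y \<in> vfields B W" and Z: "Z \<in> vfields B W" and q: "q \<in> W"
  shows "g q (D X Y q) (Z q) = sc.cderiv (rep C X) (sc.hor (rep C Y)) (sc.ver (rep C Y)) (ih K q (Z q)) (iv K q (Z q)) (snd C q)"
proof -
  note y = W_in(3)[OF q] and qB = W_pt[OF q] and qT = W_in(2)[OF q]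
  let ?E = "L.chart_field C"
  define nab where "nab U V Z = g q (D (?E U) (?E V) q) (?E Z q)" for U V Z
  have met_E: "sc.met (sc.hor U (snd C q')) (sc.ver U (snd C q')) (sc.hor V (snd C q')) (sc.ver V (snd C q')) = g q' (?E U q') (?E V q')"
    if "q' \<in> W" for U V q'
    unfolding sc.met_def components_chart_field[OF that, symmetric]
    by (rule g_adapted[OF W_pt[OF that] K W_in(2)[OF that], symmetric])
       (simp_all add: L.chart_field_def L.coord_vec_tangent[OF C W_in(1)[OF that]])
  have met: "fd (\<lambda>y. sc.met (sc.hor V y) (sc.ver V y) (sc.hor Z y) (sc.ver Z y)) (snd C q) (U (snd C q)) = nab U V Z + nab U Z V"
    if sm: "C_infinity (snd C ` W) U" "C_infinity (snd C ` W) V" "C_infinity (snd C ` W) Z" for U V Z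
  proof -
    let ?g = "\<lambda>q. g q (?E V q) (?E Z q)"
    have hess_form: "?g \<in> smooth_funs B W" by (rule g_smooth_W[OF E_vf[OF sm(2)] E_vf[OF sm(3)]])
    have "fd (\<lambda>y. sc.met (sc.hor V y) (sc.ver V y) (sc.hor Z y) (sc.ver Z y)) (snd C q) = fd (\<lambda>y. ?g (chart_inv C y)) (snd C q)"
      by (rule fd_cong[OF sc.open_\<Omega> y]) (auto simp: met_E L.chart_inv_left[OF C W_in(1)])
    then have "fd (\<lambda>y. sc.met (sc.hor V y) (sc.ver V y) (sc.hor Z y) (sc.ver Z y)) (snd C q) (U (snd C q)) = ?E U q ?g"
      unfolding L.chart_field_def[of C U q] L.coord_vec_apply[OF L.smooth_nearI[OF hess_form q]] by simp
    also have "\<dots> = g q (D (?E U) (?E V) q) (?E Z q) + g q (?E V q) (D (?E U) (?E Z) q)"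
      by (rule lc_rules(1)[OF E_vf[OF sm(1)] E_vf[OF sm(2)] E_vf[OF sm(3)] q])
    also have "g q (?E V q) (D (?E U) (?E Z) q) = g q (D (?E U) (?E Z) q) (?E V q)"
      by (rule g_sym[OF qB K qT L.vf_tangent[OF E_vf[OF sm(2)] q] L.vf_tangent[OF L.nabla_vf[OF E_vf[OF sm(1)] E_vf[OF sm(3)]] q]])
    finally show ?thesis by (simp only: nab_def)
  qed
  have tor: "nab U V Z - nab V U Z = sc.met (sc.hor (sc.lie U V) (snd C q)) (sc.ver (sc.lie U V) (snd C q)) (sc.hor Z (snd C q)) (sc.ver Z (snd C q))"
    if sm: "C_infinity (snd C ` W) U" "C_infinity (snd C ` W) V" "C_infinity (snd C ` W) Z" for U V Z
  proof -
    note EU = E_vf[OF sm(1)] and EV = E_vf[OF sm(2)] and EZ = E_vf[OF sm(3)]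
    have rE: "rep C (?E V) y = V y" if "y \<in> snd C ` W" for V y
      using L.rep_chart_field[OF C, of y V] that W_sub(1) by blast
    have "nab U V Z - nab V U Z = g q (1 *\<^sub>R D (?E U) (?E V) q + (- 1) *\<^sub>R D (?E V) (?E U) q) (?E Z q)"
      unfolding nab_def g_lin(1)[OF qB K qT L.vf_tangent[OF L.nabla_vf[OF EU EV] q]
          L.vf_tangent[OF L.nabla_vf[OF EV EU] q] L.vf_tangent[OF EZ q]] by simp
    also have "1 *\<^sub>R D (?E U) (?E V) q + (- 1) *\<^sub>R D (?E V) (?E U) q = bracket B (?E U) (?E V) q"
      using lc_rules(2)[OF EU EV EZ q] by simp
    also have "bracket B (?E U) (?E V) q = ?E (sc.lie U V) q"
    proof -
      have "fd (rep C (?E V)) (snd C q) = fd V (snd C q)" for V by (rule fd_cong[OF sc.open_\<Omega> y rE])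
      then show ?thesis
        unfolding L.bracket_chart[OF C W_sub(1) EU EV q] L.chart_field_def[of C "sc.lie U V" q] sc.lie_def rE[OF y]
        by (simp only:)
    qed
    finally show ?thesis by (simp only: met_E[OF q])
  qed
  have u: "nab (rep C X) (rep C Y) (rep C Z) = sc.cderiv (rep C X) (sc.hor (rep C Y)) (sc.ver (rep C Y))
      (sc.hor (rep C Z) (snd C q)) (sc.ver (rep C Z) (snd C q)) (snd C q)"
    by (rule sc.cderiv_unique[where nab = nab, OF y met tor smooth_rep[OF X] smooth_rep[OF Y] smooth_rep[OF Z]])
  have E_rep: "?E (rep C X) q' = X q'" if "X \<in> vfields B W" "q' \<in> W" for X q'
    using L.chart_field_rep[of C q' X] C W_in(1)[OF that(2)] L.vf_tangent[OF that] by simp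
  have "D (?E (rep C X)) (?E (rep C Y)) q = D X Y q"
    by (rule L.nabla_cong[OF E_vf[OF smooth_rep[OF X]] E_vf[OF smooth_rep[OF Y]] X Y q E_rep[OF X] E_rep[OF Y]])
  then have "nab (rep C X) (rep C Y) (rep C Z) = g q (D X Y q) (Z q)"
    by (simp add: nab_def E_rep[OF Z q])
  then show ?thesis unfolding u components_vf[OF Z q] by (rule sym)
qed

lemma F_formula_W:
  assumes X: "X \<in> vfields B W" and Y: "Y \<in> vfields B W" and Z: "Z \<in> vfields B W" and q: "q \<in> W"
  shows "g q (D X (\<lambda>q. phi q (Y q)) q - phi q (D X Y q)) (Z q) = F_tensor K q (X q) (Y q) (Z q)"
proof -
  note y = W_in(3)[OF q] and qB = W_pt[OF q] and qT = W_in(2)[OF q]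
  let ?Y = "\<lambda>q. phi q (Y q)" and ?Z = "\<lambda>q. phi q (Z q)"
  note Y' = phi_vf_W[OF Y] and Z' = phi_vf_W[OF Z]
  note tX = L.vf_tangent[OF X q] and tY = L.vf_tangent[OF Y q] and tZ = L.vf_tangent[OF Z q]
  note tD = L.vf_tangent[OF L.nabla_vf[OF X Y'(1)] q] and tD' = L.vf_tangent[OF L.nabla_vf[OF X Y] q]
  have "g q (D X ?Y q - phi q (D X Y q)) (Z q) = g q (1 *\<^sub>R D X ?Y q + (- 1) *\<^sub>R phi q (D X Y q)) (Z q)" by simp
  also have "\<dots> = g q (D X ?Y q) (Z q) - g q (phi q (D X Y q)) (Z q)"
    unfolding g_lin(1)[OF qB K qT tD phi_adapted(1)[OF qB K qT tD'] tZ] by simp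
  also have "\<dots> = g q (D X ?Y q) (Z q) + g q (D X Y q) (?Z q)"
    by (simp add: g_phi_left[OF qB K qT tD' tZ])
  also have "\<dots> = sc.cderiv (rep C X) (sc.hor (rep C ?Y)) (sc.ver (rep C ?Y)) (sc.hor (rep C Z) (snd C q)) (sc.ver (rep C Z) (snd C q)) (snd C q)
     + sc.cderiv (rep C X) (sc.hor (rep C Y)) (sc.ver (rep C Y)) (sc.hor (rep C ?Z) (snd C q)) (sc.ver (rep C ?Z) (snd C q)) (snd C q)"
    unfolding nabla_is_cderiv[OF X Y'(1) Z q] nabla_is_cderiv[OF X Y Z'(1) q]
      components_vf[OF Z q] components_vf[OF Z'(1) q] by simp
  also have "\<dots> = - 2 * a * (snd (iota C K (snd C q)) \<bullet> sc.R (fst (iota C K (snd C q))) (sc.hor (rep C Y) (snd C q))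
        (sc.hor (rep C Z) (snd C q)) (sc.hor (rep C X) (snd C q)))
      + sc.eta (rep C Y) (snd C q) * sc.H (rep C X) (rep C Z) (snd C q)
      - sc.eta (rep C Z) (snd C q) * sc.H (rep C X) (rep C Y) (snd C q)"
    by (rule sc.cderiv_phi[OF y smooth_rep[OF X] smooth_rep[OF Y] smooth_rep[OF Z] _ _ Z'(2)[OF q] Z'(3)[OF q]])
       (use Y'(2,3) in auto)
  also have "\<dots> = F_tensor K q (X q) (Y q) (Z q)"
  proof -
    have H: "sc.H (rep C X) (rep C V) (snd C q) = second_form K q (X q) (V q)" if V: "V \<in> vfields B W" for V
      unfolding sc.H_def sc_met[OF X V q]
      unfolding second_form_def hess_form_def curv_form_def curv_at_def hess_at_def sc_eta[OF X q] sc_eta[OF V q]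
        components_vf[OF X q] components_vf[OF V q] sc_s[OF q] iota_W[OF q]
      by (simp add: algebra_simps)
    show ?thesis
      unfolding H[OF Y] H[OF Z] F_tensor_def curv_term_def curv_at_def sc_eta[OF Y q] sc_eta[OF Z q] components_vf[OF X q]
        components_vf[OF Y q] components_vf[OF Z q] iota_W[OF q] by simp
  qed
  finally show ?thesis .
qed

lemma deta_W:
  assumes X: "X \<in> vfields B W" and Y: "Y \<in> vfields B W" and q: "q \<in> W"
  shows "X q (\<lambda>q. eta q (Y q)) - Y q (\<lambda>q. eta q (X q)) - eta q (bracket B X Y q)
    = sqrt b * (iv K q (X q) \<bullet> ih K q (Y q) - iv K q (Y q) \<bullet> ih K q (X q))"
proof -
  note y = W_in(3)[OF q]
  have act: "X q (\<lambda>q. eta q (Y q)) = fd (sc.eta (rep C Y)) (snd C q) (rep C X (snd C q))"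
    if X: "X \<in> vfields B W" and Y: "Y \<in> vfields B W" for X Y
  proof -
    have 1: "X q (\<lambda>q. eta q (Y q)) = fd (\<lambda>y. eta (chart_inv C y) (Y (chart_inv C y))) (snd C q) (rep C X (snd C q))"
      by (rule L.vf_apply_rep[OF X q C W_in(1)[OF q] L.smooth_nearI[OF eta_smooth_W[OF Y] q]])
    have 2: "fd (\<lambda>y. eta (chart_inv C y) (Y (chart_inv C y))) (snd C q) = fd (sc.eta (rep C Y)) (snd C q)"
      by (rule fd_cong[OF sc.open_\<Omega> y])
         (auto simp: L.chart_inv_left[OF C W_in(1)] sc_eta[OF Y])
    show ?thesis unfolding 1 2 ..
  qed
  have "eta q (bracket B X Y q) = sc.eta (sc.lie (rep C X) (rep C Y)) (snd C q)"
  proof -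
    have b: "bracket B X Y q = L.chart_field C (sc.lie (rep C X) (rep C Y)) q"
      unfolding L.bracket_chart[OF C W_sub(1) X Y q] L.chart_field_def sc.lie_def ..
    have "L.chart_field C (sc.lie (rep C X) (rep C Y)) q \<in> tangent_space B q"
      by (simp add: L.chart_field_def L.coord_vec_tangent[OF C W_in(1)[OF q]])
    then show ?thesis
      unfolding b eta_adapted[OF W_pt[OF q] K W_in(2)[OF q]] sc.eta_def components_chart_field[OF q] sc_s[OF q] iota_W[OF q]
      by (simp add: eta_adapted[OF W_pt[OF q] K W_in(2)[OF q]] components_chart_field[OF q])
  qed
  then show ?thesis
    using sc.eta_exterior_derivative[OF y smooth_rep[OF X] smooth_rep[OF Y]]
    by (simp only: act[OF X Y] act[OF Y X] components_vf[OF X q] components_vf[OF Y q])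
qed

end

end

context level_hypersurface
begin

section \<open>The almost paracontact metric structure\<close>

lemma phi_vf:
  assumes X: "X \<in> vfields B U"
  shows "(\<lambda>q. phi q (X q)) \<in> vfields B U"
proof (rule L.vf_local[OF L.vf_opn[OF X]])
  fix q assume "q \<in> U"
  then obtain C K W where W: "C \<in> B" "K \<in> M" "L.opn W" "W \<subseteq> fst C \<inter> fst (TC K)" "q \<in> W" "W \<subseteq> U"
    using local_domain[OF L.vf_opn[OF X]] by metis
  show "\<exists>W. q \<in> W \<and> (\<lambda>q. phi q (X q)) \<in> vfields B W"
    by (intro exI[of _ W] conjI W(5) phi_vf_W(1)[OF W(1-4) L.vf_restrict[OF X W(3,6)]])
qed

lemma xibar_vf:
  assumes "L.opn U"
  shows "xibar \<in> vfields B U"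
proof (rule L.vf_local[OF assms])
  fix q assume "q \<in> U"
  then obtain C K W where W: "C \<in> B" "K \<in> M" "L.opn W" "W \<subseteq> fst C \<inter> fst (TC K)" "q \<in> W" "W \<subseteq> U"
    using local_domain[OF assms] by metis
  show "\<exists>W. q \<in> W \<and> xibar \<in> vfields B W"
    by (intro exI[of _ W] conjI W(5) xibar_vf_W[OF W(1-4)])
qed

lemma eta_smooth:
  assumes X: "X \<in> vfields B U"
  shows "(\<lambda>q. eta q (X q)) \<in> smooth_funs B U"
proof (rule L.sf_local[OF L.vf_opn[OF X]])
  fix q assume "q \<in> U"
  then obtain C K W where W: "C \<in> B" "K \<in> M" "L.opn W" "W \<subseteq> fst C \<inter> fst (TC K)" "q \<in> W" "W \<subseteq> U"
    using local_domain[OF L.vf_opn[OF X]] by metis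
  show "\<exists>W. q \<in> W \<and> (\<lambda>q. eta q (X q)) \<in> smooth_funs B W"
    by (intro exI[of _ W] conjI W(5) eta_smooth_W[OF W(1-4) L.vf_restrict[OF X W(3,6)]])
qed

lemma g_smooth:
  assumes X: "X \<in> vfields B U" and Y: "Y \<in> vfields B U"
  shows "(\<lambda>q. g q (X q) (Y q)) \<in> smooth_funs B U"
proof (rule L.sf_local[OF L.vf_opn[OF X]])
  fix q assume "q \<in> U"
  then obtain C K W where W: "C \<in> B" "K \<in> M" "L.opn W" "W \<subseteq> fst C \<inter> fst (TC K)" "q \<in> W" "W \<subseteq> U"
    using local_domain[OF L.vf_opn[OF X]] by metis
  show "\<exists>W. q \<in> W \<and> (\<lambda>q. g q (X q) (Y q)) \<in> smooth_funs B W"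
    by (intro exI[of _ W] conjI W(5) g_smooth_W[OF W(1-4) L.vf_restrict[OF X W(3,6)] L.vf_restrict[OF Y W(3,6)]])
qed

lemma F_formula:
  assumes X: "X \<in> vfields B U" and Y: "Y \<in> vfields B U" and Z: "Z \<in> vfields B U" and q: "q \<in> U"
    and K: "K \<in> M" "q \<in> fst (TC K)"
  shows "g q (D X (\<lambda>q. phi q (Y q)) q - phi q (D X Y q)) (Z q) = F_tensor K q (X q) (Y q) (Z q)"
proof -
  obtain C where C: "C \<in> B" "q \<in> fst C" using L.point_chart L.vf_points[OF X q] by blast
  let ?W = "U \<inter> (fst C \<inter> fst (TC K))"
  have W: "L.opn ?W" using L.vf_opn[OF X] opn_pair[OF C(1) K(1)] by auto
  note r = L.vf_restrict[OF _ W]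
  show ?thesis by (rule F_formula_W[OF C(1) K(1) W _ r[OF X] r[OF Y] r[OF Z]]) (use q C K in auto)
qed

lemma deta:
  assumes X: "X \<in> vfields B U" and Y: "Y \<in> vfields B U" and q: "q \<in> U"
    and K: "K \<in> M" "q \<in> fst (TC K)"
  shows "X q (\<lambda>q. eta q (Y q)) - Y q (\<lambda>q. eta q (X q)) - eta q (bracket B X Y q)
    = sqrt b / a * g q (X q) (phi q (Y q))"
proof -
  obtain C where C: "C \<in> B" "q \<in> fst C" using L.point_chart L.vf_points[OF X q] by blast
  let ?W = "U \<inter> (fst C \<inter> fst (TC K))"
  have W: "L.opn ?W" using L.vf_opn[OF X] opn_pair[OF C(1) K(1)] by auto
  note r = L.vf_restrict[OF _ W]
  have "X q (\<lambda>q. eta q (Y q)) - Y q (\<lambda>q. eta q (X q)) - eta q (bracket B X Y q)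
      = sqrt b * (iv K q (X q) \<bullet> ih K q (Y q) - iv K q (Y q) \<bullet> ih K q (X q))"
    by (rule deta_W[OF C(1) K(1) W _ r[OF X] r[OF Y]]) (use q C K in auto)
  then show ?thesis
    unfolding g_phi_right[OF L.vf_points[OF X q] K L.vf_tangent[OF X q] L.vf_tangent[OF Y q]]
    using a_pos by simp
qed

lemma chart_at_B: "q \<in> points B \<Longrightarrow> \<exists>K\<in>M. q \<in> fst (TC K)"
  using chart_at points_B_TM by blast

lemma phi_lin:
  assumes q: "q \<in> points B" and u: "u \<in> tangent_space B q" and v: "v \<in> tangent_space B q"
  shows "phi q (r *\<^sub>R u + s *\<^sub>R v) = r *\<^sub>R phi q u + s *\<^sub>R phi q v"
proof -
  obtain K where K: "K \<in> M" "q \<in> fst (TC K)" using chart_at_B[OF q] by blast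
  note ph = phi_adapted[OF q K]
  note uv = L.tangent_lin[OF q u v]
  note lin = linear_add[OF linear_ih[OF q K]] linear_scale[OF linear_ih[OF q K]] linear_add[OF linear_iv[OF q K]] linear_scale[OF linear_iv[OF q K]]
  show ?thesis
    by (rule B_eqI[OF q K ph(1)[OF uv] L.tangent_lin[OF q ph(1)[OF u] ph(1)[OF v]]])
       (simp_all only: ph(2,3)[OF uv] lin ph(2,3)[OF u] ph(2,3)[OF v] eta_lin[OF q K u v],
        simp_all add: algebra_simps)
qed

lemma almost_paracontact: "almost_paracontact_metric B phi xibar eta g"
  unfolding almost_paracontact_metric_def
proof (intro conjI ballI)
  show "smooth_manifold B" using emb by (simp add: embedded_submanifold_def)
  show "odd DIM('h)" using dim_h dim2 by simp
  show "xibar \<in> vfields B (points B)" by (rule xibar_vf[OF L.opn_points])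
  show "tensor11 B phi"
    unfolding tensor11_def lin_on_def
  proof (intro conjI ballI allI)
    fix q assume q: "q \<in> points B"
    then obtain K where K: "K \<in> M" "q \<in> fst (TC K)" using chart_at_B by blast
    show "phi q ` tangent_space B q \<subseteq> tangent_space B q" using phi_adapted(1)[OF q K] by blast
    show "phi q (r *\<^sub>R u + s *\<^sub>R v) = r *\<^sub>R phi q u + s *\<^sub>R phi q v"
      if "u \<in> tangent_space B q" "v \<in> tangent_space B q" for u v r s
      by (rule phi_lin[OF q that])
  qed (rule phi_vf)
  show "eta \<in> one_forms B (points B)"
    unfolding one_forms_def
  proof (intro CollectI conjI ballI allI impI L.opn_points)
    fix q assume q: "q \<in> points B"
    then obtain K where K: "K \<in> M" "q \<in> fst (TC K)" using chart_at_B by blast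
    show "eta q \<in> cotangent_space B q"
      unfolding cotangent_space_def lin_on_def using eta_lin[OF q K] by (auto simp: eta_def)
  qed (rule eta_smooth)
  show "pseudo_riemannian_metric B g"
    unfolding pseudo_riemannian_metric_def tensor02_def lin_on_def
  proof (intro conjI ballI allI impI)
    fix q u v z r s assume q: "q \<in> points B" and t: "u \<in> tangent_space B q" "v \<in> tangent_space B q" "z \<in> tangent_space B q"
    obtain K where K: "K \<in> M" "q \<in> fst (TC K)" using chart_at_B[OF q] by blast
    show "g q (r *\<^sub>R v + s *\<^sub>R z) u = r *\<^sub>R g q v u + s *\<^sub>R g q z u" "g q u (r *\<^sub>R v + s *\<^sub>R z) = r *\<^sub>R g q u v + s *\<^sub>R g q u z"
      using g_lin[OF q K t(2,3,1)] by simp_all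
  next
    fix q u v assume q: "q \<in> points B" and t: "u \<in> tangent_space B q" "v \<in> tangent_space B q"
    obtain K where K: "K \<in> M" "q \<in> fst (TC K)" using chart_at_B[OF q] by blast
    show "g q u v = g q v u" by (rule g_sym[OF q K t])
  next
    fix q u assume q: "q \<in> points B" and t: "u \<in> tangent_space B q" and 0: "\<forall>v\<in>tangent_space B q. g q u v = 0"
    obtain K where K: "K \<in> M" "q \<in> fst (TC K)" using chart_at_B[OF q] by blast
    show "u = 0" using g_nondegenerate[OF q K t] 0 by blast
  qed (rule g_smooth)
  fix q assume q: "q \<in> points B"
  then obtain K where K: "K \<in> M" "q \<in> fst (TC K)" using chart_at_B by blast
  show "eta q (xibar q) = 1" by (rule eta_xibar[OF q K])
  show "phi q (xibar q) = 0" by (rule phi_xibar[OF q K])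
  fix u assume u: "u \<in> tangent_space B q"
  show "phi q (phi q u) = u - eta q u *\<^sub>R xibar q" by (rule phi_phi[OF q K u])
  fix v assume v: "v \<in> tangent_space B q"
  show "g q (phi q u) (phi q v) = - g q u v + eta q u * eta q v" by (rule g_phi_phi[OF q K u v])
qed

text \<open>A vertical tangent vector \<open>u\<close> satisfies \<open>\<phi> u = - u\<close>; there is a nonzero one because covectors that
  annihilate \<open>\<xi>\<close> exist in dimension at least 2.\<close>

lemma fundamental_form_nonzero:
  "\<exists>q\<in>points B. \<exists>u\<in>tangent_space B q. \<exists>v\<in>tangent_space B q. g q u (phi q v) \<noteq> 0"
proof -
  obtain p where p: "p \<in> points M" using nonempty by blast
  then obtain K where K: "K \<in> M" "p \<in> fst K" using point_chart by blast
  let ?\<xi> = "rep K xi (snd K p)"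
  have \<xi>0: "?\<xi> \<bullet> ?\<xi> \<noteq> 0" using xr_nonzero[OF K(1)] K(2) by simp
  \<comment> \<open>The covector proportional to \<open>\<xi>\<close> that lies on the hypersurface.\<close>
  define q where "q = (p, covec K p (((t - f p) / (?\<xi> \<bullet> ?\<xi>)) *\<^sub>R ?\<xi>))"
  have q: "q \<in> fst (TC K)" and yq: "yy K q = snd K p" and wq: "ww K q = ((t - f p) / (?\<xi> \<bullet> ?\<xi>)) *\<^sub>R ?\<xi>"
    using TC_surj[OF K] by (auto simp: q_def snd_TC)
  have "ss K q = t - f p" using \<xi>0 by (simp add: yq wq)
  then have qB: "q \<in> points B" using in_B_iff[OF K(1) q] chart_inv_left[OF K] by (simp only:) (simp add: yq)
  have "dim {z. xr K q \<bullet> z = 0} = DIM('e) - 1" using xr_nonzero[OF K(1) yy_in[OF K(1) q]] by (simp add: dim_hyperplane)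
  then obtain r where r: "xr K q \<bullet> r = 0" "r \<noteq> 0" using dim2 dim_eq_0[of "{z. xr K q \<bullet> z = 0}"] by auto
  let ?u = "of_parts K q 0 r"
  note adK = of_parts_simps[OF K(1) q, of 0 r]
  have "vv K q ?u \<bullet> xr K q = \<kappa> * ss K q * (ww K q \<bullet> hh K ?u) - dF K q (hh K ?u)"
    using r(1) by (simp add: adK linear_0[OF lin_dF[OF qB K(1) q]] inner_commute)
  then obtain u where u: "u \<in> tangent_space B q" "ic q u = ?u"
    using in_incl_image[OF qB K(1) q adK(3)] by blast
  have "u \<noteq> 0"
  proof
    assume "u = 0"
    then have "iv K q u = 0" using linear_0[OF linear_iv[OF qB K(1) q]] by simp
    then show False using r(2) u(2) adK(2) by simp
  qed
  then obtain v where v: "v \<in> tangent_space B q" "g q u v \<noteq> 0" using g_nondegenerate[OF qB K(1) q u(1)] by blast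
  have "g q v u = - g q v (phi q u)"
    unfolding g_adapted[OF qB K(1) q v(1) u(1)] g_phi_right[OF qB K(1) q v(1) u(1)] u(2) adK by simp
  then show ?thesis using v u(1) g_sym[OF qB K(1) q u(1) v(1)] qB by force
qed

lemma paracontact_iff: "paracontact_metric B phi xibar eta g \<longleftrightarrow> b = 4 * a\<^sup>2"
proof
  assume b: "b = 4 * a\<^sup>2"
  have r: "sqrt b = 2 * a" unfolding b using a_pos by (simp add: real_sqrt_mult)
  show "paracontact_metric B phi xibar eta g"
    unfolding paracontact_metric_def
  proof (intro conjI allI ballI almost_paracontact)
    fix U X Y q assume X: "X \<in> vfields B U" and Y: "Y \<in> vfields B U" and q: "q \<in> U"
    obtain K where K: "K \<in> M" "q \<in> fst (TC K)" using chart_at_B[OF L.vf_points[OF X q]] by blast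
    show "g q (X q) (phi q (Y q)) = 1 / 2 * (X q (\<lambda>q. eta q (Y q)) - Y q (\<lambda>q. eta q (X q)) - eta q (bracket B X Y q))"
      unfolding deta[OF X Y q K] r using a_pos by simp
  qed
next
  assume pm: "paracontact_metric B phi xibar eta g"
  obtain q u v where q: "q \<in> points B" and u: "u \<in> tangent_space B q" and v: "v \<in> tangent_space B q"
    and nz: "g q u (phi q v) \<noteq> 0" using fundamental_form_nonzero by blast
  obtain C where C: "C \<in> B" "q \<in> fst C" using L.point_chart[OF q] by blast
  obtain K where K: "K \<in> M" "q \<in> fst (TC K)" using chart_at_B[OF q] by blast
  let ?X = "\<lambda>u. L.chart_field C (\<lambda>_. vcomp C u)"
  have X: "?X u \<in> vfields B (fst C)" for u by (rule L.chart_field_const_vf[OF C(1) L.fst_opn[OF C(1)] order_refl])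
  have Xq: "?X u q = u" "?X v q = v"
    using L.coord_vec_vcomp[OF C u] L.coord_vec_vcomp[OF C v] by (simp_all add: L.chart_field_def)
  have h: "\<forall>U. \<forall>X\<in>vfields B U. \<forall>Y\<in>vfields B U. \<forall>q\<in>U. g q (X q) (phi q (Y q)) =
      1 / 2 * (X q (\<lambda>q. eta q (Y q)) - Y q (\<lambda>q. eta q (X q)) - eta q (bracket B X Y q))"
    using pm unfolding paracontact_metric_def by (rule conjunct2)
  have "g q u (phi q v) = 1 / 2 * (sqrt b / a * g q u (phi q v))"
    using h[rule_format, OF X[of u] X[of v] C(2)] unfolding deta[OF X[of u] X[of v] C(2) K] unfolding Xq .
  then have "sqrt b = 2 * a" using a_pos nz by (simp add: field_simps)
  then have "(sqrt b)\<^sup>2 = 4 * a\<^sup>2" by (simp add: power_mult_distrib)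
  then show "b = 4 * a\<^sup>2" using b_pos by simp
qed

end

section \<open>The classes\<close>

text \<open>The functionals \<open>\<beta>(\<cdot>, e\<^sub>j)\<close> separate the vectors of the span, so it has a basis dual to them; the
  rows of \<open>h\<close> are the coordinates of its members.\<close>

lemma inverse_gram_exists:
  fixes e :: "nat \<Rightarrow> 'h::euclidean_space" and \<beta> :: "'h \<Rightarrow> 'h \<Rightarrow> real"
  assumes inj: "inj_on e {..<m}" and ind: "independent (e ` {..<m})"
    and lin: "\<And>y. linear (\<lambda>x. \<beta> x y)"
    and nondeg: "\<And>x. x \<in> span (e ` {..<m}) \<Longrightarrow> (\<And>j. j < m \<Longrightarrow> \<beta> x (e j) = 0) \<Longrightarrow> x = 0"
  shows "\<exists>h. \<forall>i<m. \<forall>j<m. (\<Sum>k<m. h i k * \<beta> (e k) (e j)) = (if i = j then 1 else (0::real))"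
proof -
  let ?S = "span (e ` {..<m})"
  define T where "T x = (\<Sum>j<m. \<beta> x (e j) *\<^sub>R e j)" for x
  have coeff: "c j = 0" if "(\<Sum>j<m. c j *\<^sub>R e j) = 0" "j < m" for c j
  proof -
    have "(\<Sum>v\<in>e ` {..<m}. c (inv_into {..<m} e v) *\<^sub>R v) = 0"
      using that(1) by (simp add: sum.reindex[OF inj] inv_into_f_f[OF inj])
    then have "c (inv_into {..<m} e (e j)) = 0"
      using independentD[OF ind, of "e ` {..<m}" "\<lambda>v. c (inv_into {..<m} e v)"] that(2) by auto
    then show ?thesis using that(2) by (simp add: inv_into_f_f[OF inj])
  qed
  have linT: "linear T"
    by (rule linearI) (simp_all add: T_def linear_add[OF lin] linear_scale[OF lin] scaleR_left_distrib sum.distrib scaleR_sum_right)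
  have "inj_on T ?S"
    unfolding linear_inj_on_iff_eq_0[OF linT subspace_span]
  proof (intro ballI impI)
    fix x assume x: "x \<in> ?S" and "T x = 0"
    then show "x = 0" by (intro nondeg[OF x] coeff[of "\<lambda>j. \<beta> x (e j)"]) (auto simp: T_def)
  qed
  then have "dim (T ` ?S) = dim ?S" using dim_image_eq[OF linT, of ?S] by (simp only: span_span)
  moreover have "T ` ?S \<subseteq> ?S" unfolding T_def by (intro image_subsetI span_sum span_scale span_base) auto
  ultimately have TS: "T ` ?S = ?S"
    by (intro subspace_dim_equal) (auto intro: linear_subspace_image[OF linT])
  have "\<exists>h. \<forall>j<m. (\<Sum>k<m. h k * \<beta> (e k) (e j)) = (if i = j then 1 else 0)" if i: "i < m" for i
  proof -
    have "e i \<in> T ` ?S" unfolding TS using i by (auto intro: span_base)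
    then obtain x where x: "x \<in> ?S" "e i = T x" by blast
    have "(\<Sum>j<m. (\<beta> x (e j) - (if i = j then 1 else 0)) *\<^sub>R e j) = T x - e i"
      using i by (simp add: T_def scaleR_left_diff_distrib sum_subtractf if_distrib[of "\<lambda>r. r *\<^sub>R _"] cong: if_cong)
    then have d: "\<beta> x (e j) = (if i = j then 1 else 0)" if "j < m" for j
      using coeff[of "\<lambda>j. \<beta> x (e j) - (if i = j then 1 else 0)" j] that x(2) by simp
    obtain u where "x = (\<Sum>v\<in>e ` {..<m}. u v *\<^sub>R v)" using x(1) by (auto simp: span_finite)
    then have xs: "x = (\<Sum>k<m. u (e k) *\<^sub>R e k)" by (simp add: sum.reindex[OF inj])
    have "\<beta> x y = (\<Sum>k<m. u (e k) * \<beta> (e k) y)" for y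
      unfolding xs linear_sum[OF lin] linear_scale[OF lin] by simp
    then show ?thesis using d by (intro exI[of _ "\<lambda>k. u (e k)"]) simp
  qed
  then show ?thesis by metis
qed

context level_hypersurface
begin

text \<open>The projection to \<open>ker \<eta>\<close> along the structure vector field; it is \<open>\<phi>\<^sup>2\<close>.\<close>

definition ker_part :: "'p cot \<Rightarrow> 'p cot tvec \<Rightarrow> 'p cot tvec"
  where "ker_part q v = v - eta q v *\<^sub>R xibar q"

definition G10_form :: "('p, 'e) chart \<Rightarrow> 'p cot \<Rightarrow> 'e \<Rightarrow> 'e \<Rightarrow> real"
  where "G10_form K q h k = - a / (sqrt b * ss K q) *
    (hess_at K q h k + 2 / ss K q * dF K q h * dF K q k - ww K q \<bullet> curv_at K q k (xr K q) h)"

text \<open>The class components have to be defined on the whole hypersurface, so a chart is chosen at every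
  point; smoothness of the components is derived from \<open>F_fields\<close>.\<close>

definition some_chart :: "'p cot \<Rightarrow> ('p, 'e) chart"
  where "some_chart q = (SOME K. K \<in> M \<and> q \<in> fst (TC K))"

lemma some_chart: "q \<in> points B \<Longrightarrow> some_chart q \<in> M" "q \<in> points B \<Longrightarrow> q \<in> fst (TC (some_chart q))"
  using someI_ex[of "\<lambda>K. K \<in> M \<and> q \<in> fst (TC K)"] chart_at_B[of q] by (auto simp: some_chart_def Bex_def)

definition F_G4 :: "'p cot \<Rightarrow> 'p cot tvec \<Rightarrow> 'p cot tvec \<Rightarrow> 'p cot tvec \<Rightarrow> real"
  where "F_G4 q u v z = curv_term (some_chart q) q (ker_part q u) (ker_part q v) (ker_part q z)"

definition F_G5 :: "'p cot \<Rightarrow> 'p cot tvec \<Rightarrow> 'p cot tvec \<Rightarrow> 'p cot tvec \<Rightarrow> real"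
  where "F_G5 q u v z = sqrt b / (2 * a) * (eta q v * g q u z - eta q z * g q u v)"

definition F_G10 :: "'p cot \<Rightarrow> 'p cot tvec \<Rightarrow> 'p cot tvec \<Rightarrow> 'p cot tvec \<Rightarrow> real"
  where "F_G10 q u v z = eta q v * G10_form (some_chart q) q (ih (some_chart q) q u) (ih (some_chart q) q z) - eta q z * G10_form (some_chart q) q (ih (some_chart q) q u) (ih (some_chart q) q v)"

context
  fixes q K
  assumes qB: "q \<in> points B" and K: "K \<in> M" and q: "q \<in> fst (TC K)"
begin

interpretation bc: base_calculus "snd K ` fst K" "\<Gamma> K" "rep K xi" "FK K"
  by (rule base_calc[OF K])

lemma curv_at_linear: "linear (\<lambda>u. curv_at K q u v z)" "linear (\<lambda>v. curv_at K q u v z)" "linear (curv_at K q u v)"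
  unfolding curv_at_def using bc.R_linear[OF yy_in[OF K q]] by auto

lemma curv_at_skew: "curv_at K q u v z = - curv_at K q v u z"
  unfolding curv_at_def by (rule bc.R_skew)

lemma curv_at_same: "curv_at K q u u z = 0"
  using curv_at_skew[of u u z] by (simp add: eq_neg_iff_add_eq_0 flip: scaleR_2)

lemma curv_at_bianchi: "curv_at K q u v z + curv_at K q v z u + curv_at K q z u v = 0"
  unfolding curv_at_def by (rule bc.R_bianchi[OF yy_in[OF K q]])

lemma curv_at_xr: "curv_at K q u v (xr K q) = 0"
  unfolding curv_at_def by (rule bc.R_\<xi>[OF yy_in[OF K q]])

lemma curv_at_nh: "curv_at K q u v (nh K q) = 0"
  unfolding nh_def linear_scale[OF curv_at_linear(3)] curv_at_xr by simp

lemma hess_at_props: "linear (hess_at K q u)" "linear (\<lambda>u. hess_at K q u z)" "hess_at K q u z = hess_at K q z u" "hess_at K q u (xr K q) = 0"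
  unfolding hess_at_def
  by (rule bc.Hess_linear(1)[OF yy_in[OF K q]], rule bc.Hess_linear(2)[OF yy_in[OF K q]],
      rule bc.Hess_sym[OF yy_in[OF K q]], rule bc.Hess_\<xi>[OF yy_in[OF K q]])

lemma ker_part_tangent: "v \<in> tangent_space B q \<Longrightarrow> ker_part q v \<in> tangent_space B q"
  unfolding ker_part_def by (rule perp_tangent[OF qB K q])

lemma ih_ker_part: "ih K q (ker_part q v) = ih K q v - eta q v *\<^sub>R nh K q"
  unfolding ker_part_def linear_diff[OF linear_ih[OF qB K q]] linear_scale[OF linear_ih[OF qB K q]] xibar_adapted(2)[OF qB K q] ..

lemma eta_ker_part: "v \<in> tangent_space B q \<Longrightarrow> eta q (ker_part q v) = 0"
  using eta_lin[OF qB K q _ xibar_adapted(1)[OF qB K q], of v 1 "- eta q v"] eta_xibar[OF qB K q]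
  by (simp add: ker_part_def)

lemma curv_at_ker_part:
  "ww K q \<bullet> curv_at K q (ih K q (ker_part q v)) (ih K q (ker_part q z)) (ih K q (ker_part q u)) = ww K q \<bullet> curv_at K q (ih K q v) (ih K q z) (ih K q u)
    - (eta q z * (ww K q \<bullet> curv_at K q (ih K q v) (xr K q) (ih K q u))
      - eta q v * (ww K q \<bullet> curv_at K q (ih K q z) (xr K q) (ih K q u))) / (sqrt b * ss K q)"
proof -
  have n: "curv_at K q h (nh K q) u = (1 / (sqrt b * ss K q)) *\<^sub>R curv_at K q h (xr K q) u" for h u
    unfolding nh_def linear_scale[OF curv_at_linear(2)] ..
  have n': "curv_at K q (nh K q) h u = - (1 / (sqrt b * ss K q)) *\<^sub>R curv_at K q h (xr K q) u" for h u
    using curv_at_skew[of "nh K q" h u] by (simp add: n)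
  show ?thesis
    unfolding ih_ker_part linear_diff[OF curv_at_linear(3)] linear_scale[OF curv_at_linear(3)] curv_at_nh
      linear_diff[OF curv_at_linear(1)] linear_scale[OF curv_at_linear(1)] linear_diff[OF curv_at_linear(2)] linear_scale[OF curv_at_linear(2)]
      curv_at_same n n'
    by (simp add: inner_add_right inner_diff_right diff_divide_distrib add_divide_distrib)
qed

lemma curv_term_ker_part: "curv_term K q (ker_part q u) (ker_part q v) (ker_part q z) = curv_term K q u v z - 2 * eta q z * curv_form K q u v + 2 * eta q v * curv_form K q u z"
  unfolding curv_term_def curv_at_ker_part curv_form_def by (simp add: diff_divide_distrib algebra_simps)

lemma G10_form_eq: "G10_form K q (ih K q u) (ih K q v) = hess_form K q u v - curv_form K q u v"
  unfolding G10_form_def hess_form_def curv_form_def by (simp add: algebra_simps)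

text \<open>Every argument is split into its part in \<open>ker \<eta>\<close> and a multiple of the structure vector field.\<close>

lemma F_tensor_split:
  "F_tensor K q u v z = curv_term K q (ker_part q u) (ker_part q v) (ker_part q z)
    + sqrt b / (2 * a) * (eta q v * g q u z - eta q z * g q u v)
    + (eta q v * G10_form K q (ih K q u) (ih K q z) - eta q z * G10_form K q (ih K q u) (ih K q v))"
  unfolding curv_term_ker_part G10_form_eq F_tensor_def second_form_def by (simp add: algebra_simps)

lemma G10_form_linear: "linear (G10_form K q h)" "linear (\<lambda>h. G10_form K q h k)"
  using hess_at_props(1,2) curv_at_linear(1,3)
  by (auto intro!: linearI simp: G10_form_def linear_add linear_scale linear_add[OF lin_dF[OF qB K q]] linear_scale[OF lin_dF[OF qB K q]]
      linear_add[OF curv_at_linear(1)] linear_scale[OF curv_at_linear(1)] linear_add[OF curv_at_linear(3)] linear_scale[OF curv_at_linear(3)]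
      linear_add[OF hess_at_props(1)] linear_scale[OF hess_at_props(1)] linear_add[OF hess_at_props(2)] linear_scale[OF hess_at_props(2)]
      inner_add_right algebra_simps add_divide_distrib)

lemma G10_form_sym: "G10_form K q h k = G10_form K q k h"
proof -
  have "curv_at K q k (xr K q) h = curv_at K q h (xr K q) k"
    using curv_at_bianchi[of k "xr K q" h] curv_at_skew[of "xr K q" h k] by (simp add: curv_at_xr)
  then show ?thesis unfolding G10_form_def hess_at_props(3)[of h k] by (simp add: mult.commute mult.left_commute)
qed

lemma G10_form_nh: "G10_form K q h (nh K q) = 0" "G10_form K q (nh K q) h = 0"
proof -
  have "G10_form K q h (xr K q) = 0"
    unfolding G10_form_def hess_at_props(4) dF_xi[OF K yy_in[OF K q]] curv_at_same by simp
  then show "G10_form K q h (nh K q) = 0" unfolding nh_def linear_scale[OF G10_form_linear(1)] by simp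
  then show "G10_form K q (nh K q) h = 0" using G10_form_sym by simp
qed

lemma G10_form_perp: "G10_form K q (h - r *\<^sub>R nh K q) (k - s *\<^sub>R nh K q) = G10_form K q h k"
  by (simp add: linear_diff[OF G10_form_linear(1)] linear_scale[OF G10_form_linear(1)] linear_diff[OF G10_form_linear(2)] linear_scale[OF G10_form_linear(2)] G10_form_nh)

lemma curv_term_lin:
  "curv_term K q (r *\<^sub>R u + s *\<^sub>R u') v z = r * curv_term K q u v z + s * curv_term K q u' v z"
  "curv_term K q v (r *\<^sub>R u + s *\<^sub>R u') z = r * curv_term K q v u z + s * curv_term K q v u' z"
  "curv_term K q v z (r *\<^sub>R u + s *\<^sub>R u') = r * curv_term K q v z u + s * curv_term K q v z u'"
  unfolding curv_term_def linear_add[OF linear_ih[OF qB K q]] linear_scale[OF linear_ih[OF qB K q]]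
    linear_add[OF curv_at_linear(1)] linear_scale[OF curv_at_linear(1)] linear_add[OF curv_at_linear(2)] linear_scale[OF curv_at_linear(2)]
    linear_add[OF curv_at_linear(3)] linear_scale[OF curv_at_linear(3)]
  by (simp_all add: inner_add_right algebra_simps)

lemma curv_term_skew: "curv_term K q u v z = - curv_term K q u z v"
  unfolding curv_term_def using curv_at_skew[of "ih K q v"] by simp

lemma curv_term_cyclic: "curv_term K q u v z + curv_term K q v z u + curv_term K q z u v = 0"
proof -
  have "curv_term K q u v z + curv_term K q v z u + curv_term K q z u v = - 2 * a * (ww K q \<bullet>
      (curv_at K q (ih K q v) (ih K q z) (ih K q u) + curv_at K q (ih K q z) (ih K q u) (ih K q v) + curv_at K q (ih K q u) (ih K q v) (ih K q z)))"
    by (simp add: curv_term_def inner_add_right algebra_simps)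
  then show ?thesis unfolding curv_at_bianchi by simp
qed

lemma curv_term_cong: "ih K q u = ih K q u' \<Longrightarrow> ih K q v = ih K q v' \<Longrightarrow> ih K q z = ih K q z' \<Longrightarrow> curv_term K q u v z = curv_term K q u' v' z'"
  by (simp add: curv_term_def)

lemma ker_part_lin:
  assumes "u \<in> tangent_space B q" "v \<in> tangent_space B q"
  shows "ker_part q (r *\<^sub>R u + s *\<^sub>R v) = r *\<^sub>R ker_part q u + s *\<^sub>R ker_part q v"
  unfolding ker_part_def eta_lin[OF qB K q assms]
  by (simp only: scaleR_left_distrib scaleR_right_diff_distrib scaleR_scaleR diff_add_eq add_diff_eq diff_diff_add add.assoc add.commute add.left_commute)

lemma ker_part_xibar: "ker_part q (xibar q) = 0"
  by (simp add: ker_part_def eta_xibar[OF qB K q])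

lemma ih_ker_part_phi: "v \<in> tangent_space B q \<Longrightarrow> ih K q (ker_part q (phi q v)) = ih K q (ker_part q v)"
  unfolding ih_ker_part phi_adapted(2)[OF qB K q] eta_phi[OF qB K q] by simp

lemma curv_term_zero:
  shows "curv_term K q 0 v z = 0" "curv_term K q v 0 z = 0" "curv_term K q v z 0 = 0"
  using curv_term_lin[where r = 0 and s = 0 and u = 0 and u' = 0] by simp_all

text \<open>\<open>ker \<eta>\<close> projects to a hyperplane of the tangent space of the base, which is a line here, and \<open>R\<close> is
  skew in its first two arguments.\<close>

lemma curv_term_dim2:
  assumes d: "DIM('e) = 2" and v: "v \<in> tangent_space B q" and z: "z \<in> tangent_space B q"
  shows "curv_term K q u (ker_part q v) (ker_part q z) = 0"
proof -
  \<comment> \<open>The vector representing \<open>\<eta>\<close> on horizontal parts; \<open>c \<noteq> 0\<close> since \<open>\<eta>\<close> is not zero.\<close>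
  define c where "c = sqrt b *\<^sub>R ww K q - (2 * a / (sqrt b * ss K q)) *\<^sub>R gradient (FK K) (yy K q)"
  have c: "c \<bullet> ih K q v = eta q v" if "v \<in> tangent_space B q" for v
    unfolding c_def inner_diff_left inner_scaleR_left grad_FK[OF K q] eta_adapted[OF qB K q that] ..
  have "c \<bullet> ih K q (xibar q) = 1" using c[OF xibar_adapted(1)[OF qB K q]] eta_xibar[OF qB K q] by simp
  then have "c \<noteq> 0" by auto
  then have "dim {x. c \<bullet> x = 0} = 1" using d by (simp add: dim_hyperplane)
  then obtain Bs where Bs: "Bs \<subseteq> {x. c \<bullet> x = 0}" "{x. c \<bullet> x = 0} \<subseteq> span Bs" "card Bs = 1"
    using basis_exists[of "{x. c \<bullet> x = 0}"] by metis
  then obtain e where "Bs = {e}" by (auto simp: card_1_singleton_iff)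
  then have line: "\<exists>r. x = r *\<^sub>R e" if "c \<bullet> x = 0" for x
    using Bs(2) that by (auto simp: span_singleton)
  obtain r s where "ih K q (ker_part q v) = r *\<^sub>R e" "ih K q (ker_part q z) = s *\<^sub>R e"
    using line c[OF ker_part_tangent[OF v]] c[OF ker_part_tangent[OF z]] eta_ker_part[OF v] eta_ker_part[OF z] by metis
  then show ?thesis
    unfolding curv_term_def by (simp add: linear_scale[OF curv_at_linear(1)] linear_scale[OF curv_at_linear(2)] curv_at_same)
qed

lemma curv_term_flat: "flat M nabla \<Longrightarrow> curv_term K q u v z = 0"
  using curv_flat[OF _ K yy_in[OF K q]] unfolding curv_term_def curv_at_def bc.R_def curv_def by simp

end

lemma F_tensor_sum: "q \<in> points B \<Longrightarrow> F_tensor (some_chart q) q u v z = F_G4 q u v z + F_G5 q u v z + F_G10 q u v z"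
  unfolding F_tensor_split[OF _ some_chart] F_G4_def F_G5_def F_G10_def by simp

lemma F_fields:
  assumes "X \<in> vfields B U" "Y \<in> vfields B U" "Z \<in> vfields B U" "q \<in> U"
  shows "g q (D X (\<lambda>q. phi q (Y q)) q - phi q (D X Y q)) (Z q) =
    F_G4 q (X q) (Y q) (Z q) + F_G5 q (X q) (Y q) (Z q) + F_G10 q (X q) (Y q) (Z q)"
  unfolding F_formula[OF assms some_chart[OF L.vf_points[OF assms(1,4)]]] by (rule F_tensor_sum[OF L.vf_points[OF assms(1,4)]])

lemma F_smooth:
  assumes X: "X \<in> vfields B U" and Y: "Y \<in> vfields B U" and Z: "Z \<in> vfields B U"
  shows "(\<lambda>q. F_G4 q (X q) (Y q) (Z q) + F_G5 q (X q) (Y q) (Z q) + F_G10 q (X q) (Y q) (Z q)) \<in> smooth_funs B U"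
  by (rule L.sf_cong[OF g_smooth[OF L.vf_diff[OF L.nabla_vf[OF X phi_vf[OF Y]] phi_vf[OF L.nabla_vf[OF X Y]]] Z]])
     (simp add: F_fields[OF X Y Z])

lemma ker_part_vf: "X \<in> vfields B U \<Longrightarrow> (\<lambda>q. ker_part q (X q)) \<in> vfields B U"
  unfolding ker_part_def by (intro L.vf_diff L.vf_scale eta_smooth xibar_vf L.vf_opn)

lemma F_G5_smooth:
  assumes X: "X \<in> vfields B U" and Y: "Y \<in> vfields B U" and Z: "Z \<in> vfields B U"
  shows "(\<lambda>q. F_G5 q (X q) (Y q) (Z q)) \<in> smooth_funs B U"
proof (rule L.sf_cong)
  note c = L.sf_const[OF L.vf_opn[OF X]]
  show "(\<lambda>q. sqrt b / (2 * a) * (eta q (Y q) * g q (X q) (Z q) + (- 1) * (eta q (Z q) * g q (X q) (Y q)))) \<in> smooth_funs B U"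
    by (intro L.sf_mult L.sf_add c eta_smooth g_smooth X Y Z)
qed (simp add: F_G5_def)

text \<open>On fields in \<open>ker \<eta>\<close> the other two components vanish, so the smoothness of \<open>g((D\<^sub>X \<phi>) Y, Z)\<close> is
  inherited.\<close>

lemma F_G4_smooth:
  assumes X: "X \<in> vfields B U" and Y: "Y \<in> vfields B U" and Z: "Z \<in> vfields B U"
  shows "(\<lambda>q. F_G4 q (X q) (Y q) (Z q)) \<in> smooth_funs B U"
proof (rule L.sf_cong[OF F_smooth[OF ker_part_vf[OF X] ker_part_vf[OF Y] ker_part_vf[OF Z]]])
  fix q assume q: "q \<in> U"
  note qB = L.vf_points[OF X q] and e = eta_ker_part[OF L.vf_points[OF X q] some_chart[OF L.vf_points[OF X q]]]
  have pp: "ker_part q (ker_part q v) = ker_part q v" if "v \<in> tangent_space B q" for v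
    unfolding ker_part_def[of q "ker_part q v"] e[OF that] by simp
  note t = L.vf_tangent[OF X q] L.vf_tangent[OF Y q] L.vf_tangent[OF Z q]
  show "F_G4 q (X q) (Y q) (Z q) = F_G4 q (ker_part q (X q)) (ker_part q (Y q)) (ker_part q (Z q)) + F_G5 q (ker_part q (X q)) (ker_part q (Y q)) (ker_part q (Z q))
      + F_G10 q (ker_part q (X q)) (ker_part q (Y q)) (ker_part q (Z q))"
    unfolding F_G5_def F_G10_def e[OF t(2)] e[OF t(3)] by (simp add: F_G4_def pp t)
qed

lemma F_G10_smooth:
  assumes X: "X \<in> vfields B U" and Y: "Y \<in> vfields B U" and Z: "Z \<in> vfields B U"
  shows "(\<lambda>q. F_G10 q (X q) (Y q) (Z q)) \<in> smooth_funs B U"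
proof (rule L.sf_cong)
  note c = L.sf_const[OF L.vf_opn[OF X], of "- 1"]
  show "(\<lambda>q. F_G4 q (X q) (Y q) (Z q) + F_G5 q (X q) (Y q) (Z q) + F_G10 q (X q) (Y q) (Z q)
      + (- 1) * (F_G4 q (X q) (Y q) (Z q) + F_G5 q (X q) (Y q) (Z q))) \<in> smooth_funs B U"
    by (intro L.sf_mult L.sf_add[OF F_smooth] L.sf_add[OF F_G4_smooth F_G5_smooth] c X Y Z)
qed simp

lemma F_G4_space: "F_space B phi xibar eta F_G4"
  unfolding F_space_def tensor03_def lin_on_def
proof (intro conjI ballI allI)
  fix q u v u1 u2 r s
  assume q: "q \<in> points B" and t: "u \<in> tangent_space B q" "v \<in> tangent_space B q" "u1 \<in> tangent_space B q" "u2 \<in> tangent_space B q"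
  note T = curv_term_lin[OF q some_chart[OF q]] and p = ker_part_lin[OF q some_chart[OF q] t(3,4)]
  show "F_G4 q (r *\<^sub>R u1 + s *\<^sub>R u2) u v = r *\<^sub>R F_G4 q u1 u v + s *\<^sub>R F_G4 q u2 u v"
    "F_G4 q u (r *\<^sub>R u1 + s *\<^sub>R u2) v = r *\<^sub>R F_G4 q u u1 v + s *\<^sub>R F_G4 q u u2 v"
    "F_G4 q u v (r *\<^sub>R u1 + s *\<^sub>R u2) = r *\<^sub>R F_G4 q u v u1 + s *\<^sub>R F_G4 q u v u2"
    unfolding F_G4_def p T by simp_all
next
  fix q x y z assume q: "q \<in> points B" and t: "x \<in> tangent_space B q" "y \<in> tangent_space B q" "z \<in> tangent_space B q"
  note qK = q some_chart[OF q]
  show "F_G4 q x y z = - F_G4 q x z y" unfolding F_G4_def by (rule curv_term_skew[OF qK])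
  show "F_G4 q x (phi q y) (phi q z) = F_G4 q x y z + eta q y * F_G4 q x z (xibar q) - eta q z * F_G4 q x y (xibar q)"
    unfolding F_G4_def ker_part_xibar[OF qK] curv_term_zero[OF qK]
    using curv_term_cong[OF qK refl ih_ker_part_phi[OF qK t(2)] ih_ker_part_phi[OF qK t(3)]] by simp
qed (rule F_G4_smooth)

lemma F_G5_space: "F_space B phi xibar eta F_G5"
  unfolding F_space_def tensor03_def lin_on_def
proof (intro conjI ballI allI)
  fix q u v u1 u2 r s
  assume q: "q \<in> points B" and t: "u \<in> tangent_space B q" "v \<in> tangent_space B q" "u1 \<in> tangent_space B q" "u2 \<in> tangent_space B q"
  note qK = q some_chart[OF q]
  note e = eta_lin[OF qK t(3,4)]
  show "F_G5 q (r *\<^sub>R u1 + s *\<^sub>R u2) u v = r *\<^sub>R F_G5 q u1 u v + s *\<^sub>R F_G5 q u2 u v"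
    "F_G5 q u (r *\<^sub>R u1 + s *\<^sub>R u2) v = r *\<^sub>R F_G5 q u u1 v + s *\<^sub>R F_G5 q u u2 v"
    "F_G5 q u v (r *\<^sub>R u1 + s *\<^sub>R u2) = r *\<^sub>R F_G5 q u v u1 + s *\<^sub>R F_G5 q u v u2"
    unfolding F_G5_def e g_lin[OF qK t(3,4) t(1)] g_lin[OF qK t(3,4) t(2)] real_scaleR_def by (simp_all only: algebra_simps)
next
  fix q x y z assume q: "q \<in> points B" and t: "x \<in> tangent_space B q" "y \<in> tangent_space B q" "z \<in> tangent_space B q"
  note qK = q some_chart[OF q]
  show "F_G5 q x y z = - F_G5 q x z y" unfolding F_G5_def by (simp add: algebra_simps)
  show "F_G5 q x (phi q y) (phi q z) = F_G5 q x y z + eta q y * F_G5 q x z (xibar q) - eta q z * F_G5 q x y (xibar q)"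
    unfolding F_G5_def eta_phi[OF qK t(2)] eta_phi[OF qK t(3)] eta_xibar[OF qK] g_xibar[OF qK t(1)] by (simp add: algebra_simps)
qed (rule F_G5_smooth)

lemma F_G10_space: "F_space B phi xibar eta F_G10"
  unfolding F_space_def tensor03_def lin_on_def
proof (intro conjI ballI allI)
  fix q u v u1 u2 r s
  assume q: "q \<in> points B" and t: "u \<in> tangent_space B q" "v \<in> tangent_space B q" "u1 \<in> tangent_space B q" "u2 \<in> tangent_space B q"
  note qK = q some_chart[OF q]
  note lin = linear_add[OF linear_ih[OF qK]] linear_scale[OF linear_ih[OF qK]] linear_add[OF G10_form_linear(1)[OF qK]]
    linear_scale[OF G10_form_linear(1)[OF qK]] linear_add[OF G10_form_linear(2)[OF qK]] linear_scale[OF G10_form_linear(2)[OF qK]]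
  show "F_G10 q (r *\<^sub>R u1 + s *\<^sub>R u2) u v = r *\<^sub>R F_G10 q u1 u v + s *\<^sub>R F_G10 q u2 u v"
    "F_G10 q u (r *\<^sub>R u1 + s *\<^sub>R u2) v = r *\<^sub>R F_G10 q u u1 v + s *\<^sub>R F_G10 q u u2 v"
    "F_G10 q u v (r *\<^sub>R u1 + s *\<^sub>R u2) = r *\<^sub>R F_G10 q u v u1 + s *\<^sub>R F_G10 q u v u2"
    unfolding F_G10_def eta_lin[OF qK t(3,4)] lin real_scaleR_def by (simp_all only: algebra_simps)
next
  fix q x y z assume q: "q \<in> points B" and t: "x \<in> tangent_space B q" "y \<in> tangent_space B q" "z \<in> tangent_space B q"
  note qK = q some_chart[OF q]
  show "F_G10 q x y z = - F_G10 q x z y" unfolding F_G10_def by simp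
  show "F_G10 q x (phi q y) (phi q z) = F_G10 q x y z + eta q y * F_G10 q x z (xibar q) - eta q z * F_G10 q x y (xibar q)"
    unfolding F_G10_def eta_phi[OF qK t(2)] eta_phi[OF qK t(3)] eta_xibar[OF qK] xibar_adapted(2)[OF qK] G10_form_nh[OF qK]
    by (simp add: algebra_simps)
qed (rule F_G10_smooth)

lemma F_G4_class: "class_G4 B phi xibar eta g F_G4"
  unfolding class_G4_def
proof (intro conjI ballI F_G4_space)
  fix q x y z assume q: "q \<in> points B"
  note qK = q some_chart[OF q]
  show "F_G4 q (xibar q) y z = 0" "F_G4 q x (xibar q) z = 0"
    unfolding F_G4_def ker_part_xibar[OF qK] curv_term_zero[OF qK] by simp_all
  show "F_G4 q x y z + F_G4 q y z x + F_G4 q z x y = 0" unfolding F_G4_def by (rule curv_term_cyclic[OF qK])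
qed

lemma F_G10_class: "class_G10 B phi xibar eta g F_G10"
  unfolding class_G10_def
proof (intro conjI ballI F_G10_space)
  fix q x y z assume q: "q \<in> points B" and t: "x \<in> tangent_space B q" "y \<in> tangent_space B q" "z \<in> tangent_space B q"
  note qK = q some_chart[OF q]
  have e: "F_G10 q x y (xibar q) = - G10_form (some_chart q) q (ih (some_chart q) q x) (ih (some_chart q) q y)" for x y
    unfolding F_G10_def eta_xibar[OF qK] xibar_adapted(2)[OF qK] G10_form_nh[OF qK] by simp
  show "F_G10 q x y z = - eta q y * F_G10 q x z (xibar q) + eta q z * F_G10 q x y (xibar q)"
    unfolding e by (simp add: F_G10_def)
  show "F_G10 q x y (xibar q) = F_G10 q y x (xibar q)"
    unfolding e using G10_form_sym[OF qK] by simp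
  show "F_G10 q y x (xibar q) = F_G10 q (phi q x) (phi q y) (xibar q)"
    unfolding e phi_adapted(2)[OF qK t(1)] phi_adapted(2)[OF qK t(2)] G10_form_perp[OF qK] using G10_form_sym[OF qK] by simp
qed

lemma F_G4_vanishes:
  assumes "flat M nabla \<or> DIM('e) = 2" and q: "q \<in> points B"
    and "u \<in> tangent_space B q" "v \<in> tangent_space B q" "z \<in> tangent_space B q"
  shows "F_G4 q u v z = 0"
  using assms curv_term_flat[OF q some_chart[OF q]] curv_term_dim2[OF q some_chart[OF q]] unfolding F_G4_def by blast

text \<open>Exhibits the data over which the description of \<open>theta\<close> ranges; without it the value would not be
  determined.\<close>

lemma kernel_basis:
  assumes q: "q \<in> points B"
  shows "\<exists>(e :: nat \<Rightarrow> 'p cot tvec) (h :: nat \<Rightarrow> nat \<Rightarrow> real). inj_on e {..<DIM('h) - 1} \<and> independent (e ` {..<DIM('h) - 1}) \<and>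
    span (e ` {..<DIM('h) - 1}) = {v \<in> tangent_space B q. eta q v = 0} \<and>
    (\<forall>i\<in>{..<DIM('h) - 1}. \<forall>j\<in>{..<DIM('h) - 1}. (\<Sum>k\<in>{..<DIM('h) - 1}. h i k * g q (e k) (e j)) = (if i = j then 1 else 0))"
proof -
  let ?m = "DIM('h) - 1"
  obtain C where C: "C \<in> B" "q \<in> fst C" using L.point_chart[OF q] by blast
  note qK = q some_chart[OF q]
  let ?L = "coord_vec B C q"
  have linL: "linear ?L" by (rule L.linear_coord_vec[OF C])
  have injL: "inj ?L" by (rule inj_on_inverseI[of _ "vcomp C"]) (simp add: L.vcomp_coord_vec[OF C])
  have T: "tangent_space B q = range ?L" by (rule L.tangent_space_chart[OF C])
  have tL: "?L x \<in> tangent_space B q" for x by (rule L.coord_vec_tangent[OF C])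
  have Ladd: "?L (x + y) = 1 *\<^sub>R ?L x + 1 *\<^sub>R ?L y" and Lsc: "?L (r *\<^sub>R x) = r *\<^sub>R ?L x + 0 *\<^sub>R ?L x" for x y r
    by (simp_all add: linear_add[OF linL] linear_scale[OF linL])
  have lin_eta: "linear (\<lambda>x. eta q (?L x))"
    by (rule linearI) (simp_all only: Ladd Lsc eta_lin[OF qK tL tL], simp_all)
  define c where "c = (\<Sum>b\<in>Basis. eta q (?L b) *\<^sub>R b)"
  have c: "eta q (?L x) = c \<bullet> x" for x
    unfolding c_def inner_sum_left by (subst linear_euclidean_sum[OF lin_eta, of x]) (simp add: inner_commute[of _ x] mult.commute)
  obtain x0 where "xibar q = ?L x0" using xibar_adapted(1)[OF qK] unfolding T by blast
  then have "c \<bullet> x0 = 1" using eta_xibar[OF qK] c[of x0] by simp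
  then have "c \<noteq> 0" by auto
  then have dimS: "dim {x. c \<bullet> x = 0} = ?m" by (simp add: dim_hyperplane)
  obtain Bs where Bs: "Bs \<subseteq> {x. c \<bullet> x = 0}" "independent Bs" "{x. c \<bullet> x = 0} \<subseteq> span Bs" "card Bs = ?m"
    using basis_exists[of "{x. c \<bullet> x = 0}"] dimS by metis
  have spanBs: "span Bs = {x. c \<bullet> x = 0}"
    using Bs(1,3) span_mono[OF Bs(1)] subspace_hyperplane[of c] by (metis span_eq_iff subset_antisym)
  obtain e0 where e0: "bij_betw e0 {..<?m} Bs"
    using ex_bij_betw_nat_finite[OF independent_imp_finite[OF Bs(2)]] Bs(4) by (auto simp: atLeast0LessThan)
  then have e0i: "inj_on e0 {..<?m}" "e0 ` {..<?m} = Bs" by (auto simp: bij_betw_def)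
  have nondeg: "x = 0" if x: "x \<in> span (e0 ` {..<?m})" and 0: "\<And>j. j < ?m \<Longrightarrow> g q (?L x) (?L (e0 j)) = 0" for x
  proof -
    have lin2: "linear (\<lambda>y. g q (?L x) (?L y))"
      by (rule linearI) (simp_all only: Ladd Lsc g_lin(2)[OF qK tL tL tL], simp_all)
    have "g q (?L x) (?L y) = 0" if "y \<in> span Bs" for y
      using linear_eq_0_on_span[OF lin2 _ that] 0 e0i(2) by fastforce
    then have ker: "g q (?L x) v = 0" if "v \<in> tangent_space B q" "eta q v = 0" for v
      using that unfolding T spanBs by (auto simp: c)
    have ex: "eta q (?L x) = 0" using x unfolding e0i(2) spanBs by (simp add: c)
    have "g q (?L x) v = 0" if v: "v \<in> tangent_space B q" for v
    proof -
      have "v = 1 *\<^sub>R ker_part q v + eta q v *\<^sub>R xibar q" by (simp add: ker_part_def)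
      then have "g q (?L x) v = g q (?L x) (1 *\<^sub>R ker_part q v + eta q v *\<^sub>R xibar q)" by simp
      also have "\<dots> = 0"
        unfolding g_lin(2)[OF qK ker_part_tangent[OF qK v] xibar_adapted(1)[OF qK] tL] g_xibar[OF qK tL] ex
        using ker[OF ker_part_tangent[OF qK v] eta_ker_part[OF qK v]] by simp
      finally show ?thesis .
    qed
    then have "?L x = 0" by (rule g_nondegenerate[OF qK tL])
    then show "x = 0" using injL linear_0[OF linL] by (metis injD)
  qed
  have lin1: "linear (\<lambda>x. g q (?L x) (?L y))" for y
    by (rule linearI) (simp_all only: Ladd Lsc g_lin(1)[OF qK tL tL tL], simp_all)
  obtain h where h: "\<forall>i<?m. \<forall>j<?m. (\<Sum>k<?m. h i k * g q (?L (e0 k)) (?L (e0 j))) = (if i = j then 1 else 0)"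
    using inverse_gram_exists[where \<beta> = "\<lambda>x y. g q (?L x) (?L y)", OF e0i(1) Bs(2)[folded e0i(2)] lin1 nondeg]
    by blast
  let ?e = "\<lambda>i. ?L (e0 i)"
  have im: "?e ` {..<?m} = ?L ` Bs" using e0i(2) by auto
  have "inj_on ?e {..<?m}" using comp_inj_on[OF e0i(1) inj_on_subset[OF injL]] by (simp add: o_def)
  moreover have "independent (?e ` {..<?m})" unfolding im by (rule linear_independent_injective_image[OF linL Bs(2) inj_on_subset[OF injL subset_UNIV]])
  moreover have "span (?e ` {..<?m}) = {v \<in> tangent_space B q. eta q v = 0}"
    unfolding im linear_span_image[OF linL] spanBs T by (auto simp: c)
  ultimately show ?thesis using h by (intro exI[of _ ?e] exI[of _ h]) auto
qed

text \<open>On \<open>ker \<eta>\<close> the tensor is a multiple of \<open>g\<close> in its first two arguments, and the contraction of \<open>g\<close>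
  with its inverse matrix is the dimension of \<open>ker \<eta>\<close>.\<close>

lemma theta_F_G5:
  assumes q: "q \<in> points B"
  shows "theta B xibar eta g F_G5 q = - sqrt b / (2 * a) * real (DIM('h) - 1)"
  unfolding theta_def Let_def
proof (rule the_equality)
  note qK = q some_chart[OF q]
  let ?I = "{..<DIM('h) - 1}"
  have val: "(\<Sum>i\<in>?I. \<Sum>j\<in>?I. h i j * F_G5 q (e i) (e j) (xibar q)) = - sqrt b / (2 * a) * real (DIM('h) - 1)"
    if sp: "span (e ` ?I) = {v \<in> tangent_space B q. eta q v = 0}"
      and h: "\<forall>i\<in>?I. \<forall>j\<in>?I. (\<Sum>k\<in>?I. h i k * g q (e k) (e j)) = (if i = j then 1 else 0)"
    for e :: "nat \<Rightarrow> 'p cot tvec" and h :: "nat \<Rightarrow> nat \<Rightarrow> real"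
  proof -
    have e: "e i \<in> tangent_space B q" "eta q (e i) = 0" if "i \<in> ?I" for i
      using sp span_base[of "e i" "e ` ?I"] that by auto
    have F: "F_G5 q (e i) (e j) (xibar q) = - sqrt b / (2 * a) * g q (e j) (e i)" if "i \<in> ?I" "j \<in> ?I" for i j
      unfolding F_G5_def e(2)[OF that(2)] eta_xibar[OF qK] using g_sym[OF qK e(1)[OF that(1)] e(1)[OF that(2)]] by simp
    have "(\<Sum>i\<in>?I. \<Sum>j\<in>?I. h i j * F_G5 q (e i) (e j) (xibar q)) =
        (\<Sum>i\<in>?I. - sqrt b / (2 * a) * (\<Sum>j\<in>?I. h i j * g q (e j) (e i)))"
      by (rule sum.cong[OF refl]) (simp add: F sum_distrib_left mult.left_commute)
    also have "\<dots> = (\<Sum>i\<in>?I. - sqrt b / (2 * a) * 1)"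
      by (rule sum.cong[OF refl]) (use h in simp)
    also have "\<dots> = - sqrt b / (2 * a) * real (DIM('h) - 1)" by simp
    finally show ?thesis .
  qed
  obtain e h where eh: "inj_on e ?I" "independent (e ` ?I)"
    "span (e ` ?I) = {v \<in> tangent_space B q. eta q v = 0}"
    "\<forall>i\<in>?I. \<forall>j\<in>?I. (\<Sum>k\<in>?I. h i k * g q (e k) (e j)) = (if i = j then 1 else (0::real))"
    using kernel_basis[OF q] by blast
  show "\<exists>e h. inj_on e ?I \<and> independent (e ` ?I) \<and> span (e ` ?I) = {v \<in> tangent_space B q. eta q v = 0} \<and>
      (\<forall>i\<in>?I. \<forall>j\<in>?I. (\<Sum>k\<in>?I. h i k * g q (e k) (e j)) = (if i = j then 1 else 0)) \<and>
      - sqrt b / (2 * a) * real (DIM('h) - 1) = (\<Sum>i\<in>?I. \<Sum>j\<in>?I. h i j * F_G5 q (e i) (e j) (xibar q))"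
    by (intro exI[of _ e] exI[of _ h] conjI eh val[OF eh(3,4), symmetric])
  fix s assume "\<exists>e h. inj_on e ?I \<and> independent (e ` ?I) \<and> span (e ` ?I) = {v \<in> tangent_space B q. eta q v = 0} \<and>
      (\<forall>i\<in>?I. \<forall>j\<in>?I. (\<Sum>k\<in>?I. h i k * g q (e k) (e j)) = (if i = j then 1 else 0)) \<and>
      s = (\<Sum>i\<in>?I. \<Sum>j\<in>?I. h i j * F_G5 q (e i) (e j) (xibar q))"
  then show "s = - sqrt b / (2 * a) * real (DIM('h) - 1)" using val by (elim exE conjE) simp
qed

lemma F_G5_class: "class_G5 B phi xibar eta g F_G5"
  unfolding class_G5_def
proof (intro conjI ballI F_G5_space)
  fix q x y z assume q: "q \<in> points B" and t: "x \<in> tangent_space B q" "y \<in> tangent_space B q" "z \<in> tangent_space B q"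
  note qK = q some_chart[OF q]
  have "real (DIM('h) - 1) \<noteq> 0" using dim_h dim2 by simp
  then have th: "theta B xibar eta g F_G5 q / real (DIM('h) - 1) = - sqrt b / (2 * a)" unfolding theta_F_G5[OF q] by simp
  show "F_G5 q x y z = theta B xibar eta g F_G5 q / real (DIM('h) - 1) *
      (eta q y * g q (phi q x) (phi q z) - eta q z * g q (phi q x) (phi q y))"
    unfolding th g_phi_phi[OF qK t(1,3)] g_phi_phi[OF qK t(1,2)] F_G5_def by (simp add: algebra_simps)
qed

lemma in_class_sum_flat:
  assumes "flat M nabla \<or> DIM('e) = 2"
  shows "in_class_sum B D phi xibar eta g [class_G5, class_G10]"
  unfolding in_class_sum_def
proof (intro conjI almost_paracontact exI[of _ "[F_G5, F_G10]"] allI ballI)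
  show "list_all2 (\<lambda>G F. G B phi xibar eta g F) [class_G5, class_G10] [F_G5, F_G10]" by (simp add: F_G5_class F_G10_class)
  fix U X Y Z q assume f: "X \<in> vfields B U" "Y \<in> vfields B U" "Z \<in> vfields B U" "q \<in> U"
  show "g q (D X (\<lambda>q. phi q (Y q)) q - phi q (D X Y q)) (Z q) = (\<Sum>F\<leftarrow>[F_G5, F_G10]. F q (X q) (Y q) (Z q))"
    unfolding F_fields[OF f]
    using F_G4_vanishes[OF assms L.vf_points[OF f(1,4)] L.vf_tangent[OF f(1,4)] L.vf_tangent[OF f(2,4)] L.vf_tangent[OF f(3,4)]]
    by simp
qed

lemma in_class_sum_general: "in_class_sum B D phi xibar eta g [class_G4, class_G5, class_G10]"
  unfolding in_class_sum_def
proof (intro conjI almost_paracontact exI[of _ "[F_G4, F_G5, F_G10]"] allI ballI)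
  show "list_all2 (\<lambda>G F. G B phi xibar eta g F) [class_G4, class_G5, class_G10] [F_G4, F_G5, F_G10]"
    by (simp add: F_G4_class F_G5_class F_G10_class)
  fix U X Y Z q assume f: "X \<in> vfields B U" "Y \<in> vfields B U" "Z \<in> vfields B U" "q \<in> U"
  show "g q (D X (\<lambda>q. phi q (Y q)) q - phi q (D X Y q)) (Z q) = (\<Sum>F\<leftarrow>[F_G4, F_G5, F_G10]. F q (X q) (Y q) (Z q))"
    unfolding F_fields[OF f] by simp
qed

end

theorem theorem4p3:
  fixes A :: "('p, 'e::euclidean_space) atlas"
    and nabla :: "'p connection"
    and xi :: "'p vfield"
    and xiC :: "'p cot vfield"
    and f :: "'p \<Rightarrow> real"
    and a b t :: real
    and gbar :: "'p cot \<Rightarrow> 'p cot tvec \<Rightarrow> 'p cot tvec \<Rightarrow> real"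
    and P :: "'p cot \<Rightarrow> 'p cot tvec \<Rightarrow> 'p cot tvec"
    and B :: "('p cot, 'h::euclidean_space) atlas"
    and N :: "'p cot vfield"
    and xibar :: "'p cot vfield"
    and eta :: "'p cot \<Rightarrow> 'p cot covec"
    and phi :: "'p cot \<Rightarrow> 'p cot tvec \<Rightarrow> 'p cot tvec"
    and g :: "'p cot \<Rightarrow> 'p cot tvec \<Rightarrow> 'p cot tvec \<Rightarrow> real"
    and D :: "'p cot connection"
  assumes "smooth_manifold A" and "connected_space (manifold_topology A)" and "points A \<noteq> {}"
    and "DIM('e) \<ge> 2"
    and "symmetric_connection A nabla"
    and "xi \<in> vfields A (points A)" and "\<forall>x\<in>points A. xi x \<noteq> 0" and "parallel_field A nabla xi"
    and "f \<in> smooth_funs A (points A)" and "\<forall>x\<in>points A. f x \<noteq> t"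
    and "a > 0" and "b > 0"
    and "natural_riemann_extension A nabla a b gbar"
    and "natural_paracomplex A nabla a b P"
    and "complete_lift A (points A) xi xiC"
    and "embedded_submanifold (cotangent_atlas A) B"
    and "points B = hypersurface A xi f t" and "DIM('h) = 2 * DIM('e) - 1"
    and "g = induced_metric (cotangent_atlas A) gbar"
    and "N = hypersurface_normal A a b xi xiC f"
    and "timelike_unit_normal (cotangent_atlas A) B gbar N"
    and "xibar = (\<lambda>q. tangent_part (cotangent_atlas A) B q (P q (N q)))"
    and "eta = (\<lambda>q v. if v \<in> tangent_space B q
                      then gbar q (incl (cotangent_atlas A) q v) (P q (N q)) else 0)"
    and "phi = (\<lambda>q v. tangent_part (cotangent_atlas A) B q
                        (P q (incl (cotangent_atlas A) q v) - eta q v *\<^sub>R N q))"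
    and "levi_civita B g D"
  shows "(flat A nabla \<or> DIM('e) = 2 \<longrightarrow>
            in_class_sum B D phi xibar eta g [class_G5, class_G10]) \<and>
         (\<not> flat A nabla \<and> DIM('e) > 2 \<longrightarrow>
            in_class_sum B D phi xibar eta g [class_G4, class_G5, class_G10]) \<and>
         (paracontact_metric B phi xibar eta g \<longleftrightarrow> b = 4 * a\<^sup>2)"
proof -
  interpret H: level_hypersurface A nabla a b gbar P xi xiC f t B N D
  proof unfold_locales
    show "smooth_atlas A" using assms(1) by (simp add: smooth_manifold_def)
    show "linear_connection A nabla" using assms(5) by (simp add: symmetric_connection_def)
    show "levi_civita B (induced_metric (cotangent_atlas A) gbar) D" using assms(19,25) by simp
  qed (rule assms)+
  have "xibar = H.xibar" unfolding assms(22) H.xibar_def ..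
  moreover have "eta = H.eta" unfolding assms(23) H.eta_def ..
  moreover from this have "phi = H.phi" unfolding assms(24) H.phi_def by simp
  ultimately show ?thesis
    using H.in_class_sum_flat H.in_class_sum_general H.paracontact_iff unfolding assms(19) by simp
qed

end
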